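(* Let $(M,g)$ be a Riemannian manifold, and let $\pi:E\to M$ be a vector bundle with a bundle metric $h$ and a connection $\nabla^E$ compatible with $h$. For $p\in M$ let $E_p$ be the fiber over $p$ with the norm given by $h$, let $\mathrm{Hol}_p$ be the holonomy group at $p$, and define $L_p:\mathrm{Hol}_p\to\mathbb{R}$ by $$L_p(a)=\inf\{\ell(\alpha):\alpha\in\Omega_p,\ P^\alpha_1=a\}.$$ Then for every $p\in M$ the triplet $(E_p,\mathrm{Hol}_p,L_p)$ is a holonomic space. Furthermore, if $E$ is endowed with the corresponding Sasaki-type metric, with Riemannian distance $d_E$, then for all $u,v\in E_p$ $$d_E(u,v)=\inf_{a\in\mathrm{Hol}_p}\sqrt{L_p(a)^2+\|au-v\|^2},$$ that is, the associated holonomic distance on $E_p$ coincides with the restriction to $E_p$ of the metric (distance) of $E$.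
   Context: A group-norm on a group $G$ is a function $N:G\to\mathbb{R}$ such that $N(A)\ge 0$; $N(A)=0$ if and only if $A$ is the identity; $N(A^{-1})=N(A)$; and $N(AB)\le N(A)+N(B)$, for all $A,B\in G$. A triplet $(V,H,L)$, with $V$ a normed vector space, $H$ a subgroup of the group of norm-preserving linear automorphisms of $V$, and $L:H\to\mathbb{R}$ a group-norm on $H$, is a holonomic space if: for all $u\in V$ there exists $r>0$ such that for all $v,w\in V$ with $\|v-u\|<r$, $\|w-u\|<r$, and all $A\in H$, $\|v-w\|^2-\|v-Aw\|^2\le L^2(A)$. The associated holonomic distance is $d_L(u,v)=\inf_{a\in H}\sqrt{L^2(a)+\|u-av\|^2}$ (equivalently with $\|au-v\|$ in place of $\|u-av\|$). $\Omega_p$ is the set of piecewise smooth loops $\alpha:[0,1]\to M$ based at $p$; $\ell(\alpha)$ is the length of $\alpha$ with respect to $g$; $P^\alpha_1:E_p\to E_p$ is parallel translation of $\nabla^E$ along $\alpha$; and $\mathrm{Hol}_p=\{P^\alpha_1:\alpha\in\Omega_p\}$. The Sasaki-type metric on the total space $E$ is the Riemannian metric $\mathbf{G}(\xi,\eta)=g(\pi_*\xi,\pi_*\eta)+h(\kappa\xi,\kappa\eta)$ for $\xi,\eta\in T_eE$, where $\kappa:TE\to E$ is the connection map, uniquely determined by $\kappa(\sigma_*x)=\nabla^E_x\sigma$ for all sections $\sigma$ of $E$ and tangent vectors $x$ of $M$. *)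

theory Defs
  imports "HOL-Analysis.Analysis" "HOL-Algebra.Bij"
begin

text \<open>
  Fibres and tangent spaces depend on a point of the base, so they cannot be types.
\<close>

record 'v vspace =
  vcarrier :: "'v set"
  vzero :: "'v"
  vplus :: "'v \<Rightarrow> 'v \<Rightarrow> 'v"
  vscale :: "real \<Rightarrow> 'v \<Rightarrow> 'v"

definition vspace_on :: "'v vspace \<Rightarrow> bool" where
  "vspace_on V \<longleftrightarrow>
     comm_group \<lparr>carrier = vcarrier V, mult = vplus V, one = vzero V\<rparr> \<and>
     (\<forall>a. \<forall>u\<in>vcarrier V. vscale V a u \<in> vcarrier V) \<and>
     (\<forall>a. \<forall>u\<in>vcarrier V. \<forall>v\<in>vcarrier V.
        vscale V a (vplus V u v) = vplus V (vscale V a u) (vscale V a v)) \<and>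
     (\<forall>a b. \<forall>u\<in>vcarrier V. vscale V (a + b) u = vplus V (vscale V a u) (vscale V b u)) \<and>
     (\<forall>a b. \<forall>u\<in>vcarrier V. vscale V (a * b) u = vscale V a (vscale V b u)) \<and>
     (\<forall>u\<in>vcarrier V. vscale V 1 u = u)"

definition vminus :: "'v vspace \<Rightarrow> 'v \<Rightarrow> 'v \<Rightarrow> 'v" where
  "vminus V u v = vplus V u (vscale V (-1) v)"

definition type_vspace :: "'f::real_vector vspace" where
  "type_vspace = \<lparr>vcarrier = UNIV, vzero = 0, vplus = (+), vscale = scaleR\<rparr>"

definition linear_map :: "'v vspace \<Rightarrow> 'w vspace \<Rightarrow> ('v \<Rightarrow> 'w) \<Rightarrow> bool" where
  "linear_map V W f \<longleftrightarrow>
     (\<forall>u\<in>vcarrier V. f u \<in> vcarrier W) \<and>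
     (\<forall>u\<in>vcarrier V. \<forall>v\<in>vcarrier V. f (vplus V u v) = vplus W (f u) (f v)) \<and>
     (\<forall>a. \<forall>u\<in>vcarrier V. f (vscale V a u) = vscale W a (f u))"

definition norm_on :: "'v vspace \<Rightarrow> ('v \<Rightarrow> real) \<Rightarrow> bool" where
  "norm_on V nrm \<longleftrightarrow>
     (\<forall>u\<in>vcarrier V. nrm u \<ge> 0) \<and>
     (\<forall>u\<in>vcarrier V. nrm u = 0 \<longleftrightarrow> u = vzero V) \<and>
     (\<forall>a. \<forall>u\<in>vcarrier V. nrm (vscale V a u) = \<bar>a\<bar> * nrm u) \<and>
     (\<forall>u\<in>vcarrier V. \<forall>v\<in>vcarrier V. nrm (vplus V u v) \<le> nrm u + nrm v)"

definition inner_product_on :: "'v vspace \<Rightarrow> ('v \<Rightarrow> 'v \<Rightarrow> real) \<Rightarrow> bool" where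
  "inner_product_on V ip \<longleftrightarrow>
     (\<forall>u\<in>vcarrier V. \<forall>v\<in>vcarrier V. ip u v = ip v u) \<and>
     (\<forall>u\<in>vcarrier V. \<forall>v\<in>vcarrier V. \<forall>w\<in>vcarrier V. ip (vplus V u v) w = ip u w + ip v w) \<and>
     (\<forall>a. \<forall>u\<in>vcarrier V. \<forall>v\<in>vcarrier V. ip (vscale V a u) v = a * ip u v) \<and>
     (\<forall>u\<in>vcarrier V. u \<noteq> vzero V \<longrightarrow> ip u u > 0)"

definition group_norm :: "('a, 'b) monoid_scheme \<Rightarrow> ('a \<Rightarrow> real) \<Rightarrow> bool" where
  "group_norm G N \<longleftrightarrow>
     (\<forall>A\<in>carrier G. N A \<ge> 0) \<and>
     (\<forall>A\<in>carrier G. N A = 0 \<longleftrightarrow> A = \<one>\<^bsub>G\<^esub>) \<and>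
     (\<forall>A\<in>carrier G. N (inv\<^bsub>G\<^esub> A) = N A) \<and>
     (\<forall>A\<in>carrier G. \<forall>B\<in>carrier G. N (A \<otimes>\<^bsub>G\<^esub> B) \<le> N A + N B)"

text \<open>
  As in \<open>BijGroup\<close>, automorphisms are extensional functions on the carrier, multiplied by
  composition.
\<close>

definition isom_group :: "'v vspace \<Rightarrow> ('v \<Rightarrow> real) \<Rightarrow> ('v \<Rightarrow> 'v) monoid" where
  "isom_group V nrm = (BijGroup (vcarrier V))
     \<lparr>carrier := {f \<in> Bij (vcarrier V). linear_map V V f \<and> (\<forall>u\<in>vcarrier V. nrm (f u) = nrm u)}\<rparr>"

definition holonomic_space ::
  "'v vspace \<Rightarrow> ('v \<Rightarrow> real) \<Rightarrow> ('v \<Rightarrow> 'v) set \<Rightarrow> (('v \<Rightarrow> 'v) \<Rightarrow> real) \<Rightarrow> bool" where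
  "holonomic_space V nrm H L \<longleftrightarrow>
     vspace_on V \<and> norm_on V nrm \<and>
     subgroup H (isom_group V nrm) \<and>
     group_norm ((isom_group V nrm)\<lparr>carrier := H\<rparr>) L \<and>
     (\<forall>u\<in>vcarrier V. \<exists>r>0. \<forall>v\<in>vcarrier V. \<forall>w\<in>vcarrier V.
        nrm (vminus V v u) < r \<longrightarrow> nrm (vminus V w u) < r \<longrightarrow>
        (\<forall>A\<in>H. (nrm (vminus V v w))\<^sup>2 - (nrm (vminus V v (A w)))\<^sup>2 \<le> (L A)\<^sup>2))"

definition holonomic_dist ::
  "'v vspace \<Rightarrow> ('v \<Rightarrow> real) \<Rightarrow> ('v \<Rightarrow> 'v) set \<Rightarrow> (('v \<Rightarrow> 'v) \<Rightarrow> real) \<Rightarrow> 'v \<Rightarrow> 'v \<Rightarrow> real" where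
  "holonomic_dist V nrm H L u v =
     (INF a\<in>H. sqrt ((L a)\<^sup>2 + (nrm (vminus V u (a v)))\<^sup>2))"

text \<open>
  \<open>Ck_on\<close> and \<open>smooth_on\<close> are only meant for open sets in finite-dimensional spaces, where
  the directional derivatives of the derivative control the Frechet derivative.
\<close>

primrec Ck_on ::
  "nat \<Rightarrow> 'a::real_normed_vector set \<Rightarrow> ('a \<Rightarrow> 'b::real_normed_vector) \<Rightarrow> bool" where
  "Ck_on 0 S f \<longleftrightarrow> continuous_on S f"
| "Ck_on (Suc k) S f \<longleftrightarrow>
     (\<forall>x\<in>S. f differentiable (at x)) \<and> (\<forall>v. Ck_on k S (\<lambda>x. frechet_derivative f (at x) v))"

definition smooth_on :: "'a::real_normed_vector set \<Rightarrow> ('a \<Rightarrow> 'b::real_normed_vector) \<Rightarrow> bool" where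
  "smooth_on S f \<longleftrightarrow> (\<forall>k. Ck_on k S f)"

text \<open>A chart is given by its domain and its coordinate map.\<close>

type_synonym ('m, 'e) chart = "'m set \<times> ('m \<Rightarrow> 'e)"

definition chart_inv :: "('m, 'e) chart \<Rightarrow> 'e \<Rightarrow> 'm" where
  "chart_inv c = inv_into (fst c) (snd c)"

definition smooth_atlas ::
  "('m::topological_space, 'e::euclidean_space) chart set \<Rightarrow> bool" where
  "smooth_atlas A \<longleftrightarrow>
     (\<forall>c\<in>A. open (fst c) \<and> open (snd c ` fst c) \<and>
        homeomorphism (fst c) (snd c ` fst c) (snd c) (chart_inv c)) \<and>
     (\<Union>c\<in>A. fst c) = UNIV \<and>
     (\<forall>c\<in>A. \<forall>d\<in>A. smooth_on (snd c ` (fst c \<inter> fst d)) (snd d \<circ> chart_inv c))"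

definition smooth_fun_on ::
  "('m, 'e::euclidean_space) chart set \<Rightarrow> 'm set \<Rightarrow> ('m \<Rightarrow> 'b::real_normed_vector) \<Rightarrow> bool" where
  "smooth_fun_on A U f \<longleftrightarrow> (\<forall>c\<in>A. smooth_on (snd c ` (fst c \<inter> U)) (f \<circ> chart_inv c))"

definition smooth_map ::
  "('m::topological_space, 'e::euclidean_space) chart set \<Rightarrow>
   ('n::topological_space, 'd::euclidean_space) chart set \<Rightarrow> ('m \<Rightarrow> 'n) \<Rightarrow> bool" where
  "smooth_map A B F \<longleftrightarrow>
     continuous_on UNIV F \<and>
     (\<forall>c\<in>A. \<forall>d\<in>B. smooth_on (snd c ` (fst c \<inter> F -` fst d)) (snd d \<circ> F \<circ> chart_inv c))"

text \<open>
  A tangent vector at \<open>p\<close> is the family of its components in all charts around \<open>p\<close>, subject to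
  the transformation rule. Components in other charts are 0, so that the family is unique.
\<close>

type_synonym ('m, 'e) tvec = "('m, 'e) chart \<Rightarrow> 'e"

definition tangent_space ::
  "('m, 'e::euclidean_space) chart set \<Rightarrow> 'm \<Rightarrow> ('m, 'e) tvec vspace" where
  "tangent_space A p =
     \<lparr>vcarrier = {X.
        (\<forall>c. c \<notin> A \<or> p \<notin> fst c \<longrightarrow> X c = 0) \<and>
        (\<forall>c\<in>A. \<forall>d\<in>A. p \<in> fst c \<longrightarrow> p \<in> fst d \<longrightarrow>
           X d = frechet_derivative (snd d \<circ> chart_inv c) (at (snd c p)) (X c))},
      vzero = (\<lambda>c. 0),
      vplus = (\<lambda>X Y c. X c + Y c),
      vscale = (\<lambda>a X c. a *\<^sub>R X c)\<rparr>"

text \<open>The tangent vector at \<open>p\<close> with component \<open>w\<close> in the chart \<open>c\<close>.\<close>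

definition coord_vec ::
  "('m, 'e::euclidean_space) chart set \<Rightarrow> ('m, 'e) chart \<Rightarrow> 'm \<Rightarrow> 'e \<Rightarrow> ('m, 'e) tvec" where
  "coord_vec A c p w = (\<lambda>d. if d \<in> A \<and> p \<in> fst d
     then frechet_derivative (snd d \<circ> chart_inv c) (at (snd c p)) w else 0)"

definition chart_at :: "('m, 'e) chart set \<Rightarrow> 'm \<Rightarrow> ('m, 'e) chart" where
  "chart_at A p = (SOME c. c \<in> A \<and> p \<in> fst c)"

text \<open>
  By the chain rule, the next two definitions do not depend on the chart chosen at \<open>p\<close>.
\<close>

definition tangent_deriv ::
  "('m, 'e::euclidean_space) chart set \<Rightarrow> 'm \<Rightarrow> ('m, 'e) tvec \<Rightarrow> ('m \<Rightarrow> real) \<Rightarrow> real" where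
  "tangent_deriv A p X f =
     (let c = chart_at A p in frechet_derivative (f \<circ> chart_inv c) (at (snd c p)) (X c))"

definition pushforward ::
  "('m, 'e::euclidean_space) chart set \<Rightarrow> ('n, 'd::euclidean_space) chart set \<Rightarrow>
   ('m \<Rightarrow> 'n) \<Rightarrow> 'm \<Rightarrow> ('m, 'e) tvec \<Rightarrow> ('n, 'd) tvec" where
  "pushforward A B F p X = (\<lambda>d. if d \<in> B \<and> F p \<in> fst d
     then let c = chart_at A p
          in frechet_derivative (snd d \<circ> F \<circ> chart_inv c) (at (snd c p)) (X c)
     else 0)"

definition smooth_vector_field ::
  "('m, 'e::euclidean_space) chart set \<Rightarrow> ('m \<Rightarrow> ('m, 'e) tvec) \<Rightarrow> bool" where
  "smooth_vector_field A X \<longleftrightarrow>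
     (\<forall>p. X p \<in> vcarrier (tangent_space A p)) \<and>
     (\<forall>c\<in>A. smooth_on (snd c ` fst c) (\<lambda>y. X (chart_inv c y) c))"

definition riemannian_metric ::
  "('m, 'e::euclidean_space) chart set \<Rightarrow>
   ('m \<Rightarrow> ('m, 'e) tvec \<Rightarrow> ('m, 'e) tvec \<Rightarrow> real) \<Rightarrow> bool" where
  "riemannian_metric A g \<longleftrightarrow>
     (\<forall>p. inner_product_on (tangent_space A p) (g p)) \<and>
     (\<forall>c\<in>A. \<forall>v w. smooth_on (snd c ` fst c)
        (\<lambda>y. g (chart_inv c y) (coord_vec A c (chart_inv c y) v) (coord_vec A c (chart_inv c y) w)))"

text \<open>
  Derivatives of all orders on the closed interval, one-sided at its end points.
\<close>

definition smooth_on_interval ::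
  "real \<Rightarrow> real \<Rightarrow> (real \<Rightarrow> 'e::real_normed_vector) \<Rightarrow> bool" where
  "smooth_on_interval a b f \<longleftrightarrow>
     (\<exists>D :: nat \<Rightarrow> real \<Rightarrow> 'e. D 0 = f \<and>
        (\<forall>k. \<forall>t\<in>{a..b}. (D k has_vector_derivative D (Suc k) t) (at t within {a..b})))"

definition smooth_curve_on ::
  "('m::topological_space, 'e::euclidean_space) chart set \<Rightarrow> real \<Rightarrow> real \<Rightarrow> (real \<Rightarrow> 'm) \<Rightarrow> bool" where
  "smooth_curve_on A a b \<gamma> \<longleftrightarrow>
     continuous_on {a..b} \<gamma> \<and>
     (\<forall>c\<in>A. \<forall>s t. a \<le> s \<and> s < t \<and> t \<le> b \<and> \<gamma> ` {s..t} \<subseteq> fst c \<longrightarrow>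
        smooth_on_interval s t (snd c \<circ> \<gamma>))"

definition piecewise_smooth_path ::
  "('m::topological_space, 'e::euclidean_space) chart set \<Rightarrow> (real \<Rightarrow> 'm) \<Rightarrow> bool" where
  "piecewise_smooth_path A \<gamma> \<longleftrightarrow>
     continuous_on {0..1} \<gamma> \<and>
     (\<exists>S. finite S \<and>
        (\<forall>a b. 0 \<le> a \<and> a < b \<and> b \<le> 1 \<and> {a<..<b} \<inter> S = {} \<longrightarrow> smooth_curve_on A a b \<gamma>))"

text \<open>
  The two-sided derivative is only meaningful in the interior of a smooth piece. Below,
  finitely many parameters are always irrelevant.
\<close>

definition velocity ::
  "('m, 'e::euclidean_space) chart set \<Rightarrow> (real \<Rightarrow> 'm) \<Rightarrow> real \<Rightarrow> ('m, 'e) tvec" where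
  "velocity A \<gamma> t = (\<lambda>c. if c \<in> A \<and> \<gamma> t \<in> fst c
     then vector_derivative (snd c \<circ> \<gamma>) (at t) else 0)"

definition curve_length ::
  "('m, 'e::euclidean_space) chart set \<Rightarrow>
   ('m \<Rightarrow> ('m, 'e) tvec \<Rightarrow> ('m, 'e) tvec \<Rightarrow> real) \<Rightarrow> (real \<Rightarrow> 'm) \<Rightarrow> real" where
  "curve_length A g \<gamma> =
     integral {0..1} (\<lambda>t. sqrt (g (\<gamma> t) (velocity A \<gamma> t) (velocity A \<gamma> t)))"

text \<open>
  For points in different components the infimum is over the empty set and has no meaning.
\<close>

definition riemannian_dist ::
  "('m::topological_space, 'e::euclidean_space) chart set \<Rightarrow>
   ('m \<Rightarrow> ('m, 'e) tvec \<Rightarrow> ('m, 'e) tvec \<Rightarrow> real) \<Rightarrow> 'm \<Rightarrow> 'm \<Rightarrow> real" where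
  "riemannian_dist A g u v =
     Inf {curve_length A g \<gamma> |\<gamma>. piecewise_smooth_path A \<gamma> \<and> \<gamma> 0 = u \<and> \<gamma> 1 = v}"

definition loops ::
  "('m::topological_space, 'e::euclidean_space) chart set \<Rightarrow> 'm \<Rightarrow> (real \<Rightarrow> 'm) set" where
  "loops A p = {\<alpha>. piecewise_smooth_path A \<alpha> \<and> \<alpha> 0 = p \<and> \<alpha> 1 = p}"

text \<open>
  A local trivialization over \<open>U\<close> is a pair \<open>(U, \<tau>)\<close>, where \<open>\<tau>\<close> is the component of the
  trivializing map in the model fibre \<open>'f\<close>.
\<close>

record ('x, 'm, 'f) vbundle =
  proj :: "'x \<Rightarrow> 'm"
  bzero :: "'m \<Rightarrow> 'x"
  bplus :: "'x \<Rightarrow> 'x \<Rightarrow> 'x"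
  bscale :: "real \<Rightarrow> 'x \<Rightarrow> 'x"
  trivs :: "('m set \<times> ('x \<Rightarrow> 'f)) set"

definition fibre :: "('x, 'm, 'f) vbundle \<Rightarrow> 'm \<Rightarrow> 'x vspace" where
  "fibre E p = \<lparr>vcarrier = proj E -` {p}, vzero = bzero E p, vplus = bplus E, vscale = bscale E\<rparr>"

definition triv_inv :: "('x, 'm, 'f) vbundle \<Rightarrow> ('m set \<times> ('x \<Rightarrow> 'f)) \<Rightarrow> 'm \<times> 'f \<Rightarrow> 'x" where
  "triv_inv E T = inv_into (proj E -` fst T) (\<lambda>e. (proj E e, snd T e))"

definition vector_bundle ::
  "('m::topological_space, 'e::euclidean_space) chart set \<Rightarrow>
   ('x::topological_space, 'm, 'f::euclidean_space) vbundle \<Rightarrow> bool" where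
  "vector_bundle A E \<longleftrightarrow>
     (\<forall>p. vspace_on (fibre E p)) \<and>
     (\<Union>T\<in>trivs E. fst T) = UNIV \<and>
     (\<forall>T\<in>trivs E.
        open (fst T) \<and> open (proj E -` fst T) \<and>
        homeomorphism (proj E -` fst T) (fst T \<times> UNIV) (\<lambda>e. (proj E e, snd T e)) (triv_inv E T) \<and>
        (\<forall>p\<in>fst T. linear_map (fibre E p) type_vspace (snd T))) \<and>
     (\<forall>S\<in>trivs E. \<forall>T\<in>trivs E. \<forall>w.
        smooth_fun_on A (fst S \<inter> fst T) (\<lambda>p. snd T (triv_inv E S (p, w))))"

definition total_atlas ::
  "('m, 'e) chart set \<Rightarrow> ('x, 'm, 'f) vbundle \<Rightarrow> ('x, 'e \<times> 'f) chart set" where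
  "total_atlas A E =
     {(proj E -` (fst c \<inter> fst T), \<lambda>e. (snd c (proj E e), snd T e)) |c T. c \<in> A \<and> T \<in> trivs E}"

definition smooth_section ::
  "('m::topological_space, 'e::euclidean_space) chart set \<Rightarrow>
   ('x::topological_space, 'm, 'f::euclidean_space) vbundle \<Rightarrow> ('m \<Rightarrow> 'x) \<Rightarrow> bool" where
  "smooth_section A E \<sigma> \<longleftrightarrow> (\<forall>p. proj E (\<sigma> p) = p) \<and> smooth_map A (total_atlas A E) \<sigma>"

text \<open>Bundle metrics are only constrained on pairs of vectors in the same fibre.\<close>

definition bundle_metric ::
  "('m::topological_space, 'e::euclidean_space) chart set \<Rightarrow>
   ('x::topological_space, 'm, 'f::euclidean_space) vbundle \<Rightarrow> ('x \<Rightarrow> 'x \<Rightarrow> real) \<Rightarrow> bool" where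
  "bundle_metric A E h \<longleftrightarrow>
     (\<forall>p. inner_product_on (fibre E p) h) \<and>
     (\<forall>T\<in>trivs E. \<forall>v w.
        smooth_fun_on A (fst T) (\<lambda>p. h (triv_inv E T (p, v)) (triv_inv E T (p, w))))"

definition fibre_norm :: "('x \<Rightarrow> 'x \<Rightarrow> real) \<Rightarrow> 'x \<Rightarrow> real" where
  "fibre_norm h e = sqrt (h e e)"

text \<open>
  A connection maps a point \<open>p\<close>, a tangent vector at \<open>p\<close> and a smooth section to the covariant
  derivative, an element of the fibre over \<open>p\<close>. The point is an explicit argument because the
  zero vectors of all tangent spaces are represented by the same family of components.
\<close>

type_synonym ('x, 'm, 'e) covariant_derivative = "'m \<Rightarrow> ('m, 'e) tvec \<Rightarrow> ('m \<Rightarrow> 'x) \<Rightarrow> 'x"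

definition connection ::
  "('m::topological_space, 'e::euclidean_space) chart set \<Rightarrow>
   ('x::topological_space, 'm, 'f::euclidean_space) vbundle \<Rightarrow>
   ('x, 'm, 'e) covariant_derivative \<Rightarrow> bool" where
  "connection A E nabla \<longleftrightarrow>
     (\<forall>p \<sigma>. smooth_section A E \<sigma> \<longrightarrow>
        linear_map (tangent_space A p) (fibre E p) (\<lambda>x. nabla p x \<sigma>)) \<and>
     (\<forall>p. \<forall>x\<in>vcarrier (tangent_space A p). \<forall>\<sigma> \<tau>. smooth_section A E \<sigma> \<longrightarrow> smooth_section A E \<tau> \<longrightarrow>
        nabla p x (\<lambda>q. bplus E (\<sigma> q) (\<tau> q)) = bplus E (nabla p x \<sigma>) (nabla p x \<tau>)) \<and>
     (\<forall>p. \<forall>x\<in>vcarrier (tangent_space A p). \<forall>f \<sigma>. smooth_fun_on A UNIV f \<longrightarrow> smooth_section A E \<sigma> \<longrightarrow>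
        nabla p x (\<lambda>q. bscale E (f q) (\<sigma> q)) =
          bplus E (bscale E (tangent_deriv A p x f) (\<sigma> p)) (bscale E (f p) (nabla p x \<sigma>))) \<and>
     (\<forall>X \<sigma>. smooth_vector_field A X \<longrightarrow> smooth_section A E \<sigma> \<longrightarrow>
        smooth_section A E (\<lambda>p. nabla p (X p) \<sigma>))"

definition metric_compatible ::
  "('m::topological_space, 'e::euclidean_space) chart set \<Rightarrow>
   ('x::topological_space, 'm, 'f::euclidean_space) vbundle \<Rightarrow> ('x \<Rightarrow> 'x \<Rightarrow> real) \<Rightarrow>
   ('x, 'm, 'e) covariant_derivative \<Rightarrow> bool" where
  "metric_compatible A E h nabla \<longleftrightarrow>
     (\<forall>p. \<forall>x\<in>vcarrier (tangent_space A p). \<forall>\<sigma> \<tau>. smooth_section A E \<sigma> \<longrightarrow> smooth_section A E \<tau> \<longrightarrow>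
        tangent_deriv A p x (\<lambda>q. h (\<sigma> q) (\<tau> q)) = h (nabla p x \<sigma>) (\<tau> p) + h (\<sigma> p) (nabla p x \<tau>))"

text \<open>
  The connection map is uniquely determined on the tangent bundle of \<open>E\<close> because the base has
  positive dimension: each tangent space of \<open>E\<close> is spanned by the vectors \<open>\<sigma>\<^sub>* x\<close>. The choice
  in \<open>connection_map\<close> is only visible at arguments that are not tangent vectors.
\<close>

definition is_connection_map ::
  "('m::topological_space, 'e::euclidean_space) chart set \<Rightarrow>
   ('x::topological_space, 'm, 'f::euclidean_space) vbundle \<Rightarrow>
   ('x, 'm, 'e) covariant_derivative \<Rightarrow> ('x \<Rightarrow> ('x, 'e \<times> 'f) tvec \<Rightarrow> 'x) \<Rightarrow> bool" where
  "is_connection_map A E nabla \<kappa> \<longleftrightarrow>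
     (\<forall>e. linear_map (tangent_space (total_atlas A E) e) (fibre E (proj E e)) (\<kappa> e)) \<and>
     (\<forall>\<sigma> p. \<forall>x\<in>vcarrier (tangent_space A p). smooth_section A E \<sigma> \<longrightarrow>
        \<kappa> (\<sigma> p) (pushforward A (total_atlas A E) \<sigma> p x) = nabla p x \<sigma>)"

definition connection_map ::
  "('m::topological_space, 'e::euclidean_space) chart set \<Rightarrow>
   ('x::topological_space, 'm, 'f::euclidean_space) vbundle \<Rightarrow>
   ('x, 'm, 'e) covariant_derivative \<Rightarrow> 'x \<Rightarrow> ('x, 'e \<times> 'f) tvec \<Rightarrow> 'x" where
  "connection_map A E nabla = (SOME \<kappa>. is_connection_map A E nabla \<kappa>)"

definition sasaki_metric ::
  "('m::topological_space, 'e::euclidean_space) chart set \<Rightarrow>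
   ('m \<Rightarrow> ('m, 'e) tvec \<Rightarrow> ('m, 'e) tvec \<Rightarrow> real) \<Rightarrow>
   ('x::topological_space, 'm, 'f::euclidean_space) vbundle \<Rightarrow> ('x \<Rightarrow> 'x \<Rightarrow> real) \<Rightarrow>
   ('x, 'm, 'e) covariant_derivative \<Rightarrow>
   'x \<Rightarrow> ('x, 'e \<times> 'f) tvec \<Rightarrow> ('x, 'e \<times> 'f) tvec \<Rightarrow> real" where
  "sasaki_metric A g E h nabla e \<xi> \<eta> =
     g (proj E e) (pushforward (total_atlas A E) A (proj E) e \<xi>)
       (pushforward (total_atlas A E) A (proj E) e \<eta>) +
     h (connection_map A E nabla e \<xi>) (connection_map A E nabla e \<eta>)"

text \<open>
  The covariant derivative along \<open>\<alpha>\<close> of a section \<open>V\<close> along \<open>\<alpha>\<close> is \<open>\<kappa> (V' t)\<close>.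
\<close>

definition parallel_along ::
  "('m::topological_space, 'e::euclidean_space) chart set \<Rightarrow>
   ('x::topological_space, 'm, 'f::euclidean_space) vbundle \<Rightarrow>
   ('x, 'm, 'e) covariant_derivative \<Rightarrow> (real \<Rightarrow> 'm) \<Rightarrow> (real \<Rightarrow> 'x) \<Rightarrow> bool" where
  "parallel_along A E nabla \<alpha> V \<longleftrightarrow>
     piecewise_smooth_path (total_atlas A E) V \<and>
     (\<forall>t\<in>{0..1}. proj E (V t) = \<alpha> t) \<and>
     (\<exists>S. finite S \<and> (\<forall>t\<in>{0..1} - S.
        connection_map A E nabla (V t) (velocity (total_atlas A E) V t) = bzero E (\<alpha> t)))"

definition parallel_translation ::
  "('m::topological_space, 'e::euclidean_space) chart set \<Rightarrow>
   ('x::topological_space, 'm, 'f::euclidean_space) vbundle \<Rightarrow>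
   ('x, 'm, 'e) covariant_derivative \<Rightarrow> (real \<Rightarrow> 'm) \<Rightarrow> 'x \<Rightarrow> 'x" where
  "parallel_translation A E nabla \<alpha> =
     (\<lambda>u\<in>vcarrier (fibre E (\<alpha> 0)). THE w. \<exists>V. parallel_along A E nabla \<alpha> V \<and> V 0 = u \<and> V 1 = w)"

definition Hol ::
  "('m::topological_space, 'e::euclidean_space) chart set \<Rightarrow>
   ('x::topological_space, 'm, 'f::euclidean_space) vbundle \<Rightarrow>
   ('x, 'm, 'e) covariant_derivative \<Rightarrow> 'm \<Rightarrow> ('x \<Rightarrow> 'x) set" where
  "Hol A E nabla p = parallel_translation A E nabla ` loops A p"

definition hol_length ::
  "('m::topological_space, 'e::euclidean_space) chart set \<Rightarrow>
   ('m \<Rightarrow> ('m, 'e) tvec \<Rightarrow> ('m, 'e) tvec \<Rightarrow> real) \<Rightarrow>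
   ('x::topological_space, 'm, 'f::euclidean_space) vbundle \<Rightarrow>
   ('x, 'm, 'e) covariant_derivative \<Rightarrow> 'm \<Rightarrow> ('x \<Rightarrow> 'x) \<Rightarrow> real" where
  "hol_length A g E nabla p a =
     Inf {curve_length A g \<alpha> |\<alpha>. \<alpha> \<in> loops A p \<and> parallel_translation A E nabla \<alpha> = a}"

end

theory Submission
  imports Defs
begin

text \<open>
  Along a loop \<open>\<alpha>\<close> at \<open>p\<close>, parallel translation preserves \<open>h\<close>, and in a trivialization it solves a linear
  equation \<open>z' = - \<Gamma>(x) x' z\<close>. For short loops \<open>x\<close> stays close to \<open>x(0)\<close>, and since \<open>x\<close> closes up, the
  first-order term integrates to zero: \<open>\<parallel>a w - w\<parallel>\<close> is at most a constant times \<open>L(a)\<^sup>2 \<parallel>w\<parallel>\<close>. This makes \<open>L\<close>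
  vanish only at the identity and yields the local condition of a holonomic space.

  For the distance formula, a curve \<open>\<gamma>\<close> from \<open>u\<close> to \<open>v\<close> projects to a loop with holonomy \<open>a\<close>, and in a parallel
  frame along this loop \<open>\<gamma>\<close> becomes a curve of the same length in a Euclidean product with horizontal
  displacement the length of the loop and vertical displacement \<open>\<parallel>a u - v\<parallel>\<close>, so it is at least as long as the
  segment. Conversely, given a loop, moving from the parallel field of \<open>u\<close> in the direction of a parallel field,
  at vertical speed proportional to the horizontal speed, attains this bound up to an arbitrarily small error.
\<close>

section \<open>Smooth functions on open sets\<close>

text \<open>The connection is given on global sections only, so its local form has to be extracted
  by cutting off: bump functions, extended by zero thanks to the Hausdorff property, show that
  \<open>nabla\<close> sees germs only and lead to Christoffel symbols \<open>Gam\<close> that are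
  smooth in the base point. Curves are piecewise smooth and wander through many charts, so
  statements about them are proved on single smooth pieces inside one chart and one trivialization
  and spread by a bisection principle. Two further obstacles shape the estimates. The infimum
  \<open>hlen\<close> need not be attained, so the quadratic holonomy bound is proved for single
  loops with constants depending on \<open>p\<close> alone and then passed to the limit. Of a
  parallel frame only one field enters each inequality: the parallel field whose end value is the
  displacement \<open>v - a u\<close>. Pairing with it detects, and moving along it produces, the
  whole vertical part.\<close>

lemma Ck_on_Suc_iff:
  "Ck_on (Suc k) S f \<longleftrightarrow>
     (\<exists>f'. (\<forall>x\<in>S. (f has_derivative f' x) (at x)) \<and> (\<forall>v. Ck_on k S (\<lambda>x. f' x v)))" if "open S"
proof -
  \<comment> \<open>\<open>Ck_on\<close> refers to the selected derivative
    \<open>frechet_derivative\<close>, with which \<open>f'\<close> is known to agree on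
    \<open>S\<close> only. As \<open>S\<close> is open, agreement on \<open>S\<close> passes to
    derivatives at points of \<open>S\<close>, hence to all orders.\<close>
  have cong: "Ck_on k S g" if "Ck_on k S f" "\<And>x. x \<in> S \<Longrightarrow> f x = g x" for k and f g :: "'a \<Rightarrow> 'b"
    using that
  proof (induction k arbitrary: f g)
    case 0
    then show ?case using continuous_on_cong by force
  next
    case (Suc k)
    have d: "(g has_derivative frechet_derivative f (at x)) (at x)" if "x \<in> S" for x
      using Suc.prems that has_derivative_transform_within_open[OF _ \<open>open S\<close> that, of f _ UNIV g]
      by (auto simp: frechet_derivative_works)
    then have "frechet_derivative g (at x) = frechet_derivative f (at x)" if "x \<in> S" for x
      using frechet_derivative_at that by metis
    then have "Ck_on k S (\<lambda>x. frechet_derivative g (at x) v)" for v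
      using Suc.prems Suc.IH[of "\<lambda>x. frechet_derivative f (at x) v"] by auto
    then show ?case using d by (auto simp: differentiable_def)
  qed
  show ?thesis
  proof
    assume "Ck_on (Suc k) S f"
    then show "\<exists>f'. (\<forall>x\<in>S. (f has_derivative f' x) (at x)) \<and> (\<forall>v. Ck_on k S (\<lambda>x. f' x v))"
      by (intro exI[of _ "\<lambda>x. frechet_derivative f (at x)"]) (auto simp: frechet_derivative_works)
  next
    assume "\<exists>f'. (\<forall>x\<in>S. (f has_derivative f' x) (at x)) \<and> (\<forall>v. Ck_on k S (\<lambda>x. f' x v))"
    then obtain f' where f': "\<And>x. x \<in> S \<Longrightarrow> (f has_derivative f' x) (at x)" "\<And>v. Ck_on k S (\<lambda>x. f' x v)"
      by auto
    have eq: "f' x v = frechet_derivative f (at x) v" if "x \<in> S" for x v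
      using frechet_derivative_at[OF f'(1)[OF that]] by (rule fun_cong)
    have "Ck_on k S (\<lambda>x. frechet_derivative f (at x) v)" for v
      using f'(2)[of v] eq by (rule cong)
    then show "Ck_on (Suc k) S f" using f' by (auto simp: differentiable_def)
  qed
qed

lemma Ck_on_SucI:
  "open S \<Longrightarrow> (\<And>x. x \<in> S \<Longrightarrow> (f has_derivative f' x) (at x)) \<Longrightarrow>
   (\<And>v. Ck_on k S (\<lambda>x. f' x v)) \<Longrightarrow> Ck_on (Suc k) S f"
  using Ck_on_Suc_iff by blast

lemma Ck_on_SucE:
  assumes "Ck_on (Suc k) S f"
  obtains f' where "\<And>x. x \<in> S \<Longrightarrow> (f has_derivative f' x) (at x)" "\<And>v. Ck_on k S (\<lambda>x. f' x v)"
  using assms frechet_derivative_works by (metis Ck_on.simps(2))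

lemma Ck_on_cong:
  assumes "open S" "\<And>x. x \<in> S \<Longrightarrow> f x = g x" "Ck_on k S f"
  shows "Ck_on k S g"
proof (cases k)
  case 0
  then show ?thesis using assms continuous_on_cong by force
next
  case (Suc n)
  then obtain f' where f': "\<And>x. x \<in> S \<Longrightarrow> (f has_derivative f' x) (at x)" "\<And>v. Ck_on n S (\<lambda>x. f' x v)"
    using assms(3) Ck_on_SucE by metis
  have "(g has_derivative f' x) (at x)" if "x \<in> S" for x
    using has_derivative_transform_within_open[OF f'(1)[OF that] \<open>open S\<close> that] assms(2) by auto
  then show ?thesis unfolding Suc using Ck_on_SucI[OF assms(1)] f'(2) by blast
qed

lemma Ck_on_subset: "Ck_on k S f \<Longrightarrow> T \<subseteq> S \<Longrightarrow> Ck_on k T f"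
  by (induction k arbitrary: f) (auto intro: continuous_on_subset)

lemma Ck_on_Suc_D: "Ck_on (Suc k) S f \<Longrightarrow> Ck_on k S f"
proof (induction k arbitrary: f)
  case 0
  then show ?case
    by (auto intro!: continuous_at_imp_continuous_on differentiable_imp_continuous_within)
next
  case (Suc k)
  then show ?case unfolding Ck_on.simps(2)[of "Suc k"] Ck_on.simps(2)[of k S f] by blast
qed

lemma Ck_on_local:
  assumes "\<And>x. x \<in> S \<Longrightarrow> \<exists>N. open N \<and> x \<in> N \<and> Ck_on k N f"
  shows "Ck_on k S f"
  using assms
proof (induction k arbitrary: f)
  case 0
  then show ?case unfolding Ck_on.simps
    by (intro continuous_at_imp_continuous_on ballI) (metis continuous_on_eq_continuous_at)
next
  case (Suc k)
  have "f differentiable at x" if "x \<in> S" for x using Suc.prems[OF that] by auto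
  moreover have "Ck_on k S (\<lambda>x. frechet_derivative f (at x) v)" for v
    by (rule Suc.IH) (use Suc.prems in fastforce)
  ultimately show ?case by simp
qed

lemma Ck_on_const: "open S \<Longrightarrow> Ck_on k S (\<lambda>x. c)"
proof (induction k arbitrary: c)
  case (Suc k)
  then show ?case by (intro Ck_on_SucI[where f'="\<lambda>x v. 0"]) auto
qed auto

lemma Ck_on_bounded_linear: "open S \<Longrightarrow> bounded_linear f \<Longrightarrow> Ck_on k S f"
proof (cases k)
  case 0
  assume "bounded_linear f"
  then show ?thesis using 0 by (simp add: linear_continuous_on)
next
  case (Suc n)
  assume "open S" "bounded_linear f"
  then show ?thesis unfolding Suc
    by (intro Ck_on_SucI[where f'="\<lambda>x. f"]) (auto intro: bounded_linear_imp_has_derivative Ck_on_const)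
qed

lemma Ck_on_add: "open S \<Longrightarrow> Ck_on k S f \<Longrightarrow> Ck_on k S g \<Longrightarrow> Ck_on k S (\<lambda>x. f x + g x)"
proof (induction k arbitrary: f g)
  case 0
  then show ?case by (simp add: continuous_on_add)
next
  case (Suc k)
  obtain f' where f': "\<And>x. x \<in> S \<Longrightarrow> (f has_derivative f' x) (at x)" "\<And>v. Ck_on k S (\<lambda>x. f' x v)"
    using Suc.prems(2) Ck_on_SucE by metis
  obtain g' where g': "\<And>x. x \<in> S \<Longrightarrow> (g has_derivative g' x) (at x)" "\<And>v. Ck_on k S (\<lambda>x. g' x v)"
    using Suc.prems(3) Ck_on_SucE by metis
  show ?case
    by (rule Ck_on_SucI[where f'="\<lambda>x v. f' x v + g' x v"])
      (use Suc f' g' in \<open>auto intro!: has_derivative_add\<close>)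
qed

lemma Ck_on_bilinear:
  assumes "bounded_bilinear mul" "open S" "Ck_on k S f" "Ck_on k S g"
  shows "Ck_on k S (\<lambda>x. mul (f x) (g x))"
  using assms(3,4)
proof (induction k arbitrary: f g)
  case 0
  then show ?case using assms(1) by (simp add: bounded_bilinear.continuous_on)
next
  case (Suc k)
  obtain f' where f': "\<And>x. x \<in> S \<Longrightarrow> (f has_derivative f' x) (at x)" "\<And>v. Ck_on k S (\<lambda>x. f' x v)"
    using Suc.prems(1) Ck_on_SucE by metis
  obtain g' where g': "\<And>x. x \<in> S \<Longrightarrow> (g has_derivative g' x) (at x)" "\<And>v. Ck_on k S (\<lambda>x. g' x v)"
    using Suc.prems(2) Ck_on_SucE by metis
  have "Ck_on k S f" "Ck_on k S g" using Suc.prems Ck_on_Suc_D by auto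
  then show ?case
    by (intro Ck_on_SucI[where f'="\<lambda>x v. mul (f x) (g' x v) + mul (f' x v) (g x)"])
      (use assms Suc.IH f' g' in \<open>auto intro!: Ck_on_add bounded_bilinear.FDERIV\<close>)
qed

lemma Ck_on_sum:
  "open S \<Longrightarrow> (\<And>i. i \<in> I \<Longrightarrow> Ck_on k S (f i)) \<Longrightarrow> Ck_on k S (\<lambda>x. \<Sum>i\<in>I. f i x)"
  by (induction I rule: infinite_finite_induct) (auto intro: Ck_on_const Ck_on_add)

lemma linear_euclidean_expansion: "linear f \<Longrightarrow> f v = (\<Sum>i\<in>Basis. (v \<bullet> i) *\<^sub>R f i)"
  for v :: "'a::euclidean_space"
  by (metis (no_types, lifting) euclidean_representation linear_scale linear_sum sum.cong)

text \<open>The chain rule produces \<open>F' (f x) (f' x v)\<close>, whose direction varies with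
  \<open>x\<close>, while \<open>Ck_on\<close> controls fixed directions. Expanding the direction in
  the basis of the finite-dimensional middle space reduces it to finitely many fixed ones.\<close>

lemma Ck_on_compose:
  fixes f :: "'a::real_normed_vector \<Rightarrow> 'b::euclidean_space"
  assumes "open S" "open T" "Ck_on k S f" "Ck_on k T F" "f ` S \<subseteq> T"
  shows "Ck_on k S (\<lambda>x. F (f x))"
  using assms(3,4)
proof (induction k arbitrary: F)
  case 0
  then show ?case using assms(5) continuous_on_compose2 by auto
next
  case (Suc k)
  obtain f' where f': "\<And>x. x \<in> S \<Longrightarrow> (f has_derivative f' x) (at x)" "\<And>v. Ck_on k S (\<lambda>x. f' x v)"
    using Suc.prems(1) Ck_on_SucE by metis
  obtain F' where F': "\<And>x. x \<in> T \<Longrightarrow> (F has_derivative F' x) (at x)" "\<And>v. Ck_on k T (\<lambda>x. F' x v)"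
    using Suc.prems(2) Ck_on_SucE by metis
  have f: "Ck_on k S f" using Suc.prems Ck_on_Suc_D by auto
  have "((\<lambda>x. F (f x)) has_derivative (\<lambda>v. \<Sum>i\<in>Basis. (f' x v \<bullet> i) *\<^sub>R F' (f x) i)) (at x)"
    if "x \<in> S" for x
  proof -
    have T: "f x \<in> T" using that assms(5) by auto
    have "((\<lambda>x. F (f x)) has_derivative (\<lambda>v. F' (f x) (f' x v))) (at x)"
      using has_derivative_compose[OF f'(1)[OF that] F'(1)[OF T]] .
    moreover have "F' (f x) (f' x v) = (\<Sum>i\<in>Basis. (f' x v \<bullet> i) *\<^sub>R F' (f x) i)" for v
      using linear_euclidean_expansion has_derivative_linear[OF F'(1)[OF T]] by blast
    ultimately show ?thesis by simp
  qed
  then show ?case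
    using assms Suc.IH[OF f F'(2)]
      Ck_on_bilinear[OF bounded_bilinear_inner assms(1) f'(2) Ck_on_const[OF assms(1)]]
    by (intro Ck_on_SucI[where f'="\<lambda>x v. \<Sum>i\<in>Basis. (f' x v \<bullet> i) *\<^sub>R F' (f x) i"])
      (auto intro!: Ck_on_sum Ck_on_bilinear[OF bounded_bilinear_scaleR])
qed

lemma smooth_on_cong: "open S \<Longrightarrow> (\<And>x. x \<in> S \<Longrightarrow> f x = g x) \<Longrightarrow> smooth_on S f \<Longrightarrow> smooth_on S g"
  unfolding smooth_on_def using Ck_on_cong by blast

lemma smooth_on_subset: "smooth_on S f \<Longrightarrow> T \<subseteq> S \<Longrightarrow> smooth_on T f"
  unfolding smooth_on_def using Ck_on_subset by blast

lemma smooth_on_local: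
  "(\<And>x. x \<in> S \<Longrightarrow> \<exists>N. open N \<and> x \<in> N \<and> smooth_on N f) \<Longrightarrow> smooth_on S f"
  unfolding smooth_on_def by (meson Ck_on_local)

lemma smooth_on_const: "open S \<Longrightarrow> smooth_on S (\<lambda>x. c)"
  unfolding smooth_on_def using Ck_on_const by blast

lemma smooth_on_bounded_linear: "open S \<Longrightarrow> bounded_linear f \<Longrightarrow> smooth_on S f"
  unfolding smooth_on_def using Ck_on_bounded_linear by blast

lemma smooth_on_add: "open S \<Longrightarrow> smooth_on S f \<Longrightarrow> smooth_on S g \<Longrightarrow> smooth_on S (\<lambda>x. f x + g x)"
  unfolding smooth_on_def using Ck_on_add by blast

lemma smooth_on_bilinear:
  "bounded_bilinear mul \<Longrightarrow> open S \<Longrightarrow> smooth_on S f \<Longrightarrow> smooth_on S g \<Longrightarrow>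
   smooth_on S (\<lambda>x. mul (f x) (g x))"
  unfolding smooth_on_def using Ck_on_bilinear by blast

lemmas smooth_on_scaleR = smooth_on_bilinear[OF bounded_bilinear_scaleR]
  and smooth_on_inner = smooth_on_bilinear[OF bounded_bilinear_inner]

lemma smooth_on_sum:
  "open S \<Longrightarrow> (\<And>i. i \<in> I \<Longrightarrow> smooth_on S (f i)) \<Longrightarrow> smooth_on S (\<lambda>x. \<Sum>i\<in>I. f i x)"
  by (simp add: smooth_on_def Ck_on_sum)

lemma smooth_on_compose:
  fixes f :: "'a::real_normed_vector \<Rightarrow> 'b::euclidean_space"
  assumes "open S" "open T" "smooth_on S f" "smooth_on T F" "f ` S \<subseteq> T"
  shows "smooth_on S (\<lambda>x. F (f x))"
  unfolding smooth_on_def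
  by (intro allI Ck_on_compose[OF assms(1,2) _ _ assms(5), where F=F]) (use assms(3,4) in \<open>auto simp: smooth_on_def\<close>)

lemma smooth_on_bounded_linear_compose:
  fixes f :: "'a::real_normed_vector \<Rightarrow> 'b::euclidean_space"
  shows "open S \<Longrightarrow> bounded_linear F \<Longrightarrow> smooth_on S f \<Longrightarrow> smooth_on S (\<lambda>x. F (f x))"
  using smooth_on_compose[of S UNIV f F] smooth_on_bounded_linear[of UNIV F] by auto

lemma smooth_on_Pair:
  fixes f :: "'a::real_normed_vector \<Rightarrow> 'b::euclidean_space"
    and g :: "'a \<Rightarrow> 'c::euclidean_space"
  assumes "open S" "smooth_on S f" "smooth_on S g"
  shows "smooth_on S (\<lambda>x. (f x, g x))"
proof -
  have "bounded_linear (\<lambda>y::'b. (y, 0::'c))" "bounded_linear (\<lambda>y::'c. (0::'b, y))"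
    by (auto intro!: bounded_linear_Pair bounded_linear_ident bounded_linear_zero)
  then have "smooth_on S (\<lambda>x. (f x, 0::'c) + (0::'b, g x))"
    using smooth_on_add[OF assms(1) smooth_on_bounded_linear_compose[OF assms(1) _ assms(2)]
        smooth_on_bounded_linear_compose[OF assms(1) _ assms(3)]] by blast
  then show ?thesis by simp
qed

lemma smooth_on_imp_has_derivative:
  "smooth_on S f \<Longrightarrow> x \<in> S \<Longrightarrow> (f has_derivative frechet_derivative f (at x)) (at x)"
  unfolding smooth_on_def by (metis Ck_on.simps(2) frechet_derivative_works)

lemma smooth_on_frechet_derivative:
  "smooth_on S f \<Longrightarrow> smooth_on S (\<lambda>x. frechet_derivative f (at x) v)"
  unfolding smooth_on_def by (metis Ck_on.simps(2))

lemma smooth_on_imp_continuous_on: "smooth_on S f \<Longrightarrow> continuous_on S f"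
  unfolding smooth_on_def by (metis Ck_on.simps(1))

section \<open>The flat function exp(-1/s) and Euclidean bump functions\<close>

definition flat :: "nat \<Rightarrow> real \<Rightarrow> real" where
  "flat n s = (if s > 0 then inverse s ^ n * exp (- inverse s) else 0)"

lemma flat_tendsto_0: "(flat n \<longlongrightarrow> 0) (at 0)"
proof -
  have "((\<lambda>s. inverse s ^ n / exp (inverse s)) \<longlongrightarrow> 0) (at_right (0::real))"
    by (rule filterlim_compose[OF tendsto_power_div_exp_0 filterlim_inverse_at_top_right])
  moreover have "\<forall>\<^sub>F s in at_right 0. inverse s ^ n / exp (inverse s) = flat n s"
    unfolding eventually_at flat_def by (intro exI[of _ 1]) (auto simp: exp_minus divide_inverse)
  ultimately have "(flat n \<longlongrightarrow> 0) (at_right 0)" by (rule Lim_transform_eventually)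
  moreover have "(flat n \<longlongrightarrow> 0) (at_left 0)"
    by (rule tendsto_eventually) (auto simp: eventually_at flat_def intro!: exI[of _ 1])
  ultimately show ?thesis by (simp add: filterlim_split_at)
qed

text \<open>The powers of \<open>inverse s\<close> are part of the family so that it is closed under
  differentiation up to linear combinations; induction on the order then runs for all
  \<open>n\<close> at once. At 0 the difference quotient of \<open>flat n\<close> is
  \<open>flat (Suc n)\<close>, which tends to 0.\<close>

lemma flat_has_derivative:
  "(flat n has_real_derivative (flat (n + 2) s - real n * flat (n + 1) s)) (at s)"
proof -
  consider "s > 0" | "s < 0" | "s = 0" by linarith
  then show ?thesis
  proof cases
    case 1
    have "((\<lambda>s. inverse s ^ n * exp (- inverse s)) has_real_derivative
      (flat (n + 2) s - real n * flat (n + 1) s)) (at s)"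
    proof (cases n)
      case 0
      then show ?thesis using 1
        by (auto intro!: derivative_eq_intros simp: flat_def field_simps power2_eq_square)
    next
      case (Suc m)
      then show ?thesis using 1
        by (auto intro!: derivative_eq_intros simp: flat_def field_simps power2_eq_square)
          (metis Suc_pred neq0_conv power_Suc)
    qed
    then show ?thesis
      by (rule has_field_derivative_transform_within_open[where S="{0<..}"])
        (use 1 in \<open>auto simp: flat_def\<close>)
  next
    case 2
    have "((\<lambda>s. 0) has_real_derivative 0) (at s)" by simp
    then have "(flat n has_real_derivative 0) (at s)"
      by (rule has_field_derivative_transform_within_open[where S="{..<0}"])
        (use 2 in \<open>auto simp: flat_def\<close>)
    then show ?thesis using 2 by (simp add: flat_def)
  next
    case 3
    have "((\<lambda>y. (flat n y - flat n 0) / (y - 0)) \<longlongrightarrow> 0) (at 0)"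
      by (rule Lim_transform_eventually[OF flat_tendsto_0[of "Suc n"]])
        (auto simp: eventually_at flat_def field_simps intro!: exI[of _ 1])
    then show ?thesis using 3 by (simp add: has_field_derivative_iff flat_def)
  qed
qed

lemma smooth_on_flat: "smooth_on UNIV (flat n)"
proof -
  have "Ck_on k UNIV (flat n)" for k
  proof (induction k arbitrary: n)
    case 0
    show ?case unfolding Ck_on.simps by (rule DERIV_continuous_on[OF flat_has_derivative])
  next
    case (Suc k)
    have *: "Ck_on k UNIV (\<lambda>x. c *\<^sub>R f x)" if "Ck_on k UNIV f" for c :: real and f :: "real \<Rightarrow> real"
      by (intro Ck_on_bilinear[OF bounded_bilinear_scaleR] Ck_on_const that) auto
    have "Ck_on k UNIV (\<lambda>x. v *\<^sub>R (flat (n + 2) x + (- real n) *\<^sub>R flat (n + 1) x))" for v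
      by (intro * Ck_on_add Suc.IH) auto
    moreover have "(flat n has_derivative (\<lambda>v. v *\<^sub>R (flat (n + 2) s + (- real n) *\<^sub>R flat (n + 1) s))) (at s)" for s
      using flat_has_derivative[of n s] unfolding has_field_derivative_def
      by (rule has_derivative_eq_rhs) (auto simp: fun_eq_iff algebra_simps)
    ultimately show ?case by (intro Ck_on_SucI) auto
  qed
  then show ?thesis by (simp add: smooth_on_def)
qed

text \<open>With \<open>f = flat 0\<close>, the function \<open>e f (1 - e f s)\<close> is 1 for \<open>s \<le> 0\<close> and 0 for \<open>s \<ge> 1\<close>.\<close>

lemma bump_function_exists:
  fixes y0 :: "'e::euclidean_space"
  assumes "r > 0"
  obtains \<beta> :: "'e \<Rightarrow> real" where "smooth_on UNIV \<beta>" "\<And>y. y \<in> ball y0 (r/2) \<Longrightarrow> \<beta> y = 1"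
    "\<And>y. y \<notin> ball y0 r \<Longrightarrow> \<beta> y = 0"
proof -
  \<comment> \<open>The shift puts the value 0 on the sphere of radius \<open>r/2\<close>, and the
    factor, the inverse of \<open>r\<^sup>2 - (r/2)\<^sup>2\<close>, puts the value 1 on the sphere
    of radius \<open>r\<close>.\<close>
  define \<sigma> where "\<sigma> y = ((y - y0) \<bullet> (y - y0) + - (r/2)\<^sup>2) *\<^sub>R (4 / (3 * r\<^sup>2))" for y :: 'e
  define \<beta> where "\<beta> y = exp 1 *\<^sub>R flat 0 (1 + (- exp 1) *\<^sub>R flat 0 (\<sigma> y))" for y :: 'e
  have lin: "smooth_on UNIV (\<lambda>y::'e. y - y0)"
    using smooth_on_add[of UNIV "\<lambda>y. y" "\<lambda>y. - y0"]
    by (simp add: smooth_on_bounded_linear bounded_linear_ident smooth_on_const)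
  have \<sigma>: "smooth_on UNIV \<sigma>" unfolding \<sigma>_def
    by (intro smooth_on_scaleR smooth_on_add smooth_on_inner smooth_on_const lin) auto
  have "smooth_on UNIV (\<lambda>y. flat 0 (\<sigma> y))"
    by (intro smooth_on_compose[OF _ _ \<sigma> smooth_on_flat]) auto
  then have "smooth_on UNIV (\<lambda>y. 1 + (- exp 1) *\<^sub>R flat 0 (\<sigma> y))"
    by (intro smooth_on_scaleR smooth_on_add smooth_on_const) auto
  then have "smooth_on UNIV \<beta>" unfolding \<beta>_def
    by (intro smooth_on_scaleR smooth_on_const smooth_on_compose[OF _ _ _ smooth_on_flat]) auto
  moreover have "\<beta> y = 1" if "y \<in> ball y0 (r/2)" for y
  proof -
    have "norm (y - y0) < r/2" using that by (simp add: dist_norm norm_minus_commute)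
    then have "(norm (y - y0))\<^sup>2 \<le> (r/2)\<^sup>2" by (intro power_mono) auto
    then have "\<sigma> y \<le> 0" unfolding \<sigma>_def dot_square_norm using assms
      by (simp add: mult_le_0_iff divide_le_0_iff)
    then show ?thesis by (simp add: \<beta>_def flat_def exp_minus)
  qed
  moreover have "\<beta> y = 0" if "y \<notin> ball y0 r" for y
  proof -
    have "norm (y - y0) \<ge> r" using that by (simp add: dist_norm norm_minus_commute)
    then have "(norm (y - y0))\<^sup>2 \<ge> r\<^sup>2" using assms by (intro power_mono) auto
    then have *: "\<sigma> y \<ge> 1" unfolding \<sigma>_def dot_square_norm using assms
      by (simp add: field_simps)
    then have "flat 0 (\<sigma> y) \<ge> exp (-1)"
      using le_imp_inverse_le[of 1 "\<sigma> y"] by (simp add: flat_def)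
    then have "exp 1 * flat 0 (\<sigma> y) \<ge> exp 1 * exp (-1)" by (intro mult_left_mono) auto
    then have "1 - exp 1 * flat 0 (\<sigma> y) \<le> 0" by (simp add: exp_minus)
    then show ?thesis by (simp add: \<beta>_def flat_def)
  qed
  ultimately show ?thesis using that by blast
qed

section \<open>Smooth functions on compact intervals\<close>

text \<open>\<open>smooth_on_interval\<close> asks for one infinite sequence of derivatives, which
  does not lend itself to product and chain rules. Counting the order allows them to be proved by
  induction, as for \<open>Ck_on\<close>.\<close>

primrec Ck_interval :: "nat \<Rightarrow> real \<Rightarrow> real \<Rightarrow> (real \<Rightarrow> 'e::real_normed_vector) \<Rightarrow> bool" where
  "Ck_interval 0 a b f \<longleftrightarrow> continuous_on {a..b} f"
| "Ck_interval (Suc k) a b f \<longleftrightarrow>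
     (\<exists>f'. (\<forall>t\<in>{a..b}. (f has_vector_derivative f' t) (at t within {a..b})) \<and> Ck_interval k a b f')"

lemma Ck_interval_cong: "(\<And>t. t \<in> {a..b} \<Longrightarrow> f t = g t) \<Longrightarrow> Ck_interval k a b f \<Longrightarrow> Ck_interval k a b g"
proof (cases k)
  case 0
  assume "\<And>t. t \<in> {a..b} \<Longrightarrow> f t = g t" "Ck_interval k a b f"
  then show ?thesis using 0 continuous_on_cong[OF refl, of "{a..b}" f g] by auto
next
  case (Suc n)
  assume *: "\<And>t. t \<in> {a..b} \<Longrightarrow> f t = g t" "Ck_interval k a b f"
  then obtain f' where f': "\<And>t. t \<in> {a..b} \<Longrightarrow> (f has_vector_derivative f' t) (at t within {a..b})"
    "Ck_interval n a b f'" unfolding Suc by (auto simp del: atLeastAtMost_iff)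
  have "(g has_vector_derivative f' t) (at t within {a..b})" if "t \<in> {a..b}" for t
    using has_vector_derivative_transform[OF that _ f'(1)[OF that]] *(1) by simp
  then show ?thesis unfolding Suc using f'(2) by (auto simp del: atLeastAtMost_iff)
qed

lemma Ck_interval_SucI:
  "(\<And>t. t \<in> {a..b} \<Longrightarrow> (f has_vector_derivative f' t) (at t within {a..b})) \<Longrightarrow>
   Ck_interval k a b f' \<Longrightarrow> Ck_interval (Suc k) a b f"
  by (auto simp del: atLeastAtMost_iff)

lemma has_vector_derivative_continuous_on:
  "(\<And>t. t \<in> S \<Longrightarrow> (f has_vector_derivative f' t) (at t within S)) \<Longrightarrow> continuous_on S f"
  by (intro continuous_on_eq_continuous_within[THEN iffD2] ballI has_vector_derivative_continuous)

text \<open>On a nondegenerate interval one-sided derivatives are unique, so the derivatives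
  witnessed for different orders coincide and iterate to a single sequence.\<close>

lemma smooth_on_interval_iff:
  assumes "a < b"
  shows "smooth_on_interval a b f \<longleftrightarrow> (\<forall>n. Ck_interval n a b f)"
proof
  assume "smooth_on_interval a b f"
  then obtain D where D: "D 0 = f"
    "\<And>k t. t \<in> {a..b} \<Longrightarrow> (D k has_vector_derivative D (Suc k) t) (at t within {a..b})"
    unfolding smooth_on_interval_def by blast
  have "Ck_interval n a b (D k)" for n k
  proof (induction n arbitrary: k)
    case 0
    show ?case using D(2) has_vector_derivative_continuous_on[of "{a..b}" "D k" "D (Suc k)"] by simp
  next
    case (Suc n)
    then show ?case using D(2) by (auto simp del: atLeastAtMost_iff)
  qed
  then show "\<forall>n. Ck_interval n a b f" using D(1) by metis
next
  assume all: "\<forall>n. Ck_interval n a b f"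
  define d where "d h = (\<lambda>t. vector_derivative h (at t within {a..b}))" for h :: "real \<Rightarrow> 'a"
  have step: "(\<forall>t\<in>{a..b}. (h has_vector_derivative d h t) (at t within {a..b})) \<and> (\<forall>n. Ck_interval n a b (d h))"
    if h: "\<forall>n. Ck_interval n a b h" for h
  proof -
    have "\<exists>h'. (\<forall>t\<in>{a..b}. (h has_vector_derivative h' t) (at t within {a..b})) \<and> Ck_interval n a b h'" for n
      using h[rule_format, of "Suc n"] by (simp del: atLeastAtMost_iff)
    then obtain h' where h': "\<And>n t. t \<in> {a..b} \<Longrightarrow> (h has_vector_derivative h' n t) (at t within {a..b})"
      "\<And>n. Ck_interval n a b (h' n)"
      by metis
    have eq: "h' n t = d h t" if "t \<in> {a..b}" for n t
      unfolding d_def using assms that h'(1)[OF that]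
      by (intro vector_derivative_within[symmetric]) (simp_all add: trivial_limit_within)
    show ?thesis using h' eq Ck_interval_cong by metis
  qed
  have "\<forall>n. Ck_interval n a b ((d ^^ k) f)" for k
    by (induction k) (use all step in auto)
  then show "smooth_on_interval a b f" unfolding smooth_on_interval_def
    by (intro exI[of _ "\<lambda>k. (d ^^ k) f"]) (use step in auto)
qed

lemma Ck_interval_Suc_D: "Ck_interval (Suc k) a b f \<Longrightarrow> Ck_interval k a b f"
proof (induction k arbitrary: f)
  case 0
  then show ?case using has_vector_derivative_continuous_on[of "{a..b}" f]
    by (auto simp del: atLeastAtMost_iff)
next
  case (Suc k)
  then show ?case unfolding Ck_interval.simps(2)[of "Suc k"] Ck_interval.simps(2)[of k _ _ f] by blast
qed

lemma Ck_interval_SucE: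
  assumes "Ck_interval (Suc k) a b f"
  obtains f' where "\<And>t. t \<in> {a..b} \<Longrightarrow> (f has_vector_derivative f' t) (at t within {a..b})"
    "Ck_interval k a b f'" "Ck_interval k a b f"
  using assms Ck_interval_Suc_D[OF assms] by (auto simp del: atLeastAtMost_iff)

lemma Ck_interval_const: "Ck_interval k a b (\<lambda>t. c)"
proof (induction k arbitrary: c)
  case (Suc k)
  then show ?case by (auto intro!: exI[of _ "\<lambda>t. 0"])
qed auto

lemma Ck_interval_add: "Ck_interval k a b f \<Longrightarrow> Ck_interval k a b g \<Longrightarrow> Ck_interval k a b (\<lambda>t. f t + g t)"
proof (induction k arbitrary: f g)
  case 0
  then show ?case by (simp add: continuous_on_add)
next
  case (Suc k)
  obtain f' where f': "\<And>t. t \<in> {a..b} \<Longrightarrow> (f has_vector_derivative f' t) (at t within {a..b})"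
    "Ck_interval k a b f'" using Suc.prems(1) Ck_interval_SucE by metis
  obtain g' where g': "\<And>t. t \<in> {a..b} \<Longrightarrow> (g has_vector_derivative g' t) (at t within {a..b})"
    "Ck_interval k a b g'" using Suc.prems(2) Ck_interval_SucE by metis
  show ?case using f' g' Suc.IH
    by (auto intro!: exI[of _ "\<lambda>t. f' t + g' t"] has_vector_derivative_add simp del: atLeastAtMost_iff)
qed

lemma Ck_interval_bilinear:
  assumes "bounded_bilinear mul" "Ck_interval k a b f" "Ck_interval k a b g"
  shows "Ck_interval k a b (\<lambda>t. mul (f t) (g t))"
  using assms(2,3)
proof (induction k arbitrary: f g)
  case 0
  then show ?case using assms(1) by (simp add: bounded_bilinear.continuous_on)
next
  case (Suc k)
  obtain f' where f': "\<And>t. t \<in> {a..b} \<Longrightarrow> (f has_vector_derivative f' t) (at t within {a..b})"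
    "Ck_interval k a b f'" "Ck_interval k a b f" using Suc.prems(1) Ck_interval_SucE by metis
  obtain g' where g': "\<And>t. t \<in> {a..b} \<Longrightarrow> (g has_vector_derivative g' t) (at t within {a..b})"
    "Ck_interval k a b g'" "Ck_interval k a b g" using Suc.prems(2) Ck_interval_SucE by metis
  show ?case using f' g' Suc.IH
    by (auto intro!: exI[of _ "\<lambda>t. mul (f t) (g' t) + mul (f' t) (g t)"] Ck_interval_add
        bounded_bilinear.has_vector_derivative[OF assms(1)] simp del: atLeastAtMost_iff)
qed

lemma Ck_interval_sum:
  "(\<And>i. i \<in> I \<Longrightarrow> Ck_interval k a b (f i)) \<Longrightarrow> Ck_interval k a b (\<lambda>t. \<Sum>i\<in>I. f i t)"
  by (induction I rule: infinite_finite_induct) (auto intro: Ck_interval_const Ck_interval_add)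

lemma Ck_interval_compose:
  fixes f :: "real \<Rightarrow> 'b::euclidean_space"
  assumes "open T" "Ck_interval k a b f" "Ck_on k T F" "f ` {a..b} \<subseteq> T"
  shows "Ck_interval k a b (\<lambda>t. F (f t))"
  using assms(2,3)
proof (induction k arbitrary: F)
  case 0
  then show ?case using assms(4) continuous_on_compose2 by auto
next
  case (Suc k)
  obtain f' where f': "\<And>t. t \<in> {a..b} \<Longrightarrow> (f has_vector_derivative f' t) (at t within {a..b})"
    "Ck_interval k a b f'" "Ck_interval k a b f" using Suc.prems(1) Ck_interval_SucE by metis
  obtain F' where F': "\<And>x. x \<in> T \<Longrightarrow> (F has_derivative F' x) (at x)" "\<And>v. Ck_on k T (\<lambda>x. F' x v)"
    using Suc.prems(2) Ck_on_SucE by metis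
  have "((\<lambda>t. F (f t)) has_vector_derivative (\<Sum>i\<in>Basis. (f' t \<bullet> i) *\<^sub>R F' (f t) i)) (at t within {a..b})"
    if "t \<in> {a..b}" for t
  proof -
    have T: "f t \<in> T" using that assms(4) by auto
    have "((\<lambda>t. F (f t)) has_vector_derivative F' (f t) (f' t)) (at t within {a..b})"
      using vector_derivative_diff_chain_within[OF f'(1)[OF that] has_derivative_at_withinI[OF F'(1)[OF T]]]
      by (simp add: o_def)
    then show ?thesis
      using linear_euclidean_expansion[OF has_derivative_linear[OF F'(1)[OF T]]] by metis
  qed
  moreover have "Ck_interval k a b (\<lambda>t. \<Sum>i\<in>Basis. (f' t \<bullet> i) *\<^sub>R F' (f t) i)"
    by (intro Ck_interval_sum Ck_interval_bilinear[OF bounded_bilinear_scaleR]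
        Ck_interval_bilinear[OF bounded_bilinear_inner] Ck_interval_const f' Suc.IH F')
  ultimately show ?case by (rule Ck_interval_SucI)
qed

lemma smooth_on_interval_cong:
  "a < b \<Longrightarrow> (\<And>t. t \<in> {a..b} \<Longrightarrow> f t = g t) \<Longrightarrow> smooth_on_interval a b f \<Longrightarrow> smooth_on_interval a b g"
  using Ck_interval_cong unfolding smooth_on_interval_iff by blast

lemma smooth_on_interval_subset:
  "smooth_on_interval a b f \<Longrightarrow> {c..d} \<subseteq> {a..b} \<Longrightarrow> smooth_on_interval c d f"
  unfolding smooth_on_interval_def using has_vector_derivative_within_subset by (metis subset_iff)

lemma smooth_on_interval_const: "smooth_on_interval a b (\<lambda>t. c)"
  unfolding smooth_on_interval_def
  by (intro exI[of _ "\<lambda>k. if k = 0 then (\<lambda>t. c) else (\<lambda>t. 0)"]) auto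

lemma smooth_on_interval_add:
  "a < b \<Longrightarrow> smooth_on_interval a b f \<Longrightarrow> smooth_on_interval a b g \<Longrightarrow>
   smooth_on_interval a b (\<lambda>t. f t + g t)"
  using Ck_interval_add unfolding smooth_on_interval_iff by blast

lemma smooth_on_interval_bilinear:
  "a < b \<Longrightarrow> bounded_bilinear mul \<Longrightarrow> smooth_on_interval a b f \<Longrightarrow> smooth_on_interval a b g \<Longrightarrow>
   smooth_on_interval a b (\<lambda>t. mul (f t) (g t))"
  using Ck_interval_bilinear unfolding smooth_on_interval_iff by blast

lemma smooth_on_interval_compose:
  fixes f :: "real \<Rightarrow> 'b::euclidean_space"
  assumes "a < b" "open T" "smooth_on_interval a b f" "smooth_on T F" "f ` {a..b} \<subseteq> T"
  shows "smooth_on_interval a b (\<lambda>t. F (f t))"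
  unfolding smooth_on_interval_iff[OF assms(1)]
  by (intro allI Ck_interval_compose[OF assms(2) _ _ assms(5), where F=F])
    (use assms(3,4) in \<open>auto simp: smooth_on_def smooth_on_interval_iff[OF assms(1)]\<close>)

lemma smooth_on_interval_imp_continuous_on: "smooth_on_interval a b f \<Longrightarrow> continuous_on {a..b} f"
  unfolding smooth_on_interval_def using has_vector_derivative_continuous_on[of "{a..b}"] by metis

lemma smooth_on_intervalE:
  assumes "smooth_on_interval a b f"
  obtains f' where "\<And>t. t \<in> {a..b} \<Longrightarrow> (f has_vector_derivative f' t) (at t within {a..b})"
    "smooth_on_interval a b f'"
proof -
  obtain D where D: "D 0 = f"
    "\<forall>k. \<forall>t\<in>{a..b}. (D k has_vector_derivative D (Suc k) t) (at t within {a..b})"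
    using assms unfolding smooth_on_interval_def by blast
  then have "smooth_on_interval a b (D (Suc 0))" unfolding smooth_on_interval_def
    by (intro exI[of _ "\<lambda>k. D (Suc k)"]) auto
  then show ?thesis using that[of "D (Suc 0)"] D by metis
qed

lemma smooth_on_interval_bounded_linear:
  assumes "bounded_linear F" "smooth_on_interval a b f"
  shows "smooth_on_interval a b (\<lambda>t. F (f t))"
proof -
  obtain D where D: "D 0 = f"
    "\<forall>k. \<forall>t\<in>{a..b}. (D k has_vector_derivative D (Suc k) t) (at t within {a..b})"
    using assms unfolding smooth_on_interval_def by blast
  then show ?thesis unfolding smooth_on_interval_def
    using bounded_linear.has_vector_derivative[OF assms(1)]
    by (intro exI[of _ "\<lambda>k t. F (D k t)"]) auto
qed

lemma smooth_on_interval_Pair: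
  fixes f :: "real \<Rightarrow> 'b::real_normed_vector" and g :: "real \<Rightarrow> 'c::real_normed_vector"
  assumes "smooth_on_interval a b f" "smooth_on_interval a b g"
  shows "smooth_on_interval a b (\<lambda>t. (f t, g t))"
proof -
  obtain D where D: "D 0 = f"
    "\<forall>k. \<forall>t\<in>{a..b}. (D k has_vector_derivative D (Suc k) t) (at t within {a..b})"
    using assms unfolding smooth_on_interval_def by blast
  obtain D' where D': "D' 0 = g"
    "\<forall>k. \<forall>t\<in>{a..b}. (D' k has_vector_derivative D' (Suc k) t) (at t within {a..b})"
    using assms unfolding smooth_on_interval_def by blast
  show ?thesis unfolding smooth_on_interval_def using D D'
    by (intro exI[of _ "\<lambda>k t. (D k t, D' k t)"]) (auto intro!: has_vector_derivative_Pair)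
qed

lemma smooth_on_interval_affine:
  assumes "smooth_on_interval a b f" "\<And>t. t \<in> {c..d} \<Longrightarrow> k * t + m \<in> {a..b}"
  shows "smooth_on_interval c d (\<lambda>t. f (k * t + m))"
proof -
  obtain D where D: "D 0 = f"
    "\<And>n t. t \<in> {a..b} \<Longrightarrow> (D n has_vector_derivative D (Suc n) t) (at t within {a..b})"
    using assms unfolding smooth_on_interval_def by blast
  have "((\<lambda>t. k ^ n *\<^sub>R D n (k * t + m)) has_vector_derivative k ^ Suc n *\<^sub>R D (Suc n) (k * t + m))
      (at t within {c..d})" if "t \<in> {c..d}" for n t
  proof -
    have "((\<lambda>t. k * t + m) has_vector_derivative k) (at t within {c..d})"
      by (auto intro!: derivative_eq_intros simp: has_vector_derivative_def)
    moreover have "(D n has_vector_derivative D (Suc n) (k * t + m)) (at (k * t + m) within (\<lambda>t. k * t + m) ` {c..d})"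
      by (rule has_vector_derivative_within_subset[OF D(2)[OF assms(2)[OF that]]]) (use assms(2) in blast)
    ultimately have "(D n \<circ> (\<lambda>t. k * t + m) has_vector_derivative k *\<^sub>R D (Suc n) (k * t + m)) (at t within {c..d})"
      by (rule vector_diff_chain_within)
    then show ?thesis
      using bounded_linear.has_vector_derivative[OF bounded_linear_scaleR_right[of "k ^ n"]]
      by (fastforce simp: o_def mult.commute)
  qed
  then show ?thesis unfolding smooth_on_interval_def using D(1)
    by (intro exI[of _ "\<lambda>n t. k ^ n *\<^sub>R D n (k * t + m)"]) auto
qed

text \<open>Serves the Stone-Weierstrass approximation of the speed in
  \<open>speed_majorant\<close>.\<close>

lemma smooth_on_interval_polynomial:
  assumes "real_polynomial_function q"
  shows "smooth_on_interval a b q"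
proof -
  obtain d where d: "\<And>p. real_polynomial_function p \<Longrightarrow> real_polynomial_function (d p)"
    "\<And>p x. real_polynomial_function p \<Longrightarrow> (p has_real_derivative (d p x)) (at x)"
    using has_real_derivative_polynomial_function by metis
  have "real_polynomial_function ((d ^^ k) q)" for k by (induction k) (use assms d in auto)
  then show ?thesis unfolding smooth_on_interval_def
    by (intro exI[of _ "\<lambda>k. (d ^^ k) q"])
      (use d in \<open>auto simp flip: has_real_derivative_iff_has_vector_derivative intro: has_field_derivative_at_within\<close>)
qed

lemma has_vector_derivative_cong_nhds:
  "\<forall>\<^sub>F s in nhds t. f s = g s \<Longrightarrow> (f has_vector_derivative v) (at t) \<Longrightarrow> (g has_vector_derivative v) (at t)"
  using has_vector_derivative_cong_ev[where S=UNIV and f=f and g=g and x=t] eventually_nhds_x_imp_x[of _ t]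
  by (auto elim: eventually_mono)

section \<open>Smooth families of bilinear maps\<close>

text \<open>The common shape of the two metrics and the Christoffel symbols in coordinates.
  Smoothness is required for fixed vectors only; joint regularity comes back through the expansion
  in bases.\<close>

definition smooth_bilinear ::
  "'y::euclidean_space set \<Rightarrow> ('y \<Rightarrow> 'v::euclidean_space \<Rightarrow> 'w::euclidean_space \<Rightarrow> 'z::euclidean_space) \<Rightarrow> bool" where
  "smooth_bilinear U H \<longleftrightarrow> open U \<and> (\<forall>y\<in>U. bilinear (H y)) \<and> (\<forall>v w. smooth_on U (\<lambda>y. H y v w))"

lemma smooth_bilinear_expand:
  assumes "smooth_bilinear U H" "y \<in> U"
  shows "H y v w = (\<Sum>i\<in>Basis. \<Sum>j\<in>Basis. ((v \<bullet> i) * (w \<bullet> j)) *\<^sub>R H y i j)"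
proof -
  have "bilinear (H y)" using assms by (auto simp: smooth_bilinear_def)
  then have lin: "linear (H y v)" "linear (\<lambda>v. H y v w)" for v w by (auto simp: bilinear_def)
  have "H y v w = (\<Sum>i\<in>Basis. (v \<bullet> i) *\<^sub>R H y i w)" using linear_euclidean_expansion[OF lin(2)] .
  also have "\<dots> = (\<Sum>i\<in>Basis. \<Sum>j\<in>Basis. ((v \<bullet> i) * (w \<bullet> j)) *\<^sub>R H y i j)"
    by (subst linear_euclidean_expansion[OF lin(1)]) (simp add: scaleR_sum_right)
  finally show ?thesis .
qed

lemma smooth_bilinear_continuous_on:
  assumes "smooth_bilinear U H" "continuous_on X x" "continuous_on X v" "continuous_on X w" "x ` X \<subseteq> U"
  shows "continuous_on X (\<lambda>t. H (x t) (v t) (w t))"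
proof -
  have "continuous_on U (\<lambda>y. H y i j)" for i j
    using assms(1) smooth_on_imp_continuous_on unfolding smooth_bilinear_def by blast
  then have "continuous_on X (\<lambda>t. H (x t) i j)" for i j
    using continuous_on_compose2[OF _ assms(2,5)] by blast
  then have "continuous_on X (\<lambda>t. \<Sum>i\<in>Basis. \<Sum>j\<in>Basis. ((v t \<bullet> i) * (w t \<bullet> j)) *\<^sub>R H (x t) i j)"
    by (intro continuous_on_sum continuous_on_scaleR continuous_on_mult continuous_on_inner assms continuous_on_const)
  moreover have "H (x t) (v t) (w t) = (\<Sum>i\<in>Basis. \<Sum>j\<in>Basis. ((v t \<bullet> i) * (w t \<bullet> j)) *\<^sub>R H (x t) i j)"
    if "t \<in> X" for t
    using smooth_bilinear_expand[OF assms(1)] assms(5) that by blast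
  ultimately show ?thesis by (simp cong: continuous_on_cong)
qed

text \<open>In bases the function is a finite sum of scalar products
  \<open>(v t \<bullet> i) * (w t \<bullet> j)\<close> times coefficients
  \<open>H (x t) i j\<close>, to which the product and chain rules apply. The terms that
  differentiate the coefficients reassemble to the derivative in the base point with frozen
  vectors.\<close>

lemma smooth_bilinear_has_vector_derivative:
  assumes H: "smooth_bilinear U H" and U: "x t \<in> U" and x: "(x has_vector_derivative x') (at t)"
    and v: "(v has_vector_derivative v') (at t)" and w: "(w has_vector_derivative w') (at t)"
  shows "((\<lambda>t. H (x t) (v t) (w t)) has_vector_derivative
    (frechet_derivative (\<lambda>y. H y (v t) (w t)) (at (x t)) x' + H (x t) v' (w t) + H (x t) (v t) w')) (at t)"
proof -
  have "open U" and bil: "bilinear (H (x t))" using H U by (auto simp: smooth_bilinear_def)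
  define d where "d i j = frechet_derivative (\<lambda>y. H y i j) (at (x t)) x'" for i j
  define e where "e i j t = (v t \<bullet> i) * (w t \<bullet> j)" for i j t
  have der: "((\<lambda>y. H y i j) has_derivative frechet_derivative (\<lambda>y. H y i j) (at (x t))) (at (x t))" for i j
    using H U smooth_on_imp_has_derivative unfolding smooth_bilinear_def by blast
  have dH: "((\<lambda>t. H (x t) i j) has_vector_derivative d i j) (at t)" for i j
    using vector_derivative_diff_chain_within[OF x has_derivative_at_withinI[OF der], of i j]
    unfolding o_def d_def by simp
  have e: "(e i j has_vector_derivative (v t \<bullet> i) * (w' \<bullet> j) + (v' \<bullet> i) * (w t \<bullet> j)) (at t)" for i j
    unfolding e_def
    by (intro has_vector_derivative_mult bounded_linear.has_vector_derivative[OF bounded_linear_inner_left] v w)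
  have ev: "\<forall>\<^sub>F s in nhds t. x s \<in> U"
    using topological_tendstoD[OF _ \<open>open U\<close> U] has_vector_derivative_continuous[OF x]
    by (simp add: continuous_within tendsto_at_iff_tendsto_nhds)
  have "((\<lambda>t. \<Sum>i\<in>Basis. \<Sum>j\<in>Basis. e i j t *\<^sub>R H (x t) i j) has_vector_derivative
      (\<Sum>i\<in>Basis. \<Sum>j\<in>Basis. e i j t *\<^sub>R d i j + ((v t \<bullet> i) * (w' \<bullet> j) + (v' \<bullet> i) * (w t \<bullet> j)) *\<^sub>R H (x t) i j)) (at t)"
    by (intro has_vector_derivative_sum bounded_bilinear.has_vector_derivative[OF bounded_bilinear_scaleR] dH e)
  moreover have "((\<lambda>y. \<Sum>i\<in>Basis. \<Sum>j\<in>Basis. e i j t *\<^sub>R H y i j) has_derivative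
      (\<lambda>x'. \<Sum>i\<in>Basis. \<Sum>j\<in>Basis. e i j t *\<^sub>R frechet_derivative (\<lambda>y. H y i j) (at (x t)) x')) (at (x t))"
    by (intro has_derivative_sum has_derivative_scaleR_right der)
  then have "((\<lambda>y. H y (v t) (w t)) has_derivative
      (\<lambda>x'. \<Sum>i\<in>Basis. \<Sum>j\<in>Basis. e i j t *\<^sub>R frechet_derivative (\<lambda>y. H y i j) (at (x t)) x')) (at (x t))"
    by (rule has_derivative_transform_within_open[OF _ \<open>open U\<close> U])
      (simp add: smooth_bilinear_expand[OF H, symmetric] e_def)
  then have "frechet_derivative (\<lambda>y. H y (v t) (w t)) (at (x t)) x' = (\<Sum>i\<in>Basis. \<Sum>j\<in>Basis. e i j t *\<^sub>R d i j)"
    unfolding d_def by (metis (no_types, lifting) frechet_derivative_at)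
  ultimately have "((\<lambda>t. \<Sum>i\<in>Basis. \<Sum>j\<in>Basis. e i j t *\<^sub>R H (x t) i j) has_vector_derivative
      (frechet_derivative (\<lambda>y. H y (v t) (w t)) (at (x t)) x' + H (x t) v' (w t) + H (x t) (v t) w')) (at t)"
    by (simp add: smooth_bilinear_expand[OF H U, of v' "w t"] smooth_bilinear_expand[OF H U, of "v t" w']
        sum.distrib scaleR_left_distrib algebra_simps)
  moreover have "\<forall>\<^sub>F s in nhds t. (\<Sum>i\<in>Basis. \<Sum>j\<in>Basis. e i j s *\<^sub>R H (x s) i j) = H (x s) (v s) (w s)"
    using ev by eventually_elim (simp add: smooth_bilinear_expand[OF H, symmetric] e_def)
  ultimately show ?thesis by (rule has_vector_derivative_cong_nhds[rotated])
qed

section \<open>Charts and tangent vectors\<close>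

locale smooth_manifold =
  fixes A :: "('m::topological_space, 'e::euclidean_space) chart set"
  assumes atlas: "smooth_atlas A"
begin

lemma chart_open: "c \<in> A \<Longrightarrow> open (fst c)"
  and chart_image_open: "c \<in> A \<Longrightarrow> open (snd c ` fst c)"
  and chart_homeo: "c \<in> A \<Longrightarrow> homeomorphism (fst c) (snd c ` fst c) (snd c) (chart_inv c)"
  and transition_smooth: "c \<in> A \<Longrightarrow> d \<in> A \<Longrightarrow>
    smooth_on (snd c ` (fst c \<inter> fst d)) (snd d \<circ> chart_inv c)"
  using atlas unfolding smooth_atlas_def by auto

lemma chart_cont: "c \<in> A \<Longrightarrow> continuous_on (fst c) (snd c)"
  and chart_inv_cont: "c \<in> A \<Longrightarrow> continuous_on (snd c ` fst c) (chart_inv c)"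
  and chart_inv_chart [simp]: "c \<in> A \<Longrightarrow> q \<in> fst c \<Longrightarrow> chart_inv c (snd c q) = q"
  using chart_homeo[of c] by (auto simp: homeomorphism_def)

lemma open_chart_image:
  assumes "c \<in> A" "open U" shows "open (snd c ` (fst c \<inter> U))"
proof -
  have "snd c ` (fst c \<inter> U) = snd c ` fst c \<inter> chart_inv c -` U" using assms by auto
  then show ?thesis
    using continuous_on_open_vimage[OF chart_image_open] chart_inv_cont assms
    by (metis Int_commute)
qed

lemma open_chart_image_subset: "c \<in> A \<Longrightarrow> open U \<Longrightarrow> U \<subseteq> fst c \<Longrightarrow> open (snd c ` U)"
  using open_chart_image[of c U] by (simp add: Int_absorb1)

lemma ex_chart: "\<exists>c. c \<in> A \<and> q \<in> fst c"
  using atlas unfolding smooth_atlas_def by blast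

lemma chart_at: "chart_at A q \<in> A" "q \<in> fst (chart_at A q)"
  unfolding chart_at_def using someI_ex[OF ex_chart[of q]] by auto

abbreviation transition_deriv where
  "transition_deriv c d q \<equiv> frechet_derivative (snd d \<circ> chart_inv c) (at (snd c q))"

lemma transition_has_derivative:
  "c \<in> A \<Longrightarrow> d \<in> A \<Longrightarrow> q \<in> fst c \<Longrightarrow> q \<in> fst d \<Longrightarrow>
    ((snd d \<circ> chart_inv c) has_derivative transition_deriv c d q) (at (snd c q))"
  by (rule smooth_on_imp_has_derivative[OF transition_smooth]) auto

lemma has_derivative_change_chart:
  assumes "c \<in> A" "d \<in> A" "q \<in> fst c" "q \<in> fst d" "((\<phi> \<circ> chart_inv d) has_derivative D) (at (snd d q))"
  shows "((\<phi> \<circ> chart_inv c) has_derivative (\<lambda>v. D (transition_deriv c d q v))) (at (snd c q))"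
proof -
  have "(((\<phi> \<circ> chart_inv d) \<circ> (snd d \<circ> chart_inv c)) has_derivative (D \<circ> transition_deriv c d q)) (at (snd c q))"
    using assms by (intro diff_chain_at transition_has_derivative) auto
  then have "((\<phi> \<circ> chart_inv c) has_derivative (D \<circ> transition_deriv c d q)) (at (snd c q))"
    by (rule has_derivative_transform_within_open[OF _ open_chart_image[OF assms(1) chart_open[OF assms(2)]]])
      (use assms in auto)
  then show ?thesis by (simp add: o_def)
qed

lemma frechet_derivative_change_chart:
  assumes "c \<in> A" "d \<in> A" "q \<in> fst c" "q \<in> fst d" "(\<phi> \<circ> chart_inv d) differentiable (at (snd d q))"
  shows "frechet_derivative (\<phi> \<circ> chart_inv c) (at (snd c q)) v =
    frechet_derivative (\<phi> \<circ> chart_inv d) (at (snd d q)) (transition_deriv c d q v)"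
  using has_derivative_change_chart[OF assms(1-4)] assms(5) frechet_derivative_works
  by (metis (no_types, lifting) frechet_derivative_at)

lemma transition_deriv_comp:
  assumes "c \<in> A" "d \<in> A" "d' \<in> A" "q \<in> fst c" "q \<in> fst d" "q \<in> fst d'"
  shows "transition_deriv c d' q v = transition_deriv d d' q (transition_deriv c d q v)"
  using transition_has_derivative[OF assms(2,3,5,6)] assms
  by (intro frechet_derivative_change_chart) (auto simp: differentiable_def)

lemma transition_deriv_self: "c \<in> A \<Longrightarrow> q \<in> fst c \<Longrightarrow> transition_deriv c c q v = v"
proof -
  assume c: "c \<in> A" "q \<in> fst c"
  have "((\<lambda>x. x) has_derivative (\<lambda>v. v)) (at (snd c q))" by simp
  then have "((snd c \<circ> chart_inv c) has_derivative (\<lambda>v. v)) (at (snd c q))"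
    by (rule has_derivative_transform_within_open[OF _ chart_image_open[OF c(1)]]) (use c in auto)
  then show ?thesis by (metis frechet_derivative_at)
qed

lemma linear_transition_deriv:
  "c \<in> A \<Longrightarrow> d \<in> A \<Longrightarrow> q \<in> fst c \<Longrightarrow> q \<in> fst d \<Longrightarrow> linear (transition_deriv c d q)"
  using transition_has_derivative has_derivative_linear by blast

lemma mem_tangent_space:
  "X \<in> vcarrier (tangent_space A q) \<longleftrightarrow> (\<forall>c. c \<notin> A \<or> q \<notin> fst c \<longrightarrow> X c = 0) \<and>
    (\<forall>c\<in>A. \<forall>d\<in>A. q \<in> fst c \<longrightarrow> q \<in> fst d \<longrightarrow> X d = transition_deriv c d q (X c))"
  unfolding tangent_space_def by (simp only: vspace.select_convs mem_Collect_eq)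

lemma tangent_change_chart:
  "X \<in> vcarrier (tangent_space A q) \<Longrightarrow> c \<in> A \<Longrightarrow> d \<in> A \<Longrightarrow> q \<in> fst c \<Longrightarrow> q \<in> fst d \<Longrightarrow>
    X d = transition_deriv c d q (X c)"
  unfolding mem_tangent_space by blast

text \<open>The transformation rule between two arbitrary charts is the cocycle identity
  \<open>transition_deriv_comp\<close>.\<close>

lemma coord_vec_in_tangent_space:
  assumes "c \<in> A" "q \<in> fst c" shows "coord_vec A c q w \<in> vcarrier (tangent_space A q)"
  unfolding mem_tangent_space
proof (intro conjI allI ballI impI)
  fix d d' assume d: "d \<in> A" "d' \<in> A" "q \<in> fst d" "q \<in> fst d'"
  show "coord_vec A c q w d' = transition_deriv d d' q (coord_vec A c q w d)"
    using d transition_deriv_comp[OF assms(1) d(1,2) assms(2) d(3,4), of w] by (simp add: coord_vec_def)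
qed (auto simp: coord_vec_def)

lemma coord_vec_self [simp]: "c \<in> A \<Longrightarrow> q \<in> fst c \<Longrightarrow> coord_vec A c q w c = w"
  by (simp add: coord_vec_def transition_deriv_self)

lemma coord_vec_component:
  "X \<in> vcarrier (tangent_space A q) \<Longrightarrow> c \<in> A \<Longrightarrow> q \<in> fst c \<Longrightarrow> coord_vec A c q (X c) = X"
proof
  fix d assume X: "X \<in> vcarrier (tangent_space A q)" "c \<in> A" "q \<in> fst c"
  show "coord_vec A c q (X c) d = X d"
  proof (cases "d \<in> A \<and> q \<in> fst d")
    case True
    then show ?thesis using tangent_change_chart[OF X(1,2) _ X(3), of d] by (simp add: coord_vec_def)
  next
    case False
    then have "X d = 0" using X(1) unfolding mem_tangent_space by blast
    then show ?thesis using False by (auto simp: coord_vec_def)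
  qed
qed

lemma coord_vec_add:
  "c \<in> A \<Longrightarrow> q \<in> fst c \<Longrightarrow>
    coord_vec A c q (v + w) = vplus (tangent_space A q) (coord_vec A c q v) (coord_vec A c q w)"
  using linear_transition_deriv[of c _ q] by (auto simp: coord_vec_def tangent_space_def fun_eq_iff linear_add)

lemma coord_vec_scale:
  "c \<in> A \<Longrightarrow> q \<in> fst c \<Longrightarrow>
    coord_vec A c q (k *\<^sub>R v) = vscale (tangent_space A q) k (coord_vec A c q v)"
  using linear_transition_deriv[of c _ q] by (auto simp: coord_vec_def tangent_space_def fun_eq_iff linear_scale)

lemma tangent_deriv_chart:
  assumes "c \<in> A" "q \<in> fst c" "X \<in> vcarrier (tangent_space A q)" "(\<phi> \<circ> chart_inv c) differentiable (at (snd c q))"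
  shows "tangent_deriv A q X \<phi> = frechet_derivative (\<phi> \<circ> chart_inv c) (at (snd c q)) (X c)"
  using frechet_derivative_change_chart[OF chart_at(1) assms(1) chart_at(2) assms(2,4)]
    tangent_change_chart[OF assms(3) chart_at(1) assms(1) chart_at(2) assms(2)]
  by (simp add: tangent_deriv_def Let_def)

lemma pushforward_chart:
  assumes "c \<in> A" "q \<in> fst c" "X \<in> vcarrier (tangent_space A q)" "d \<in> B" "F q \<in> fst d"
    "(snd d \<circ> F \<circ> chart_inv c) differentiable (at (snd c q))"
  shows "pushforward A B F q X d = frechet_derivative (snd d \<circ> F \<circ> chart_inv c) (at (snd c q)) (X c)"
  using frechet_derivative_change_chart[OF chart_at(1) assms(1) chart_at(2) assms(2,6)] assms(4,5)
    tangent_change_chart[OF assms(3) chart_at(1) assms(1) chart_at(2) assms(2)]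
  by (simp add: pushforward_def Let_def)

subsection \<open>Smooth functions and maps\<close>

lemma smooth_fun_onI:
  assumes "open U"
    and loc: "\<And>q. q \<in> U \<Longrightarrow> \<exists>c\<in>A. \<exists>N. open N \<and> q \<in> N \<and> N \<subseteq> fst c \<and> smooth_on (snd c ` N) (f \<circ> chart_inv c)"
  shows "smooth_fun_on A U f"
  unfolding smooth_fun_on_def
proof (intro ballI smooth_on_local)
  fix d y assume d: "d \<in> A" and "y \<in> snd d ` (fst d \<inter> U)"
  then obtain q where q: "q \<in> fst d" "q \<in> U" "y = snd d q" by auto
  then obtain c N where c: "c \<in> A" "open N" "q \<in> N" "N \<subseteq> fst c" "smooth_on (snd c ` N) (f \<circ> chart_inv c)"
    using loc by metis
  let ?N = "snd d ` (fst d \<inter> N)"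
  have o: "open ?N" using open_chart_image d c by blast
  have "smooth_on ?N (\<lambda>x. (f \<circ> chart_inv c) ((snd c \<circ> chart_inv d) x))"
  proof (rule smooth_on_compose[OF o _ _ c(5)])
    show "open (snd c ` N)" using open_chart_image_subset c by blast
    show "smooth_on ?N (snd c \<circ> chart_inv d)"
      by (rule smooth_on_subset[OF transition_smooth[OF d c(1)]]) (use c(4) in auto)
    show "(snd c \<circ> chart_inv d) ` ?N \<subseteq> snd c ` N" using d by auto
  qed
  then have "smooth_on ?N (f \<circ> chart_inv d)"
    by (rule smooth_on_cong[OF o, rotated]) (use c d in auto)
  then show "\<exists>N. open N \<and> y \<in> N \<and> smooth_on N (f \<circ> chart_inv d)" using o q c by blast
qed

lemma smooth_fun_onD:
  "smooth_fun_on A U f \<Longrightarrow> c \<in> A \<Longrightarrow> V \<subseteq> U \<Longrightarrow> V \<subseteq> fst c \<Longrightarrow> smooth_on (snd c ` V) (f \<circ> chart_inv c)"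
  unfolding smooth_fun_on_def by (meson IntI image_mono smooth_on_subset subset_iff)

lemma smooth_fun_on_subset: "smooth_fun_on A U f \<Longrightarrow> V \<subseteq> U \<Longrightarrow> smooth_fun_on A V f"
  unfolding smooth_fun_on_def by (meson Int_mono image_mono order_refl smooth_on_subset)

lemma smooth_fun_on_cong:
  assumes "open U" "\<And>q. q \<in> U \<Longrightarrow> f q = f' q" "smooth_fun_on A U f"
  shows "smooth_fun_on A U f'"
  unfolding smooth_fun_on_def
proof
  fix c assume c: "c \<in> A"
  then have "smooth_on (snd c ` (fst c \<inter> U)) (f \<circ> chart_inv c)" using assms(3) by (simp add: smooth_fun_on_def)
  then show "smooth_on (snd c ` (fst c \<inter> U)) (f' \<circ> chart_inv c)"
    by (rule smooth_on_cong[OF open_chart_image[OF c assms(1)], rotated]) (use c assms(2) in auto)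
qed

lemma smooth_fun_on_const: "open U \<Longrightarrow> smooth_fun_on A U (\<lambda>q. k)"
  unfolding smooth_fun_on_def o_def by (auto intro!: smooth_on_const open_chart_image)

lemma smooth_fun_on_add:
  "open U \<Longrightarrow> smooth_fun_on A U f \<Longrightarrow> smooth_fun_on A U f' \<Longrightarrow> smooth_fun_on A U (\<lambda>q. f q + f' q)"
  unfolding smooth_fun_on_def o_def by (auto intro!: smooth_on_add open_chart_image)

lemma smooth_fun_on_bilinear:
  "bounded_bilinear mul \<Longrightarrow> open U \<Longrightarrow> smooth_fun_on A U f \<Longrightarrow> smooth_fun_on A U f' \<Longrightarrow>
    smooth_fun_on A U (\<lambda>q. mul (f q) (f' q))"
  unfolding smooth_fun_on_def o_def
  by (rule ballI, rule smooth_on_bilinear[where mul=mul], assumption, rule open_chart_image, auto)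

lemma smooth_fun_on_sum:
  "open U \<Longrightarrow> (\<And>i. i \<in> I \<Longrightarrow> smooth_fun_on A U (f i)) \<Longrightarrow> smooth_fun_on A U (\<lambda>q. \<Sum>i\<in>I. f i q)"
  unfolding smooth_fun_on_def o_def by (auto intro!: smooth_on_sum open_chart_image)

lemma smooth_fun_on_Un:
  assumes "open U" "open V" "smooth_fun_on A U f" "smooth_fun_on A V f"
  shows "smooth_fun_on A (U \<union> V) f"
proof (rule smooth_fun_onI)
  fix q assume q: "q \<in> U \<union> V"
  obtain c where c: "c \<in> A" "q \<in> fst c" using ex_chart by blast
  obtain W where "open W" "q \<in> W" "smooth_fun_on A W f" using q assms by auto
  then have "open (W \<inter> fst c)" "q \<in> W \<inter> fst c" "smooth_on (snd c ` (W \<inter> fst c)) (f \<circ> chart_inv c)"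
    using c open_Int[OF _ chart_open[OF c(1)]] smooth_fun_onD[OF _ c(1), of W f "W \<inter> fst c"] by auto
  then show "\<exists>c\<in>A. \<exists>N. open N \<and> q \<in> N \<and> N \<subseteq> fst c \<and> smooth_on (snd c ` N) (f \<circ> chart_inv c)"
    using c by blast
qed (use assms in auto)

text \<open>One pair of charts at each point is enough, since any other pair differs from it by
  transition maps.\<close>

lemma smooth_mapI:
  fixes B :: "('n::topological_space, 'd::euclidean_space) chart set"
  assumes B: "smooth_atlas B"
    and loc: "\<And>q. \<exists>c\<in>A. \<exists>d\<in>B. \<exists>N. open N \<and> q \<in> N \<and> N \<subseteq> fst c \<and> F ` N \<subseteq> fst d \<and>
      smooth_on (snd c ` N) (snd d \<circ> F \<circ> chart_inv c)"
  shows "smooth_map A B F"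
proof -
  interpret B: smooth_manifold B using B by unfold_locales
  have "\<exists>N. open N \<and> q \<in> N \<and> continuous_on N F" for q
  proof -
    obtain c d N where c: "c \<in> A" "d \<in> B" "open N" "q \<in> N" "N \<subseteq> fst c" "F ` N \<subseteq> fst d"
      "smooth_on (snd c ` N) (snd d \<circ> F \<circ> chart_inv c)" using loc by metis
    have "continuous_on N (\<lambda>x. (snd d \<circ> F \<circ> chart_inv c) (snd c x))"
      using continuous_on_compose2[OF smooth_on_imp_continuous_on[OF c(7)]
          continuous_on_subset[OF chart_cont[OF c(1)] c(5)]] by blast
    then have "continuous_on N (\<lambda>x. snd d (F x))"
      by (rule continuous_on_eq) (use c in auto)
    then have "continuous_on N (\<lambda>x. chart_inv d (snd d (F x)))"
      using continuous_on_compose2[OF B.chart_inv_cont[OF c(2)]] c(6) by blast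
    then have "continuous_on N F"
      by (rule continuous_on_eq) (use c in auto)
    then show ?thesis using c by blast
  qed
  then obtain NN where NN: "\<And>q. open (NN q)" "\<And>q. q \<in> NN q" "\<And>q. continuous_on (NN q) F" by metis
  have "continuous_on (\<Union>q\<in>UNIV. NN q) F" using NN by (intro continuous_on_open_UN) auto
  moreover have "(\<Union>q\<in>UNIV. NN q) = UNIV" using NN(2) by auto
  ultimately have cont: "continuous_on UNIV F" by simp
  have "smooth_on (snd c' ` (fst c' \<inter> F -` fst d')) (snd d' \<circ> F \<circ> chart_inv c')"
    if c': "c' \<in> A" and d': "d' \<in> B" for c' d'
  proof -
    have "open (F -` fst d')" using cont B.chart_open[OF d'] open_vimage by blast
    moreover have "\<exists>c\<in>A. \<exists>N. open N \<and> q \<in> N \<and> N \<subseteq> fst c \<and> smooth_on (snd c ` N) ((snd d' \<circ> F) \<circ> chart_inv c)"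
      if "q \<in> F -` fst d'" for q
    proof -
      obtain c d N where c: "c \<in> A" "d \<in> B" "open N" "q \<in> N" "N \<subseteq> fst c" "F ` N \<subseteq> fst d"
        "smooth_on (snd c ` N) (snd d \<circ> F \<circ> chart_inv c)" using loc by metis
      define N' where "N' = N \<inter> F -` fst d'"
      have N': "open N'" "q \<in> N'" "N' \<subseteq> fst c" using c that \<open>open (F -` fst d')\<close> by (auto simp: N'_def)
      have o: "open (snd c ` N')" using open_chart_image_subset c N' by blast
      have "smooth_on (snd c ` N') (\<lambda>x. (snd d' \<circ> chart_inv d) ((snd d \<circ> F \<circ> chart_inv c) x))"
      proof (rule smooth_on_compose[OF o _ _ B.transition_smooth[OF c(2) d']])
        show "open (snd d ` (fst d \<inter> fst d'))" using B.open_chart_image B.chart_open c d' by blast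
        show "smooth_on (snd c ` N') (snd d \<circ> F \<circ> chart_inv c)"
          by (rule smooth_on_subset[OF c(7)]) (auto simp: N'_def)
        show "(snd d \<circ> F \<circ> chart_inv c) ` snd c ` N' \<subseteq> snd d ` (fst d \<inter> fst d')"
          using c N' by (auto simp: N'_def subset_iff)
      qed
      then have "smooth_on (snd c ` N') ((snd d' \<circ> F) \<circ> chart_inv c)"
        by (rule smooth_on_cong[OF o, rotated]) (use c N' in \<open>auto simp: N'_def subset_iff image_iff\<close>)
      then show ?thesis using c N' by blast
    qed
    ultimately have "smooth_fun_on A (F -` fst d') (snd d' \<circ> F)" by (rule smooth_fun_onI)
    then show ?thesis using c' by (auto simp: smooth_fun_on_def o_assoc)
  qed
  then show ?thesis using cont by (simp add: smooth_map_def)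
qed

lemma smooth_map_component:
  assumes "smooth_map A B F" "d \<in> B"
  shows "smooth_fun_on A (F -` fst d) (snd d \<circ> F)"
  using assms by (auto simp: smooth_map_def smooth_fun_on_def o_assoc)

end

section \<open>Bump functions on a Hausdorff manifold\<close>

lemma manifold_bump:
  fixes A :: "('m::t2_space, 'e::euclidean_space) chart set"
  assumes "smooth_atlas A" "open U" "q \<in> U"
  obtains \<rho> :: "'m \<Rightarrow> real" and N K where "smooth_fun_on A UNIV \<rho>" "open N" "q \<in> N" "N \<subseteq> U"
    "\<And>x. x \<in> N \<Longrightarrow> \<rho> x = 1" "closed K" "K \<subseteq> U" "\<And>x. x \<notin> K \<Longrightarrow> \<rho> x = 0"
proof -
  interpret smooth_manifold A using assms(1) by unfold_locales
  obtain c where c: "c \<in> A" "q \<in> fst c" using ex_chart by blast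
  let ?V = "snd c ` (fst c \<inter> U)"
  have "open ?V" "snd c q \<in> ?V" using open_chart_image c assms by auto
  then obtain r where r: "r > 0" "cball (snd c q) r \<subseteq> ?V" using open_contains_cball by metis
  obtain \<beta> :: "'e \<Rightarrow> real" where \<beta>: "smooth_on UNIV \<beta>" "\<And>y. y \<in> ball (snd c q) (r/2) \<Longrightarrow> \<beta> y = 1"
    "\<And>y. y \<notin> ball (snd c q) r \<Longrightarrow> \<beta> y = 0" using bump_function_exists[OF r(1)] by metis
  define K where "K = chart_inv c ` cball (snd c q) r"
  define N where "N = fst c \<inter> snd c -` ball (snd c q) (r/2)"
  define \<rho> where "\<rho> x = (if x \<in> fst c then \<beta> (snd c x) else 0)" for x
  \<comment> \<open>The Hausdorff property enters here: \<open>K\<close>, the image of a closed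
    coordinate ball, is compact and therefore closed. Its complement is open and
    \<open>\<rho>\<close> vanishes there, which makes the extension by zero smooth across the
    boundary of the chart domain.\<close>
  have "compact K" unfolding K_def
    using r chart_inv_cont[OF c(1)] by (intro compact_continuous_image) (auto elim!: continuous_on_subset)
  then have K: "closed K" by (rule compact_imp_closed)
  have KU: "K \<subseteq> fst c \<inter> U" using r c by (auto simp: K_def)
  have out: "\<rho> x = 0" if "x \<notin> K" for x
  proof (cases "x \<in> fst c")
    case True
    then have "snd c x \<notin> ball (snd c q) r"
      using that c unfolding K_def by (metis ball_subset_cball chart_inv_chart image_eqI subsetD)
    then show ?thesis using \<beta> True by (simp add: \<rho>_def)
  qed (simp add: \<rho>_def)
  have "smooth_fun_on A (fst c) \<rho>"
  proof (rule smooth_fun_onI)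
    have o: "open (snd c ` fst c)" using chart_image_open c by blast
    have "smooth_on (snd c ` fst c) (\<rho> \<circ> chart_inv c)"
      by (rule smooth_on_cong[OF o _ smooth_on_subset[OF \<beta>(1)]]) (use c in \<open>auto simp: \<rho>_def\<close>)
    then show "\<exists>c\<in>A. \<exists>N. open N \<and> x \<in> N \<and> N \<subseteq> fst c \<and> smooth_on (snd c ` N) (\<rho> \<circ> chart_inv c)"
      if "x \<in> fst c" for x
      using c chart_open that by blast
  qed (use c chart_open in auto)
  moreover have "smooth_fun_on A (- K) \<rho>"
    by (rule smooth_fun_on_cong[OF _ _ smooth_fun_on_const[of _ 0]]) (use K out in auto)
  ultimately have "smooth_fun_on A (fst c \<union> - K) \<rho>"
    using smooth_fun_on_Un chart_open c K by blast
  moreover have "fst c \<union> - K = UNIV" using KU by auto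
  moreover have "open N" unfolding N_def using chart_cont[OF c(1)] chart_open[OF c(1)]
    by (intro continuous_open_preimage) auto
  moreover have "q \<in> N" using c r by (auto simp: N_def)
  moreover have "N \<subseteq> U"
  proof
    fix x assume x: "x \<in> N"
    then have "x = chart_inv c (snd c x)" "snd c x \<in> cball (snd c q) r"
      using c r by (auto simp: N_def)
    then have "x \<in> K" unfolding K_def by blast
    then show "x \<in> U" using KU by auto
  qed
  moreover have "\<And>x. x \<in> N \<Longrightarrow> \<rho> x = 1" using \<beta> by (auto simp: N_def \<rho>_def)
  ultimately show ?thesis using that[of \<rho> N K] K KU out by auto
qed

section \<open>Piecewise smooth curves\<close>

text \<open>The notion of \<open>piecewise_smooth_path\<close> on an arbitrary interval, so that
  curves can be cut, glued and reparametrized before returning to the unit interval.\<close>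

definition pw_smooth ::
  "('m::topological_space, 'e::euclidean_space) chart set \<Rightarrow> real \<Rightarrow> real \<Rightarrow> (real \<Rightarrow> 'm) \<Rightarrow> bool" where
  "pw_smooth A a b \<gamma> \<longleftrightarrow> continuous_on {a..b} \<gamma> \<and>
     (\<exists>S. finite S \<and> (\<forall>s t. a \<le> s \<and> s < t \<and> t \<le> b \<and> {s<..<t} \<inter> S = {} \<longrightarrow> smooth_curve_on A s t \<gamma>))"

lemma piecewise_smooth_path_iff: "piecewise_smooth_path A \<gamma> \<longleftrightarrow> pw_smooth A 0 1 \<gamma>"
  by (simp add: piecewise_smooth_path_def pw_smooth_def)

lemma smooth_curve_on_subset:
  "smooth_curve_on A a b \<gamma> \<Longrightarrow> a \<le> c \<Longrightarrow> d \<le> b \<Longrightarrow> smooth_curve_on A c d \<gamma>"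
  unfolding smooth_curve_on_def by (auto elim!: continuous_on_subset)

lemma pw_smooth_subset: "pw_smooth A a b \<gamma> \<Longrightarrow> a \<le> c \<Longrightarrow> d \<le> b \<Longrightarrow> pw_smooth A c d \<gamma>"
  unfolding pw_smooth_def
proof (elim conjE exE, intro conjI)
  fix S assume *: "a \<le> c" "d \<le> b" "finite S"
    "\<forall>s t. a \<le> s \<and> s < t \<and> t \<le> b \<and> {s<..<t} \<inter> S = {} \<longrightarrow> smooth_curve_on A s t \<gamma>"
  show "\<exists>S. finite S \<and> (\<forall>s t. c \<le> s \<and> s < t \<and> t \<le> d \<and> {s<..<t} \<inter> S = {} \<longrightarrow> smooth_curve_on A s t \<gamma>)"
    using * by (intro exI[of _ S]) auto
qed (auto elim!: continuous_on_subset)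

lemma pw_smooth_combine:
  assumes "pw_smooth A a b \<gamma>" "pw_smooth A b c \<gamma>" "a \<le> b" "b \<le> c"
  shows "pw_smooth A a c \<gamma>"
proof -
  obtain S where S: "finite S"
    "\<And>s t. a \<le> s \<Longrightarrow> s < t \<Longrightarrow> t \<le> b \<Longrightarrow> {s<..<t} \<inter> S = {} \<Longrightarrow> smooth_curve_on A s t \<gamma>"
    using assms(1) unfolding pw_smooth_def by blast
  obtain T where T: "finite T"
    "\<And>s t. b \<le> s \<Longrightarrow> s < t \<Longrightarrow> t \<le> c \<Longrightarrow> {s<..<t} \<inter> T = {} \<Longrightarrow> smooth_curve_on A s t \<gamma>"
    using assms(2) unfolding pw_smooth_def by blast
  have "continuous_on ({a..b} \<union> {b..c}) \<gamma>"
    using assms unfolding pw_smooth_def by (intro continuous_on_closed_Un) auto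
  then have "continuous_on {a..c} \<gamma>" using assms by (simp add: ivl_disj_un_two_touch)
  moreover have "smooth_curve_on A s t \<gamma>"
    if "a \<le> s" "s < t" "t \<le> c" "{s<..<t} \<inter> (insert b (S \<union> T)) = {}" for s t
  proof -
    have "t \<le> b \<or> b \<le> s" using that by force
    then show ?thesis using S T that by blast
  qed
  ultimately show ?thesis unfolding pw_smooth_def using S(1) T(1)
    by (intro conjI exI[of _ "insert b (S \<union> T)"]) auto
qed

lemma smooth_curve_on_cong:
  assumes "\<And>t. t \<in> {a..b} \<Longrightarrow> \<gamma> t = \<gamma>' t" "smooth_curve_on A a b \<gamma>"
  shows "smooth_curve_on A a b \<gamma>'"
proof -
  have "continuous_on {a..b} \<gamma>'" using assms continuous_on_eq unfolding smooth_curve_on_def by blast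
  moreover have "smooth_on_interval s t (snd c \<circ> \<gamma>')"
    if "c \<in> A" "a \<le> s" "s < t" "t \<le> b" "\<gamma>' ` {s..t} \<subseteq> fst c" for c s t
  proof -
    have eq: "\<gamma> u = \<gamma>' u" if "u \<in> {s..t}" for u using assms(1) that \<open>a \<le> s\<close> \<open>t \<le> b\<close> by auto
    then have "\<gamma> ` {s..t} \<subseteq> fst c" using that by auto
    then have "smooth_on_interval s t (snd c \<circ> \<gamma>)" using that assms(2) unfolding smooth_curve_on_def by blast
    then show ?thesis by (rule smooth_on_interval_cong[OF \<open>s < t\<close>, rotated]) (simp add: eq)
  qed
  ultimately show ?thesis unfolding smooth_curve_on_def by blast
qed

lemma pw_smooth_cong:
  assumes "\<And>t. t \<in> {a..b} \<Longrightarrow> \<gamma> t = \<gamma>' t" "pw_smooth A a b \<gamma>"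
  shows "pw_smooth A a b \<gamma>'"
proof -
  obtain S where S: "finite S"
    "\<And>s t. a \<le> s \<Longrightarrow> s < t \<Longrightarrow> t \<le> b \<Longrightarrow> {s<..<t} \<inter> S = {} \<Longrightarrow> smooth_curve_on A s t \<gamma>"
    using assms(2) unfolding pw_smooth_def by blast
  have "smooth_curve_on A s t \<gamma>'" if "a \<le> s" "s < t" "t \<le> b" "{s<..<t} \<inter> S = {}" for s t
    using smooth_curve_on_cong[OF _ S(2)[OF that]] assms(1) that by auto
  moreover have "continuous_on {a..b} \<gamma>'"
    using assms continuous_on_eq unfolding pw_smooth_def by blast
  ultimately show ?thesis unfolding pw_smooth_def using S(1) by blast
qed

text \<open>Both signs of \<open>k\<close> are covered through \<open>min\<close> and
  \<open>max\<close>: concatenation of loops uses \<open>k = 2\<close>, reversal uses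
  \<open>k = -1\<close>.\<close>

lemma affine_image_interval:
  fixes k m s t :: real
  assumes "k \<noteq> 0" "s < t" "lo = min (k * s + m) (k * t + m)" "hi = max (k * s + m) (k * t + m)"
  shows "lo < hi" "(\<lambda>u. k * u + m) ` {s..t} = {lo..hi}" "(\<lambda>u. k * u + m) ` {s<..<t} = {lo<..<hi}"
proof -
  have im: "(\<lambda>u. k * u + m) ` X = {x. (x - m) / k \<in> X}" for X
    using assms(1) by (auto simp: image_iff intro!: bexI[of _ "(_ - m) / k"])
  consider "k > 0" | "k < 0" using assms(1) by linarith
  then have "lo < hi \<and> {x. (x - m) / k \<in> {s..t}} = {lo..hi} \<and> {x. (x - m) / k \<in> {s<..<t}} = {lo<..<hi}"
  proof cases
    case 1
    then have "lo = k * s + m" "hi = k * t + m" using assms by auto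
    then show ?thesis using 1 assms(2) by (auto simp: field_simps)
  next
    case 2
    then have "lo = k * t + m" "hi = k * s + m" using assms by auto
    then show ?thesis using 2 assms(2) by (auto simp: field_simps)
  qed
  then show "lo < hi" "(\<lambda>u. k * u + m) ` {s..t} = {lo..hi}" "(\<lambda>u. k * u + m) ` {s<..<t} = {lo<..<hi}"
    unfolding im by blast+
qed

lemma smooth_curve_on_affine:
  fixes k m :: real
  assumes "smooth_curve_on A a b \<gamma>" "k \<noteq> 0" "(\<lambda>t. k * t + m) ` {c..d} \<subseteq> {a..b}"
  shows "smooth_curve_on A c d (\<lambda>t. \<gamma> (k * t + m))"
proof -
  have "continuous_on {c..d} (\<lambda>t. \<gamma> (k * t + m))"
    by (rule continuous_on_compose2[OF _ _ assms(3)])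
      (use assms(1) in \<open>auto intro!: continuous_intros simp: smooth_curve_on_def\<close>)
  moreover have "smooth_on_interval s t (snd e \<circ> (\<lambda>t. \<gamma> (k * t + m)))"
    if e: "e \<in> A" "c \<le> s" "s < t" "t \<le> d" "(\<lambda>t. \<gamma> (k * t + m)) ` {s..t} \<subseteq> fst e" for e s t
  proof -
    define lo hi where "lo = min (k * s + m) (k * t + m)" and "hi = max (k * s + m) (k * t + m)"
    note lh = affine_image_interval(1)[OF assms(2) e(3) lo_def hi_def]
      and im = affine_image_interval(2)[OF assms(2) e(3) lo_def hi_def]
      and im' = affine_image_interval(3)[OF assms(2) e(3) lo_def hi_def]
    have "\<gamma> ` {lo..hi} \<subseteq> fst e" unfolding im[symmetric] using e(5) by (simp add: image_image)
    moreover have "{s..t} \<subseteq> {c..d}" using e by auto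
    then have "{lo..hi} \<subseteq> {a..b}"
      using order_trans[OF image_mono assms(3), of "{s..t}"] unfolding im by blast
    then have "a \<le> lo" "hi \<le> b" using lh by auto
    ultimately have "smooth_on_interval lo hi (snd e \<circ> \<gamma>)"
      using assms(1) e(1) lh unfolding smooth_curve_on_def by blast
    then have "smooth_on_interval s t (\<lambda>t. (snd e \<circ> \<gamma>) (k * t + m))"
      by (rule smooth_on_interval_affine) (use im in blast)
    then show ?thesis by (simp add: o_def)
  qed
  ultimately show ?thesis unfolding smooth_curve_on_def by blast
qed

lemma pw_smooth_affine:
  fixes k m :: real
  assumes "pw_smooth A a b \<gamma>" "k \<noteq> 0" "(\<lambda>t. k * t + m) ` {c..d} \<subseteq> {a..b}"
  shows "pw_smooth A c d (\<lambda>t. \<gamma> (k * t + m))"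
proof -
  obtain S where S: "finite S"
    "\<And>s t. a \<le> s \<Longrightarrow> s < t \<Longrightarrow> t \<le> b \<Longrightarrow> {s<..<t} \<inter> S = {} \<Longrightarrow> smooth_curve_on A s t \<gamma>"
    using assms(1) unfolding pw_smooth_def by blast
  define S' where "S' = (\<lambda>s. (s - m) / k) ` S"
  have "continuous_on {c..d} (\<lambda>t. \<gamma> (k * t + m))"
    by (rule continuous_on_compose2[OF _ _ assms(3)])
      (use assms(1) in \<open>auto intro!: continuous_intros simp: pw_smooth_def\<close>)
  moreover have "smooth_curve_on A s t (\<lambda>t. \<gamma> (k * t + m))"
    if st: "c \<le> s" "s < t" "t \<le> d" "{s<..<t} \<inter> S' = {}" for s t
  proof -
    define lo hi where "lo = min (k * s + m) (k * t + m)" and "hi = max (k * s + m) (k * t + m)"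
    note lh = affine_image_interval(1)[OF assms(2) st(2) lo_def hi_def]
      and im = affine_image_interval(2)[OF assms(2) st(2) lo_def hi_def]
      and im' = affine_image_interval(3)[OF assms(2) st(2) lo_def hi_def]
    have "{s..t} \<subseteq> {c..d}" using st by auto
    then have "{lo..hi} \<subseteq> {a..b}"
      using order_trans[OF image_mono assms(3), of "{s..t}"] unfolding im by blast
    then have "a \<le> lo" "hi \<le> b" using lh by auto
    moreover have "{lo<..<hi} \<inter> S = {}"
    proof (rule ccontr)
      assume "{lo<..<hi} \<inter> S \<noteq> {}"
      then obtain u where u: "u \<in> {lo<..<hi}" "u \<in> S" by blast
      then obtain v where v: "v \<in> {s<..<t}" "k * v + m \<in> S" unfolding im'[symmetric] by blast
      then have "v = (k * v + m - m) / k" using assms(2) by simp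
      then have "v \<in> S'" unfolding S'_def using v(2) by blast
      then show False using st(4) v(1) by blast
    qed
    ultimately have "smooth_curve_on A lo hi \<gamma>" using S(2) lh by blast
    then show ?thesis by (rule smooth_curve_on_affine) (use im assms in auto)
  qed
  ultimately show ?thesis unfolding pw_smooth_def using S(1)
    by (intro conjI exI[of _ S']) (auto simp: S'_def)
qed

context smooth_manifold
begin

text \<open>\<open>smooth_curve_on\<close> speaks about every chart that contains a subinterval of
  the curve; the transition maps carry smoothness over from the one chart \<open>c\<close>.\<close>

lemma smooth_curve_on_chart:
  assumes "c \<in> A" "\<gamma> ` {a..b} \<subseteq> fst c" "smooth_on_interval a b (snd c \<circ> \<gamma>)"
  shows "smooth_curve_on A a b \<gamma>"
proof -
  have "continuous_on {a..b} (\<lambda>t. chart_inv c ((snd c \<circ> \<gamma>) t))"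
    using continuous_on_compose2[OF chart_inv_cont[OF assms(1)] smooth_on_interval_imp_continuous_on[OF assms(3)]]
      assms(2) by auto
  then have "continuous_on {a..b} \<gamma>"
    by (rule continuous_on_eq) (use assms(1,2) in \<open>auto simp: image_subset_iff\<close>)
  moreover have "smooth_on_interval s t (snd d \<circ> \<gamma>)"
    if d: "d \<in> A" "a \<le> s" "s < t" "t \<le> b" "\<gamma> ` {s..t} \<subseteq> fst d" for d s t
  proof -
    have sub: "{s..t} \<subseteq> {a..b}" using d by auto
    have "smooth_on_interval s t (\<lambda>u. (snd d \<circ> chart_inv c) ((snd c \<circ> \<gamma>) u))"
    proof (rule smooth_on_interval_compose[OF d(3) _ _ transition_smooth[OF assms(1) d(1)]])
      show "open (snd c ` (fst c \<inter> fst d))" using open_chart_image chart_open assms(1) d by blast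
      show "smooth_on_interval s t (snd c \<circ> \<gamma>)" using smooth_on_interval_subset assms(3) sub by blast
      show "(snd c \<circ> \<gamma>) ` {s..t} \<subseteq> snd c ` (fst c \<inter> fst d)" using d(5) assms(2) sub by fastforce
    qed
    then show ?thesis by (rule smooth_on_interval_cong[OF d(3), rotated]) (use assms sub in fastforce)
  qed
  ultimately show ?thesis unfolding smooth_curve_on_def by blast
qed

lemma pw_smooth_chart:
  assumes "c \<in> A" "\<gamma> ` {a..b} \<subseteq> fst c" "a < b \<Longrightarrow> smooth_on_interval a b (snd c \<circ> \<gamma>)" "a \<le> b"
  shows "pw_smooth A a b \<gamma>"
proof (cases "a = b")
  case True
  then show ?thesis unfolding pw_smooth_def by (intro conjI exI[of _ "{}"]) auto
next
  case False
  then have sc: "smooth_curve_on A a b \<gamma>" using assms smooth_curve_on_chart by auto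
  have "smooth_curve_on A s t \<gamma>" if "a \<le> s" "t \<le> b" for s t
    using smooth_curve_on_subset[OF sc that] .
  moreover have "continuous_on {a..b} \<gamma>" using sc unfolding smooth_curve_on_def by blast
  ultimately show ?thesis unfolding pw_smooth_def by blast
qed

text \<open>Bisection: a property that is additive in intervals follows once it holds on all
  sufficiently short intervals around each parameter. Near a parameter the curve stays in one chart
  and meets no other exceptional parameter, so short intervals are made of smooth pieces in a chart.
  The neighbourhoods \<open>N\<close> let the caller confine the pieces further, for instance to the
  domain of a trivialization.\<close>

lemma pw_smooth_induct [consumes 2, case_names trans refl nhds piece]:
  assumes \<gamma>: "pw_smooth A a b \<gamma>" and ab: "a \<le> b"
    and trans: "\<And>r s t. P r s \<Longrightarrow> P s t \<Longrightarrow> a \<le> r \<Longrightarrow> r \<le> s \<Longrightarrow> s \<le> t \<Longrightarrow> t \<le> b \<Longrightarrow> P r t"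
    and refl: "\<And>t. t \<in> {a..b} \<Longrightarrow> P t t"
    and nhds: "\<And>t. t \<in> {a..b} \<Longrightarrow> open (N (\<gamma> t)) \<and> \<gamma> t \<in> N (\<gamma> t)"
    and piece: "\<And>u c s t. u \<in> {a..b} \<Longrightarrow> \<gamma> ` {s..t} \<subseteq> N (\<gamma> u) \<Longrightarrow> c \<in> A \<Longrightarrow> \<gamma> ` {s..t} \<subseteq> fst c \<Longrightarrow>
      a \<le> s \<Longrightarrow> s < t \<Longrightarrow> t \<le> b \<Longrightarrow> smooth_on_interval s t (snd c \<circ> \<gamma>) \<Longrightarrow> P s t"
  shows "P a b"
proof -
  obtain S where S: "finite S"
    "\<And>s t. a \<le> s \<Longrightarrow> s < t \<Longrightarrow> t \<le> b \<Longrightarrow> {s<..<t} \<inter> S = {} \<Longrightarrow> smooth_curve_on A s t \<gamma>"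
    using \<gamma> unfolding pw_smooth_def by blast
  have cont: "continuous_on {a..b} \<gamma>" using \<gamma> unfolding pw_smooth_def by blast
  have "a \<le> a \<and> b \<le> b \<longrightarrow> P a b" using ab
  proof (induction rule: Bolzano[where P="\<lambda>s t. a \<le> s \<and> t \<le> b \<longrightarrow> P s t"])
    case (trans r s t)
    then show ?case using assms(3) by auto
  next
    case (local u)
    then have u: "u \<in> {a..b}" by auto
    obtain c where c: "c \<in> A" "\<gamma> u \<in> fst c" using ex_chart by blast
    have "open (N (\<gamma> u) \<inter> fst c)" "\<gamma> u \<in> N (\<gamma> u) \<inter> fst c" using nhds[OF u] open_Int[OF _ chart_open[OF c(1)]] c by auto
    then obtain W where W: "open W" "u \<in> W" "\<And>t. t \<in> {a..b} \<Longrightarrow> t \<in> W \<Longrightarrow> \<gamma> t \<in> N (\<gamma> u) \<inter> fst c"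
      using cont[unfolded continuous_on_topological, rule_format, OF u, of "N (\<gamma> u) \<inter> fst c"] by blast
    obtain d1 where d1: "d1 > 0" "ball u d1 \<subseteq> W" using W open_contains_ball by metis
    obtain d2 where d2: "d2 > 0" "\<And>s. s \<in> S \<Longrightarrow> s \<noteq> u \<Longrightarrow> d2 \<le> dist u s"
      using finite_set_avoid[OF S(1), of u] by blast
    \<comment> \<open>Only intervals with \<open>u\<close> as an end point are treated, because
      \<open>u\<close> itself may be exceptional. An interval around \<open>u\<close> is cut at
      \<open>u\<close> afterwards.\<close>
    have sm: "P s t" if "a \<le> s" "s \<le> t" "t \<le> b" "s = u \<or> t = u" "t - s < min d1 d2" for s t
    proof (cases "s = t")
      case True
      then show ?thesis using refl that by auto
    next
      case False
      have sub: "\<gamma> ` {s..t} \<subseteq> N (\<gamma> u) \<inter> fst c"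
      proof (intro image_subsetI W(3))
        fix v assume v: "v \<in> {s..t}"
        then show "v \<in> {a..b}" using that by auto
        have "dist u v < d1" using v that by (auto simp: dist_real_def)
        then show "v \<in> W" using d1 by auto
      qed
      have "{s<..<t} \<inter> S = {}"
      proof (rule ccontr)
        assume "{s<..<t} \<inter> S \<noteq> {}"
        then obtain v where v: "v \<in> S" "s < v" "v < t" by auto
        then have "d2 \<le> dist u v" using d2(2)[OF v(1)] that by auto
        then show False using v that by (auto simp: dist_real_def)
      qed
      then have "smooth_curve_on A s t \<gamma>" using S(2) that False by auto
      then have "smooth_on_interval s t (snd c \<circ> \<gamma>)"
        using sub c(1) that False unfolding smooth_curve_on_def by auto
      then show ?thesis using piece[OF u, of s t c] sub c(1) that False by auto
    qed
    show ?case
    proof (intro exI[of _ "min d1 d2"] conjI allI impI)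
      fix s t assume st: "s \<le> u \<and> u \<le> t \<and> t - s < min d1 d2" "a \<le> s \<and> t \<le> b"
      have "P s u" "P u t" using sm[of s u] sm[of u t] st by auto
      then show "P s t" using assms(3)[of s u t] st by auto
    qed (use d1 d2 in auto)
  qed
  then show ?thesis by simp
qed

text \<open>\<open>vector_derivative\<close> has some value even where no derivative exists, so
  \<open>velocity\<close> is always defined but need not be a tangent vector. Differentiability in
  one chart, together with staying in its domain for nearby parameters, makes the components in all
  charts genuine derivatives that transform correctly.\<close>

definition regular_at :: "(real \<Rightarrow> 'm) \<Rightarrow> real \<Rightarrow> bool" where
  "regular_at \<gamma> t \<longleftrightarrow> (\<exists>c\<in>A. (\<forall>\<^sub>F s in nhds t. \<gamma> s \<in> fst c) \<and> (snd c \<circ> \<gamma>) differentiable (at t))"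

lemma regular_at_change_chart:
  assumes "c \<in> A" "\<forall>\<^sub>F s in nhds t. \<gamma> s \<in> fst c" "((snd c \<circ> \<gamma>) has_vector_derivative v) (at t)"
    "d \<in> A" "\<gamma> t \<in> fst d"
  shows "((snd d \<circ> \<gamma>) has_vector_derivative transition_deriv c d (\<gamma> t) v) (at t)"
proof -
  have c: "\<gamma> t \<in> fst c" using eventually_nhds_x_imp_x[OF assms(2)] .
  have "((snd d \<circ> chart_inv c \<circ> (snd c \<circ> \<gamma>)) has_vector_derivative transition_deriv c d (\<gamma> t) v) (at t)"
    using vector_derivative_diff_chain_within[OF assms(3) has_derivative_at_withinI]
      transition_has_derivative[OF assms(1,4) c assms(5)] by simp
  moreover have "\<forall>\<^sub>F s in nhds t. (snd d \<circ> chart_inv c \<circ> (snd c \<circ> \<gamma>)) s = (snd d \<circ> \<gamma>) s"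
    using assms(2) by eventually_elim (use assms in auto)
  ultimately show ?thesis by (rule has_vector_derivative_cong_nhds[rotated])
qed

lemma regular_at_has_vector_derivative:
  assumes "regular_at \<gamma> t" "d \<in> A" "\<gamma> t \<in> fst d"
  shows "((snd d \<circ> \<gamma>) has_vector_derivative velocity A \<gamma> t d) (at t)"
proof -
  obtain c where c: "c \<in> A" "\<forall>\<^sub>F s in nhds t. \<gamma> s \<in> fst c" "(snd c \<circ> \<gamma>) differentiable (at t)"
    using assms(1) unfolding regular_at_def by blast
  then obtain v where "((snd c \<circ> \<gamma>) has_vector_derivative v) (at t)"
    by (auto simp: vector_derivative_works)
  from regular_at_change_chart[OF c(1,2) this assms(2,3)] show ?thesis
    using assms vector_derivative_at by (fastforce simp: velocity_def)
qed

lemma velocity_in_tangent_space: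
  assumes "regular_at \<gamma> t"
  shows "velocity A \<gamma> t \<in> vcarrier (tangent_space A (\<gamma> t))"
proof -
  obtain c where c: "c \<in> A" "\<forall>\<^sub>F s in nhds t. \<gamma> s \<in> fst c" "(snd c \<circ> \<gamma>) differentiable (at t)"
    using assms(1) unfolding regular_at_def by blast
  then obtain v where v: "((snd c \<circ> \<gamma>) has_vector_derivative v) (at t)"
    by (auto simp: vector_derivative_works)
  have ct: "\<gamma> t \<in> fst c" using eventually_nhds_x_imp_x[OF c(2)] .
  have "velocity A \<gamma> t = coord_vec A c (\<gamma> t) v"
    using regular_at_change_chart[OF c(1,2) v] vector_derivative_at
    by (fastforce simp: velocity_def coord_vec_def fun_eq_iff)
  then show ?thesis using coord_vec_in_tangent_space[OF c(1) ct] by simp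
qed

lemma regular_at_chart:
  assumes "c \<in> A" "\<gamma> ` {a..b} \<subseteq> fst c" "t \<in> {a<..<b}" "((snd c \<circ> \<gamma>) has_vector_derivative v) (at t within {a..b})"
  shows "regular_at \<gamma> t" "velocity A \<gamma> t c = v"
proof -
  have t: "t \<in> interior {a..b}" using assms(3) by simp
  have v: "((snd c \<circ> \<gamma>) has_vector_derivative v) (at t)"
    using assms(4) unfolding at_within_interior[OF t] .
  have "\<forall>\<^sub>F s in nhds t. s \<in> {a<..<b}" using assms(3) eventually_nhds_in_open[of "{a<..<b}" t] by auto
  then have "\<forall>\<^sub>F s in nhds t. \<gamma> s \<in> fst c" by eventually_elim (use assms(2) in auto)
  then show "regular_at \<gamma> t" unfolding regular_at_def using assms(1) v
    by (auto intro!: bexI[of _ c] differentiableI_vector)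
  have "\<gamma> t \<in> fst c" using assms(2,3) by (auto simp: image_subset_iff)
  then show "velocity A \<gamma> t c = v" using v assms(1) by (auto simp: velocity_def vector_derivative_at)
qed

text \<open>On a smooth piece inside one chart only the two end points can be irregular. As finite
  sets are invisible to integrals, lengths can be computed from regular parameters.\<close>

lemma finite_irregular:
  assumes "pw_smooth A a b \<gamma>" "a \<le> b"
  shows "finite {t \<in> {a..b}. \<not> regular_at \<gamma> t}"
  using assms
proof (induction rule: pw_smooth_induct[where N="\<lambda>x. UNIV"])
  case (trans r s t)
  have "{u \<in> {r..t}. \<not> regular_at \<gamma> u} \<subseteq> {u \<in> {r..s}. \<not> regular_at \<gamma> u} \<union> {u \<in> {s..t}. \<not> regular_at \<gamma> u}"
    by auto
  then show ?case using trans finite_subset by blast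
next
  case (piece u c s t)
  obtain f' where f': "\<And>v. v \<in> {s..t} \<Longrightarrow> ((snd c \<circ> \<gamma>) has_vector_derivative f' v) (at v within {s..t})"
    using smooth_on_intervalE[OF piece(8)] by metis
  have "regular_at \<gamma> v" if "v \<in> {s<..<t}" for v
    by (rule regular_at_chart(1)[OF piece(3,4) that f']) (use that in auto)
  then have "{v \<in> {s..t}. \<not> regular_at \<gamma> v} \<subseteq> {s, t}" by force
  then show ?case using finite_subset by blast
qed auto

lemma regular_at_cong:
  assumes "\<forall>\<^sub>F s in nhds t. \<gamma> s = \<gamma>' s" "regular_at \<gamma> t"
  shows "regular_at \<gamma>' t \<and> velocity A \<gamma>' t = velocity A \<gamma> t"
proof -
  obtain c where c: "c \<in> A" "\<forall>\<^sub>F s in nhds t. \<gamma> s \<in> fst c" "(snd c \<circ> \<gamma>) differentiable (at t)"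
    using assms(2) unfolding regular_at_def by blast
  have t: "\<gamma> t = \<gamma>' t" using eventually_nhds_x_imp_x[OF assms(1)] .
  have der: "((snd d \<circ> \<gamma>') has_vector_derivative v) (at t)" if "((snd d \<circ> \<gamma>) has_vector_derivative v) (at t)"
    for d and v :: 'e
  proof -
    have "\<forall>\<^sub>F s in nhds t. (snd d \<circ> \<gamma>) s = (snd d \<circ> \<gamma>') s" using assms(1) by eventually_elim simp
    then show ?thesis using that by (rule has_vector_derivative_cong_nhds)
  qed
  have "\<forall>\<^sub>F s in nhds t. \<gamma>' s \<in> fst c" using c(2) assms(1) by eventually_elim simp
  moreover obtain v where "((snd c \<circ> \<gamma>) has_vector_derivative v) (at t)"
    using c(3) by (auto simp: vector_derivative_works)
  then have "(snd c \<circ> \<gamma>') differentiable (at t)" using der differentiableI_vector by blast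
  ultimately have "regular_at \<gamma>' t" using c unfolding regular_at_def by blast
  moreover have "velocity A \<gamma>' t d = velocity A \<gamma> t d" for d
  proof (cases "d \<in> A \<and> \<gamma> t \<in> fst d")
    case True
    then show ?thesis
      using vector_derivative_at[OF der[OF regular_at_has_vector_derivative[OF assms(2)]], of d] t
      by (simp add: velocity_def)
  qed (use t in \<open>auto simp: velocity_def\<close>)
  ultimately show ?thesis by auto
qed

lemma regular_at_affine:
  assumes "regular_at \<gamma> (k * t + m)"
  shows "regular_at (\<lambda>t. \<gamma> (k * t + m)) t \<and>
    velocity A (\<lambda>t. \<gamma> (k * t + m)) t = (\<lambda>c. k *\<^sub>R velocity A \<gamma> (k * t + m) c)"
proof -
  obtain c where c: "c \<in> A" "\<forall>\<^sub>F s in nhds (k * t + m). \<gamma> s \<in> fst c"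
    using assms(1) unfolding regular_at_def by blast
  have ct: "\<gamma> (k * t + m) \<in> fst c" using eventually_nhds_x_imp_x[OF c(2)] .
  have lim: "filterlim (\<lambda>t. k * t + m) (nhds (k * t + m)) (nhds t)"
    by (intro tendsto_intros filterlim_ident)
  have "\<forall>\<^sub>F s in nhds t. \<gamma> (k * s + m) \<in> fst c"
    using eventually_compose_filterlim[OF c(2) lim] .
  moreover have der: "((snd d \<circ> (\<lambda>t. \<gamma> (k * t + m))) has_vector_derivative k *\<^sub>R velocity A \<gamma> (k * t + m) d) (at t)"
    if "d \<in> A" "\<gamma> (k * t + m) \<in> fst d" for d
  proof -
    have "((\<lambda>t. k * t + m) has_vector_derivative k) (at t)"
      by (auto intro!: derivative_eq_intros simp: has_vector_derivative_def)
    from vector_diff_chain_at[OF this regular_at_has_vector_derivative[OF assms that]]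
    show ?thesis by (simp add: o_def)
  qed
  ultimately have "regular_at (\<lambda>t. \<gamma> (k * t + m)) t"
    using der[OF c(1) ct] c(1) unfolding regular_at_def by (auto intro!: bexI[of _ c] differentiableI_vector)
  moreover have "velocity A (\<lambda>t. \<gamma> (k * t + m)) t d = k *\<^sub>R velocity A \<gamma> (k * t + m) d" for d
    using vector_derivative_at[OF der] by (auto simp: velocity_def)
  ultimately show ?thesis by auto
qed

end

section \<open>Inner products\<close>

text \<open>Inner products on the coordinate spaces as they arise from \<open>g\<close> and
  \<open>h\<close>; they vary with the base point and are related to the fixed product
  \<open>\<bullet>\<close> only up to constants.\<close>

definition pos_bilinear :: "('v::real_vector \<Rightarrow> 'v \<Rightarrow> real) \<Rightarrow> bool" where
  "pos_bilinear K \<longleftrightarrow> bilinear K \<and> (\<forall>v w. K v w = K w v) \<and> (\<forall>v. v \<noteq> 0 \<longrightarrow> K v v > 0)"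

lemma pos_bilinear_simps:
  assumes "pos_bilinear K"
  shows "K (u + v) w = K u w + K v w" "K w (u + v) = K w u + K w v"
    "K (k *\<^sub>R v) w = k * K v w" "K w (k *\<^sub>R v) = k * K w v"
    "K (u - v) w = K u w - K v w" "K w (u - v) = K w u - K w v" "K 0 w = 0" "K w 0 = 0"
  using assms unfolding pos_bilinear_def
  by (auto simp: bilinear_ladd bilinear_radd bilinear_lmul bilinear_rmul bilinear_lsub bilinear_rsub
      bilinear_lzero bilinear_rzero)

lemma pos_bilinear_ge_0: "pos_bilinear K \<Longrightarrow> K v v \<ge> 0"
  using pos_bilinear_simps(7)[of K 0] unfolding pos_bilinear_def by (cases "v = 0") (auto simp: less_imp_le)

lemma pos_bilinear_eq_0: "pos_bilinear K \<Longrightarrow> K v v = 0 \<longleftrightarrow> v = 0"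
  using pos_bilinear_simps(7)[of K 0] unfolding pos_bilinear_def by (metis less_irrefl)

lemma pos_bilinear_Cauchy_Schwarz:
  assumes K: "pos_bilinear K"
  shows "\<bar>K v w\<bar> \<le> sqrt (K v v) * sqrt (K w w)"
proof -
  have "(K v w)\<^sup>2 \<le> K v v * K w w"
  proof (cases "w = 0")
    case False
    then have pos: "K w w > 0" using K by (simp add: pos_bilinear_def)
    have "0 \<le> K (v - (K v w / K w w) *\<^sub>R w) (v - (K v w / K w w) *\<^sub>R w)" by (rule pos_bilinear_ge_0[OF K])
    also have "\<dots> = K v v - (K v w)\<^sup>2 / K w w"
      using pos K by (simp add: pos_bilinear_simps[OF K] power2_eq_square pos_bilinear_def)
    finally show ?thesis using pos by (simp add: field_simps)
  qed (simp add: pos_bilinear_simps[OF K])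
  then have "sqrt ((K v w)\<^sup>2) \<le> sqrt (K v v * K w w)" by (rule real_sqrt_le_mono)
  then show ?thesis by (simp add: real_sqrt_mult)
qed

lemma pos_bilinear_triangle:
  assumes K: "pos_bilinear K"
  shows "sqrt (K (v + w) (v + w)) \<le> sqrt (K v v) + sqrt (K w w)"
proof (rule real_le_lsqrt)
  have "K (v + w) (v + w) = K v v + 2 * K v w + K w w"
    using K by (simp add: pos_bilinear_simps[OF K] pos_bilinear_def)
  also have "\<dots> \<le> K v v + 2 * (sqrt (K v v) * sqrt (K w w)) + K w w"
    using pos_bilinear_Cauchy_Schwarz[OF K, of v w] by linarith
  also have "\<dots> = (sqrt (K v v) + sqrt (K w w))\<^sup>2"
    using pos_bilinear_ge_0[OF K] by (simp add: power2_sum)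
  finally show "K (v + w) (v + w) \<le> (sqrt (K v v) + sqrt (K w w))\<^sup>2" .
qed (use pos_bilinear_ge_0[OF K] in auto)

section \<open>Vector bundles with metric and connection\<close>

text \<open>By the chain rule the expression of \<open>F\<close> in the chart \<open>d\<close>
  determines those in all other target charts, so the pushforward is the coordinate vector built in
  \<open>d\<close>.\<close>

lemma (in smooth_manifold) pushforward_in_tangent_space:
  assumes B: "smooth_atlas B" and c: "c \<in> A" "q \<in> fst c" and X: "X \<in> vcarrier (tangent_space A q)"
    and d: "d \<in> B" "F q \<in> fst d" "open N" "q \<in> N" "F ` N \<subseteq> fst d"
    and F: "(snd d \<circ> F \<circ> chart_inv c) differentiable (at (snd c q))"
  shows "pushforward A B F q X \<in> vcarrier (tangent_space B (F q))"
proof -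
  interpret B: smooth_manifold B using B by unfold_locales
  have ev: "(snd d' \<circ> F \<circ> chart_inv c) differentiable (at (snd c q)) \<and>
    frechet_derivative (snd d' \<circ> F \<circ> chart_inv c) (at (snd c q)) v =
      B.transition_deriv d d' (F q) (frechet_derivative (snd d \<circ> F \<circ> chart_inv c) (at (snd c q)) v)"
    if d': "d' \<in> B" "F q \<in> fst d'" for d' v
  proof -
    let ?D = "frechet_derivative (snd d \<circ> F \<circ> chart_inv c) (at (snd c q))"
    have at: "(snd d \<circ> F \<circ> chart_inv c) (snd c q) = snd d (F q)" using c by simp
    have D: "((snd d \<circ> F \<circ> chart_inv c) has_derivative ?D) (at (snd c q))"
      using F frechet_derivative_works by blast
    have "((snd d' \<circ> chart_inv d) \<circ> (snd d \<circ> F \<circ> chart_inv c) has_derivative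
        (B.transition_deriv d d' (F q) \<circ> ?D)) (at (snd c q))"
      using D B.transition_has_derivative[OF d(1) d'(1) d(2) d'(2)] at by (intro diff_chain_at) auto
    then have "((snd d' \<circ> F \<circ> chart_inv c) has_derivative (B.transition_deriv d d' (F q) \<circ> ?D)) (at (snd c q))"
      by (rule has_derivative_transform_within_open[OF _ open_chart_image[OF c(1) d(3)]])
        (use c d in auto)
    then show ?thesis
      using frechet_derivative_at[of "snd d' \<circ> F \<circ> chart_inv c"] unfolding differentiable_def
      by (metis comp_apply)
  qed
  have "pushforward A B F q X = coord_vec B d (F q) (frechet_derivative (snd d \<circ> F \<circ> chart_inv c) (at (snd c q)) (X c))"
  proof
    fix d'
    show "pushforward A B F q X d' =
      coord_vec B d (F q) (frechet_derivative (snd d \<circ> F \<circ> chart_inv c) (at (snd c q)) (X c)) d'"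
    proof (cases "d' \<in> B \<and> F q \<in> fst d'")
      case True
      then show ?thesis using ev[of d' "X c"] pushforward_chart[OF c X, of d' B F] by (simp add: coord_vec_def)
    qed (auto simp: pushforward_def coord_vec_def)
  qed
  then show ?thesis using B.coord_vec_in_tangent_space[OF d(1,2)] by simp
qed

locale metric_bundle =
  fixes A :: "('m::t2_space, 'e::euclidean_space) chart set"
    and g :: "'m \<Rightarrow> ('m, 'e) tvec \<Rightarrow> ('m, 'e) tvec \<Rightarrow> real"
    and E :: "('x::topological_space, 'm, 'f::euclidean_space) vbundle"
    and h :: "'x \<Rightarrow> 'x \<Rightarrow> real"
    and nabla :: "('x, 'm, 'e) covariant_derivative"
  assumes atlas: "smooth_atlas A"
    and metric: "riemannian_metric A g"
    and vb: "vector_bundle A E"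
    and hm: "bundle_metric A E h"
    and conn: "connection A E nabla"
    and compat: "metric_compatible A E h nabla"
begin

sublocale M: smooth_manifold A using atlas by unfold_locales

lemma triv_open: "T \<in> trivs E \<Longrightarrow> open (fst T)"
  and triv_preimage_open: "T \<in> trivs E \<Longrightarrow> open (proj E -` fst T)"
  and triv_homeo: "T \<in> trivs E \<Longrightarrow>
    homeomorphism (proj E -` fst T) (fst T \<times> UNIV) (\<lambda>e. (proj E e, snd T e)) (triv_inv E T)"
  and triv_linear: "T \<in> trivs E \<Longrightarrow> q \<in> fst T \<Longrightarrow> linear_map (fibre E q) type_vspace (snd T)"
  and ex_triv: "\<exists>T. T \<in> trivs E \<and> q \<in> fst T"
  and fibre_vspace: "vspace_on (fibre E q)"
  and triv_transition: "S \<in> trivs E \<Longrightarrow> T \<in> trivs E \<Longrightarrow>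
    smooth_fun_on A (fst S \<inter> fst T) (\<lambda>q. snd T (triv_inv E S (q, w)))"
  using vb unfolding vector_bundle_def by blast+

lemma lift_triv [simp]: "T \<in> trivs E \<Longrightarrow> proj E e \<in> fst T \<Longrightarrow> triv_inv E T (proj E e, snd T e) = e"
  and proj_lift [simp]: "T \<in> trivs E \<Longrightarrow> q \<in> fst T \<Longrightarrow> proj E (triv_inv E T (q, w)) = q"
  and triv_lift [simp]: "T \<in> trivs E \<Longrightarrow> q \<in> fst T \<Longrightarrow> snd T (triv_inv E T (q, w)) = w"
  using triv_homeo[of T] by (auto simp: homeomorphism_def)

lemma triv_inj: "T \<in> trivs E \<Longrightarrow> proj E e \<in> fst T \<Longrightarrow> proj E e = proj E e' \<Longrightarrow> snd T e = snd T e' \<Longrightarrow> e = e'"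
  by (metis lift_triv)

lemma triv_cont: "T \<in> trivs E \<Longrightarrow> continuous_on (proj E -` fst T) (snd T)"
proof -
  assume "T \<in> trivs E"
  then have "continuous_on (proj E -` fst T) (\<lambda>e. (proj E e, snd T e))"
    using triv_homeo by (simp add: homeomorphism_def)
  from continuous_on_snd[OF this] show ?thesis by simp
qed

lemma proj_continuous: "continuous_on UNIV (proj E)"
proof -
  have "continuous_on (proj E -` fst T) (proj E)" if "T \<in> trivs E" for T
  proof -
    have "continuous_on (proj E -` fst T) (\<lambda>e. (proj E e, snd T e))"
      using triv_homeo[OF that] by (simp add: homeomorphism_def)
    from continuous_on_fst[OF this] show ?thesis by simp
  qed
  then have "continuous_on (\<Union>T\<in>trivs E. proj E -` fst T) (proj E)"
    using triv_preimage_open by (intro continuous_on_open_UN) auto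
  moreover have "(\<Union>T\<in>trivs E. proj E -` fst T) = UNIV" unfolding vimage_def using ex_triv by blast
  ultimately show ?thesis by simp
qed

lemma fibre_simps [simp]: "vcarrier (fibre E q) = proj E -` {q}" "vzero (fibre E q) = bzero E q"
  "vplus (fibre E q) = bplus E" "vscale (fibre E q) = bscale E"
  by (simp_all add: fibre_def)

lemma fibre_group: "comm_group \<lparr>carrier = proj E -` {q}, mult = bplus E, one = bzero E q\<rparr>"
  using fibre_vspace[of q] by (simp add: vspace_on_def)

lemma proj_bzero [simp]: "proj E (bzero E q) = q"
proof -
  interpret G: comm_group "\<lparr>carrier = proj E -` {q}, mult = bplus E, one = bzero E q\<rparr>" by (rule fibre_group)
  show ?thesis using G.one_closed by simp
qed

lemma proj_bplus [simp]: "proj E e = proj E e' \<Longrightarrow> proj E (bplus E e e') = proj E e'"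
proof -
  interpret G: comm_group "\<lparr>carrier = proj E -` {proj E e'}, mult = bplus E, one = bzero E (proj E e')\<rparr>"
    by (rule fibre_group)
  show "proj E e = proj E e' \<Longrightarrow> ?thesis" using G.m_closed[of e e'] by simp
qed

lemma proj_bscale [simp]: "proj E (bscale E k e) = proj E e"
  using fibre_vspace[of "proj E e"] by (simp add: vspace_on_def)

lemma triv_bplus [simp]: "T \<in> trivs E \<Longrightarrow> proj E e' \<in> fst T \<Longrightarrow> proj E e = proj E e' \<Longrightarrow>
    snd T (bplus E e e') = snd T e + snd T e'"
  using triv_linear[of T "proj E e'"] by (simp add: linear_map_def type_vspace_def)

lemma triv_bscale [simp]: "T \<in> trivs E \<Longrightarrow> proj E e \<in> fst T \<Longrightarrow> snd T (bscale E k e) = k *\<^sub>R snd T e"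
  using triv_linear[of T "proj E e"] by (simp add: linear_map_def type_vspace_def)

lemma triv_bzero [simp]: "T \<in> trivs E \<Longrightarrow> q \<in> fst T \<Longrightarrow> snd T (bzero E q) = 0"
proof -
  interpret G: comm_group "\<lparr>carrier = proj E -` {q}, mult = bplus E, one = bzero E q\<rparr>" by (rule fibre_group)
  assume T: "T \<in> trivs E" "q \<in> fst T"
  have "bplus E (bzero E q) (bzero E q) = bzero E q" using G.l_one[of "bzero E q"] by simp
  then show ?thesis using T triv_bplus[of T "bzero E q" "bzero E q"] by (metis add_cancel_right_right proj_bzero)
qed

lemma lift_0: "T \<in> trivs E \<Longrightarrow> q \<in> fst T \<Longrightarrow> triv_inv E T (q, 0) = bzero E q"
  by (rule triv_inj[of T]) auto

lemma bscale_0: "bscale E 0 e = bzero E (proj E e)"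
  using ex_triv[of "proj E e"] triv_inj[of _ "bscale E 0 e" "bzero E (proj E e)"] by auto

subsection \<open>The total space as a manifold\<close>

definition tchart :: "('m, 'e) chart \<Rightarrow> 'm set \<times> ('x \<Rightarrow> 'f) \<Rightarrow> ('x, 'e \<times> 'f) chart" where
  "tchart c T = (proj E -` (fst c \<inter> fst T), \<lambda>e. (snd c (proj E e), snd T e))"

lemma fst_tchart [simp]: "fst (tchart c T) = proj E -` (fst c \<inter> fst T)"
  and snd_tchart [simp]: "snd (tchart c T) e = (snd c (proj E e), snd T e)"
  by (simp_all add: tchart_def)

lemma total_atlas_eq: "total_atlas A E = {tchart c T |c T. c \<in> A \<and> T \<in> trivs E}"
  by (simp add: total_atlas_def tchart_def)

lemma tchart_in: "c \<in> A \<Longrightarrow> T \<in> trivs E \<Longrightarrow> tchart c T \<in> total_atlas A E"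
  unfolding total_atlas_eq by blast

abbreviation cdom :: "('m, 'e) chart \<Rightarrow> 'm set \<times> ('x \<Rightarrow> 'f) \<Rightarrow> 'e set" where
  "cdom c T \<equiv> snd c ` (fst c \<inter> fst T)"

lemma open_cdom: "c \<in> A \<Longrightarrow> T \<in> trivs E \<Longrightarrow> open (cdom c T)"
  using M.open_chart_image triv_open by blast

lemma open_chart_triv: "c \<in> A \<Longrightarrow> T \<in> trivs E \<Longrightarrow> open (fst c \<inter> fst T)"
  using M.chart_open triv_open by blast

lemma bscale_bzero [simp]: "bscale E k (bzero E q) = bzero E q"
  using ex_triv[of q] triv_inj[of _ "bscale E k (bzero E q)" "bzero E q"] by auto

lemma inj_on_tchart: "c \<in> A \<Longrightarrow> T \<in> trivs E \<Longrightarrow> inj_on (snd (tchart c T)) (fst (tchart c T))"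
proof (rule inj_onI)
  fix e e' assume *: "c \<in> A" "T \<in> trivs E" "e \<in> fst (tchart c T)" "e' \<in> fst (tchart c T)"
    "snd (tchart c T) e = snd (tchart c T) e'"
  have m: "proj E e \<in> fst c" "proj E e' \<in> fst c" "snd c (proj E e) = snd c (proj E e')"
    using * by auto
  have "proj E e = proj E e'"
    using M.chart_inv_chart[OF *(1) m(1)] M.chart_inv_chart[OF *(1) m(2)] m(3) by metis
  then show "e = e'" using * triv_inj[of T e e'] by auto
qed

lemma chart_inv_tchart_self: "c \<in> A \<Longrightarrow> T \<in> trivs E \<Longrightarrow> proj E e \<in> fst c \<inter> fst T \<Longrightarrow>
    chart_inv (tchart c T) (snd (tchart c T) e) = e"
  unfolding chart_inv_def using inj_on_tchart[of c T] by (intro inv_into_f_f) auto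

lemma chart_inv_tchart [simp]:
  assumes "c \<in> A" "T \<in> trivs E" "q \<in> fst c" "q \<in> fst T"
  shows "chart_inv (tchart c T) (snd c q, w) = triv_inv E T (q, w)"
  using chart_inv_tchart_self[OF assms(1,2), of "triv_inv E T (q, w)"] assms by simp

lemma tchart_image:
  assumes "c \<in> A" "T \<in> trivs E" "W \<subseteq> fst c \<inter> fst T"
  shows "snd (tchart c T) ` (proj E -` W) = snd c ` W \<times> UNIV"
proof (intro Set.set_eqI iffI)
  fix z assume "z \<in> snd c ` W \<times> (UNIV :: 'f set)"
  then obtain q w where q: "q \<in> W" "z = (snd c q, w)" by auto
  then have "z = snd (tchart c T) (triv_inv E T (q, w))" "triv_inv E T (q, w) \<in> proj E -` W"
    using assms by auto
  then show "z \<in> snd (tchart c T) ` (proj E -` W)" by blast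
qed auto

lemma triv_change_linear:
  assumes "S \<in> trivs E" "T \<in> trivs E" "q \<in> fst S" "q \<in> fst T"
  shows "linear (\<lambda>w. snd T (triv_inv E S (q, w)))"
proof (rule linearI)
  fix v w :: 'f and k :: real
  have "triv_inv E S (q, v + w) = bplus E (triv_inv E S (q, v)) (triv_inv E S (q, w))"
    by (rule triv_inj[of S]) (use assms in auto)
  then show "snd T (triv_inv E S (q, v + w)) = snd T (triv_inv E S (q, v)) + snd T (triv_inv E S (q, w))"
    using assms by simp
  have "triv_inv E S (q, k *\<^sub>R v) = bscale E k (triv_inv E S (q, v))"
    by (rule triv_inj[of S]) (use assms in auto)
  then show "snd T (triv_inv E S (q, k *\<^sub>R v)) = k *\<^sub>R snd T (triv_inv E S (q, v))"
    using assms by simp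
qed

lemma smooth_atlas_total: "smooth_atlas (total_atlas A E)"
  unfolding smooth_atlas_def
proof (intro conjI ballI)
  fix C assume "C \<in> total_atlas A E"
  then obtain c T where C: "C = tchart c T" "c \<in> A" "T \<in> trivs E" by (auto simp: total_atlas_eq)
  have im: "snd C ` fst C = cdom c T \<times> UNIV" using tchart_image[of c T "fst c \<inter> fst T"] C by simp
  have oc: "open (fst c \<inter> fst T)" using M.chart_open triv_open C by blast
  show o1: "open (fst C)" using open_vimage[OF oc proj_continuous] C by simp
  show "open (snd C ` fst C)" unfolding im using open_cdom C by (simp add: open_Times)
  have ci: "chart_inv C (snd C e) = e" if "e \<in> fst C" for e using chart_inv_tchart_self C that by simp
  have "continuous_on (fst C) (\<lambda>e. (snd c (proj E e), snd T e))"
  proof (intro continuous_on_Pair)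
    show "continuous_on (fst C) (\<lambda>e. snd c (proj E e))"
      by (rule continuous_on_compose2[OF M.chart_cont[OF C(2)] continuous_on_subset[OF proj_continuous]])
        (use C in auto)
    show "continuous_on (fst C) (snd T)"
      by (rule continuous_on_subset[OF triv_cont[OF C(3)]]) (use C in auto)
  qed
  moreover have "snd C = (\<lambda>e. (snd c (proj E e), snd T e))" using C by auto
  ultimately have co: "continuous_on (fst C) (snd C)" by simp
  have "continuous_on (cdom c T \<times> UNIV) (\<lambda>z. triv_inv E T (chart_inv c (fst z), snd z))"
  proof (rule continuous_on_compose2[of "fst T \<times> UNIV"])
    show "continuous_on (fst T \<times> UNIV) (triv_inv E T)"
      using triv_homeo[OF C(3)] by (simp add: homeomorphism_def)
    show "continuous_on (cdom c T \<times> (UNIV::'f set)) (\<lambda>z. (chart_inv c (fst z), snd z))"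
      by (intro continuous_on_Pair continuous_on_snd continuous_on_id
          continuous_on_compose2[OF M.chart_inv_cont[OF C(2)]] continuous_on_fst) auto
    show "(\<lambda>z. (chart_inv c (fst z), snd z)) ` (cdom c T \<times> UNIV) \<subseteq> fst T \<times> UNIV" using C by auto
  qed
  then have "continuous_on (cdom c T \<times> UNIV) (chart_inv C)"
    by (rule continuous_on_eq) (use C in auto)
  then show "homeomorphism (fst C) (snd C ` fst C) (snd C) (chart_inv C)"
    using ci co unfolding homeomorphism_def im[symmetric] by force
next
  show "(\<Union>C\<in>total_atlas A E. fst C) = UNIV"
  proof (intro Set.set_eqI iffI UNIV_I)
    fix e
    obtain c where "c \<in> A" "proj E e \<in> fst c" using M.ex_chart by blast
    moreover obtain T where "T \<in> trivs E" "proj E e \<in> fst T" using ex_triv by blast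
    ultimately show "e \<in> (\<Union>C\<in>total_atlas A E. fst C)" using tchart_in[of c T] by force
  qed
next
  fix C D assume "C \<in> total_atlas A E" "D \<in> total_atlas A E"
  then obtain c T d S where C: "C = tchart c T" "c \<in> A" "T \<in> trivs E"
    and D: "D = tchart d S" "d \<in> A" "S \<in> trivs E" by (auto simp: total_atlas_eq)
  let ?W = "fst c \<inter> fst d \<inter> (fst T \<inter> fst S)"
  have W: "open ?W" using M.chart_open triv_open C D by blast
  have "fst C \<inter> fst D = proj E -` ?W" using C D by auto
  then have im: "snd C ` (fst C \<inter> fst D) = snd c ` ?W \<times> UNIV" using tchart_image[of c T ?W] C by auto
  have oy: "open (snd c ` ?W)" using M.open_chart_image_subset[OF C(2) W] by blast
  let ?P = "snd c ` ?W \<times> (UNIV :: 'f set)"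
  have o: "open ?P" using oy by (simp add: open_Times)
  have fstsm: "smooth_on ?P fst" "smooth_on ?P snd"
    using o by (auto intro!: smooth_on_bounded_linear bounded_linear_fst bounded_linear_snd)
  have "smooth_on ?P (\<lambda>z. (snd d \<circ> chart_inv c) (fst z))"
    by (rule smooth_on_compose[OF o oy fstsm(1) smooth_on_subset[OF M.transition_smooth[OF C(2) D(2)]]]) auto
  \<comment> \<open>The fibre coordinate changes linearly, and the transition functions of the
    bundle are smooth in the base point for each fixed vector. The expansion in the basis turns this
    into smoothness in both variables together.\<close>
  moreover have "smooth_on ?P (\<lambda>z. \<Sum>b\<in>Basis. (snd z \<bullet> b) *\<^sub>R ((\<lambda>q. snd S (triv_inv E T (q, b))) \<circ> chart_inv c) (fst z))"
  proof (intro smooth_on_sum o smooth_on_scaleR smooth_on_inner fstsm(2) smooth_on_const)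
    fix b :: 'f
    show "smooth_on ?P (\<lambda>z. ((\<lambda>q. snd S (triv_inv E T (q, b))) \<circ> chart_inv c) (fst z))"
      by (rule smooth_on_compose[OF o oy fstsm(1) M.smooth_fun_onD[OF triv_transition[OF C(3) D(3)] C(2)]]) auto
  qed
  ultimately have "smooth_on ?P (\<lambda>z. ((snd d \<circ> chart_inv c) (fst z),
      \<Sum>b\<in>Basis. (snd z \<bullet> b) *\<^sub>R ((\<lambda>q. snd S (triv_inv E T (q, b))) \<circ> chart_inv c) (fst z)))"
    by (rule smooth_on_Pair[OF o])
  then show "smooth_on (snd C ` (fst C \<inter> fst D)) (snd D \<circ> chart_inv C)"
    unfolding im
  proof (rule smooth_on_cong[OF o, rotated])
    fix z assume "z \<in> ?P"
    then obtain q w where q: "q \<in> ?W" "z = (snd c q, w)" by auto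
    have "snd S (triv_inv E T (q, w)) = (\<Sum>b\<in>Basis. (w \<bullet> b) *\<^sub>R snd S (triv_inv E T (q, b)))"
      by (rule linear_euclidean_expansion[OF triv_change_linear]) (use q C D in auto)
    then show "((snd d \<circ> chart_inv c) (fst z),
      \<Sum>b\<in>Basis. (snd z \<bullet> b) *\<^sub>R ((\<lambda>q. snd S (triv_inv E T (q, b))) \<circ> chart_inv c) (fst z)) = (snd D \<circ> chart_inv C) z"
      using q C D by simp
  qed
qed

sublocale tot: smooth_manifold "total_atlas A E" using smooth_atlas_total by unfold_locales

subsection \<open>The metrics in local coordinates\<close>

definition loc_g :: "('m, 'e) chart \<Rightarrow> 'e \<Rightarrow> 'e \<Rightarrow> 'e \<Rightarrow> real" where
  "loc_g c y v w = g (chart_inv c y) (coord_vec A c (chart_inv c y) v) (coord_vec A c (chart_inv c y) w)"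

definition loc_h :: "('m, 'e) chart \<Rightarrow> 'm set \<times> ('x \<Rightarrow> 'f) \<Rightarrow> 'e \<Rightarrow> 'f \<Rightarrow> 'f \<Rightarrow> real" where
  "loc_h c T y v w = h (triv_inv E T (chart_inv c y, v)) (triv_inv E T (chart_inv c y, w))"

text \<open>Carries inner products from fibres and tangent spaces, which are carriers inside a type,
  to the model spaces; it is applied to \<open>g\<close> through \<open>coord_vec\<close> and to
  \<open>h\<close> through \<open>triv_inv\<close>. The last assumption is injectivity of the linear
  map \<open>\<phi>\<close> and gives definiteness.\<close>

lemma pos_bilinear_pullback:
  assumes "inner_product_on V ip" and cl: "\<And>v. \<phi> v \<in> vcarrier V"
    and add: "\<And>v w. \<phi> (v + w) = vplus V (\<phi> v) (\<phi> w)" and sc: "\<And>k v. \<phi> (k *\<^sub>R v) = vscale V k (\<phi> v)"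
    and nz: "\<And>v. v \<noteq> 0 \<Longrightarrow> \<phi> v \<noteq> vzero V"
  shows "pos_bilinear (\<lambda>v w. ip (\<phi> v) (\<phi> w))"
proof -
  have sym: "ip (\<phi> v) (\<phi> w) = ip (\<phi> w) (\<phi> v)" for v w using assms(1) cl by (simp add: inner_product_on_def)
  have l: "ip (\<phi> (v + w)) (\<phi> u) = ip (\<phi> v) (\<phi> u) + ip (\<phi> w) (\<phi> u)"
    "ip (\<phi> (k *\<^sub>R v)) (\<phi> u) = k * ip (\<phi> v) (\<phi> u)" for u v w k
    using assms(1) cl by (simp_all add: inner_product_on_def add sc)
  then have "linear (\<lambda>v. ip (\<phi> v) (\<phi> u))" for u by (intro linearI) auto
  then have "bilinear (\<lambda>v w. ip (\<phi> v) (\<phi> w))" unfolding bilinear_def using sym by simp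
  moreover have "ip (\<phi> v) (\<phi> v) > 0" if "v \<noteq> 0" for v
    using assms(1) cl nz[OF that] by (simp add: inner_product_on_def)
  ultimately show ?thesis using sym by (auto simp: pos_bilinear_def)
qed

lemma pos_loc_g:
  assumes "c \<in> A" "q \<in> fst c" shows "pos_bilinear (loc_g c (snd c q))"
proof -
  have "pos_bilinear (\<lambda>v w. g q (coord_vec A c q v) (coord_vec A c q w))"
  proof (rule pos_bilinear_pullback[where V="tangent_space A q" and ip="g q" and \<phi>="coord_vec A c q"])
    show "inner_product_on (tangent_space A q) (g q)" using metric by (simp add: riemannian_metric_def)
    fix v :: 'e assume "v \<noteq> 0"
    then show "coord_vec A c q v \<noteq> vzero (tangent_space A q)"
      using M.coord_vec_self[OF assms, of v] by (auto simp: tangent_space_def)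
  qed (use assms in \<open>auto intro: M.coord_vec_in_tangent_space M.coord_vec_add M.coord_vec_scale\<close>)
  then show ?thesis using assms by (simp add: loc_g_def[abs_def])
qed

lemma pos_lift_h:
  assumes "T \<in> trivs E" "q \<in> fst T"
  shows "pos_bilinear (\<lambda>v w. h (triv_inv E T (q, v)) (triv_inv E T (q, w)))"
proof (rule pos_bilinear_pullback[where V="fibre E q" and ip=h and \<phi>="\<lambda>v. triv_inv E T (q, v)"])
  show "inner_product_on (fibre E q) h" using hm by (simp add: bundle_metric_def)
  show "triv_inv E T (q, v) \<in> vcarrier (fibre E q)" for v using assms by simp
  show "triv_inv E T (q, v + w) = vplus (fibre E q) (triv_inv E T (q, v)) (triv_inv E T (q, w))" for v w
    by (rule triv_inj[of T]) (use assms in auto)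
  show "triv_inv E T (q, k *\<^sub>R v) = vscale (fibre E q) k (triv_inv E T (q, v))" for k v
    by (rule triv_inj[of T]) (use assms in auto)
  show "triv_inv E T (q, v) \<noteq> vzero (fibre E q)" if "v \<noteq> 0" for v
    using that assms triv_lift[OF assms, of v] triv_bzero[OF assms] by (metis fibre_simps(2))
qed

lemma pos_loc_h:
  "c \<in> A \<Longrightarrow> T \<in> trivs E \<Longrightarrow> q \<in> fst c \<Longrightarrow> q \<in> fst T \<Longrightarrow> pos_bilinear (loc_h c T (snd c q))"
  using pos_lift_h[of T q] by (simp add: loc_h_def[abs_def])

lemma smooth_loc_g: "c \<in> A \<Longrightarrow> smooth_bilinear (snd c ` fst c) (loc_g c)"
  using M.chart_image_open[of c] pos_loc_g[of c] metric
  by (auto simp: smooth_bilinear_def riemannian_metric_def loc_g_def[abs_def] pos_bilinear_def)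

lemma smooth_loc_h:
  assumes "c \<in> A" "T \<in> trivs E" shows "smooth_bilinear (cdom c T) (loc_h c T)"
proof -
  have "smooth_fun_on A (fst T) (\<lambda>p. h (triv_inv E T (p, v)) (triv_inv E T (p, w)))" for v w
    using hm assms(2) by (simp add: bundle_metric_def)
  then have "smooth_on (cdom c T) (\<lambda>y. loc_h c T y v w)" for v w
    using assms(1) by (simp add: smooth_fun_on_def o_def loc_h_def)
  moreover have "bilinear (loc_h c T y)" if "y \<in> cdom c T" for y
    using that pos_loc_h[OF assms] by (auto simp: pos_bilinear_def)
  ultimately show ?thesis using open_cdom[OF assms] by (auto simp: smooth_bilinear_def)
qed

lemma h_local:
  "c \<in> A \<Longrightarrow> T \<in> trivs E \<Longrightarrow> proj E e \<in> fst c \<Longrightarrow> proj E e \<in> fst T \<Longrightarrow> proj E e' = proj E e \<Longrightarrow>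
    h e e' = loc_h c T (snd c (proj E e)) (snd T e) (snd T e')"
  by (simp add: loc_h_def) (metis lift_triv)

lemma g_local:
  "c \<in> A \<Longrightarrow> q \<in> fst c \<Longrightarrow> X \<in> vcarrier (tangent_space A q) \<Longrightarrow> Y \<in> vcarrier (tangent_space A q) \<Longrightarrow>
    g q X Y = loc_g c (snd c q) (X c) (Y c)"
  by (simp add: loc_g_def M.coord_vec_component)

subsection \<open>Sections\<close>

lemma smooth_section_triv:
  assumes "smooth_section A E \<sigma>" "T \<in> trivs E"
  shows "smooth_fun_on A (fst T) (\<lambda>q. snd T (\<sigma> q))"
proof (rule M.smooth_fun_onI)
  fix q assume q: "q \<in> fst T"
  obtain c where c: "c \<in> A" "q \<in> fst c" using M.ex_chart by blast
  have pr: "proj E (\<sigma> q) = q" for q using assms(1) by (simp add: smooth_section_def)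
  have o: "open (cdom c T)" using open_cdom c assms by blast
  have "smooth_fun_on A (\<sigma> -` fst (tchart c T)) (snd (tchart c T) \<circ> \<sigma>)"
    using M.smooth_map_component[OF _ tchart_in[OF c(1) assms(2)]] assms(1) by (simp add: smooth_section_def)
  then have "smooth_on (cdom c T) (snd (tchart c T) \<circ> \<sigma> \<circ> chart_inv c)"
    by (rule M.smooth_fun_onD[OF _ c(1)]) (use pr in auto)
  then have "smooth_on (cdom c T) (\<lambda>y. snd ((snd (tchart c T) \<circ> \<sigma> \<circ> chart_inv c) y))"
    by (rule smooth_on_bounded_linear_compose[OF o bounded_linear_snd])
  then have "smooth_on (cdom c T) ((\<lambda>q. snd T (\<sigma> q)) \<circ> chart_inv c)" by (simp add: o_def)
  then show "\<exists>c\<in>A. \<exists>N. open N \<and> q \<in> N \<and> N \<subseteq> fst c \<and> smooth_on (snd c ` N) ((\<lambda>q. snd T (\<sigma> q)) \<circ> chart_inv c)"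
    using c q open_chart_triv[OF c(1) assms(2)] by (intro bexI[of _ c] exI[of _ "fst c \<inter> fst T"]) auto
qed (use triv_open assms in auto)

text \<open>Extension by the zero section. The result is smooth when \<open>\<phi>\<close> is smooth
  and vanishes off a closed subset of \<open>fst T\<close>; this is how local components become
  arguments for \<open>nabla\<close>.\<close>

definition sec :: "'m set \<times> ('x \<Rightarrow> 'f) \<Rightarrow> ('m \<Rightarrow> 'f) \<Rightarrow> 'm \<Rightarrow> 'x" where
  "sec T \<phi> q = (if q \<in> fst T then triv_inv E T (q, \<phi> q) else bzero E q)"

lemma proj_sec [simp]: "T \<in> trivs E \<Longrightarrow> proj E (sec T \<phi> q) = q"
  by (simp add: sec_def)

lemma triv_sec [simp]: "T \<in> trivs E \<Longrightarrow> q \<in> fst T \<Longrightarrow> snd T (sec T \<phi> q) = \<phi> q"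
  by (simp add: sec_def)

lemma smooth_section_sec:
  assumes T: "T \<in> trivs E" and \<phi>: "smooth_fun_on A UNIV \<phi>"
    and K: "closed K" "K \<subseteq> fst T" "\<And>q. q \<notin> K \<Longrightarrow> \<phi> q = 0"
  shows "smooth_section A E (sec T \<phi>)"
proof -
  have "smooth_map A (total_atlas A E) (sec T \<phi>)"
  proof (rule M.smooth_mapI[OF smooth_atlas_total])
    fix q
    obtain c where c: "c \<in> A" "q \<in> fst c" using M.ex_chart by blast
    have "\<exists>T'\<in>trivs E. \<exists>N. open N \<and> q \<in> N \<and> N \<subseteq> fst c \<inter> fst T' \<and> (\<forall>q'\<in>N. snd T' (sec T \<phi> q') = \<phi> q')"
    proof (cases "q \<in> fst T")
      case True
      then show ?thesis using c T open_chart_triv[OF c(1) T]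
        by (intro bexI[of _ T] exI[of _ "fst c \<inter> fst T"]) auto
    next
      case False
      \<comment> \<open>A point outside \<open>fst T\<close> lies off \<open>K\<close>, where the
        section is the zero section; its component is 0 in any trivialization around the
        point.\<close>
      obtain T' where T': "T' \<in> trivs E" "q \<in> fst T'" using ex_triv by blast
      have "snd T' (sec T \<phi> q') = \<phi> q'" if "q' \<in> fst c \<inter> fst T' \<inter> - K" for q'
        using that T' T K(3) lift_0[OF T] by (auto simp: sec_def)
      moreover have "open (fst c \<inter> fst T' \<inter> - K)" using M.chart_open c triv_open T' K(1) by blast
      ultimately show ?thesis using c T' K(2) False
        by (intro bexI[of _ T'] exI[of _ "fst c \<inter> fst T' \<inter> - K"]) auto
    qed
    then obtain T' N where T': "T' \<in> trivs E" "open N" "q \<in> N" "N \<subseteq> fst c \<inter> fst T'"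
      "\<And>q'. q' \<in> N \<Longrightarrow> snd T' (sec T \<phi> q') = \<phi> q'" by blast
    have o: "open (snd c ` N)" using M.open_chart_image_subset c T' by blast
    have "smooth_on (snd c ` N) (\<lambda>y. (y, (\<phi> \<circ> chart_inv c) y))"
      using o T' by (intro smooth_on_Pair smooth_on_bounded_linear bounded_linear_ident M.smooth_fun_onD[OF \<phi> c(1)]) auto
    then have "smooth_on (snd c ` N) (snd (tchart c T') \<circ> sec T \<phi> \<circ> chart_inv c)"
      by (rule smooth_on_cong[OF o, rotated]) (use c T T' in \<open>auto simp: subset_iff\<close>)
    then show "\<exists>c\<in>A. \<exists>d\<in>total_atlas A E. \<exists>N. open N \<and> q \<in> N \<and> N \<subseteq> fst c \<and> sec T \<phi> ` N \<subseteq> fst d \<and>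
      smooth_on (snd c ` N) (snd d \<circ> sec T \<phi> \<circ> chart_inv c)"
      using c T T' by (intro bexI[of _ c] bexI[of _ "tchart c T'"] exI[of _ N] tchart_in) (auto simp: subset_iff)
  qed
  then show ?thesis using T by (simp add: smooth_section_def)
qed

lemma smooth_cutoff:
  fixes \<psi> :: "'m \<Rightarrow> 'b::real_normed_vector"
  assumes "open U" "smooth_fun_on A U \<psi>" "smooth_fun_on A UNIV \<rho>" "closed K" "K \<subseteq> U" "\<And>q. q \<notin> K \<Longrightarrow> \<rho> q = 0"
  shows "smooth_fun_on A UNIV (\<lambda>q. \<rho> q *\<^sub>R \<psi> q)"
proof -
  have "smooth_fun_on A U (\<lambda>q. \<rho> q *\<^sub>R \<psi> q)"
    using assms by (intro M.smooth_fun_on_bilinear[OF bounded_bilinear_scaleR] M.smooth_fun_on_subset[OF assms(3)]) auto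
  moreover have "smooth_fun_on A (- K) (\<lambda>q. \<rho> q *\<^sub>R \<psi> q)"
    by (rule M.smooth_fun_on_cong[OF _ _ M.smooth_fun_on_const[of _ 0]]) (use assms in auto)
  ultimately have "smooth_fun_on A (U \<union> - K) (\<lambda>q. \<rho> q *\<^sub>R \<psi> q)"
    using assms by (intro M.smooth_fun_on_Un) auto
  moreover have "U \<union> - K = UNIV" using assms(5) by auto
  ultimately show ?thesis by simp
qed

text \<open>The component is cut off by a bump function that is 1 near \<open>q\<close>, so its germ
  survives. This supplies global sections with prescribed value and first derivative at a
  point.\<close>

lemma section_with_germ:
  assumes T: "T \<in> trivs E" "q \<in> fst T" and U: "open U" "q \<in> U" "smooth_fun_on A U \<psi>"
  obtains \<sigma> N where "smooth_section A E \<sigma>" "open N" "q \<in> N" "N \<subseteq> U \<inter> fst T"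
    "\<And>q'. q' \<in> N \<Longrightarrow> snd T (\<sigma> q') = \<psi> q'"
proof -
  have o: "open (U \<inter> fst T)" "q \<in> U \<inter> fst T" using open_Int[OF U(1) triv_open[OF T(1)]] T U by auto
  obtain \<rho> :: "'m \<Rightarrow> real" and N K where \<rho>: "smooth_fun_on A UNIV \<rho>" "open N" "q \<in> N" "N \<subseteq> U \<inter> fst T"
    "\<And>x. x \<in> N \<Longrightarrow> \<rho> x = 1" "closed K" "K \<subseteq> U \<inter> fst T" "\<And>x. x \<notin> K \<Longrightarrow> \<rho> x = 0"
    using manifold_bump[OF atlas o] by metis
  have sm: "smooth_section A E (sec T (\<lambda>q. \<rho> q *\<^sub>R \<psi> q))"
    by (rule smooth_section_sec[OF T(1) smooth_cutoff[OF U(1,3) \<rho>(1,6) _ \<rho>(8)] \<rho>(6)]) (use \<rho> in auto)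
  have "snd T (sec T (\<lambda>q. \<rho> q *\<^sub>R \<psi> q) q') = \<psi> q'" if "q' \<in> N" for q'
    using that \<rho>(4,5) T(1) by auto
  then show ?thesis by (rule that[OF sm \<rho>(2,3,4)])
qed

subsection \<open>Christoffel symbols\<close>

lemma nabla_in_fibre [simp]:
  "smooth_section A E \<sigma> \<Longrightarrow> X \<in> vcarrier (tangent_space A q) \<Longrightarrow> proj E (nabla q X \<sigma>) = q"
  using conn by (simp add: connection_def linear_map_def)

lemma nabla_Leibniz:
  assumes "smooth_section A E \<sigma>" "X \<in> vcarrier (tangent_space A q)" "smooth_fun_on A UNIV f"
    "T \<in> trivs E" "q \<in> fst T"
  shows "snd T (nabla q X (\<lambda>q. bscale E (f q) (\<sigma> q))) =
    tangent_deriv A q X f *\<^sub>R snd T (\<sigma> q) + f q *\<^sub>R snd T (nabla q X \<sigma>)"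
proof -
  have "nabla q X (\<lambda>q. bscale E (f q) (\<sigma> q)) =
    bplus E (bscale E (tangent_deriv A q X f) (\<sigma> q)) (bscale E (f q) (nabla q X \<sigma>))"
    using conn assms unfolding connection_def by blast
  moreover have "proj E (\<sigma> q) = q" using assms by (simp add: smooth_section_def)
  ultimately show ?thesis using assms by simp
qed

lemma nabla_add:
  assumes "smooth_section A E \<sigma>" "smooth_section A E \<tau>" "X \<in> vcarrier (tangent_space A q)" "T \<in> trivs E" "q \<in> fst T"
  shows "snd T (nabla q X (\<lambda>q. bplus E (\<sigma> q) (\<tau> q))) = snd T (nabla q X \<sigma>) + snd T (nabla q X \<tau>)"
proof -
  have "nabla q X (\<lambda>q. bplus E (\<sigma> q) (\<tau> q)) = bplus E (nabla q X \<sigma>) (nabla q X \<tau>)"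
    using conn assms unfolding connection_def by blast
  then show ?thesis using assms by simp
qed

text \<open>Multiplied by a bump function supported in \<open>U\<close>, the two sections become
  equal everywhere. In the Leibniz rule at \<open>q\<close> the terms with the derivative of
  \<open>\<rho>\<close> agree because the sections have the same value at \<open>q\<close>, and
  \<open>\<rho> q = 1\<close> isolates the remaining terms.\<close>

lemma nabla_local:
  assumes \<sigma>: "smooth_section A E \<sigma>" "smooth_section A E \<sigma>'" and X: "X \<in> vcarrier (tangent_space A q)"
    and U: "open U" "q \<in> U" "\<And>q'. q' \<in> U \<Longrightarrow> \<sigma> q' = \<sigma>' q'"
  shows "nabla q X \<sigma> = nabla q X \<sigma>'"
proof -
  obtain \<rho> :: "'m \<Rightarrow> real" and N K where \<rho>: "smooth_fun_on A UNIV \<rho>" "open N" "q \<in> N" "N \<subseteq> U"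
    "\<And>x. x \<in> N \<Longrightarrow> \<rho> x = 1" "closed K" "K \<subseteq> U" "\<And>x. x \<notin> K \<Longrightarrow> \<rho> x = 0"
    using manifold_bump[OF atlas U(1,2)] by metis
  obtain T where T: "T \<in> trivs E" "q \<in> fst T" using ex_triv by blast
  have pr: "proj E (\<sigma> q) = q" "proj E (\<sigma>' q) = q" for q using \<sigma> by (auto simp: smooth_section_def)
  have "bscale E (\<rho> q) (\<sigma> q) = bscale E (\<rho> q) (\<sigma>' q)" for q
    using \<rho>(7,8) U(3) by (cases "q \<in> K") (auto simp: bscale_0 pr)
  then have "(\<lambda>q. bscale E (\<rho> q) (\<sigma> q)) = (\<lambda>q. bscale E (\<rho> q) (\<sigma>' q))" by auto
  then have "snd T (nabla q X \<sigma>) = snd T (nabla q X \<sigma>')"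
    using nabla_Leibniz[OF \<sigma>(1) X \<rho>(1) T] nabla_Leibniz[OF \<sigma>(2) X \<rho>(1) T] U(2,3) \<rho>(3,5) by simp
  then show ?thesis using triv_inj[OF T(1)] \<sigma> X T by simp
qed

lemma smooth_differentiable_chart:
  assumes "smooth_fun_on A U \<psi>" "open U" "q \<in> U" "c \<in> A" "q \<in> fst c"
  shows "((\<psi> \<circ> chart_inv c) has_derivative frechet_derivative (\<psi> \<circ> chart_inv c) (at (snd c q))) (at (snd c q))"
  by (rule smooth_on_imp_has_derivative[of "snd c ` (fst c \<inter> U)"]) (use assms in \<open>auto simp: smooth_fun_on_def\<close>)

text \<open>Since \<open>nabla\<close> acts on global sections only, \<open>\<sigma>\<close> is expanded in the cut-off frame \<open>sec T (\<rho> b)\<close>.\<close>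

lemma nabla_frame:
  assumes c: "c \<in> A" "q \<in> fst c" and T: "T \<in> trivs E" and \<sigma>: "smooth_section A E \<sigma>"
    and X: "X \<in> vcarrier (tangent_space A q)"
    and \<rho>: "smooth_fun_on A UNIV \<rho>" "open N" "q \<in> N" "N \<subseteq> fst T" "\<And>x. x \<in> N \<Longrightarrow> \<rho> x = 1"
      "closed K" "K \<subseteq> fst T" "\<And>x. x \<notin> K \<Longrightarrow> \<rho> x = 0"
  shows "snd T (nabla q X \<sigma>) = frechet_derivative ((\<lambda>q. snd T (\<sigma> q)) \<circ> chart_inv c) (at (snd c q)) (X c) +
    (\<Sum>b\<in>Basis. (snd T (\<sigma> q) \<bullet> b) *\<^sub>R snd T (nabla q X (sec T (\<lambda>q. \<rho> q *\<^sub>R b))))"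
proof -
  have qT: "q \<in> fst T" using \<rho> by auto
  have \<psi>: "smooth_fun_on A (fst T) (\<lambda>q. snd T (\<sigma> q))" by (rule smooth_section_triv[OF \<sigma> T])
  define D where "D = frechet_derivative ((\<lambda>q. snd T (\<sigma> q)) \<circ> chart_inv c) (at (snd c q))"
  have D: "(((\<lambda>q. snd T (\<sigma> q)) \<circ> chart_inv c) has_derivative D) (at (snd c q))"
    unfolding D_def by (rule smooth_differentiable_chart[OF \<psi> triv_open[OF T] qT c])
  \<comment> \<open>The cut-off makes the coefficient a global smooth function. Together with the
    cut-off inside the frame, the expansion \<open>S Basis\<close> carries the factor
    \<open>\<rho>\<close> twice; it still agrees with \<open>\<sigma>\<close> on \<open>N\<close>,
    where \<open>\<rho>\<close> is 1.\<close>
  define f where "f b = (\<lambda>q. \<rho> q *\<^sub>R (snd T (\<sigma> q) \<bullet> b))" for b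
  have f: "smooth_fun_on A UNIV (f b)" for b
    unfolding f_def
    by (rule smooth_cutoff[OF triv_open[OF T] _ \<rho>(1,6,7,8)])
      (intro M.smooth_fun_on_bilinear[OF bounded_bilinear_inner] triv_open T \<psi> M.smooth_fun_on_const)
  have s: "smooth_section A E (sec T (\<lambda>q. \<rho> q *\<^sub>R b))" for b
    by (rule smooth_section_sec[OF T smooth_cutoff[OF triv_open[OF T] _ \<rho>(1,6,7,8)] \<rho>(6,7)])
      (auto intro!: M.smooth_fun_on_const triv_open T \<rho>)
  have df: "tangent_deriv A q X (f b) = D (X c) \<bullet> b" for b
  proof -
    have "((\<lambda>y. ((\<lambda>q. snd T (\<sigma> q)) \<circ> chart_inv c) y \<bullet> b) has_derivative (\<lambda>v. D v \<bullet> b)) (at (snd c q))"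
      by (rule has_derivative_inner_left[OF D])
    then have "((f b \<circ> chart_inv c) has_derivative (\<lambda>v. D v \<bullet> b)) (at (snd c q))"
      by (rule has_derivative_transform_within_open[OF _ M.open_chart_image[OF c(1) \<rho>(2)]])
        (use c \<rho> in \<open>auto simp: f_def\<close>)
    then show ?thesis
      using M.tangent_deriv_chart[OF c X, of "f b"] frechet_derivative_at unfolding differentiable_def
      by metis
  qed
  define S where "S B = sec T (\<lambda>q. \<Sum>b\<in>B. f b q *\<^sub>R \<rho> q *\<^sub>R b)" for B
  have S: "smooth_section A E (S B)" for B
  proof -
    have "smooth_fun_on A UNIV (\<lambda>q. \<Sum>b\<in>B. f b q *\<^sub>R \<rho> q *\<^sub>R b)"
      by (intro M.smooth_fun_on_sum M.smooth_fun_on_bilinear[OF bounded_bilinear_scaleR] f \<rho> M.smooth_fun_on_const) auto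
    then show ?thesis unfolding S_def by (rule smooth_section_sec[OF T _ \<rho>(6,7)]) (use \<rho>(8) in auto)
  qed
  have fin: "snd T (nabla q X (S B)) =
    (\<Sum>b\<in>B. (D (X c) \<bullet> b) *\<^sub>R b + f b q *\<^sub>R snd T (nabla q X (sec T (\<lambda>q. \<rho> q *\<^sub>R b))))" if "finite B" for B
    using that
  proof induction
    case empty
    \<comment> \<open>The zero section is written as 0 times \<open>\<sigma>\<close>, so that the
      Leibniz rule for the constant function 0 makes its covariant derivative vanish.\<close>
    have "S {} = (\<lambda>q. bscale E 0 (\<sigma> q))"
      using \<sigma> lift_0[OF T] by (auto simp: S_def sec_def bscale_0 smooth_section_def)
    moreover have "tangent_deriv A q X (\<lambda>q. 0) = 0"
      by (simp add: tangent_deriv_def o_def frechet_derivative_const Let_def)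
    ultimately show ?case using nabla_Leibniz[OF \<sigma> X M.smooth_fun_on_const[of UNIV 0] T qT] by simp
  next
    case (insert b B)
    let ?t = "\<lambda>q. bscale E (f b q) (sec T (\<lambda>q. \<rho> q *\<^sub>R b) q)"
    have t: "smooth_section A E ?t"
    proof -
      have "?t = sec T (\<lambda>q. f b q *\<^sub>R \<rho> q *\<^sub>R b)"
      proof
        fix q show "?t q = sec T (\<lambda>q. f b q *\<^sub>R \<rho> q *\<^sub>R b) q"
        proof (cases "q \<in> fst T")
          case True
          then show ?thesis using T by (intro triv_inj[of T]) auto
        next
          case False
          then show ?thesis using \<rho>(7,8) by (auto simp: sec_def f_def bscale_0 subset_iff)
        qed
      qed
      moreover have "smooth_fun_on A UNIV (\<lambda>q. f b q *\<^sub>R \<rho> q *\<^sub>R b)"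
        by (intro M.smooth_fun_on_bilinear[OF bounded_bilinear_scaleR] f \<rho> M.smooth_fun_on_const) auto
      ultimately show ?thesis using smooth_section_sec[OF T _ \<rho>(6,7), of "\<lambda>q. f b q *\<^sub>R \<rho> q *\<^sub>R b"] \<rho>(8) by simp
    qed
    have "S (insert b B) = (\<lambda>q. bplus E (?t q) (S B q))"
    proof
      fix q show "S (insert b B) q = bplus E (?t q) (S B q)"
      proof (cases "q \<in> fst T")
        case True
        then show ?thesis using T insert by (intro triv_inj[of T]) (auto simp: S_def)
      next
        case False
        interpret G: comm_group "\<lparr>carrier = proj E -` {q}, mult = bplus E, one = bzero E q\<rparr>" by (rule fibre_group)
        show ?thesis using False \<rho>(7,8) G.l_one[of "bzero E q"] by (auto simp: S_def sec_def f_def bscale_0 subset_iff)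
      qed
    qed
    then show ?case
      using nabla_add[OF t S X T qT] nabla_Leibniz[OF s X f T qT, of b b] insert df[of b] qT T \<rho>(3,5)
      by simp
  qed
  have "nabla q X \<sigma> = nabla q X (S Basis)"
  proof (rule nabla_local[OF \<sigma> S X \<rho>(2,3)])
    fix q' assume q': "q' \<in> N"
    then have "snd T (S Basis q') = snd T (\<sigma> q')"
      using \<rho>(4,5) T by (auto simp: S_def f_def euclidean_representation)
    then show "\<sigma> q' = S Basis q'"
      using triv_inj[OF T, of "\<sigma> q'" "S Basis q'"] q' \<rho>(4) \<sigma> S[of Basis] by (auto simp: smooth_section_def)
  qed
  then show ?thesis using fin[of Basis] \<rho>(3,5)
    by (simp add: sum.distrib euclidean_representation D_def[symmetric] f_def)
qed

text \<open>By \<open>nabla_local\<close> every section that is constantly \<open>w\<close> in the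
  trivialization near \<open>q\<close> has the same covariant derivative at \<open>q\<close>, so the
  choice made here leaves no trace in \<open>Gam\<close>.\<close>

definition frame_sec :: "'m set \<times> ('x \<Rightarrow> 'f) \<Rightarrow> 'm \<Rightarrow> 'f \<Rightarrow> 'm \<Rightarrow> 'x" where
  "frame_sec T q w = (SOME \<sigma>. smooth_section A E \<sigma> \<and>
     (\<exists>N. open N \<and> q \<in> N \<and> N \<subseteq> fst T \<and> (\<forall>q'\<in>N. snd T (\<sigma> q') = w)))"

lemma frame_sec:
  assumes "T \<in> trivs E" "q \<in> fst T"
  shows "smooth_section A E (frame_sec T q w)"
    "\<exists>N. open N \<and> q \<in> N \<and> N \<subseteq> fst T \<and> (\<forall>q'\<in>N. snd T (frame_sec T q w q') = w)"
proof -
  obtain \<sigma> N where "smooth_section A E \<sigma>" "open N" "q \<in> N" "N \<subseteq> UNIV \<inter> fst T"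
    "\<And>q'. q' \<in> N \<Longrightarrow> snd T (\<sigma> q') = w"
    using section_with_germ[OF assms open_UNIV UNIV_I M.smooth_fun_on_const[OF open_UNIV, of w]] by metis
  then have "\<exists>\<sigma>. smooth_section A E \<sigma> \<and> (\<exists>N. open N \<and> q \<in> N \<and> N \<subseteq> fst T \<and> (\<forall>q'\<in>N. snd T (\<sigma> q') = w))"
    by blast
  from someI_ex[OF this] show "smooth_section A E (frame_sec T q w)"
    "\<exists>N. open N \<and> q \<in> N \<and> N \<subseteq> fst T \<and> (\<forall>q'\<in>N. snd T (frame_sec T q w q') = w)"
    unfolding frame_sec_def by blast+
qed

text \<open>The Christoffel symbols \<open>\<Gamma>\<close> of the connection: covariant derivatives
  of sections with constant components.\<close>

definition Gam :: "('m, 'e) chart \<Rightarrow> 'm set \<times> ('x \<Rightarrow> 'f) \<Rightarrow> 'e \<Rightarrow> 'e \<Rightarrow> 'f \<Rightarrow> 'f" where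
  "Gam c T y v w = snd T (nabla (chart_inv c y) (coord_vec A c (chart_inv c y) v) (frame_sec T (chart_inv c y) w))"

text \<open>In \<open>Gam\<close> the section changes with the point, which hides the dependence on
  the point. One cut-off frame serves all points of \<open>N\<close> at once and displays both the
  linearity in \<open>w\<close> and the smoothness in the base point. The derivative term of
  \<open>nabla_frame\<close> drops out because the components are constant near the point.\<close>

lemma Gam_frame:
  assumes c: "c \<in> A" "q \<in> fst c" and T: "T \<in> trivs E"
    and \<rho>: "smooth_fun_on A UNIV \<rho>" "open N" "q \<in> N" "N \<subseteq> fst T" "\<And>x. x \<in> N \<Longrightarrow> \<rho> x = 1"
      "closed K" "K \<subseteq> fst T" "\<And>x. x \<notin> K \<Longrightarrow> \<rho> x = 0"
  shows "Gam c T (snd c q) v w =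
    (\<Sum>b\<in>Basis. (w \<bullet> b) *\<^sub>R snd T (nabla q (coord_vec A c q v) (sec T (\<lambda>q. \<rho> q *\<^sub>R b))))"
proof -
  have qT: "q \<in> fst T" using \<rho> by auto
  obtain N' where N': "open N'" "q \<in> N'" "N' \<subseteq> fst T" "\<And>q'. q' \<in> N' \<Longrightarrow> snd T (frame_sec T q w q') = w"
    using frame_sec(2)[OF T qT, of w] by metis
  have "((\<lambda>y. w) has_derivative (\<lambda>v. 0)) (at (snd c q))" by simp
  then have "(((\<lambda>q'. snd T (frame_sec T q w q')) \<circ> chart_inv c) has_derivative (\<lambda>v. 0)) (at (snd c q))"
    by (rule has_derivative_transform_within_open[OF _ M.open_chart_image[OF c(1) N'(1)]])
      (use c N' in auto)
  then have "frechet_derivative ((\<lambda>q'. snd T (frame_sec T q w q')) \<circ> chart_inv c) (at (snd c q)) = (\<lambda>v. 0)"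
    by (rule frechet_derivative_at[symmetric])
  then show ?thesis
    using nabla_frame[OF c T frame_sec(1)[OF T qT, of w] M.coord_vec_in_tangent_space[OF c, of v] \<rho>] c N'
    by (simp add: Gam_def)
qed

lemma obtain_frame_bump:
  assumes c: "c \<in> A" "q \<in> fst c" and T: "T \<in> trivs E" "q \<in> fst T"
  obtains \<rho> :: "'m \<Rightarrow> real" and N K where "smooth_fun_on A UNIV \<rho>" "open N" "q \<in> N" "N \<subseteq> fst T"
    "\<And>x. x \<in> N \<Longrightarrow> \<rho> x = 1" "closed K" "K \<subseteq> fst T" "\<And>x. x \<notin> K \<Longrightarrow> \<rho> x = 0" "N \<subseteq> fst c" "K \<subseteq> fst c"
proof -
  have "open (fst c \<inter> fst T)" "q \<in> fst c \<inter> fst T" using open_chart_triv c T by auto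
  from manifold_bump[OF atlas this] show ?thesis using that by (metis le_infE)
qed

lemma nabla_Gam:
  assumes c: "c \<in> A" "q \<in> fst c" and T: "T \<in> trivs E" "q \<in> fst T" and \<sigma>: "smooth_section A E \<sigma>"
    and X: "X \<in> vcarrier (tangent_space A q)"
  shows "snd T (nabla q X \<sigma>) = frechet_derivative ((\<lambda>q. snd T (\<sigma> q)) \<circ> chart_inv c) (at (snd c q)) (X c) +
    Gam c T (snd c q) (X c) (snd T (\<sigma> q))"
proof -
  obtain \<rho> :: "'m \<Rightarrow> real" and N K where \<rho>: "smooth_fun_on A UNIV \<rho>" "open N" "q \<in> N" "N \<subseteq> fst T"
    "\<And>x. x \<in> N \<Longrightarrow> \<rho> x = 1" "closed K" "K \<subseteq> fst T" "\<And>x. x \<notin> K \<Longrightarrow> \<rho> x = 0"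
    using obtain_frame_bump[OF c T] by metis
  show ?thesis using nabla_frame[OF c T(1) \<sigma> X \<rho>] Gam_frame[OF c T(1) \<rho>] M.coord_vec_component[OF X c] by simp
qed

text \<open>Regularity of \<open>nabla\<close> in the base point is postulated for global smooth
  vector fields. These fields have the constant component \<open>v\<close> in the chart wherever
  \<open>\<rho>\<close> is 1.\<close>

lemma smooth_vector_field_cutoff:
  assumes c: "c \<in> A" and \<rho>: "smooth_fun_on A UNIV \<rho>" "closed K" "K \<subseteq> fst c" "\<And>x. x \<notin> K \<Longrightarrow> \<rho> x = 0"
  shows "smooth_vector_field A (\<lambda>q d. if q \<in> fst c then \<rho> q *\<^sub>R coord_vec A c q v d else 0)"
  unfolding smooth_vector_field_def
proof (intro conjI allI ballI)
  fix q
  show "(\<lambda>d. if q \<in> fst c then \<rho> q *\<^sub>R coord_vec A c q v d else 0) \<in> vcarrier (tangent_space A q)"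
  proof (cases "q \<in> fst c")
    case True
    then have "(\<lambda>d. \<rho> q *\<^sub>R coord_vec A c q v d) = coord_vec A c q (\<rho> q *\<^sub>R v)"
      using M.coord_vec_scale[OF c True] by (simp add: tangent_space_def)
    then show ?thesis using True M.coord_vec_in_tangent_space[OF c True] by simp
  next
    case False
    have "frechet_derivative (snd d \<circ> chart_inv d') (at (snd d' q)) 0 = 0"
      if "d' \<in> A" "d \<in> A" "q \<in> fst d'" "q \<in> fst d" for d d'
      using linear_0[OF M.linear_transition_deriv[OF that]] .
    then show ?thesis using False by (simp add: tangent_space_def)
  qed
next
  fix d assume d: "d \<in> A"
  let ?f = "\<lambda>q. \<rho> q *\<^sub>R (if q \<in> fst c then M.transition_deriv c d q v else 0)"
  have oU: "open (fst c \<inter> fst d)" using M.chart_open c d by blast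
  have "smooth_fun_on A (fst c \<inter> fst d) (\<lambda>q. if q \<in> fst c then M.transition_deriv c d q v else 0)"
  proof (rule M.smooth_fun_onI[OF oU])
    fix q assume q: "q \<in> fst c \<inter> fst d"
    have o: "open (snd c ` (fst c \<inter> fst d))" using M.open_chart_image M.chart_open c d by blast
    have "smooth_on (snd c ` (fst c \<inter> fst d)) (\<lambda>y. frechet_derivative (snd d \<circ> chart_inv c) (at y) v)"
      by (rule smooth_on_frechet_derivative[OF M.transition_smooth[OF c d]])
    then have "smooth_on (snd c ` (fst c \<inter> fst d))
        ((\<lambda>q. if q \<in> fst c then M.transition_deriv c d q v else 0) \<circ> chart_inv c)"
      by (rule smooth_on_cong[OF o, rotated]) (use c in auto)
    then show "\<exists>c'\<in>A. \<exists>N. open N \<and> q \<in> N \<and> N \<subseteq> fst c' \<and>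
        smooth_on (snd c' ` N) ((\<lambda>q. if q \<in> fst c then M.transition_deriv c d q v else 0) \<circ> chart_inv c')"
      using q oU c by (intro bexI[of _ c] exI[of _ "fst c \<inter> fst d"]) auto
  qed
  then have 1: "smooth_fun_on A (fst c \<inter> fst d) ?f"
    using oU by (intro M.smooth_fun_on_bilinear[OF bounded_bilinear_scaleR] M.smooth_fun_on_subset[OF \<rho>(1)]) auto
  have 2: "smooth_fun_on A (- K) ?f"
    by (rule M.smooth_fun_on_cong[OF _ _ M.smooth_fun_on_const[of _ 0]]) (use \<rho> in auto)
  have sf: "smooth_fun_on A (fst c \<inter> fst d \<union> - K) ?f"
    by (rule M.smooth_fun_on_Un[OF oU _ 1 2]) (use \<rho> in auto)
  have "smooth_on (snd d ` fst d) (?f \<circ> chart_inv d)"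
    by (rule M.smooth_fun_onD[OF sf d]) (use \<rho>(3) in auto)
  then show "smooth_on (snd d ` fst d) (\<lambda>y. if chart_inv d y \<in> fst c then \<rho> (chart_inv d y) *\<^sub>R coord_vec A c (chart_inv d y) v d else 0)"
    by (rule smooth_on_cong[OF M.chart_image_open[OF d], rotated]) (use d in \<open>auto simp: coord_vec_def\<close>)
qed

text \<open>Near each point \<open>Gam\<close> is a combination of components of covariant
  derivatives of fixed global sections along a fixed global field, and these are smooth sections by
  the last axiom of a connection. Linearity in the direction is linearity of \<open>nabla\<close> in
  the tangent vector; linearity in the fibre vector is read off from
  \<open>Gam_frame\<close>.\<close>

lemma smooth_Gam:
  assumes c: "c \<in> A" and T: "T \<in> trivs E"
  shows "smooth_bilinear (cdom c T) (Gam c T)"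
  unfolding smooth_bilinear_def
proof (intro conjI ballI allI open_cdom c T)
  fix y assume "y \<in> cdom c T"
  then obtain q where q: "q \<in> fst c" "q \<in> fst T" "y = snd c q" by auto
  obtain \<rho> :: "'m \<Rightarrow> real" and N K where \<rho>: "smooth_fun_on A UNIV \<rho>" "open N" "q \<in> N" "N \<subseteq> fst T"
    "\<And>x. x \<in> N \<Longrightarrow> \<rho> x = 1" "closed K" "K \<subseteq> fst T" "\<And>x. x \<notin> K \<Longrightarrow> \<rho> x = 0"
    using obtain_frame_bump[OF c q(1) T q(2)] by metis
  have G: "Gam c T y v w = (\<Sum>b\<in>Basis. (w \<bullet> b) *\<^sub>R snd T (nabla q (coord_vec A c q v) (sec T (\<lambda>q. \<rho> q *\<^sub>R b))))" for v w
    unfolding q(3) by (rule Gam_frame[OF c q(1) T \<rho>])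
  have "linear (Gam c T y v)" for v
    unfolding G[abs_def] by (intro linear_compose_sum ballI) (auto intro!: linearI simp: inner_add_left scaleR_add_left)
  moreover have "linear (\<lambda>v. Gam c T y v w)" for w
  proof -
    have s: "smooth_section A E (frame_sec T q w)" using frame_sec(1)[OF T q(2)] .
    have lin: "linear_map (tangent_space A q) (fibre E q) (\<lambda>X. nabla q X (frame_sec T q w))"
      using conn s by (simp add: connection_def)
    note cv = M.coord_vec_in_tangent_space[OF c q(1)]
    show ?thesis
    proof (rule linearI)
      fix u v :: 'e and k :: real
      have "nabla q (coord_vec A c q (u + v)) (frame_sec T q w) =
        bplus E (nabla q (coord_vec A c q u) (frame_sec T q w)) (nabla q (coord_vec A c q v) (frame_sec T q w))"
        using lin cv unfolding M.coord_vec_add[OF c q(1)] by (simp add: linear_map_def)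
      then show "Gam c T y (u + v) w = Gam c T y u w + Gam c T y v w"
        using c q T s cv by (simp add: Gam_def)
      have "nabla q (coord_vec A c q (k *\<^sub>R u)) (frame_sec T q w) = bscale E k (nabla q (coord_vec A c q u) (frame_sec T q w))"
        using lin cv unfolding M.coord_vec_scale[OF c q(1)] by (simp add: linear_map_def)
      then show "Gam c T y (k *\<^sub>R u) w = k *\<^sub>R Gam c T y u w"
        using c q T s cv by (simp add: Gam_def)
    qed
  qed
  ultimately show "bilinear (Gam c T y)" by (simp add: bilinear_def)
next
  fix v w
  show "smooth_on (cdom c T) (\<lambda>y. Gam c T y v w)"
  proof (rule smooth_on_local)
    fix y assume "y \<in> cdom c T"
    then obtain q where q: "q \<in> fst c" "q \<in> fst T" "y = snd c q" by auto
    obtain \<rho> :: "'m \<Rightarrow> real" and N K where \<rho>: "smooth_fun_on A UNIV \<rho>" "open N" "q \<in> N" "N \<subseteq> fst T"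
      "\<And>x. x \<in> N \<Longrightarrow> \<rho> x = 1" "closed K" "K \<subseteq> fst T" "\<And>x. x \<notin> K \<Longrightarrow> \<rho> x = 0" "N \<subseteq> fst c" "K \<subseteq> fst c"
      using obtain_frame_bump[OF c q(1) T q(2)] by metis
    define X where "X = (\<lambda>q d. if q \<in> fst c then \<rho> q *\<^sub>R coord_vec A c q v d else 0)"
    have X: "smooth_vector_field A X" unfolding X_def by (rule smooth_vector_field_cutoff[OF c \<rho>(1,6,10,8)])
    have s: "smooth_section A E (sec T (\<lambda>q. \<rho> q *\<^sub>R b))" for b
      by (rule smooth_section_sec[OF T smooth_cutoff[OF triv_open[OF T] _ \<rho>(1,6,7,8)] \<rho>(6,7)])
        (auto intro!: M.smooth_fun_on_const triv_open T \<rho>)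
    have sm: "smooth_fun_on A (fst T) (\<lambda>q. snd T (nabla q (X q) (sec T (\<lambda>q. \<rho> q *\<^sub>R b))))" for b
    proof (rule smooth_section_triv[OF _ T])
      show "smooth_section A E (\<lambda>q. nabla q (X q) (sec T (\<lambda>q. \<rho> q *\<^sub>R b)))"
        using conn X s unfolding connection_def by blast
    qed
    have o: "open (snd c ` N)" using M.open_chart_image_subset c \<rho> by blast
    have "smooth_on (snd c ` N) (\<lambda>y. \<Sum>b\<in>Basis. (w \<bullet> b) *\<^sub>R ((\<lambda>q. snd T (nabla q (X q) (sec T (\<lambda>q. \<rho> q *\<^sub>R b)))) \<circ> chart_inv c) y)"
      using \<rho> by (intro smooth_on_sum o smooth_on_scaleR smooth_on_const M.smooth_fun_onD[OF sm c]) auto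
    then have "smooth_on (snd c ` N) (\<lambda>y. Gam c T y v w)"
    proof (rule smooth_on_cong[OF o, rotated])
      fix y' assume "y' \<in> snd c ` N"
      then obtain q' where q': "q' \<in> N" "y' = snd c q'" by auto
      have Xq: "X q' = coord_vec A c q' v" using q' \<rho> by (auto simp: X_def fun_eq_iff)
      have "Gam c T (snd c q') v w = (\<Sum>b\<in>Basis. (w \<bullet> b) *\<^sub>R snd T (nabla q' (coord_vec A c q' v) (sec T (\<lambda>q. \<rho> q *\<^sub>R b))))"
        by (rule Gam_frame[OF c _ T \<rho>(1,2) q'(1) \<rho>(4,5,6,7,8)]) (use q' \<rho> in auto)
      then show "(\<Sum>b\<in>Basis. (w \<bullet> b) *\<^sub>R ((\<lambda>q. snd T (nabla q (X q) (sec T (\<lambda>q. \<rho> q *\<^sub>R b)))) \<circ> chart_inv c) y') = Gam c T y' v w"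
        using q' \<rho>(9) c Xq by auto
    qed
    then show "\<exists>N. open N \<and> y \<in> N \<and> smooth_on N (\<lambda>y. Gam c T y v w)" using o q \<rho> by blast
  qed
qed

text \<open>Metric compatibility is applied to two sections with constant components near
  \<open>q\<close>: their product is \<open>loc_h\<close> with fixed arguments, and their covariant
  derivatives are Christoffel symbols.\<close>

lemma Gam_metric:
  assumes c: "c \<in> A" "q \<in> fst c" and T: "T \<in> trivs E" "q \<in> fst T"
  shows "frechet_derivative (\<lambda>y. loc_h c T y w w') (at (snd c q)) v =
    loc_h c T (snd c q) (Gam c T (snd c q) v w) w' + loc_h c T (snd c q) w (Gam c T (snd c q) v w')"
proof -
  let ?s = "frame_sec T q w" and ?s' = "frame_sec T q w'" and ?X = "coord_vec A c q v"
  have X: "?X \<in> vcarrier (tangent_space A q)" by (rule M.coord_vec_in_tangent_space[OF c])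
  note s = frame_sec(1)[OF T, of w] and s' = frame_sec(1)[OF T, of w']
  have pr: "proj E (?s q) = q" "proj E (?s' q) = q" for q using s s' by (auto simp: smooth_section_def)
  obtain N where N: "open N" "q \<in> N" "N \<subseteq> fst T" "\<And>q'. q' \<in> N \<Longrightarrow> snd T (?s q') = w" using frame_sec(2)[OF T, of w] by metis
  obtain N' where N': "open N'" "q \<in> N'" "N' \<subseteq> fst T" "\<And>q'. q' \<in> N' \<Longrightarrow> snd T (?s' q') = w'" using frame_sec(2)[OF T, of w'] by metis
  have "snd c q \<in> cdom c T" using c T by auto
  then have der: "((\<lambda>y. loc_h c T y w w') has_derivative frechet_derivative (\<lambda>y. loc_h c T y w w') (at (snd c q))) (at (snd c q))"
    using smooth_loc_h[OF c(1) T(1)] smooth_on_imp_has_derivative unfolding smooth_bilinear_def by blast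
  have oN: "open (N \<inter> N')" using N N' by blast
  have D: "(((\<lambda>q. h (?s q) (?s' q)) \<circ> chart_inv c) has_derivative frechet_derivative (\<lambda>y. loc_h c T y w w') (at (snd c q))) (at (snd c q))"
  proof (rule has_derivative_transform_within_open[OF der M.open_chart_image[OF c(1) oN]])
    fix y assume "y \<in> snd c ` (fst c \<inter> (N \<inter> N'))"
    then obtain q' where q': "q' \<in> fst c" "q' \<in> N" "q' \<in> N'" "y = snd c q'" by auto
    have "h (?s q') (?s' q') = loc_h c T (snd c q') w w'"
      using h_local[OF c(1) T(1), of "?s q'" "?s' q'"] pr[of q'] q' N N' by auto
    then show "loc_h c T y w w' = ((\<lambda>q. h (?s q) (?s' q)) \<circ> chart_inv c) y" using q' c by simp
  qed (use c N N' in auto)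
  have "tangent_deriv A q ?X (\<lambda>q. h (?s q) (?s' q)) = frechet_derivative (\<lambda>y. loc_h c T y w w') (at (snd c q)) v"
    using M.tangent_deriv_chart[OF c X, of "\<lambda>q. h (?s q) (?s' q)"] D frechet_derivative_at[OF D] c
    by (auto simp: differentiable_def)
  moreover have "tangent_deriv A q ?X (\<lambda>q. h (?s q) (?s' q)) = h (nabla q ?X ?s) (?s' q) + h (?s q) (nabla q ?X ?s')"
    using compat X s s' unfolding metric_compatible_def by blast
  moreover have "h (nabla q ?X ?s) (?s' q) = loc_h c T (snd c q) (Gam c T (snd c q) v w) w'"
    using h_local[OF c(1) T(1), of "nabla q ?X ?s" "?s' q"] pr(2)[of q] nabla_in_fibre[OF s X] c T N' by (simp add: Gam_def)
  moreover have "h (?s q) (nabla q ?X ?s') = loc_h c T (snd c q) w (Gam c T (snd c q) v w')"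
    using h_local[OF c(1) T(1), of "?s q" "nabla q ?X ?s'"] pr(1)[of q] nabla_in_fibre[OF s' X] c T N by (simp add: Gam_def)
  ultimately show ?thesis by simp
qed

subsection \<open>The connection map\<close>

lemma section_tchart_derivative:
  assumes c: "c \<in> A" "q \<in> fst c" and T: "T \<in> trivs E" "q \<in> fst T" and \<sigma>: "smooth_section A E \<sigma>"
  shows "((snd (tchart c T) \<circ> \<sigma> \<circ> chart_inv c) has_derivative
    (\<lambda>v. (v, frechet_derivative ((\<lambda>q. snd T (\<sigma> q)) \<circ> chart_inv c) (at (snd c q)) v))) (at (snd c q))"
proof -
  have "((\<lambda>y. (y, ((\<lambda>q. snd T (\<sigma> q)) \<circ> chart_inv c) y)) has_derivative
    (\<lambda>v. (v, frechet_derivative ((\<lambda>q. snd T (\<sigma> q)) \<circ> chart_inv c) (at (snd c q)) v))) (at (snd c q))"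
    by (intro has_derivative_Pair has_derivative_ident smooth_differentiable_chart[OF smooth_section_triv[OF \<sigma> T(1)] triv_open[OF T(1)] T(2) c])
  then show ?thesis
    by (rule has_derivative_transform_within_open[OF _ open_cdom[OF c(1) T(1)]])
      (use c T \<sigma> in \<open>auto simp: smooth_section_def\<close>)
qed

lemma pushforward_section:
  assumes c: "c \<in> A" "q \<in> fst c" and T: "T \<in> trivs E" "q \<in> fst T" and \<sigma>: "smooth_section A E \<sigma>"
    and X: "X \<in> vcarrier (tangent_space A q)"
  shows "pushforward A (total_atlas A E) \<sigma> q X (tchart c T) =
      (X c, frechet_derivative ((\<lambda>q. snd T (\<sigma> q)) \<circ> chart_inv c) (at (snd c q)) (X c))"
    "pushforward A (total_atlas A E) \<sigma> q X \<in> vcarrier (tangent_space (total_atlas A E) (\<sigma> q))"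
proof -
  have pr: "proj E (\<sigma> q) = q" for q using \<sigma> by (simp add: smooth_section_def)
  have D: "(snd (tchart c T) \<circ> \<sigma> \<circ> chart_inv c) differentiable (at (snd c q))"
    using section_tchart_derivative[OF c T \<sigma>] by (auto simp: differentiable_def)
  show "pushforward A (total_atlas A E) \<sigma> q X (tchart c T) =
      (X c, frechet_derivative ((\<lambda>q. snd T (\<sigma> q)) \<circ> chart_inv c) (at (snd c q)) (X c))"
    using M.pushforward_chart[OF c X tchart_in[OF c(1) T(1)] _ D] pr c T
      frechet_derivative_at[OF section_tchart_derivative[OF c T \<sigma>]] by (simp add: fun_eq_iff)
  show "pushforward A (total_atlas A E) \<sigma> q X \<in> vcarrier (tangent_space (total_atlas A E) (\<sigma> q))"
    by (rule M.pushforward_in_tangent_space[OF smooth_atlas_total c X tchart_in[OF c(1) T(1)] _ _ _ _ D, of "fst c \<inter> fst T"])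
      (use pr c T open_chart_triv[OF c(1) T(1)] in auto)
qed

text \<open>The axioms fix the values on pushforwards of base vectors by sections. Every tangent
  vector with nonzero horizontal part is such a pushforward, by a section whose component is affine
  in the coordinates; a vertical vector is a difference of two of them.\<close>

lemma is_connection_map_local:
  assumes \<kappa>: "is_connection_map A E nabla \<kappa>" and c: "c \<in> A" "proj E e \<in> fst c" and T: "T \<in> trivs E" "proj E e \<in> fst T"
    and \<xi>: "\<xi> \<in> vcarrier (tangent_space (total_atlas A E) e)"
  shows "proj E (\<kappa> e \<xi>) = proj E e"
    "snd T (\<kappa> e \<xi>) = snd (\<xi> (tchart c T)) + Gam c T (snd c (proj E e)) (fst (\<xi> (tchart c T))) (snd T e)"
proof -
  define q where "q = proj E e"
  let ?C = "tchart c T"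
  have C: "?C \<in> total_atlas A E" "e \<in> fst ?C" using tchart_in c T by auto
  have lin: "linear_map (tangent_space (total_atlas A E) e) (fibre E q) (\<kappa> e)"
    using \<kappa> by (simp add: is_connection_map_def q_def)
  then show pr: "proj E (\<kappa> e \<xi>) = proj E e" using \<xi> by (simp add: linear_map_def q_def)
  have bil: "bilinear (Gam c T (snd c q))"
    using smooth_Gam[OF c(1) T(1)] c T unfolding smooth_bilinear_def q_def by auto
  have *: "snd T (\<kappa> e \<eta>) = w + Gam c T (snd c q) v (snd T e)"
    if \<eta>: "\<eta> \<in> vcarrier (tangent_space (total_atlas A E) e)" "\<eta> ?C = (v, w)" "v \<noteq> 0" for \<eta> v w
  proof -
    \<comment> \<open>The derivative of \<open>?\<psi>\<close> in the direction \<open>v\<close> is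
      \<open>(v \<bullet> v) *\<^sub>R k\<close>, and the factor is chosen to make it equal to
      \<open>w\<close>.\<close>
    define k where "k = (1 / (v \<bullet> v)) *\<^sub>R w"
    let ?\<psi> = "\<lambda>q'. snd T e + ((snd c q' + - snd c q) \<bullet> v) *\<^sub>R k"
    have oc: "open (fst c)" using M.chart_open c by blast
    have "smooth_fun_on A (fst c) (snd c)"
    proof (rule M.smooth_fun_onI[OF oc])
      have o: "open (snd c ` fst c)" using M.chart_image_open c by blast
      have "smooth_on (snd c ` fst c) (snd c \<circ> chart_inv c)"
        using M.transition_smooth[OF c(1) c(1)] by simp
      then show "\<exists>c'\<in>A. \<exists>N. open N \<and> x \<in> N \<and> N \<subseteq> fst c' \<and> smooth_on (snd c' ` N) (snd c \<circ> chart_inv c')"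
        if "x \<in> fst c" for x using that oc c by blast
    qed
    then have "smooth_fun_on A (fst c) ?\<psi>"
      using oc by (intro M.smooth_fun_on_add M.smooth_fun_on_bilinear[OF bounded_bilinear_scaleR]
          M.smooth_fun_on_bilinear[OF bounded_bilinear_inner] M.smooth_fun_on_const)
    then obtain \<sigma> N where \<sigma>: "smooth_section A E \<sigma>" "open N" "q \<in> N" "N \<subseteq> fst c \<inter> fst T"
      "\<And>q'. q' \<in> N \<Longrightarrow> snd T (\<sigma> q') = ?\<psi> q'"
      using section_with_germ[OF T oc c(2), of ?\<psi>] unfolding q_def by metis
    have prs: "proj E (\<sigma> q) = q" using \<sigma>(1) by (simp add: smooth_section_def)
    have \<sigma>e: "\<sigma> q = e"
      by (rule triv_inj[OF T(1)]) (use \<sigma> prs T q_def in auto)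
    have D: "frechet_derivative ((\<lambda>q. snd T (\<sigma> q)) \<circ> chart_inv c) (at (snd c q)) v = w"
    proof -
      have "((\<lambda>y. snd T e + ((y + - snd c q) \<bullet> v) *\<^sub>R k) has_derivative (\<lambda>v'. (v' \<bullet> v) *\<^sub>R k)) (at (snd c q))"
        by (auto intro!: derivative_eq_intros)
      then have "(((\<lambda>q. snd T (\<sigma> q)) \<circ> chart_inv c) has_derivative (\<lambda>v'. (v' \<bullet> v) *\<^sub>R k)) (at (snd c q))"
        by (rule has_derivative_transform_within_open[OF _ M.open_chart_image[OF c(1) \<sigma>(2)]])
          (use c \<sigma> q_def in auto)
      from frechet_derivative_at[OF this, symmetric] show ?thesis using \<eta>(3) by (simp add: k_def)
    qed
    let ?X = "coord_vec A c q v"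
    have X: "?X \<in> vcarrier (tangent_space A q)" using M.coord_vec_in_tangent_space c q_def by blast
    have cq: "c \<in> A" "q \<in> fst c" "T \<in> trivs E" "q \<in> fst T" using c T q_def by auto
    have "pushforward A (total_atlas A E) \<sigma> q ?X = \<eta>"
    proof -
      have "pushforward A (total_atlas A E) \<sigma> q ?X ?C = \<eta> ?C"
        using pushforward_section(1)[OF cq \<sigma>(1) X] D that(2) cq by simp
      then show ?thesis
        using tot.coord_vec_component[OF _ C, of \<eta>] tot.coord_vec_component[OF _ C, of "pushforward A (total_atlas A E) \<sigma> q ?X"]
          pushforward_section(2)[OF cq \<sigma>(1) X] \<eta>(1) \<sigma>e by metis
    qed
    then have "\<kappa> e \<eta> = nabla q ?X \<sigma>" using \<kappa> \<sigma>(1) X \<sigma>e unfolding is_connection_map_def by metis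
    then show ?thesis using nabla_Gam[OF cq \<sigma>(1) X] D cq \<sigma>e by simp
  qed
  show "snd T (\<kappa> e \<xi>) = snd (\<xi> ?C) + Gam c T (snd c (proj E e)) (fst (\<xi> ?C)) (snd T e)"
  proof (cases "fst (\<xi> ?C) = 0")
    case False
    then show ?thesis using *[OF \<xi>, of "fst (\<xi> ?C)" "snd (\<xi> ?C)"] q_def by simp
  next
    case True
    \<comment> \<open>Adding a common horizontal part \<open>v0\<close> reduces the vertical case to
      the nonhorizontally degenerate one; \<open>v0\<close> exists because the base has positive
      dimension.\<close>
    obtain v0 :: 'e where v0: "v0 \<noteq> 0" using nonzero_Basis nonempty_Basis by blast
    define \<xi>1 \<xi>2 where "\<xi>1 = coord_vec (total_atlas A E) ?C e (v0, snd (\<xi> ?C))"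
      and "\<xi>2 = coord_vec (total_atlas A E) ?C e (v0, 0)"
    have t: "\<xi>1 \<in> vcarrier (tangent_space (total_atlas A E) e)" "\<xi>2 \<in> vcarrier (tangent_space (total_atlas A E) e)"
      unfolding \<xi>1_def \<xi>2_def by (rule tot.coord_vec_in_tangent_space[OF C])+
    have val: "\<xi>1 ?C = (v0, snd (\<xi> ?C))" "\<xi>2 ?C = (v0, 0)"
      unfolding \<xi>1_def \<xi>2_def by (rule tot.coord_vec_self[OF C])+
    have sum: "\<xi> ?C + (v0, 0) = (v0, snd (\<xi> ?C))" using True by (cases "\<xi> ?C") auto
    have "\<xi>1 = vplus (tangent_space (total_atlas A E) e) \<xi> \<xi>2"
      unfolding \<xi>1_def \<xi>2_def sum[symmetric] tot.coord_vec_add[OF C] tot.coord_vec_component[OF \<xi> C] ..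
    then have "\<kappa> e \<xi>1 = bplus E (\<kappa> e \<xi>) (\<kappa> e \<xi>2)" using lin t \<xi> by (simp add: linear_map_def)
    moreover have "proj E (\<kappa> e \<xi>2) = q" using lin t by (simp add: linear_map_def)
    ultimately have "snd T (\<kappa> e \<xi>1) = snd T (\<kappa> e \<xi>) + snd T (\<kappa> e \<xi>2)"
      using pr T q_def by simp
    then show ?thesis using *[OF t(1) val(1) v0] *[OF t(2) val(2) v0] True bil
      by (simp add: bilinear_lzero q_def)
  qed
qed

text \<open>The local formula is taken as a definition, with a chart and a trivialization chosen at
  each base point. The axioms concern one point at a time, so the choice may vary arbitrarily; that
  the value on pushforwards is right is \<open>nabla_Gam\<close>.\<close>

lemma connection_map_exists: "\<exists>\<kappa>. is_connection_map A E nabla \<kappa>"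
proof -
  define tr where "tr q = (SOME T. T \<in> trivs E \<and> q \<in> fst T)" for q
  have tr: "tr q \<in> trivs E" "q \<in> fst (tr q)" for q unfolding tr_def using someI_ex[OF ex_triv[of q]] by auto
  define ch where "ch = chart_at A"
  have ch: "ch q \<in> A" "q \<in> fst (ch q)" for q unfolding ch_def using M.chart_at by auto
  define \<kappa> where "\<kappa> e \<xi> = triv_inv E (tr (proj E e)) (proj E e,
    snd (\<xi> (tchart (ch (proj E e)) (tr (proj E e)))) + Gam (ch (proj E e)) (tr (proj E e)) (snd (ch (proj E e)) (proj E e))
      (fst (\<xi> (tchart (ch (proj E e)) (tr (proj E e))))) (snd (tr (proj E e)) e))" for e \<xi>
  have "is_connection_map A E nabla \<kappa>"
    unfolding is_connection_map_def
  proof (intro conjI allI ballI impI)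
    fix e
    define q where "q = proj E e"
    have bil: "bilinear (Gam (ch q) (tr q) (snd (ch q) q))"
      using smooth_Gam[OF ch(1) tr(1)] ch(2)[of q] tr(2)[of q] unfolding smooth_bilinear_def by blast
    show "linear_map (tangent_space (total_atlas A E) e) (fibre E (proj E e)) (\<kappa> e)"
      unfolding linear_map_def q_def[symmetric]
    proof (intro conjI ballI allI)
      fix \<xi> show "\<kappa> e \<xi> \<in> vcarrier (fibre E q)" using tr by (simp add: \<kappa>_def q_def)
    next
      fix \<xi> \<eta>
      show "\<kappa> e (vplus (tangent_space (total_atlas A E) e) \<xi> \<eta>) = vplus (fibre E q) (\<kappa> e \<xi>) (\<kappa> e \<eta>)"
        by (rule triv_inj[of "tr q"])
          (use tr bil in \<open>auto simp: \<kappa>_def q_def tangent_space_def bilinear_ladd\<close>)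
    next
      fix k \<xi>
      show "\<kappa> e (vscale (tangent_space (total_atlas A E) e) k \<xi>) = vscale (fibre E q) k (\<kappa> e \<xi>)"
        by (rule triv_inj[of "tr q"])
          (use tr bil in \<open>auto simp: \<kappa>_def q_def tangent_space_def bilinear_lmul scaleR_add_right\<close>)
    qed
  next
    fix \<sigma> q X assume X: "X \<in> vcarrier (tangent_space A q)" and \<sigma>: "smooth_section A E \<sigma>"
    have pr: "proj E (\<sigma> q) = q" using \<sigma> by (simp add: smooth_section_def)
    show "\<kappa> (\<sigma> q) (pushforward A (total_atlas A E) \<sigma> q X) = nabla q X \<sigma>"
      by (rule triv_inj[OF tr(1)[of q]])
        (use tr pr \<sigma> X pushforward_section(1)[OF ch tr \<sigma> X] nabla_Gam[OF ch tr \<sigma> X] in \<open>auto simp: \<kappa>_def\<close>)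
  qed
  then show ?thesis by blast
qed

lemma is_connection_map: "is_connection_map A E nabla (connection_map A E nabla)"
  unfolding connection_map_def by (rule someI_ex[OF connection_map_exists])

lemmas connection_map_local = is_connection_map_local[OF is_connection_map]

end

section \<open>Linear ordinary differential equations\<close>

text \<open>Picard's integral operator is a contraction with factor 1/2 for the supremum norm as
  long as \<open>K * (b - a) \<le> 1/2\<close>. Longer intervals are handled by gluing in
  \<open>parallel_exists\<close>.\<close>

lemma linear_ode_short:
  fixes B :: "real \<Rightarrow> 'f::euclidean_space \<Rightarrow> 'f"
  assumes ab: "a \<le> b" and lin: "\<And>t. t \<in> {a..b} \<Longrightarrow> linear (B t)"
    and cont: "\<And>z. continuous_on {a..b} z \<Longrightarrow> continuous_on {a..b} (\<lambda>t. B t (z t))"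
    and K: "K \<ge> 0" "\<And>t z. t \<in> {a..b} \<Longrightarrow> norm (B t z) \<le> K * norm z" and small: "K * (b - a) \<le> 1/2"
  obtains z where "z a = z0" "\<And>t. t \<in> {a..b} \<Longrightarrow> (z has_vector_derivative B t (z t)) (at t within {a..b})"
proof -
  define F where "F z t = z0 + integral {a..t} (\<lambda>s. B s (apply_bcontfun z s))" for z t
  have c: "continuous_on {a..b} (\<lambda>s. B s (apply_bcontfun z s))" for z
    by (intro cont continuous_on_apply_bcontfun continuous_on_id)
  have "continuous_on (cbox a b) (F z)" for z
    unfolding F_def using indefinite_integral_continuous_1[OF integrable_continuous_real[OF c]]
    by (auto intro!: continuous_intros)
  \<comment> \<open>The fixed point is sought among bounded continuous functions on the whole line,
    so \<open>F z\<close> is continued by its boundary values with \<open>clamp\<close>.\<close>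
  then have "\<exists>w. \<forall>t. apply_bcontfun w t = F z (clamp a b t)" for z
    using continuous_on_cbox_bcontfunE[of a b "F z"] by metis
  then obtain \<Phi> where \<Phi>: "\<And>z t. apply_bcontfun (\<Phi> z) t = F z (clamp a b t)" by metis
  have clamp: "clamp a b t \<in> {a..b}" for t using clamp_in_interval[of a b t] ab by simp
  have "dist (\<Phi> z) (\<Phi> w) \<le> 1/2 * dist z w" for z w
  proof (rule dist_bound)
    fix t
    define u where "u = clamp a b t"
    have u: "u \<in> {a..b}" using clamp by (simp add: u_def)
    have sub: "{a..u} \<subseteq> {a..b}" using u by auto
    have int: "(\<lambda>s. B s (apply_bcontfun z s)) integrable_on {a..u}" for z
      by (intro integrable_continuous_real continuous_on_subset[OF c sub])
    have "F z u - F w u = integral {a..u} (\<lambda>s. B s (apply_bcontfun z s) - B s (apply_bcontfun w s))"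
      unfolding F_def using integral_diff[OF int int] by simp
    moreover have "norm (integral {a..u} (\<lambda>s. B s (apply_bcontfun z s) - B s (apply_bcontfun w s)))
        \<le> (K * dist z w) * (u - a)"
    proof (rule integral_bound)
      show "continuous_on {a..u} (\<lambda>s. B s (apply_bcontfun z s) - B s (apply_bcontfun w s))"
        by (intro continuous_on_diff continuous_on_subset[OF c sub])
      fix s assume "s \<in> {a..u}"
      then have s: "s \<in> {a..b}" using sub by blast
      have "B s (apply_bcontfun z s) - B s (apply_bcontfun w s) = B s (apply_bcontfun z s - apply_bcontfun w s)"
        using linear_diff[OF lin[OF s]] by simp
      also have "norm \<dots> \<le> K * norm (apply_bcontfun z s - apply_bcontfun w s)" by (rule K(2)[OF s])
      also have "\<dots> \<le> K * dist z w"
        using dist_bounded[of z s w] K(1) by (intro mult_left_mono) (auto simp: dist_norm)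
      finally show "norm (B s (apply_bcontfun z s) - B s (apply_bcontfun w s)) \<le> K * dist z w" .
    qed (use u in auto)
    moreover have "(K * dist z w) * (u - a) \<le> (K * (b - a)) * dist z w"
      using u K(1) by (auto intro!: mult_left_mono mult_right_mono simp: mult.assoc mult.commute[of "dist z w"])
    moreover have "(K * (b - a)) * dist z w \<le> 1/2 * dist z w" by (intro mult_right_mono small) auto
    ultimately show "dist (apply_bcontfun (\<Phi> z) t) (apply_bcontfun (\<Phi> w) t) \<le> 1/2 * dist z w"
      by (simp add: \<Phi> dist_norm flip: u_def)
  qed
  then obtain z where z: "\<Phi> z = z" using banach_fix_type[of "1/2" \<Phi>] by auto
  have eq: "apply_bcontfun z t = F z t" if "t \<in> {a..b}" for t
    using \<Phi>[of z t] that unfolding z by simp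
  have "apply_bcontfun z a = z0" using eq[of a] ab by (simp add: F_def)
  moreover have "(apply_bcontfun z has_vector_derivative B t (apply_bcontfun z t)) (at t within {a..b})"
    if "t \<in> {a..b}" for t
  proof -
    have "(F z has_vector_derivative 0 + B t (apply_bcontfun z t)) (at t within {a..b})"
      unfolding F_def
      by (intro has_vector_derivative_add has_vector_derivative_const integral_has_vector_derivative c that)
    then show ?thesis using has_vector_derivative_transform[OF that, of "apply_bcontfun z" "F z"] eq by simp
  qed
  ultimately show ?thesis using that by blast
qed

text \<open>Bootstrapping: if \<open>z\<close> has order \<open>n\<close>, so has the right-hand
  side of the equation, and \<open>z\<close> has order \<open>n + 1\<close>.\<close>

lemma linear_ode_smooth:
  fixes B :: "real \<Rightarrow> 'f::euclidean_space \<Rightarrow> 'f"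
  assumes ab: "a < b"
    and B: "\<And>k z. Ck_interval k a b z \<Longrightarrow> Ck_interval k a b (\<lambda>t. B t (z t))"
    and z: "\<And>t. t \<in> {a..b} \<Longrightarrow> (z has_vector_derivative B t (z t)) (at t within {a..b})"
  shows "smooth_on_interval a b z"
  unfolding smooth_on_interval_iff[OF ab]
proof
  fix n show "Ck_interval n a b z"
  proof (induction n)
    case 0
    then show ?case using has_vector_derivative_continuous_on[OF z] by simp
  next
    case (Suc n)
    show ?case by (rule Ck_interval_SucI[OF z B[OF Suc]])
  qed
qed

lemma smooth_bilinear_Ck_interval:
  assumes "smooth_bilinear U H" "a < b" "Ck_interval k a b x" "Ck_interval k a b v"
    "Ck_interval k a b w" "x ` {a..b} \<subseteq> U"
  shows "Ck_interval k a b (\<lambda>t. H (x t) (v t) (w t))"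
proof -
  have sm: "Ck_interval k a b (\<lambda>t. H (x t) i j)" for i j
    using assms(1) unfolding smooth_bilinear_def smooth_on_def
    by (intro Ck_interval_compose[OF _ assms(3) _ assms(6), where F="\<lambda>y. H y i j"]) auto
  have "Ck_interval k a b (\<lambda>t. \<Sum>i\<in>Basis. \<Sum>j\<in>Basis. ((v t \<bullet> i) * (w t \<bullet> j)) *\<^sub>R H (x t) i j)"
    by (intro Ck_interval_sum sm Ck_interval_bilinear[OF bounded_bilinear_scaleR]
        Ck_interval_bilinear[OF bounded_bilinear_mult] Ck_interval_bilinear[OF bounded_bilinear_inner]
        Ck_interval_const assms)
  moreover have "H (x t) (v t) (w t) = (\<Sum>i\<in>Basis. \<Sum>j\<in>Basis. ((v t \<bullet> i) * (w t \<bullet> j)) *\<^sub>R H (x t) i j)"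
    if "t \<in> {a..b}" for t
    using smooth_bilinear_expand[OF assms(1)] assms(6) that by blast
  ultimately show ?thesis using Ck_interval_cong by (metis (no_types, lifting))
qed

text \<open>The line with its identity chart. Scalar coefficients along a curve become piecewise
  smooth curves in it, so the same gluing and bisection lemmas apply to them.\<close>

definition real_atlas :: "(real, real) chart set" where
  "real_atlas = {(UNIV, \<lambda>x. x)}"

lemma smooth_atlas_real: "smooth_atlas real_atlas"
proof -
  have inv: "chart_inv (UNIV, \<lambda>x::real. x) = (\<lambda>x. x)"
    unfolding chart_inv_def by (simp add: inv_into_def fun_eq_iff)
  show ?thesis unfolding smooth_atlas_def real_atlas_def
    by (auto simp: inv homeomorphism_def o_def intro!: smooth_on_bounded_linear bounded_linear_ident continuous_on_id)
qed

interpretation R: smooth_manifold real_atlas using smooth_atlas_real by unfold_locales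

lemma pw_smooth_real: "a \<le> b \<Longrightarrow> (a < b \<Longrightarrow> smooth_on_interval a b s) \<Longrightarrow> pw_smooth real_atlas a b s"
  by (rule R.pw_smooth_chart[where c="(UNIV, \<lambda>x. x)"]) (auto simp: real_atlas_def o_def)

section \<open>Covariant derivative and parallel transport\<close>

context metric_bundle
begin

abbreviation "EA \<equiv> total_atlas A E"

definition cov :: "(real \<Rightarrow> 'x) \<Rightarrow> real \<Rightarrow> 'x" where
  "cov V t = connection_map A E nabla (V t) (velocity EA V t)"

lemma tot_regular_local:
  assumes V: "tot.regular_at V t" and c: "c \<in> A" "proj E (V t) \<in> fst c" and T: "T \<in> trivs E" "proj E (V t) \<in> fst T"
  shows "((\<lambda>s. snd c (proj E (V s))) has_vector_derivative fst (velocity EA V t (tchart c T))) (at t)"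
    "((\<lambda>s. snd T (V s)) has_vector_derivative snd (velocity EA V t (tchart c T))) (at t)"
    "\<forall>\<^sub>F s in nhds t. proj E (V s) \<in> fst c \<inter> fst T"
proof -
  have D: "((snd (tchart c T) \<circ> V) has_vector_derivative velocity EA V t (tchart c T)) (at t)"
    using tot.regular_at_has_vector_derivative[OF V tchart_in[OF c(1) T(1)]] c T by simp
  from bounded_linear.has_vector_derivative[OF bounded_linear_fst D]
    bounded_linear.has_vector_derivative[OF bounded_linear_snd D]
  show "((\<lambda>s. snd c (proj E (V s))) has_vector_derivative fst (velocity EA V t (tchart c T))) (at t)"
    "((\<lambda>s. snd T (V s)) has_vector_derivative snd (velocity EA V t (tchart c T))) (at t)"
    by (simp_all add: o_def)
  obtain C where C: "C \<in> EA" "\<forall>\<^sub>F s in nhds t. V s \<in> fst C" "(snd C \<circ> V) differentiable (at t)"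
    using V unfolding tot.regular_at_def by blast
  have Ct: "V t \<in> fst C" using eventually_nhds_x_imp_x[OF C(2)] .
  have "continuous (at t) (snd C \<circ> V)" using C(3) differentiable_imp_continuous_within by blast
  then have lim: "filterlim (snd C \<circ> V) (nhds (snd C (V t))) (nhds t)"
    using tendsto_at_iff_tendsto_nhds[of "snd C \<circ> V" t] by (simp add: continuous_within)
  let ?W = "snd C ` (fst C \<inter> fst (tchart c T))"
  have "open ?W"
    using tot.open_chart_image[OF C(1) tot.chart_open[OF tchart_in[OF c(1) T(1)]]] .
  moreover have "snd C (V t) \<in> ?W" using Ct c T by auto
  ultimately have "\<forall>\<^sub>F s in nhds t. (snd C \<circ> V) s \<in> ?W"
    using topological_tendstoD[OF lim] by blast
  then show "\<forall>\<^sub>F s in nhds t. proj E (V s) \<in> fst c \<inter> fst T"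
    using C(2)
  proof eventually_elim
    case (elim s)
    then obtain e where e: "e \<in> fst C" "e \<in> fst (tchart c T)" "snd C (V s) = snd C e" by auto
    then have "V s = e" using tot.chart_inv_chart[OF C(1) elim(2)] tot.chart_inv_chart[OF C(1) e(1)] by metis
    then show ?case using e by simp
  qed
qed

lemma tot_regular_base:
  assumes "tot.regular_at V t"
  shows "M.regular_at (\<lambda>s. proj E (V s)) t"
    "c \<in> A \<Longrightarrow> proj E (V t) \<in> fst c \<Longrightarrow> T \<in> trivs E \<Longrightarrow> proj E (V t) \<in> fst T \<Longrightarrow>
      velocity A (\<lambda>s. proj E (V s)) t c = fst (velocity EA V t (tchart c T))"
proof -
  obtain c where c: "c \<in> A" "proj E (V t) \<in> fst c" using M.ex_chart by blast
  obtain T where T: "T \<in> trivs E" "proj E (V t) \<in> fst T" using ex_triv by blast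
  have "\<forall>\<^sub>F s in nhds t. proj E (V s) \<in> fst c"
    using tot_regular_local(3)[OF assms c T] by eventually_elim simp
  then show "M.regular_at (\<lambda>s. proj E (V s)) t"
    unfolding M.regular_at_def using c differentiableI_vector[OF tot_regular_local(1)[OF assms c T]]
    by (auto simp: o_def)
next
  assume *: "c \<in> A" "proj E (V t) \<in> fst c" "T \<in> trivs E" "proj E (V t) \<in> fst T"
  show "velocity A (\<lambda>s. proj E (V s)) t c = fst (velocity EA V t (tchart c T))"
    using vector_derivative_at[OF tot_regular_local(1)[OF assms *]] * by (simp add: velocity_def o_def)
qed

text \<open>The classical expression \<open>z' + \<Gamma>(x) x' z\<close>. The derivatives are left
  to the caller, who knows them from some other description of the curve.\<close>

lemma cov_local:
  assumes V: "tot.regular_at V t" and c: "c \<in> A" "proj E (V t) \<in> fst c" and T: "T \<in> trivs E" "proj E (V t) \<in> fst T"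
    and x: "((\<lambda>s. snd c (proj E (V s))) has_vector_derivative x') (at t)"
    and z: "((\<lambda>s. snd T (V s)) has_vector_derivative z') (at t)"
  shows "snd T (cov V t) = z' + Gam c T (snd c (proj E (V t))) x' (snd T (V t))"
  using connection_map_local(2)[OF c T tot.velocity_in_tangent_space[OF V]]
    vector_derivative_unique_at[OF x tot_regular_local(1)[OF V c T]]
    vector_derivative_unique_at[OF z tot_regular_local(2)[OF V c T]]
  by (simp add: cov_def)

lemma proj_cov: "tot.regular_at V t \<Longrightarrow> proj E (cov V t) = proj E (V t)"
proof -
  assume V: "tot.regular_at V t"
  obtain c where c: "c \<in> A" "proj E (V t) \<in> fst c" using M.ex_chart by blast
  obtain T where T: "T \<in> trivs E" "proj E (V t) \<in> fst T" using ex_triv by blast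
  show ?thesis using connection_map_local(1)[OF c T tot.velocity_in_tangent_space[OF V]] by (simp add: cov_def)
qed

text \<open>In coordinates the product rule leaves a term with the derivative of
  \<open>loc_h\<close> in the base point. By \<open>Gam_metric\<close> it supplies exactly the
  Christoffel terms that complete \<open>z'\<close> and \<open>w'\<close> to covariant
  derivatives.\<close>

lemma h_has_derivative:
  assumes V: "tot.regular_at V t" and W: "tot.regular_at W t"
    and pr: "\<forall>\<^sub>F s in nhds t. proj E (V s) = proj E (W s)"
  shows "((\<lambda>s. h (V s) (W s)) has_vector_derivative (h (cov V t) (W t) + h (V t) (cov W t))) (at t)"
proof -
  obtain c where c: "c \<in> A" "proj E (V t) \<in> fst c" using M.ex_chart by blast
  obtain T where T: "T \<in> trivs E" "proj E (V t) \<in> fst T" using ex_triv by blast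
  have prt: "proj E (W t) = proj E (V t)" using eventually_nhds_x_imp_x[OF pr] by simp
  let ?x = "\<lambda>s. snd c (proj E (V s))" and ?z = "\<lambda>s. snd T (V s)" and ?w = "\<lambda>s. snd T (W s)"
  obtain x' z' where x: "(?x has_vector_derivative x') (at t)" and z: "(?z has_vector_derivative z') (at t)"
    using tot_regular_local(1,2)[OF V c T] by blast
  obtain w' where w: "(?w has_vector_derivative w') (at t)"
    using tot_regular_local(2)[OF W, of c T] c T prt by auto
  have x2: "((\<lambda>s. snd c (proj E (W s))) has_vector_derivative x') (at t)"
    by (rule has_vector_derivative_cong_nhds[OF _ x]) (use pr in \<open>auto elim: eventually_mono\<close>)
  have cd: "?x t \<in> cdom c T" using c T by auto
  have K: "pos_bilinear (loc_h c T (?x t))" using pos_loc_h[OF c(1) T(1) c(2) T(2)] .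
  have "((\<lambda>s. loc_h c T (?x s) (?z s) (?w s)) has_vector_derivative
      (frechet_derivative (\<lambda>y. loc_h c T y (?z t) (?w t)) (at (?x t)) x' + loc_h c T (?x t) z' (?w t) + loc_h c T (?x t) (?z t) w')) (at t)"
    by (rule smooth_bilinear_has_vector_derivative[OF smooth_loc_h[OF c(1) T(1)] cd x z w])
  also have "frechet_derivative (\<lambda>y. loc_h c T y (?z t) (?w t)) (at (?x t)) x' =
    loc_h c T (?x t) (Gam c T (?x t) x' (?z t)) (?w t) + loc_h c T (?x t) (?z t) (Gam c T (?x t) x' (?w t))"
    by (rule Gam_metric[OF c T])
  also have "\<dots> + loc_h c T (?x t) z' (?w t) + loc_h c T (?x t) (?z t) w' =
    loc_h c T (?x t) (z' + Gam c T (?x t) x' (?z t)) (?w t) + loc_h c T (?x t) (?z t) (w' + Gam c T (?x t) x' (?w t))"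
    by (simp add: pos_bilinear_simps[OF K])
  also have "\<dots> = h (cov V t) (W t) + h (V t) (cov W t)"
  proof -
    have "snd T (cov V t) = z' + Gam c T (?x t) x' (?z t)" by (rule cov_local[OF V c T x z])
    moreover have "snd T (cov W t) = w' + Gam c T (?x t) x' (?w t)"
      using cov_local[OF W _ _ _ _ x2 w] c T prt by simp
    ultimately show ?thesis
      using h_local[OF c(1) T(1), of "cov V t" "W t"] h_local[OF c(1) T(1), of "V t" "cov W t"]
        proj_cov[OF V] proj_cov[OF W] c T prt by simp
  qed
  finally have D: "((\<lambda>s. loc_h c T (?x s) (?z s) (?w s)) has_vector_derivative (h (cov V t) (W t) + h (V t) (cov W t))) (at t)" .
  show ?thesis
  proof (rule has_vector_derivative_cong_nhds[OF _ D])
    show "\<forall>\<^sub>F s in nhds t. loc_h c T (?x s) (?z s) (?w s) = h (V s) (W s)"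
      using pr tot_regular_local(3)[OF V c T]
      by eventually_elim (use c T h_local in auto)
  qed
qed

lemma base_pw_smooth:
  assumes "pw_smooth EA a b V" "a \<le> b"
  shows "pw_smooth A a b (\<lambda>t. proj E (V t))"
  using assms
proof (induction rule: tot.pw_smooth_induct[where N="\<lambda>x. UNIV"])
  case (trans r s t)
  then show ?case using pw_smooth_combine by blast
next
  case (refl t)
  obtain c where "c \<in> A" "proj E (V t) \<in> fst c" using M.ex_chart by blast
  then show ?case by (intro M.pw_smooth_chart[of c]) auto
next
  case (piece u C s t)
  then obtain c T where C: "C = tchart c T" "c \<in> A" "T \<in> trivs E" by (auto simp: total_atlas_eq)
  have "smooth_on_interval s t (\<lambda>r. fst ((snd C \<circ> V) r))"
    by (rule smooth_on_interval_bounded_linear[OF bounded_linear_fst piece(8)])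
  then have "smooth_on_interval s t (snd c \<circ> (\<lambda>r. proj E (V r)))" using C by (simp add: o_def)
  then show ?case
    by (intro M.pw_smooth_chart[OF C(2)]) (use piece C in auto)
qed auto

text \<open>Continuity of \<open>h (V t) (W t)\<close> is checked locally, since \<open>h\<close> is only constrained on single fibres.\<close>

lemma h_continuous_on:
  fixes a b :: real
  assumes V: "continuous_on {a..b} V" and W: "continuous_on {a..b} W"
    and pr: "\<And>t. t \<in> {a..b} \<Longrightarrow> proj E (W t) = proj E (V t)"
  shows "continuous_on {a..b} (\<lambda>t. h (V t) (W t))"
proof (rule continuous_on_eq_continuous_within[THEN iffD2], rule ballI)
  fix t0 assume t0: "t0 \<in> {a..b}"
  obtain c where c: "c \<in> A" "proj E (V t0) \<in> fst c" using M.ex_chart by blast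
  obtain T where T: "T \<in> trivs E" "proj E (V t0) \<in> fst T" using ex_triv by blast
  define D where "D = proj E -` (fst c \<inter> fst T)"
  have D: "e \<in> D \<longleftrightarrow> proj E e \<in> fst c \<and> proj E e \<in> fst T" for e by (simp add: D_def)
  have o: "open D"
    unfolding D_def using open_vimage[OF open_chart_triv[OF c(1) T(1)] proj_continuous] .
  obtain U where U: "open U" "{a..b} \<inter> V -` D = {a..b} \<inter> U"
    using continuous_openin_preimage_gen[OF V o] unfolding openin_open by blast
  define S where "S = {a..b} \<inter> U"
  have Siff: "t \<in> S \<longleftrightarrow> t \<in> {a..b} \<and> V t \<in> D" for t using U(2) unfolding S_def by blast
  have S: "V t \<in> proj E -` (fst c \<inter> fst T)" "W t \<in> proj E -` (fst c \<inter> fst T)" "t \<in> {a..b}" if "t \<in> S" for t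
    using that pr[of t] unfolding Siff D by simp_all
  have "t0 \<in> S" using t0 c T unfolding Siff D by simp
  then have t0S: "t0 \<in> S" "t0 \<in> U" unfolding S_def by blast+
  have sub: "S \<subseteq> {a..b}" by (auto simp: S_def)
  have cz: "continuous_on S (\<lambda>t. snd T (Y t))" if "continuous_on {a..b} Y" "\<And>t. t \<in> S \<Longrightarrow> Y t \<in> proj E -` (fst c \<inter> fst T)" for Y
    by (rule continuous_on_compose2[OF triv_cont[OF T(1)] continuous_on_subset[OF that(1) sub]]) (use that(2) in auto)
  have "continuous_on S (\<lambda>t. proj E (V t))"
    by (rule continuous_on_compose2[OF proj_continuous continuous_on_subset[OF V sub]]) auto
  then have cx: "continuous_on S (\<lambda>t. snd c (proj E (V t)))"
    by (rule continuous_on_compose2[OF M.chart_cont[OF c(1)]]) (use S(1) in auto)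
  have "continuous_on S (\<lambda>t. loc_h c T (snd c (proj E (V t))) (snd T (V t)) (snd T (W t)))"
    by (rule smooth_bilinear_continuous_on[OF smooth_loc_h[OF c(1) T(1)] cx cz[OF V S(1)] cz[OF W S(2)]]) (use S(1) in auto)
  then have "continuous_on S (\<lambda>t. h (V t) (W t))"
    by (rule continuous_on_eq) (use S pr h_local[OF c(1) T(1)] in auto)
  then have "continuous (at t0 within S) (\<lambda>t. h (V t) (W t))" using t0S by (simp add: continuous_on_eq_continuous_within)
  moreover have "at t0 within S = at t0 within {a..b}"
    by (rule at_within_nhd[OF t0S(2) U(1)]) (auto simp: S_def)
  ultimately show "continuous (at t0 within {a..b}) (\<lambda>t. h (V t) (W t))" by simp
qed

lemma pw_smooth_imp_continuous_on: "pw_smooth B a b \<gamma> \<Longrightarrow> continuous_on {a..b} \<gamma>"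
  by (simp add: pw_smooth_def)

lemma h_FTC:
  assumes V: "pw_smooth EA a b V" and W: "pw_smooth EA a b W" and ab: "a \<le> b"
    and pr: "\<And>t. t \<in> {a..b} \<Longrightarrow> proj E (W t) = proj E (V t)"
  shows "((\<lambda>t. h (cov V t) (W t) + h (V t) (cov W t)) has_integral (h (V b) (W b) - h (V a) (W a))) {a..b}"
proof (rule fundamental_theorem_of_calculus_interior_strong[OF _ ab])
  show "finite ({t \<in> {a..b}. \<not> tot.regular_at V t} \<union> {t \<in> {a..b}. \<not> tot.regular_at W t})"
    using tot.finite_irregular[OF V ab] tot.finite_irregular[OF W ab] by simp
  show "continuous_on {a..b} (\<lambda>t. h (V t) (W t))"
    using h_continuous_on V W pr pw_smooth_imp_continuous_on by blast
  fix t assume t: "t \<in> {a<..<b} - ({t \<in> {a..b}. \<not> tot.regular_at V t} \<union> {t \<in> {a..b}. \<not> tot.regular_at W t})"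
  then have "\<forall>\<^sub>F s in nhds t. s \<in> {a<..<b}" using eventually_nhds_in_open[of "{a<..<b}" t] by auto
  then have "\<forall>\<^sub>F s in nhds t. proj E (V s) = proj E (W s)" by eventually_elim (use pr in auto)
  then show "((\<lambda>t. h (V t) (W t)) has_vector_derivative (h (cov V t) (W t) + h (V t) (cov W t))) (at t)"
    using t by (intro h_has_derivative) auto
qed

subsection \<open>Parallel fields\<close>

text \<open>\<open>parallel_along\<close> on an arbitrary interval. Finiteness of the set of all
  exceptional parameters replaces the existence of a finite set containing them, which makes
  restricting and gluing a matter of inclusions.\<close>

definition parallel :: "real \<Rightarrow> real \<Rightarrow> (real \<Rightarrow> 'm) \<Rightarrow> (real \<Rightarrow> 'x) \<Rightarrow> bool" where
  "parallel a b \<alpha> V \<longleftrightarrow> pw_smooth EA a b V \<and> (\<forall>t\<in>{a..b}. proj E (V t) = \<alpha> t) \<and>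
     finite {t \<in> {a..b}. cov V t \<noteq> bzero E (\<alpha> t)}"

lemma parallel_along_iff: "parallel_along A E nabla \<alpha> V \<longleftrightarrow> parallel 0 1 \<alpha> V"
proof -
  have "(\<exists>S. finite S \<and> (\<forall>t\<in>{0..1} - S. cov V t = bzero E (\<alpha> t))) \<longleftrightarrow>
    finite {t \<in> {0..1}. cov V t \<noteq> bzero E (\<alpha> t)}"
  proof
    assume "\<exists>S. finite S \<and> (\<forall>t\<in>{0..1} - S. cov V t = bzero E (\<alpha> t))"
    then obtain S where "finite S" "\<forall>t\<in>{0..1} - S. cov V t = bzero E (\<alpha> t)" by blast
    then show "finite {t \<in> {0..1}. cov V t \<noteq> bzero E (\<alpha> t)}"
      by (intro finite_subset[of "{t \<in> {0..1}. cov V t \<noteq> bzero E (\<alpha> t)}" S]) auto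
  next
    assume "finite {t \<in> {0..1}. cov V t \<noteq> bzero E (\<alpha> t)}"
    then show "\<exists>S. finite S \<and> (\<forall>t\<in>{0..1} - S. cov V t = bzero E (\<alpha> t))"
      by (intro exI[of _ "{t \<in> {0..1}. cov V t \<noteq> bzero E (\<alpha> t)}"]) auto
  qed
  then show ?thesis
    by (simp add: parallel_along_def parallel_def piecewise_smooth_path_iff cov_def)
qed

lemma h_bzero [simp]: "h (bzero E (proj E e)) e = 0" "h e (bzero E (proj E e)) = 0"
proof -
  obtain T where T: "T \<in> trivs E" "proj E e \<in> fst T" using ex_triv by blast
  note K = pos_lift_h[OF T]
  show "h (bzero E (proj E e)) e = 0" "h e (bzero E (proj E e)) = 0"
    using pos_bilinear_simps(7)[OF K, of "snd T e"] pos_bilinear_simps(8)[OF K, of "snd T e"] T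
    by (simp_all add: lift_0)
qed

text \<open>The integrand in \<open>h_FTC\<close> vanishes off a finite set. Mixed products are
  included because uniqueness and the lower bound for lengths pair two different fields.\<close>

lemma parallel_h_const:
  assumes V: "parallel a b \<alpha> V" and W: "parallel a b \<alpha> W" and t: "t \<in> {a..b}"
  shows "h (V t) (W t) = h (V a) (W a)"
proof -
  have "a \<le> t" and sub: "{a..t} \<subseteq> {a..b}" using t by auto
  have pr: "proj E (V s) = \<alpha> s" "proj E (W s) = \<alpha> s" if "s \<in> {a..t}" for s
    using V W that sub by (auto simp: parallel_def subset_iff)
  have sm: "pw_smooth EA a t V" "pw_smooth EA a t W"
    using V W t pw_smooth_subset[of EA a b _ a t] by (auto simp: parallel_def)
  let ?S = "{t \<in> {a..b}. cov V t \<noteq> bzero E (\<alpha> t)} \<union> {t \<in> {a..b}. cov W t \<noteq> bzero E (\<alpha> t)}"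
  have fin: "finite ?S" using V W by (simp add: parallel_def)
  have zero: "h (cov V s) (W s) + h (V s) (cov W s) = 0" if "s \<in> {a..t} - ?S" for s
  proof -
    have "cov V s = bzero E (proj E (W s))" "cov W s = bzero E (proj E (V s))" using that sub pr[of s] by auto
    then show ?thesis by simp
  qed
  have "((\<lambda>t. h (cov V t) (W t) + h (V t) (cov W t)) has_integral 0) {a..t}"
    by (rule has_integral_spike_finite[OF fin zero has_integral_0])
  moreover have "((\<lambda>t. h (cov V t) (W t) + h (V t) (cov W t)) has_integral (h (V t) (W t) - h (V a) (W a))) {a..t}"
    by (rule h_FTC[OF sm \<open>a \<le> t\<close>]) (use pr in auto)
  ultimately have "h (V t) (W t) - h (V a) (W a) = 0" using has_integral_unique by blast
  then show ?thesis by simp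
qed

text \<open>The squared norm of \<open>V t - W t\<close> expands into products of parallel fields,
  all constant; they equal the products at the start, where the fields agree, so they
  cancel.\<close>

lemma parallel_unique:
  assumes V: "parallel a b \<alpha> V" and W: "parallel a b \<alpha> W" and eq: "V a = W a" and t: "t \<in> {a..b}"
  shows "V t = W t"
proof -
  obtain T where T: "T \<in> trivs E" "proj E (V t) \<in> fst T" using ex_triv by blast
  have pr: "proj E (V t) = proj E (W t)" using V W t by (simp add: parallel_def)
  let ?K = "\<lambda>v w. h (triv_inv E T (proj E (V t), v)) (triv_inv E T (proj E (V t), w))"
  have K: "pos_bilinear ?K" by (rule pos_lift_h[OF T])
  have lift: "triv_inv E T (proj E (V t), snd T (V t)) = V t" "triv_inv E T (proj E (V t), snd T (W t)) = W t"
    using lift_triv[OF T] lift_triv[OF T(1), of "W t"] T pr by simp_all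
  have "?K (snd T (V t) - snd T (W t)) (snd T (V t) - snd T (W t)) =
    h (V t) (V t) - h (V t) (W t) - (h (W t) (V t) - h (W t) (W t))"
    unfolding pos_bilinear_simps(5,6)[OF K] unfolding lift by simp
  also have "\<dots> = 0"
    using parallel_h_const[OF V V t] parallel_h_const[OF V W t] parallel_h_const[OF W V t] parallel_h_const[OF W W t] eq
    by simp
  finally have "snd T (V t) = snd T (W t)" using pos_bilinear_eq_0[OF K] by simp
  then show ?thesis using triv_inj[OF T pr] by simp
qed

lemma cov_cong:
  assumes "\<forall>\<^sub>F s in nhds t. V s = V' s" "tot.regular_at V t"
  shows "cov V' t = cov V t"
  using tot.regular_at_cong[OF assms] eventually_nhds_x_imp_x[OF assms(1)] by (simp add: cov_def)

lemma parallel_cong: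
  assumes V: "parallel a b \<alpha> V" and ab: "a \<le> b"
    and V': "\<And>t. t \<in> {a..b} \<Longrightarrow> V t = V' t" and \<alpha>': "\<And>t. t \<in> {a..b} \<Longrightarrow> \<alpha> t = \<alpha>' t"
  shows "parallel a b \<alpha>' V'"
proof -
  have sm: "pw_smooth EA a b V" and pr: "\<forall>t\<in>{a..b}. proj E (V t) = \<alpha> t"
    and fin: "finite {t \<in> {a..b}. cov V t \<noteq> bzero E (\<alpha> t)}" using V by (auto simp: parallel_def)
  have "{t \<in> {a..b}. cov V' t \<noteq> bzero E (\<alpha>' t)} \<subseteq>
    {t \<in> {a..b}. cov V t \<noteq> bzero E (\<alpha> t)} \<union> {t \<in> {a..b}. \<not> tot.regular_at V t} \<union> {a, b}"
  proof
    fix t assume t: "t \<in> {t \<in> {a..b}. cov V' t \<noteq> bzero E (\<alpha>' t)}"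
    show "t \<in> {t \<in> {a..b}. cov V t \<noteq> bzero E (\<alpha> t)} \<union> {t \<in> {a..b}. \<not> tot.regular_at V t} \<union> {a, b}"
    proof (cases "t = a \<or> t = b \<or> \<not> tot.regular_at V t")
      case False
      then have "t \<in> {a<..<b}" using t by auto
      then have "\<forall>\<^sub>F s in nhds t. s \<in> {a<..<b}" using eventually_nhds_in_open[of "{a<..<b}" t] by auto
      then have "\<forall>\<^sub>F s in nhds t. V s = V' s" by eventually_elim (use V' in auto)
      then show ?thesis using cov_cong[of V V' t] False t \<alpha>' by auto
    qed (use t in auto)
  qed
  then have "finite {t \<in> {a..b}. cov V' t \<noteq> bzero E (\<alpha>' t)}"
    by (rule finite_subset) (use fin tot.finite_irregular[OF sm ab] in auto)
  moreover have "pw_smooth EA a b V'" by (rule pw_smooth_cong[OF V' sm])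
  ultimately show ?thesis using pr V' \<alpha>' by (simp add: parallel_def)
qed

lemma parallel_combine:
  assumes V: "parallel a b \<alpha> V" and W: "parallel b c \<alpha> V" and abc: "a \<le> b" "b \<le> c"
  shows "parallel a c \<alpha> V"
proof -
  have "{t \<in> {a..c}. cov V t \<noteq> bzero E (\<alpha> t)} \<subseteq>
    {t \<in> {a..b}. cov V t \<noteq> bzero E (\<alpha> t)} \<union> {t \<in> {b..c}. cov V t \<noteq> bzero E (\<alpha> t)}" by auto
  then have "finite {t \<in> {a..c}. cov V t \<noteq> bzero E (\<alpha> t)}"
    by (rule finite_subset) (use V W in \<open>simp add: parallel_def\<close>)
  moreover have "proj E (V t) = \<alpha> t" if "t \<in> {a..c}" for t
    using V W that by (cases "t \<le> b") (auto simp: parallel_def)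
  ultimately show ?thesis
    using pw_smooth_combine[of EA a b V c] V W abc by (simp add: parallel_def)
qed

lemma parallel_join:
  assumes V: "parallel a b \<alpha> V" and W: "parallel b c \<alpha> W" and eq: "V b = W b" and abc: "a \<le> b" "b \<le> c"
  shows "parallel a c \<alpha> (\<lambda>t. if t \<le> b then V t else W t)"
proof (rule parallel_combine[OF _ _ abc])
  show "parallel a b \<alpha> (\<lambda>t. if t \<le> b then V t else W t)" by (rule parallel_cong[OF V]) (use abc in auto)
  show "parallel b c \<alpha> (\<lambda>t. if t \<le> b then V t else W t)" by (rule parallel_cong[OF W]) (use abc eq in auto)
qed

text \<open>Solvability is additive in intervals, so it is checked on smooth pieces over one chart
  and one trivialization. There the condition is a linear equation with bounded coefficients, and a
  second bisection brings the intervals down to the length that \<open>linear_ode_short\<close> can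
  handle.\<close>

lemma parallel_exists:
  assumes \<alpha>: "pw_smooth A a b \<alpha>" and ab: "a \<le> b" and u: "proj E u = \<alpha> a"
  obtains V where "parallel a b \<alpha> V" "V a = u"
proof -
  define P where "P s t \<longleftrightarrow> (\<forall>u. proj E u = \<alpha> s \<longrightarrow> (\<exists>V. parallel s t \<alpha> V \<and> V s = u))" for s t
  define tr where "tr q = (SOME T. T \<in> trivs E \<and> q \<in> fst T)" for q
  have tr: "tr q \<in> trivs E" "q \<in> fst (tr q)" for q unfolding tr_def using someI_ex[OF ex_triv[of q]] by auto
  have Ptrans: "P r t" if rs: "P r s" and st: "P s t" and le: "r \<le> s" "s \<le> t" for r s t
    unfolding P_def
  proof (intro allI impI)
    fix u assume "proj E u = \<alpha> r"
    then obtain V where V: "parallel r s \<alpha> V" "V r = u" using rs unfolding P_def by blast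
    then have "proj E (V s) = \<alpha> s" using le by (auto simp: parallel_def)
    then obtain W where W: "parallel s t \<alpha> W" "W s = V s" using st unfolding P_def by blast
    show "\<exists>V. parallel r t \<alpha> V \<and> V r = u"
      using parallel_join[OF V(1) W(1) W(2)[symmetric] le] V(2) le
      by (intro exI[of _ "\<lambda>t. if t \<le> s then V t else W t"]) auto
  qed
  have Prefl: "P t t" for t
    unfolding P_def
  proof (intro allI impI)
    fix u assume u: "proj E u = \<alpha> t"
    obtain C where C: "C \<in> EA" "u \<in> fst C" using tot.ex_chart by blast
    have "pw_smooth EA t t (\<lambda>s. u)" by (rule tot.pw_smooth_chart[OF C(1)]) (use C in auto)
    then have "parallel t t \<alpha> (\<lambda>s. u)" using u by (auto simp: parallel_def intro: finite_subset[of _ "{t}"])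
    then show "\<exists>V. parallel t t \<alpha> V \<and> V t = u" by blast
  qed
  have "P a b" using \<alpha> ab
  proof (induction rule: M.pw_smooth_induct[where N="\<lambda>x. fst (tr x)"])
    case (trans r s t)
    then show ?case using Ptrans by blast
  next
    case (refl t)
    then show ?case using Prefl by blast
  next
    case (nhds t)
    then show ?case using tr triv_open by auto
  next
    case (piece u c s t)
    define T where "T = tr (\<alpha> u)"
    have T: "T \<in> trivs E" using tr by (simp add: T_def)
    have in_cT: "\<alpha> r \<in> fst c" "\<alpha> r \<in> fst T" if "r \<in> {s..t}" for r using piece that by (auto simp: T_def)
    define x where "x = snd c \<circ> \<alpha>"
    have x: "smooth_on_interval s t x" using piece by (simp add: x_def)
    obtain x' where x': "\<And>r. r \<in> {s..t} \<Longrightarrow> (x has_vector_derivative x' r) (at r within {s..t})"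
      and x's: "smooth_on_interval s t x'" using smooth_on_intervalE[OF x] by metis
    define B where "B r z = - Gam c T (x r) (x' r) z" for r z
    have xin: "x r \<in> cdom c T" if "r \<in> {s..t}" for r using in_cT that by (auto simp: x_def)
    note G = smooth_Gam[OF piece(3) T]
    have lin: "linear (B r)" if "r \<in> {s..t}" for r
    proof -
      have "bilinear (Gam c T (x r))" using G xin[OF that] unfolding smooth_bilinear_def by blast
      then show ?thesis unfolding B_def[abs_def] by (auto simp: bilinear_def intro!: linear_compose_neg)
    qed
    have cont: "continuous_on {s1..t1} (\<lambda>r. B r (z r))" if "{s1..t1} \<subseteq> {s..t}" "continuous_on {s1..t1} z" for s1 t1 z
      unfolding B_def
      by (intro continuous_on_minus smooth_bilinear_continuous_on[OF G]
          continuous_on_subset[OF smooth_on_interval_imp_continuous_on[OF x] that(1)]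
          continuous_on_subset[OF smooth_on_interval_imp_continuous_on[OF x's] that(1)] that(2))
        (use xin that(1) in auto)
    have "continuous_on {s..t} (\<lambda>r. \<Sum>b\<in>Basis. norm (B r b))"
      by (intro continuous_on_sum continuous_on_norm cont continuous_on_const) auto
    then have "bounded ((\<lambda>r. \<Sum>b\<in>Basis. norm (B r b)) ` {s..t})"
      by (intro compact_imp_bounded compact_continuous_image) auto
    then obtain K where K: "K > 0" "\<And>r. r \<in> {s..t} \<Longrightarrow> norm (\<Sum>b\<in>Basis. norm (B r b)) \<le> K"
      unfolding bounded_pos by auto
    have Kb: "norm (B r z) \<le> K * norm z" if "r \<in> {s..t}" for r z
    proof -
      have "norm (B r z) = norm (\<Sum>b\<in>Basis. (z \<bullet> b) *\<^sub>R B r b)"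
        by (rule arg_cong[OF linear_euclidean_expansion[OF lin[OF that]]])
      also have "\<dots> \<le> (\<Sum>b\<in>Basis. norm ((z \<bullet> b) *\<^sub>R B r b))" by (rule norm_sum)
      also have "\<dots> \<le> (\<Sum>b\<in>Basis. norm z * norm (B r b))"
        by (intro sum_mono) (auto intro!: mult_right_mono simp: Basis_le_norm)
      also have "\<dots> \<le> norm z * K"
        unfolding sum_distrib_left[symmetric] using K(2)[OF that] by (intro mult_left_mono) auto
      finally show ?thesis by (simp add: mult.commute)
    qed
    \<comment> \<open>With the bound \<open>K\<close> on the coefficients, length
      \<open>1 / (2 * K)\<close> is what makes the integral operator a contraction.\<close>
    have short: "P s1 t1" if st: "s \<le> s1" "s1 < t1" "t1 \<le> t" "t1 - s1 < 1 / (2 * K)" for s1 t1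
      unfolding P_def
    proof (intro allI impI)
      fix u0 assume u0: "proj E u0 = \<alpha> s1"
      have sub: "{s1..t1} \<subseteq> {s..t}" using st by auto
      have small: "K * (t1 - s1) \<le> 1/2" using st(4) K(1) by (simp add: field_simps)
      obtain z where z: "z s1 = snd T u0"
        "\<And>r. r \<in> {s1..t1} \<Longrightarrow> (z has_vector_derivative B r (z r)) (at r within {s1..t1})"
      proof (rule linear_ode_short[where a=s1 and b=t1 and B=B and K=K and ?z0.0="snd T u0"])
        show "\<And>z. continuous_on {s1..t1} z \<Longrightarrow> continuous_on {s1..t1} (\<lambda>t. B t (z t))" by (rule cont[OF sub])
      qed (use st sub lin Kb K small in auto)
      have sx: "smooth_on_interval s1 t1 x" "smooth_on_interval s1 t1 x'"
        using smooth_on_interval_subset[OF _ sub] x x's by auto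
      have zs: "smooth_on_interval s1 t1 z"
      proof (rule linear_ode_smooth[where B=B and z=z, OF st(2)])
        show "\<And>r. r \<in> {s1..t1} \<Longrightarrow> (z has_vector_derivative B r (z r)) (at r within {s1..t1})" by (rule z(2))
      next
        fix k and z :: "real \<Rightarrow> 'f" assume "Ck_interval k s1 t1 z"
        then have "Ck_interval k s1 t1 (\<lambda>t. Gam c T (x t) (x' t) (z t))"
          using sx smooth_on_interval_iff[OF st(2)] xin sub
          by (intro smooth_bilinear_Ck_interval[OF G st(2)]) auto
        from Ck_interval_bilinear[OF bounded_bilinear_scaleR Ck_interval_const[of k s1 t1 "-1"] this]
        show "Ck_interval k s1 t1 (\<lambda>t. B t (z t))" by (simp add: B_def)
      qed
      define V where "V r = triv_inv E T (\<alpha> r, z r)" for r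
      have Vin: "V ` {s1..t1} \<subseteq> fst (tchart c T)" using in_cT sub T by (auto simp: V_def subset_iff)
      have pr: "proj E (V r) = \<alpha> r" "snd T (V r) = z r" if "r \<in> {s1..t1}" for r
        using that in_cT sub T by (auto simp: V_def subset_iff)
      have "smooth_on_interval s1 t1 (\<lambda>r. (x r, z r))" by (rule smooth_on_interval_Pair[OF sx(1) zs])
      then have sV: "smooth_on_interval s1 t1 (snd (tchart c T) \<circ> V)"
        by (rule smooth_on_interval_cong[OF st(2), rotated]) (use pr in \<open>auto simp: x_def\<close>)
      have sm: "pw_smooth EA s1 t1 V"
        by (rule tot.pw_smooth_chart[OF tchart_in[OF piece(3) T] Vin sV]) (use st in auto)
      have "cov V r = bzero E (\<alpha> r)" if r: "r \<in> {s1<..<t1}" for r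
      proof -
        have rr: "r \<in> {s1..t1}" "r \<in> interior {s1..t1}" using r by auto
        have inn: "proj E (V r) \<in> fst c" "proj E (V r) \<in> fst T" using pr[OF rr(1)] in_cT sub rr by auto
        have ev: "\<forall>\<^sub>F s in nhds r. s \<in> {s1<..<t1}" using r eventually_nhds_in_open[of "{s1<..<t1}" r] by auto
        have zd: "(z has_vector_derivative B r (z r)) (at r)" using z(2)[OF rr(1)] unfolding at_within_interior[OF rr(2)] .
        have "(x has_vector_derivative x' r) (at r within {s1..t1})"
          by (rule has_vector_derivative_within_subset[OF x' sub]) (use rr sub in auto)
        then have xd: "(x has_vector_derivative x' r) (at r)" unfolding at_within_interior[OF rr(2)] .
        obtain v where "((snd (tchart c T) \<circ> V) has_vector_derivative v) (at r within {s1..t1})"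
          using smooth_on_intervalE[OF sV] rr(1) by metis
        then have reg: "tot.regular_at V r"
          by (rule tot.regular_at_chart(1)[OF tchart_in[OF piece(3) T] Vin r])
        have xd': "((\<lambda>s. snd c (proj E (V s))) has_vector_derivative x' r) (at r)"
          by (rule has_vector_derivative_cong_nhds[OF _ xd], use ev in eventually_elim) (use pr in \<open>auto simp: x_def\<close>)
        have zd': "((\<lambda>s. snd T (V s)) has_vector_derivative B r (z r)) (at r)"
          by (rule has_vector_derivative_cong_nhds[OF _ zd], use ev in eventually_elim) (use pr in auto)
        have "snd T (cov V r) = 0"
          using cov_local[OF reg piece(3) inn(1) T inn(2) xd' zd'] pr[OF rr(1)] by (simp add: B_def x_def)
        then show ?thesis
          using triv_inj[OF T, of "cov V r" "bzero E (\<alpha> r)"] proj_cov[OF reg] pr[OF rr(1)] inn T by simp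
      qed
      then have "{r \<in> {s1..t1}. cov V r \<noteq> bzero E (\<alpha> r)} \<subseteq> {s1, t1}" by force
      then have "finite {r \<in> {s1..t1}. cov V r \<noteq> bzero E (\<alpha> r)}" using finite_subset by blast
      then have "parallel s1 t1 \<alpha> V" using sm pr by (simp add: parallel_def)
      moreover have "V s1 = u0" using z(1) u0 T in_cT[of s1] st lift_triv[OF T, of u0] by (simp add: V_def)
      ultimately show "\<exists>V. parallel s1 t1 \<alpha> V \<and> V s1 = u0" by blast
    qed
    have "s \<le> t" using piece by simp
    then have "s \<le> s \<and> t \<le> t \<longrightarrow> P s t"
    proof (induction rule: Bolzano[where P="\<lambda>s1 t1. s \<le> s1 \<and> t1 \<le> t \<longrightarrow> P s1 t1"])
      case (trans r1 r2 r3)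
      then show ?case using Ptrans[of r1 r2 r3] by auto
    next
      case (local r)
      show ?case
      proof (intro exI[of _ "1 / (2 * K)"] conjI allI impI)
        fix s1 t1 assume *: "s1 \<le> r \<and> r \<le> t1 \<and> t1 - s1 < 1 / (2 * K)" "s \<le> s1 \<and> t1 \<le> t"
        show "P s1 t1"
        proof (cases "s1 = t1")
          case True then show ?thesis using Prefl by simp
        next
          case False then show ?thesis using short[of s1 t1] * by auto
        qed
      qed (use K in auto)
    qed
    then show ?case by simp
  qed
  then show ?thesis using that u unfolding P_def by blast
qed

lemma cov_affine:
  assumes "tot.regular_at V (k * t + m)"
  shows "cov (\<lambda>t. V (k * t + m)) t = bscale E k (cov V (k * t + m))"
proof -
  let ?e = "V (k * t + m)"
  have "linear_map (tangent_space EA ?e) (fibre E (proj E ?e)) (connection_map A E nabla ?e)"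
    using is_connection_map by (simp add: is_connection_map_def)
  then have "connection_map A E nabla ?e (vscale (tangent_space EA ?e) k (velocity EA V (k * t + m))) =
    bscale E k (connection_map A E nabla ?e (velocity EA V (k * t + m)))"
    using tot.velocity_in_tangent_space[OF assms] by (simp add: linear_map_def)
  then show ?thesis
    using conjunct2[OF tot.regular_at_affine[OF assms]] by (simp add: cov_def tangent_space_def)
qed

lemma parallel_affine:
  fixes k m :: real
  assumes V: "parallel a b \<alpha> V" and ab: "a \<le> b" and k: "k \<noteq> 0" and im: "(\<lambda>t. k * t + m) ` {c..d} \<subseteq> {a..b}"
  shows "parallel c d (\<lambda>t. \<alpha> (k * t + m)) (\<lambda>t. V (k * t + m))"
proof -
  have sm: "pw_smooth EA a b V" and pr: "\<forall>t\<in>{a..b}. proj E (V t) = \<alpha> t"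
    and fin: "finite {t \<in> {a..b}. cov V t \<noteq> bzero E (\<alpha> t)}" using V by (auto simp: parallel_def)
  define S where "S = {t \<in> {a..b}. cov V t \<noteq> bzero E (\<alpha> t)} \<union> {t \<in> {a..b}. \<not> tot.regular_at V t}"
  have S: "finite S" using fin tot.finite_irregular[OF sm ab] by (simp add: S_def)
  have "{t \<in> {c..d}. cov (\<lambda>t. V (k * t + m)) t \<noteq> bzero E (\<alpha> (k * t + m))} \<subseteq> (\<lambda>t. k * t + m) -` S"
  proof
    fix t assume t: "t \<in> {t \<in> {c..d}. cov (\<lambda>t. V (k * t + m)) t \<noteq> bzero E (\<alpha> (k * t + m))}"
    then have ti: "k * t + m \<in> {a..b}" using im by blast
    then show "t \<in> (\<lambda>t. k * t + m) -` S" using t cov_affine[of V k t m] by (auto simp: S_def)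
  qed
  moreover have "finite ((\<lambda>t. k * t + m) -` S)" by (rule finite_vimageI[OF S]) (use k in \<open>auto simp: inj_on_def\<close>)
  ultimately have "finite {t \<in> {c..d}. cov (\<lambda>t. V (k * t + m)) t \<noteq> bzero E (\<alpha> (k * t + m))}"
    using finite_subset by blast
  moreover have "\<forall>t\<in>{c..d}. proj E (V (k * t + m)) = \<alpha> (k * t + m)" using pr im by blast
  ultimately show ?thesis using pw_smooth_affine[OF sm k im] by (simp add: parallel_def)
qed

end

section \<open>Integral estimates\<close>

lemma norm_diff_le_integral:
  fixes f :: "real \<Rightarrow> 'a::banach" and k :: "real \<Rightarrow> real"
  assumes ab: "a \<le> b" and S: "finite S" and cont: "continuous_on {a..b} f"
    and der: "\<And>t. t \<in> {a<..<b} - S \<Longrightarrow> (f has_vector_derivative f' t) (at t)"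
    and le: "\<And>t. t \<in> {a<..<b} - S \<Longrightarrow> norm (f' t) \<le> k t" and k: "k integrable_on {a..b}"
  shows "norm (f b - f a) \<le> integral {a..b} k"
proof -
  \<comment> \<open>At exceptional parameters neither \<open>f'\<close> nor its bound is under
    control, so both are set to 0 there; the integrals do not notice.\<close>
  define F where "F t = (if t \<in> {a<..<b} - S then f' t else 0)" for t
  define K where "K t = (if t \<in> {a<..<b} - S then k t else 0)" for t
  have "(F has_integral (f b - f a)) {a..b}"
    by (rule fundamental_theorem_of_calculus_interior_strong[OF S ab _ cont]) (use der in \<open>auto simp: F_def\<close>)
  moreover have "(K has_integral integral {a..b} k) {a..b}"
  proof (rule has_integral_spike_finite[OF _ _ integrable_integral[OF k]])
    show "finite (insert a (insert b S))" using S by simp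
  qed (auto simp: K_def)
  moreover have "norm (F t) \<le> K t" for t using le by (simp add: F_def K_def)
  ultimately show ?thesis
    using integral_norm_bound_integral[of F "{a..b}" K] by (metis has_integral_integrable_integral)
qed

lemma integral_mono_finite:
  fixes f k :: "real \<Rightarrow> real"
  assumes "f integrable_on {a..b}" "k integrable_on {a..b}" "finite S" "\<And>t. t \<in> {a..b} - S \<Longrightarrow> f t \<le> k t"
  shows "integral {a..b} f \<le> integral {a..b} k"
proof -
  define F where "F t = (if t \<in> S then k t else f t)" for t
  have "(F has_integral integral {a..b} f) {a..b}"
    by (rule has_integral_spike_finite[OF assms(3) _ integrable_integral[OF assms(1)]]) (auto simp: F_def)
  then show ?thesis
    by (rule has_integral_le[OF _ integrable_integral[OF assms(2)]]) (use assms(4) in \<open>auto simp: F_def\<close>)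
qed

lemma integral_affine:
  fixes f :: "real \<Rightarrow> real"
  assumes k: "k \<noteq> 0" and im: "(\<lambda>t. k * t + m) ` {c..d} = {lo..hi}" and f: "f integrable_on {lo..hi}"
  shows "((\<lambda>t. \<bar>k\<bar> * f (k * t + m)) has_integral integral {lo..hi} f) {c..d}"
proof -
  have "(f has_integral integral {lo..hi} f) (cbox lo hi)" using f by (simp add: integrable_integral)
  from has_integral_affinity[OF this k, of m]
  have aff: "((\<lambda>t. f (k * t + m)) has_integral (1 / \<bar>k\<bar>) * integral {lo..hi} f) ((\<lambda>x. (1 / k) * x + - ((1 / k) * m)) ` {lo..hi})"
    by simp
  have cd: "(\<lambda>x. (1 / k) * x + - ((1 / k) * m)) ` {lo..hi} = {c..d}"
    unfolding im[symmetric] image_image using k by (simp add: field_simps)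
  have "((\<lambda>t. \<bar>k\<bar> * f (k * t + m)) has_integral \<bar>k\<bar> * ((1 / \<bar>k\<bar>) * integral {lo..hi} f)) {c..d}"
    by (rule has_integral_mult_right[OF aff[unfolded cd]])
  then show ?thesis using k by simp
qed

section \<open>Local bounds for smooth bilinear families\<close>

lemma bilinear_norm_bound:
  fixes B :: "'v::euclidean_space \<Rightarrow> 'w::euclidean_space \<Rightarrow> 'z::real_normed_vector"
  assumes "bilinear B"
  shows "norm (B v w) \<le> (\<Sum>i\<in>Basis. \<Sum>j\<in>Basis. norm (B i j)) * norm v * norm w"
proof -
  have lin: "linear (B v)" "linear (\<lambda>v. B v w)" for v w using assms by (auto simp: bilinear_def)
  have "B v w = (\<Sum>i\<in>Basis. \<Sum>j\<in>Basis. ((v \<bullet> i) * (w \<bullet> j)) *\<^sub>R B i j)"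
  proof -
    have "B v w = (\<Sum>i\<in>Basis. (v \<bullet> i) *\<^sub>R B i w)"
      using linear_euclidean_expansion[OF lin(2), of v w] .
    also have "\<dots> = (\<Sum>i\<in>Basis. \<Sum>j\<in>Basis. ((v \<bullet> i) * (w \<bullet> j)) *\<^sub>R B i j)"
      by (subst linear_euclidean_expansion[OF lin(1)]) (simp add: scaleR_sum_right)
    finally show ?thesis .
  qed
  also have "norm \<dots> \<le> (\<Sum>i\<in>Basis. \<Sum>j\<in>Basis. norm (((v \<bullet> i) * (w \<bullet> j)) *\<^sub>R B i j))"
    by (intro order_trans[OF norm_sum] sum_mono) (auto intro: norm_sum)
  also have "\<dots> \<le> (\<Sum>i\<in>Basis. \<Sum>j\<in>Basis. norm (B i j) * (norm v * norm w))"
  proof (intro sum_mono)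
    fix i :: 'v and j :: 'w assume "i \<in> Basis" "j \<in> Basis"
    then have "\<bar>v \<bullet> i\<bar> * \<bar>w \<bullet> j\<bar> \<le> norm v * norm w" by (intro mult_mono Basis_le_norm) auto
    then show "norm (((v \<bullet> i) * (w \<bullet> j)) *\<^sub>R B i j) \<le> norm (B i j) * (norm v * norm w)"
      by (simp add: abs_mult mult.commute mult_left_mono)
  qed
  also have "\<dots> = (\<Sum>i\<in>Basis. \<Sum>j\<in>Basis. norm (B i j)) * norm v * norm w"
    by (simp add: sum_distrib_right mult.assoc)
  finally show ?thesis .
qed

lemma has_derivative_locally_lipschitz:
  fixes f :: "'a::real_normed_vector \<Rightarrow> 'b::real_normed_vector"
  assumes "(f has_derivative f') (at y0)"
  obtains K where "K \<ge> 0" "\<forall>\<^sub>F y in nhds y0. norm (f y - f y0) \<le> K * norm (y - y0)"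
proof -
  obtain B where B: "B > 0" "\<And>v. norm (f' v) \<le> norm v * B"
    using bounded_linear.pos_bounded[OF has_derivative_bounded_linear[OF assms]] by blast
  obtain d where d: "d > 0" "\<And>y. norm (y - y0) < d \<Longrightarrow> norm (f y - f y0 - f' (y - y0)) \<le> 1 * norm (y - y0)"
    using assms unfolding has_derivative_at_alt by (metis zero_less_one)
  \<comment> \<open>\<open>B\<close> bounds the linear part and 1 the remainder on the ball of
    radius \<open>d\<close>.\<close>
  have "norm (f y - f y0) \<le> (B + 1) * norm (y - y0)" if "dist y y0 < d" for y
  proof -
    have "norm (f y - f y0) \<le> norm (f y - f y0 - f' (y - y0)) + norm (f' (y - y0))"
      using norm_triangle_ineq[of "f y - f y0 - f' (y - y0)" "f' (y - y0)"] by simp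
    also have "\<dots> \<le> 1 * norm (y - y0) + norm (y - y0) * B" using B(2) d(2)[of y] that by (intro add_mono) (auto simp: dist_norm)
    finally show ?thesis by (simp add: algebra_simps)
  qed
  then show ?thesis using that[of "B + 1"] B d by (auto simp: eventually_nhds_metric)
qed

text \<open>A bilinear map is bounded by its finitely many coefficients, and each coefficient, being
  differentiable at \<open>y0\<close>, varies at most linearly with the distance from
  \<open>y0\<close>.\<close>

lemma smooth_bilinear_lipschitz:
  assumes H: "smooth_bilinear U H" and y0: "y0 \<in> U"
  obtains K where "K \<ge> 0" "\<forall>\<^sub>F y in nhds y0. \<forall>v w. norm (H y v w - H y0 v w) \<le> K * norm (y - y0) * norm v * norm w"
proof -
  have ex: "\<exists>K. 0 \<le> K \<and> (\<forall>\<^sub>F y in nhds y0. norm (H y i j - H y0 i j) \<le> K * norm (y - y0))" for i j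
  proof -
    have "((\<lambda>y. H y i j) has_derivative frechet_derivative (\<lambda>y. H y i j) (at y0)) (at y0)"
      using H y0 smooth_on_imp_has_derivative unfolding smooth_bilinear_def by blast
    from has_derivative_locally_lipschitz[OF this] show ?thesis by blast
  qed
  have "\<exists>k. \<forall>i j. 0 \<le> k i j \<and> (\<forall>\<^sub>F y in nhds y0. norm (H y i j - H y0 i j) \<le> k i j * norm (y - y0))"
    by (rule choice, rule allI, rule choice, rule allI, rule ex)
  then obtain k where k: "\<And>i j. k i j \<ge> 0" "\<And>i j. \<forall>\<^sub>F y in nhds y0. norm (H y i j - H y0 i j) \<le> k i j * norm (y - y0)"
    by blast
  have "\<forall>\<^sub>F y in nhds y0. \<forall>i\<in>Basis. \<forall>j\<in>Basis. norm (H y i j - H y0 i j) \<le> k i j * norm (y - y0)"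
    by (intro eventually_ball_finite ballI k(2)) auto
  moreover have "\<forall>\<^sub>F y in nhds y0. y \<in> U" using H y0 by (auto simp: smooth_bilinear_def eventually_nhds_in_open)
  ultimately have "\<forall>\<^sub>F y in nhds y0. \<forall>v w. norm (H y v w - H y0 v w) \<le>
    (\<Sum>i\<in>Basis. \<Sum>j\<in>Basis. k i j) * norm (y - y0) * norm v * norm w"
  proof eventually_elim
    case (elim y)
    have b: "bilinear (\<lambda>v w. H y v w - H y0 v w)"
      using H y0 elim(2) unfolding smooth_bilinear_def bilinear_def by (auto intro!: linear_compose_sub)
    show ?case
    proof (intro allI)
      fix v w
      have "norm (H y v w - H y0 v w) \<le> (\<Sum>i\<in>Basis. \<Sum>j\<in>Basis. norm (H y i j - H y0 i j)) * norm v * norm w"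
        using bilinear_norm_bound[OF b] by simp
      also have "\<dots> \<le> (\<Sum>i\<in>Basis. \<Sum>j\<in>Basis. k i j * norm (y - y0)) * norm v * norm w"
        using elim(1) by (intro mult_right_mono sum_mono) auto
      finally show "norm (H y v w - H y0 v w) \<le> (\<Sum>i\<in>Basis. \<Sum>j\<in>Basis. k i j) * norm (y - y0) * norm v * norm w"
        by (simp add: sum_distrib_right)
    qed
  qed
  then show ?thesis by (rule that[rotated]) (auto intro!: sum_nonneg k(1))
qed

lemma smooth_bilinear_near:
  assumes H: "smooth_bilinear U H" and y0: "y0 \<in> U" and e: "e > 0"
  shows "\<forall>\<^sub>F y in nhds y0. \<forall>v w. norm (H y v w - H y0 v w) \<le> e * norm v * norm w"
proof -
  obtain K where K: "K \<ge> 0" "\<forall>\<^sub>F y in nhds y0. \<forall>v w. norm (H y v w - H y0 v w) \<le> K * norm (y - y0) * norm v * norm w"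
    using smooth_bilinear_lipschitz[OF H y0] by blast
  have "\<forall>\<^sub>F y in nhds y0. dist y y0 < e / (K + 1)"
    using e K(1) by (auto simp: eventually_nhds_metric intro!: exI[of _ "e / (K + 1)"])
  with K(2) show ?thesis
  proof eventually_elim
    case (elim y)
    have "K * norm (y - y0) \<le> (K + 1) * norm (y - y0)" by (simp add: mult_right_mono)
    also have "\<dots> \<le> e" using elim(2) K(1) by (simp add: dist_norm field_simps)
    finally have le: "K * norm (y - y0) \<le> e" .
    show ?case
    proof (intro allI)
      fix v w
      have "norm (H y v w - H y0 v w) \<le> K * norm (y - y0) * norm v * norm w" using elim(1) by blast
      also have "\<dots> \<le> e * norm v * norm w" by (intro mult_right_mono le) auto
      finally show "norm (H y v w - H y0 v w) \<le> e * norm v * norm w" .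
    qed
  qed
qed

lemma pos_bilinear_lower_bound:
  fixes K :: "'v::euclidean_space \<Rightarrow> 'v \<Rightarrow> real"
  assumes K: "pos_bilinear K"
  obtains \<mu> where "\<mu> > 0" "\<And>v. \<mu> * (norm v)\<^sup>2 \<le> K v v"
proof -
  have b: "bilinear K" using K by (simp add: pos_bilinear_def)
  have "continuous_on (sphere 0 1) (\<lambda>v. K v v)"
    by (rule bilinear_continuous_on_compose[OF continuous_on_id continuous_on_id b])
  moreover obtain b :: 'v where "b \<in> Basis" using nonempty_Basis by blast
  then have "sphere (0::'v) 1 \<noteq> {}" by (auto intro!: exI[of _ b])
  ultimately obtain v0 where v0: "v0 \<in> sphere 0 1" "\<And>v. v \<in> sphere 0 1 \<Longrightarrow> K v0 v0 \<le> K v v"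
    using continuous_attains_inf[of "sphere (0::'v) 1" "\<lambda>v. K v v"] by auto
  have "K v0 v0 * (norm v)\<^sup>2 \<le> K v v" for v
  proof (cases "v = 0")
    case False
    let ?u = "(1 / norm v) *\<^sub>R v"
    have "K v0 v0 \<le> K ?u ?u" using False by (intro v0(2)) simp
    also have "\<dots> = K v v / (norm v)\<^sup>2" by (simp add: pos_bilinear_simps[OF K] power2_eq_square)
    finally show ?thesis using False by (simp add: field_simps)
  qed (simp add: pos_bilinear_simps[OF K])
  moreover have "v0 \<noteq> 0" using v0(1) by auto
  then have "K v0 v0 > 0" using K by (simp add: pos_bilinear_def)
  ultimately show ?thesis using that by blast
qed

text \<open>At \<open>y0\<close> the form is at least \<open>\<mu>\<close> on the compact unit
  sphere. A perturbation of size at most \<open>\<mu> / 2\<close> leaves half of this lower bound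
  and adds at most \<open>\<mu>\<close> to the upper bound \<open>C\<close>; the square roots of
  these are the constants.\<close>

lemma smooth_bilinear_norm_equiv:
  fixes H :: "'y::euclidean_space \<Rightarrow> 'v::euclidean_space \<Rightarrow> 'v \<Rightarrow> real"
  assumes H: "smooth_bilinear U H" and y0: "y0 \<in> U" and pos: "pos_bilinear (H y0)"
  obtains m M where "m > 0" "M > 0"
    "\<forall>\<^sub>F y in nhds y0. \<forall>v. m * norm v \<le> sqrt (H y v v) \<and> sqrt (H y v v) \<le> M * norm v"
proof -
  obtain \<mu> where \<mu>: "\<mu> > 0" "\<And>v. \<mu> * (norm v)\<^sup>2 \<le> H y0 v v" using pos_bilinear_lower_bound[OF pos] by blast
  define C where "C = (\<Sum>i\<in>Basis. \<Sum>j\<in>Basis. norm (H y0 i j))"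
  have C: "C \<ge> 0" unfolding C_def by (intro sum_nonneg) auto
  have up: "H y0 v v \<le> C * (norm v)\<^sup>2" for v
    using bilinear_norm_bound[of "H y0" v v] pos unfolding C_def pos_bilinear_def
    by (simp add: power2_eq_square mult.assoc)
  have "\<forall>\<^sub>F y in nhds y0. \<forall>v w. norm (H y v w - H y0 v w) \<le> (\<mu> / 2) * norm v * norm w"
    using \<mu>(1) by (intro smooth_bilinear_near[OF H y0]) auto
  then have "\<forall>\<^sub>F y in nhds y0. \<forall>v. sqrt (\<mu> / 2) * norm v \<le> sqrt (H y v v) \<and> sqrt (H y v v) \<le> sqrt (C + \<mu>) * norm v"
  proof eventually_elim
    case (elim y)
    show ?case
    proof
      fix v
      have n: "\<bar>H y v v - H y0 v v\<bar> \<le> \<mu> / 2 * (norm v)\<^sup>2"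
        using elim[rule_format, of v v] by (simp add: power2_eq_square mult.assoc)
      then have n': "H y0 v v - H y v v \<le> \<mu> / 2 * (norm v)\<^sup>2" "H y v v - H y0 v v \<le> \<mu> / 2 * (norm v)\<^sup>2"
        unfolding abs_le_iff by linarith+
      have half: "\<mu> * (norm v)\<^sup>2 = \<mu> / 2 * (norm v)\<^sup>2 + \<mu> / 2 * (norm v)\<^sup>2" by (simp add: field_simps)
      have nn: "0 \<le> \<mu> / 2 * (norm v)\<^sup>2" using \<mu>(1) by simp
      have "\<mu> / 2 * (norm v)\<^sup>2 \<le> H y v v" using n'(1) \<mu>(2)[of v] half by linarith
      from real_sqrt_le_mono[OF this] have 1: "sqrt (\<mu> / 2) * norm v \<le> sqrt (H y v v)"
        unfolding real_sqrt_mult by simp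
      have "H y v v \<le> (C + \<mu>) * (norm v)\<^sup>2" using n'(2) up[of v] half nn unfolding distrib_right by linarith
      from real_sqrt_le_mono[OF this] have 2: "sqrt (H y v v) \<le> sqrt (C + \<mu>) * norm v"
        unfolding real_sqrt_mult by simp
      show "sqrt (\<mu> / 2) * norm v \<le> sqrt (H y v v) \<and> sqrt (H y v v) \<le> sqrt (C + \<mu>) * norm v"
        using 1 2 by blast
    qed
  qed
  moreover have "sqrt (\<mu> / 2) > 0" "sqrt (C + \<mu>) > 0" using \<mu>(1) C by auto
  ultimately show ?thesis using that by blast
qed

context metric_bundle
begin

section \<open>Combinations of fields along a curve\<close>

text \<open>The field \<open>V + s Z\<close> over a common base curve. With constant
  \<open>s\<close> it gives linearity of parallel translation; with \<open>s\<close> increasing from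
  0 to 1 it is the nearly optimal curve of \<open>length_upper_bound\<close>.\<close>

definition comb :: "(real \<Rightarrow> 'x) \<Rightarrow> (real \<Rightarrow> real) \<Rightarrow> (real \<Rightarrow> 'x) \<Rightarrow> real \<Rightarrow> 'x" where
  "comb V s Z t = bplus E (V t) (bscale E (s t) (Z t))"

lemma proj_comb: "proj E (V t) = proj E (Z t) \<Longrightarrow> proj E (comb V s Z t) = proj E (V t)"
  by (simp add: comb_def)

lemma triv_comb: "T \<in> trivs E \<Longrightarrow> proj E (Z t) \<in> fst T \<Longrightarrow> proj E (V t) = proj E (Z t) \<Longrightarrow>
    snd T (comb V s Z t) = snd T (V t) + s t *\<^sub>R snd T (Z t)"
  by (simp add: comb_def)

lemma pw_smooth_at_point: "pw_smooth EA t t V"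
proof -
  obtain C where C: "C \<in> EA" "V t \<in> fst C" using tot.ex_chart by blast
  show ?thesis by (rule tot.pw_smooth_chart[OF C(1)]) (use C in auto)
qed

text \<open>Three bisections are nested because \<open>V\<close>, \<open>Z\<close> and
  \<open>s\<close> have unrelated exceptional parameters. The first fixes a chart for
  \<open>V\<close>, which is also a chart for \<open>Z\<close> as both lie over the same curve; the
  second keeps the pieces of \<open>Z\<close> inside that chart.\<close>

lemma pw_smooth_comb:
  assumes V: "pw_smooth EA a b V" and Z: "pw_smooth EA a b Z" and s: "pw_smooth real_atlas a b s" and ab: "a \<le> b"
    and pr: "\<And>t. t \<in> {a..b} \<Longrightarrow> proj E (Z t) = proj E (V t)"
  shows "pw_smooth EA a b (comb V s Z)"
  using V ab
proof (induction rule: tot.pw_smooth_induct[where N="\<lambda>x. UNIV"])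
  case (piece u C a1 b1)
  then obtain c T where C: "C = tchart c T" "c \<in> A" "T \<in> trivs E" by (auto simp: total_atlas_eq)
  have VC: "V t \<in> fst C" if "t \<in> {a1..b1}" for t using piece(4) that by blast
  have oC: "open (fst C)" using tot.chart_open piece(3) .
  have ZC: "Z t \<in> fst C" if "t \<in> {a1..b1}" for t
    using VC[OF that] pr[of t] that piece C by auto
  have "pw_smooth EA a1 b1 Z" by (rule pw_smooth_subset[OF Z]) (use piece in auto)
  then show ?case using less_imp_le[OF piece(6)]
  proof (induction rule: tot.pw_smooth_induct[where N="\<lambda>x. fst C"])
    case (piece u' C' a2 b2)
    have "smooth_curve_on EA a2 b2 Z" by (rule tot.smooth_curve_on_chart[OF piece(3,4,8)])
    then have Zs: "smooth_on_interval a2 b2 (snd C \<circ> Z)"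
      using piece(2,6) \<open>C \<in> EA\<close> unfolding smooth_curve_on_def by auto
    have Vs: "smooth_on_interval a2 b2 (snd C \<circ> V)"
      by (rule smooth_on_interval_subset[OF \<open>smooth_on_interval a1 b1 (snd C \<circ> V)\<close>]) (use piece in auto)
    have "pw_smooth real_atlas a2 b2 s"
      by (rule pw_smooth_subset[OF s]) (use piece \<open>a \<le> a1\<close> \<open>b1 \<le> b\<close> in auto)
    then show ?case using less_imp_le[OF piece(6)]
    proof (induction rule: R.pw_smooth_induct[where N="\<lambda>x. UNIV"])
      case (piece u'' c' a3 b3)
      have ss: "smooth_on_interval a3 b3 s" using piece(3,8) by (simp add: real_atlas_def o_def)
      have sub: "{a3..b3} \<subseteq> {a2..b2}" "{a3..b3} \<subseteq> {a1..b1}" using piece \<open>a1 \<le> a2\<close> \<open>b2 \<le> b1\<close> by auto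
      have inC: "V t \<in> fst C" "Z t \<in> fst C" "proj E (Z t) = proj E (V t)" if "t \<in> {a3..b3}" for t
      proof -
        have t: "t \<in> {a1..b1}" using sub that by blast
        show "V t \<in> fst C" "Z t \<in> fst C" using VC[OF t] ZC[OF t] .
        show "proj E (Z t) = proj E (V t)" by (rule pr) (use t \<open>a \<le> a1\<close> \<open>b1 \<le> b\<close> in auto)
      qed
      have V3: "smooth_on_interval a3 b3 (snd C \<circ> V)" and Z3: "smooth_on_interval a3 b3 (snd C \<circ> Z)"
        using smooth_on_interval_subset[OF _ sub(1)] Vs Zs by auto
      have "smooth_on_interval a3 b3 (\<lambda>t. (fst ((snd C \<circ> V) t), snd ((snd C \<circ> V) t) + s t *\<^sub>R snd ((snd C \<circ> Z) t)))"
        by (intro smooth_on_interval_Pair smooth_on_interval_add smooth_on_interval_bilinear[OF piece(6) bounded_bilinear_scaleR] piece(6) ss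
            smooth_on_interval_bounded_linear[OF bounded_linear_fst V3] smooth_on_interval_bounded_linear[OF bounded_linear_snd V3]
            smooth_on_interval_bounded_linear[OF bounded_linear_snd Z3])
      then have "smooth_on_interval a3 b3 (snd C \<circ> comb V s Z)"
        by (rule smooth_on_interval_cong[OF piece(6), rotated])
          (use inC C in \<open>auto simp: proj_comb triv_comb\<close>)
      moreover have "comb V s Z ` {a3..b3} \<subseteq> fst C" using inC C by (auto simp: proj_comb)
      ultimately show ?case using tot.pw_smooth_chart[OF \<open>C \<in> EA\<close>] piece(6) by simp
    qed (auto intro: pw_smooth_combine pw_smooth_at_point)
  next
    case (nhds t)
    then show ?case using oC ZC by simp
  qed (auto intro: pw_smooth_combine pw_smooth_at_point)
qed (auto intro: pw_smooth_combine pw_smooth_at_point)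

lemma cov_comb:
  assumes V: "tot.regular_at V t" and Z: "tot.regular_at Z t" and C: "tot.regular_at (comb V s Z) t"
    and pr: "\<forall>\<^sub>F r in nhds t. proj E (Z r) = proj E (V r)" and s: "(s has_vector_derivative s') (at t)"
  shows "cov (comb V s Z) t = bplus E (bplus E (cov V t) (bscale E (s t) (cov Z t))) (bscale E s' (Z t))"
proof -
  obtain c where c: "c \<in> A" "proj E (V t) \<in> fst c" using M.ex_chart by blast
  obtain T where T: "T \<in> trivs E" "proj E (V t) \<in> fst T" using ex_triv by blast
  have prt: "proj E (Z t) = proj E (V t)" using eventually_nhds_x_imp_x[OF pr] .
  have prc: "proj E (comb V s Z t) = proj E (V t)" using prt by (simp add: proj_comb)
  let ?x = "\<lambda>r. snd c (proj E (V r))" and ?z = "\<lambda>r. snd T (V r)" and ?w = "\<lambda>r. snd T (Z r)"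
  obtain x' z' where x: "(?x has_vector_derivative x') (at t)" and z: "(?z has_vector_derivative z') (at t)"
    using tot_regular_local(1,2)[OF V c T] by blast
  obtain w' where w: "(?w has_vector_derivative w') (at t)"
    using tot_regular_local(2)[OF Z, of c T] c T prt by auto
  have xZ: "((\<lambda>r. snd c (proj E (Z r))) has_vector_derivative x') (at t)"
    by (rule has_vector_derivative_cong_nhds[OF _ x], use pr in eventually_elim) simp
  have xC: "((\<lambda>r. snd c (proj E (comb V s Z r))) has_vector_derivative x') (at t)"
    by (rule has_vector_derivative_cong_nhds[OF _ x], use pr in eventually_elim) (simp add: proj_comb)
  have zC: "((\<lambda>r. snd T (comb V s Z r)) has_vector_derivative (z' + (s t *\<^sub>R w' + s' *\<^sub>R ?w t))) (at t)"
  proof (rule has_vector_derivative_cong_nhds)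
    show "((\<lambda>r. ?z r + s r *\<^sub>R ?w r) has_vector_derivative (z' + (s t *\<^sub>R w' + s' *\<^sub>R ?w t))) (at t)"
      by (intro has_vector_derivative_add z bounded_bilinear.has_vector_derivative[OF bounded_bilinear_scaleR] s w)
    show "\<forall>\<^sub>F r in nhds t. ?z r + s r *\<^sub>R ?w r = snd T (comb V s Z r)"
      using pr tot_regular_local(3)[OF V c T] by eventually_elim (use T in \<open>auto simp: triv_comb\<close>)
  qed
  have "?x t \<in> cdom c T" using c T by auto
  then have bil: "bilinear (Gam c T (?x t))"
    using smooth_Gam[OF c(1) T(1)] unfolding smooth_bilinear_def by blast
  have 1: "snd T (cov V t) = z' + Gam c T (?x t) x' (?z t)" by (rule cov_local[OF V c T x z])
  have 2: "snd T (cov Z t) = w' + Gam c T (?x t) x' (?w t)"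
    using cov_local[OF Z _ _ _ _ xZ w] c T prt by simp
  have 3: "snd T (cov (comb V s Z) t) = z' + (s t *\<^sub>R w' + s' *\<^sub>R ?w t) + Gam c T (?x t) x' (?z t + s t *\<^sub>R ?w t)"
    using cov_local[OF C _ _ _ _ xC zC] c T prt prc by (simp add: triv_comb)
  show ?thesis
  proof (rule triv_inj[OF T(1)])
    show "proj E (cov (comb V s Z) t) \<in> fst T" using proj_cov[OF C] prc T by simp
    show "proj E (cov (comb V s Z) t) = proj E (bplus E (bplus E (cov V t) (bscale E (s t) (cov Z t))) (bscale E s' (Z t)))"
      using proj_cov[OF C] proj_cov[OF V] proj_cov[OF Z] prc prt by simp
    show "snd T (cov (comb V s Z) t) = snd T (bplus E (bplus E (cov V t) (bscale E (s t) (cov Z t))) (bscale E s' (Z t)))"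
      using 1 2 3 proj_cov[OF V] proj_cov[OF Z] prt T bil
      by (simp add: bilinear_radd bilinear_rmul scaleR_add_right)
  qed
qed

lemma parallel_comb:
  assumes V: "parallel a b \<alpha> V" and Z: "parallel a b \<alpha> Z" and ab: "a \<le> b"
  shows "parallel a b \<alpha> (comb V (\<lambda>t. k) Z)"
proof -
  have sm: "pw_smooth EA a b V" "pw_smooth EA a b Z" and prV: "\<And>t. t \<in> {a..b} \<Longrightarrow> proj E (V t) = \<alpha> t"
    and prZ: "\<And>t. t \<in> {a..b} \<Longrightarrow> proj E (Z t) = \<alpha> t"
    using V Z by (auto simp: parallel_def)
  have "pw_smooth real_atlas a b (\<lambda>t. k)" by (rule pw_smooth_real[OF ab smooth_on_interval_const])
  then have smC: "pw_smooth EA a b (comb V (\<lambda>t. k) Z)"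
    by (rule pw_smooth_comb[OF sm _ ab]) (simp add: prV prZ)
  let ?S = "{t \<in> {a..b}. cov V t \<noteq> bzero E (\<alpha> t)} \<union> {t \<in> {a..b}. cov Z t \<noteq> bzero E (\<alpha> t)} \<union>
    {t \<in> {a..b}. \<not> tot.regular_at V t} \<union> {t \<in> {a..b}. \<not> tot.regular_at Z t} \<union>
    {t \<in> {a..b}. \<not> tot.regular_at (comb V (\<lambda>t. k) Z) t} \<union> {a, b}"
  have "finite ?S" using V Z tot.finite_irregular[OF sm(1) ab] tot.finite_irregular[OF sm(2) ab] tot.finite_irregular[OF smC ab]
    by (simp add: parallel_def)
  moreover have "{t \<in> {a..b}. cov (comb V (\<lambda>t. k) Z) t \<noteq> bzero E (\<alpha> t)} \<subseteq> ?S"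
  proof (rule subsetI, rule ccontr)
    fix t assume t: "t \<in> {t \<in> {a..b}. cov (comb V (\<lambda>t. k) Z) t \<noteq> bzero E (\<alpha> t)}" "t \<notin> ?S"
    then have ti: "t \<in> {a<..<b}" by auto
    then have "\<forall>\<^sub>F r in nhds t. r \<in> {a<..<b}" using eventually_nhds_in_open[of "{a<..<b}" t] by auto
    then have pr: "\<forall>\<^sub>F r in nhds t. proj E (Z r) = proj E (V r)" by eventually_elim (use prV prZ in auto)
    have "cov (comb V (\<lambda>t. k) Z) t = bplus E (bplus E (cov V t) (bscale E k (cov Z t))) (bscale E 0 (Z t))"
      by (rule cov_comb[OF _ _ _ pr]) (use t in auto)
    also have "\<dots> = bplus E (bplus E (bzero E (\<alpha> t)) (bzero E (\<alpha> t))) (bzero E (\<alpha> t))"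
      using t prZ by (auto simp: bscale_0)
    also have "\<dots> = bzero E (\<alpha> t)"
    proof -
      interpret G: comm_group "\<lparr>carrier = proj E -` {\<alpha> t}, mult = bplus E, one = bzero E (\<alpha> t)\<rparr>" by (rule fibre_group)
      show ?thesis using G.l_one[of "bzero E (\<alpha> t)"] by simp
    qed
    finally show False using t by simp
  qed
  ultimately have "finite {t \<in> {a..b}. cov (comb V (\<lambda>t. k) Z) t \<noteq> bzero E (\<alpha> t)}" by (rule finite_subset[rotated])
  then show ?thesis using smC prV prZ by (simp add: parallel_def proj_comb)
qed

section \<open>Lengths\<close>

definition spd :: "(real \<Rightarrow> 'm) \<Rightarrow> real \<Rightarrow> real" where
  "spd \<alpha> t = sqrt (g (\<alpha> t) (velocity A \<alpha> t) (velocity A \<alpha> t))"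

lemma curve_length_spd: "curve_length A g \<alpha> = integral {0..1} (spd \<alpha>)"
  by (simp add: curve_length_def spd_def[abs_def])

lemma spd_local:
  assumes r: "M.regular_at \<alpha> t" and c: "c \<in> A" "\<alpha> t \<in> fst c"
  shows "spd \<alpha> t = sqrt (loc_g c (snd c (\<alpha> t)) (velocity A \<alpha> t c) (velocity A \<alpha> t c))"
  using g_local[OF c M.velocity_in_tangent_space[OF r] M.velocity_in_tangent_space[OF r]] by (simp add: spd_def)

lemma spd_nonneg: "M.regular_at \<alpha> t \<Longrightarrow> spd \<alpha> t \<ge> 0"
proof -
  assume r: "M.regular_at \<alpha> t"
  obtain c where c: "c \<in> A" "\<alpha> t \<in> fst c" using M.ex_chart by blast
  show ?thesis using spd_local[OF r c] pos_bilinear_ge_0[OF pos_loc_g[OF c]] by simp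
qed

text \<open>At the ends of a piece the two-sided velocity may be meaningless. The one-sided
  derivatives give a function that is continuous on the closed piece, hence integrable and
  accessible to polynomial approximation.\<close>

lemma spd_piece:
  assumes c: "c \<in> A" "\<alpha> ` {s..t} \<subseteq> fst c" and sm: "smooth_on_interval s t (snd c \<circ> \<alpha>)"
  obtains k where "continuous_on {s..t} k" "\<And>u. u \<in> {s..t} \<Longrightarrow> k u \<ge> 0" "\<And>u. u \<in> {s<..<t} \<Longrightarrow> spd \<alpha> u = k u"
proof -
  obtain x' where x': "\<And>u. u \<in> {s..t} \<Longrightarrow> ((snd c \<circ> \<alpha>) has_vector_derivative x' u) (at u within {s..t})"
    and x's: "smooth_on_interval s t x'" using smooth_on_intervalE[OF sm] by metis
  define k where "k u = sqrt (loc_g c ((snd c \<circ> \<alpha>) u) (x' u) (x' u))" for u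
  have "continuous_on {s..t} k" unfolding k_def
    by (intro continuous_on_real_sqrt smooth_bilinear_continuous_on[OF smooth_loc_g[OF c(1)]]
        smooth_on_interval_imp_continuous_on sm x's) (use c in auto)
  moreover have "k u \<ge> 0" if "u \<in> {s..t}" for u
    unfolding k_def using pos_bilinear_ge_0[OF pos_loc_g[OF c(1)]] c(2) that by (auto simp: image_subset_iff)
  moreover have "spd \<alpha> u = k u" if u: "u \<in> {s<..<t}" for u
  proof -
    have uu: "u \<in> {s..t}" "\<alpha> u \<in> fst c" using u c(2) by auto
    note r = M.regular_at_chart[OF c u x'[OF uu(1)]]
    show ?thesis using spd_local[OF r(1) c(1) uu(2)] r(2) by (simp add: k_def)
  qed
  ultimately show ?thesis using that by blast
qed

lemma spd_integrable:
  assumes "pw_smooth A a b \<alpha>" "a \<le> b" shows "spd \<alpha> integrable_on {a..b}"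
  using assms
proof (induction rule: M.pw_smooth_induct[where N="\<lambda>x. UNIV"])
  case (trans r s t)
  show ?case by (rule Henstock_Kurzweil_Integration.integrable_combine[OF trans(4,5,1,2)])
next
  case (refl t)
  then show ?case using integrable_on_refl[of "spd \<alpha>" t] by simp
next
  case (piece u c s t)
  obtain k where k: "continuous_on {s..t} k" "\<And>u. u \<in> {s<..<t} \<Longrightarrow> spd \<alpha> u = k u"
    using spd_piece[OF piece(3,4,8)] by metis
  show ?case
    by (rule integrable_spike_finite[of "{s, t}" _ _ k]) (use k integrable_continuous_real in auto)
qed auto

lemma length_nonneg:
  assumes "pw_smooth A a b \<alpha>" "a \<le> b" shows "integral {a..b} (spd \<alpha>) \<ge> 0"
  using integral_mono_finite[OF integrable_0 spd_integrable[OF assms] M.finite_irregular[OF assms]] spd_nonneg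
  by auto

lemma spd_affine:
  assumes "M.regular_at \<alpha> (k * t + m)"
  shows "spd (\<lambda>t. \<alpha> (k * t + m)) t = \<bar>k\<bar> * spd \<alpha> (k * t + m)"
proof -
  obtain c where c: "c \<in> A" "\<alpha> (k * t + m) \<in> fst c" using M.ex_chart by blast
  note r = M.regular_at_affine[OF assms]
  have K: "pos_bilinear (loc_g c (snd c (\<alpha> (k * t + m))))" by (rule pos_loc_g[OF c])
  show ?thesis
    using spd_local[OF assms c] spd_local[OF conjunct1[OF r] c(1)] c(2) r
    by (simp add: pos_bilinear_simps[OF K] real_sqrt_mult flip: mult.assoc power2_eq_square)
qed

lemma length_affine:
  assumes \<alpha>: "pw_smooth A lo hi \<alpha>" and le: "lo \<le> hi" and k: "k \<noteq> 0" and im: "(\<lambda>t. k * t + m) ` {c..d} = {lo..hi}"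
  shows "(spd (\<lambda>t. \<alpha> (k * t + m)) has_integral integral {lo..hi} (spd \<alpha>)) {c..d}"
proof (rule has_integral_spike_finite[OF _ _ integral_affine[OF k im spd_integrable[OF \<alpha> le]]])
  let ?S = "{t \<in> {lo..hi}. \<not> M.regular_at \<alpha> t}"
  show "finite ((\<lambda>t. k * t + m) -` ?S)"
    by (rule finite_vimageI[OF M.finite_irregular[OF \<alpha> le]]) (use k in \<open>auto simp: inj_on_def\<close>)
  fix t assume t: "t \<in> {c..d} - (\<lambda>t. k * t + m) -` ?S"
  then have "k * t + m \<in> {lo..hi}" using im by blast
  then show "spd (\<lambda>t. \<alpha> (k * t + m)) t = \<bar>k\<bar> * spd \<alpha> (k * t + m)" using t by (intro spd_affine) auto
qed

lemma spd_cong: "\<forall>\<^sub>F s in nhds t. \<alpha> s = \<beta> s \<Longrightarrow> M.regular_at \<alpha> t \<Longrightarrow> spd \<beta> t = spd \<alpha> t"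
  using M.regular_at_cong[of \<alpha> \<beta> t] eventually_nhds_x_imp_x[of "\<lambda>s. \<alpha> s = \<beta> s" t] by (simp add: spd_def)

lemma length_cong:
  assumes \<alpha>: "pw_smooth A a b \<alpha>" and le: "a \<le> b" and eq: "\<And>t. t \<in> {a..b} \<Longrightarrow> \<alpha> t = \<beta> t"
    and i: "(spd \<alpha> has_integral i) {a..b}"
  shows "(spd \<beta> has_integral i) {a..b}"
proof (rule has_integral_spike_finite[OF _ _ i])
  show "finite ({t \<in> {a..b}. \<not> M.regular_at \<alpha> t} \<union> {a, b})" using M.finite_irregular[OF \<alpha> le] by simp
  fix t assume t: "t \<in> {a..b} - ({t \<in> {a..b}. \<not> M.regular_at \<alpha> t} \<union> {a, b})"
  then have "t \<in> {a<..<b}" by auto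
  then have "\<forall>\<^sub>F s in nhds t. s \<in> {a<..<b}" using eventually_nhds_in_open[of "{a<..<b}" t] by auto
  then have "\<forall>\<^sub>F s in nhds t. \<alpha> s = \<beta> s" by eventually_elim (use eq in auto)
  then show "spd \<beta> t = spd \<alpha> t" using t by (intro spd_cong) auto
qed

end

context metric_bundle
begin

section \<open>Short curves and the quadratic holonomy estimate\<close>

lemma displacement_le_length:
  assumes c: "c \<in> A" and \<alpha>: "pw_smooth A a b \<alpha>" and ab: "a \<le> b" and im: "\<alpha> ` {a..b} \<subseteq> fst c"
    and m: "m > 0" "\<And>t v. t \<in> {a..b} \<Longrightarrow> m * norm v \<le> sqrt (loc_g c (snd c (\<alpha> t)) v v)"
  shows "norm (snd c (\<alpha> b) - snd c (\<alpha> a)) \<le> integral {a..b} (spd \<alpha>) / m"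
proof -
  let ?S = "{t \<in> {a..b}. \<not> M.regular_at \<alpha> t}"
  have "norm ((snd c \<circ> \<alpha>) b - (snd c \<circ> \<alpha>) a) \<le> integral {a..b} (\<lambda>t. spd \<alpha> t * (1 / m))"
  proof (rule norm_diff_le_integral[OF ab M.finite_irregular[OF \<alpha> ab]])
    show "continuous_on {a..b} (snd c \<circ> \<alpha>)"
      using continuous_on_compose[OF pw_smooth_imp_continuous_on[OF \<alpha>] continuous_on_subset[OF M.chart_cont[OF c] im]] .
    fix t assume t: "t \<in> {a<..<b} - ?S"
    then have r: "M.regular_at \<alpha> t" and ct: "\<alpha> t \<in> fst c" and ti: "t \<in> {a..b}" using im by auto
    show "((snd c \<circ> \<alpha>) has_vector_derivative velocity A \<alpha> t c) (at t)"
      by (rule M.regular_at_has_vector_derivative[OF r c ct])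
    show "norm (velocity A \<alpha> t c) \<le> spd \<alpha> t * (1 / m)"
      using m(2)[OF ti, of "velocity A \<alpha> t c"] m(1) spd_local[OF r c ct] by (simp add: field_simps)
  next
    show "(\<lambda>t. spd \<alpha> t * (1 / m)) integrable_on {a..b}"
      by (rule integrable_on_mult_left[OF spd_integrable[OF \<alpha> ab]])
  qed
  then show ?thesis by simp
qed

lemma length_mono:
  assumes \<alpha>: "pw_smooth A a b \<alpha>" and t: "t \<in> {a..b}"
  shows "integral {a..t} (spd \<alpha>) \<le> integral {a..b} (spd \<alpha>)"
proof -
  have "integral {a..t} (spd \<alpha>) + integral {t..b} (spd \<alpha>) = integral {a..b} (spd \<alpha>)"
    by (rule Henstock_Kurzweil_Integration.integral_combine) (use t spd_integrable[OF \<alpha>] in auto)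
  moreover have "integral {t..b} (spd \<alpha>) \<ge> 0"
    by (rule length_nonneg[OF pw_smooth_subset[OF \<alpha>]]) (use t in auto)
  ultimately show ?thesis by linarith
qed

text \<open>Consider the first parameter \<open>t1\<close> at which the curve leaves the open
  coordinate ball. Up to \<open>t1\<close> it lies in the closed ball, where the metric dominates
  \<open>m\<close> times the coordinate norm, so the displacement is less than \<open>r\<close> and
  the curve has not left after all.\<close>

lemma short_curve_confined:
  assumes c: "c \<in> A" "p \<in> fst c" and r: "r > 0" "cball (snd c p) r \<subseteq> snd c ` fst c"
    and m: "m > 0" "\<And>y v. y \<in> cball (snd c p) r \<Longrightarrow> m * norm v \<le> sqrt (loc_g c y v v)"
    and \<alpha>: "pw_smooth A 0 1 \<alpha>" "\<alpha> 0 = p" and short: "integral {0..1} (spd \<alpha>) < m * r"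
    and t: "t \<in> {0..1}"
  shows "\<alpha> t \<in> fst c \<and> snd c (\<alpha> t) \<in> ball (snd c p) r"
proof (rule ccontr)
  assume neg: "\<not> ?thesis"
  define Q where "Q = fst c \<inter> snd c -` ball (snd c p) r"
  define K where "K = chart_inv c ` cball (snd c p) r"
  have cont: "continuous_on {0..1} \<alpha>" by (rule pw_smooth_imp_continuous_on[OF \<alpha>(1)])
  have oQ: "open Q" unfolding Q_def
    by (intro continuous_open_preimage M.chart_cont M.chart_open c open_ball)
  \<comment> \<open>\<open>K\<close> is closed because it is compact in a Hausdorff space. This
    keeps the point at \<open>t1\<close>, a limit of points of \<open>Q\<close>, inside the chart
    domain: the curve cannot slip out of the chart without crossing the coordinate sphere.\<close>
  have "compact K" unfolding K_def
    by (intro compact_continuous_image continuous_on_subset[OF M.chart_inv_cont[OF c(1)] r(2)]) auto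
  then have K: "closed K" by (rule compact_imp_closed)
  have QK: "Q \<subseteq> K"
  proof
    fix q assume "q \<in> Q"
    then have "q = chart_inv c (snd c q)" "snd c q \<in> cball (snd c p) r" using c by (auto simp: Q_def)
    then show "q \<in> K" unfolding K_def by blast
  qed
  have Kc: "q \<in> fst c \<and> snd c q \<in> cball (snd c p) r" if "q \<in> K" for q
    using that r(2) c(1) by (auto simp: K_def)
  define B where "B = {0..1} \<inter> \<alpha> -` (- Q)"
  have "closed B" unfolding B_def by (rule continuous_closed_preimage[OF cont]) (use oQ in auto)
  moreover have "bounded B" by (rule bounded_subset[of "{0..1}"]) (auto simp: B_def)
  ultimately have cB: "compact B" by (simp add: compact_eq_bounded_closed)
  have "B \<noteq> {}" using neg t by (auto simp: B_def Q_def)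
  then obtain t1 where t1: "t1 \<in> B" "\<And>s. s \<in> B \<Longrightarrow> t1 \<le> s" using compact_attains_inf[OF cB] by blast
  have "\<alpha> 0 \<in> Q" using \<alpha>(2) c r by (simp add: Q_def)
  then have "0 \<noteq> t1" using t1(1) by (auto simp: B_def)
  then have t1': "0 < t1" "t1 \<le> 1" using t1(1) by (auto simp: B_def)
  have before: "\<alpha> s \<in> Q" if "s \<in> {0..<t1}" for s using t1(2)[of s] that t1' by (force simp: B_def)
  have "closed ({0..1} \<inter> \<alpha> -` K)" by (rule continuous_closed_preimage[OF cont]) (use K in auto)
  moreover have "\<alpha> s \<in> K" if "s \<in> {0..<t1}" for s using before[OF that] QK by blast
  then have "{0..<t1} \<subseteq> {0..1} \<inter> \<alpha> -` K" using t1' by auto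
  ultimately have "closure {0..<t1} \<subseteq> {0..1} \<inter> \<alpha> -` K" by (rule closure_minimal[rotated])
  then have inK: "\<alpha> s \<in> K" if "s \<in> {0..t1}" for s using that t1'(1) by (auto simp: closure_atLeastLessThan)
  have \<alpha>1: "pw_smooth A 0 t1 \<alpha>" by (rule pw_smooth_subset[OF \<alpha>(1)]) (use t1' in auto)
  have "norm (snd c (\<alpha> t1) - snd c (\<alpha> 0)) \<le> integral {0..t1} (spd \<alpha>) / m"
    by (rule displacement_le_length[OF c(1) \<alpha>1 _ _ m(1)]) (use inK Kc m(2) t1' in auto)
  also have "\<dots> \<le> integral {0..1} (spd \<alpha>) / m"
    using length_mono[OF \<alpha>(1), of t1] t1' m(1) by (intro divide_right_mono) auto
  also have "\<dots> < r" using short m(1) by (simp add: field_simps)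
  finally have "\<alpha> t1 \<in> Q"
    using Kc[OF inK[of t1]] t1' \<alpha>(2) by (simp add: Q_def dist_norm norm_minus_commute)
  then show False using t1(1) by (simp add: B_def)
qed

lemma fibre_norm_triv:
  assumes "c \<in> A" "T \<in> trivs E" "proj E e \<in> fst c" "proj E e \<in> fst T"
  shows "fibre_norm h e = sqrt (loc_h c T (snd c (proj E e)) (snd T e) (snd T e))"
  using h_local[OF assms(1,2,3,4) refl] by (simp add: fibre_norm_def)

lemma triv_vminus:
  "T \<in> trivs E \<Longrightarrow> proj E e \<in> fst T \<Longrightarrow> proj E e' = proj E e \<Longrightarrow>
    proj E (vminus (fibre E q) e e') = proj E e \<and> snd T (vminus (fibre E q) e e') = snd T e - snd T e'"
  by (simp add: vminus_def)

text \<open>In a chart around \<open>p\<close>, a parallel field solves \<open>z' = - \<Gamma>(x) x' z\<close>. Along a closed curve the first-order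
  term \<open>\<Gamma>(x(0)) x' z(0)\<close> integrates to 0, so that the holonomy deviates from the identity to second order only.\<close>

lemma holonomy_quadratic:
  fixes p :: 'm
  obtains \<epsilon> C where "\<epsilon> > 0" "C \<ge> 0"
    "\<And>\<alpha> V. pw_smooth A 0 1 \<alpha> \<Longrightarrow> \<alpha> 0 = p \<Longrightarrow> \<alpha> 1 = p \<Longrightarrow> integral {0..1} (spd \<alpha>) < \<epsilon> \<Longrightarrow> parallel 0 1 \<alpha> V \<Longrightarrow>
      fibre_norm h (vminus (fibre E p) (V 1) (V 0)) \<le> C * (integral {0..1} (spd \<alpha>))\<^sup>2 * fibre_norm h (V 0)"
proof -
  obtain c where c: "c \<in> A" "p \<in> fst c" using M.ex_chart by blast
  obtain T where T: "T \<in> trivs E" "p \<in> fst T" using ex_triv by blast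
  define y0 where "y0 = snd c p"
  have y0: "y0 \<in> cdom c T" "y0 \<in> snd c ` fst c" using c T by (auto simp: y0_def)
  note G = smooth_Gam[OF c(1) T(1)]
  have "pos_bilinear (loc_g c y0)" unfolding y0_def by (rule pos_loc_g[OF c])
  from smooth_bilinear_norm_equiv[OF smooth_loc_g[OF c(1)] y0(2) this]
  obtain m M where m: "m > 0"
    "\<forall>\<^sub>F y in nhds y0. \<forall>v. m * norm v \<le> sqrt (loc_g c y v v) \<and> sqrt (loc_g c y v v) \<le> M * norm v" by blast
  have "pos_bilinear (loc_h c T y0)" unfolding y0_def by (rule pos_loc_h[OF c(1) T(1) c(2) T(2)])
  from smooth_bilinear_norm_equiv[OF smooth_loc_h[OF c(1) T(1)] y0(1) this]
  obtain m' M' where m': "m' > 0" "M' > 0"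
    "\<forall>\<^sub>F y in nhds y0. \<forall>v. m' * norm v \<le> sqrt (loc_h c T y v v) \<and> sqrt (loc_h c T y v v) \<le> M' * norm v" by blast
  obtain K where K: "K \<ge> 0"
    "\<forall>\<^sub>F y in nhds y0. \<forall>v w. norm (Gam c T y v w - Gam c T y0 v w) \<le> K * norm (y - y0) * norm v * norm w"
    using smooth_bilinear_lipschitz[OF G y0(1)] by blast
  have bil0: "bilinear (Gam c T y0)" using G y0(1) unfolding smooth_bilinear_def by blast
  define K0 where "K0 = (\<Sum>i\<in>Basis. \<Sum>j\<in>Basis. norm (Gam c T y0 i j))"
  have K0: "K0 \<ge> 0" unfolding K0_def by (intro sum_nonneg) auto
  have G0: "norm (Gam c T y0 v w) \<le> K0 * norm v * norm w" for v w
    unfolding K0_def by (rule bilinear_norm_bound[OF bil0])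
  have "\<forall>\<^sub>F y in nhds y0. y \<in> cdom c T" using open_cdom[OF c(1) T(1)] y0(1) by (rule eventually_nhds_in_open)
  with m(2) m'(3) K(2)
  have "\<forall>\<^sub>F y in nhds y0. y \<in> cdom c T \<and> (\<forall>v. m * norm v \<le> sqrt (loc_g c y v v)) \<and>
    (\<forall>v. m' * norm v \<le> sqrt (loc_h c T y v v) \<and> sqrt (loc_h c T y v v) \<le> M' * norm v) \<and>
    (\<forall>v w. norm (Gam c T y v w - Gam c T y0 v w) \<le> K * norm (y - y0) * norm v * norm w)"
    by eventually_elim blast
  then obtain d where d: "d > 0" "\<And>y. dist y y0 < d \<Longrightarrow> y \<in> cdom c T \<and> (\<forall>v. m * norm v \<le> sqrt (loc_g c y v v)) \<and>
    (\<forall>v. m' * norm v \<le> sqrt (loc_h c T y v v) \<and> sqrt (loc_h c T y v v) \<le> M' * norm v) \<and>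
    (\<forall>v w. norm (Gam c T y v w - Gam c T y0 v w) \<le> K * norm (y - y0) * norm v * norm w)"
    unfolding eventually_nhds_metric by blast
  \<comment> \<open>Half of \<open>d\<close>, so that the local estimates hold on the closed ball
    needed for confinement.\<close>
  define r where "r = d / 2"
  have r: "r > 0" using d(1) by (simp add: r_def)
  have near: "y \<in> cdom c T" "\<And>v. m * norm v \<le> sqrt (loc_g c y v v)" "\<And>v. m' * norm v \<le> sqrt (loc_h c T y v v)"
    "\<And>v. sqrt (loc_h c T y v v) \<le> M' * norm v"
    "\<And>v w. norm (Gam c T y v w - Gam c T y0 v w) \<le> K * norm (y - y0) * norm v * norm w"
    if "y \<in> cball y0 r" for y
  proof -
    have "dist y y0 < d" using that d(1) by (simp add: r_def dist_commute)
    from d(2)[OF this] show "y \<in> cdom c T" "\<And>v. m * norm v \<le> sqrt (loc_g c y v v)" "\<And>v. m' * norm v \<le> sqrt (loc_h c T y v v)"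
      "\<And>v. sqrt (loc_h c T y v v) \<le> M' * norm v"
      "\<And>v w. norm (Gam c T y v w - Gam c T y0 v w) \<le> K * norm (y - y0) * norm v * norm w" by blast+
  qed
  define K1 where "K1 = K0 + K * r"
  have K1: "K1 \<ge> 0" using K0 K(1) r by (simp add: K1_def)
  have G1: "norm (Gam c T y v w) \<le> K1 * norm v * norm w" if "y \<in> cball y0 r" for y v w
  proof -
    have "norm (Gam c T y v w) \<le> norm (Gam c T y0 v w) + norm (Gam c T y v w - Gam c T y0 v w)"
      using norm_triangle_ineq[of "Gam c T y0 v w" "Gam c T y v w - Gam c T y0 v w"] by simp
    also have "\<dots> \<le> K0 * norm v * norm w + K * norm (y - y0) * norm v * norm w"
      by (intro add_mono G0 near(5)[OF that])
    also have "\<dots> \<le> K0 * norm v * norm w + K * r * norm v * norm w"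
      using that K(1) by (intro add_left_mono mult_right_mono mult_left_mono) (auto simp: dist_norm norm_minus_commute)
    finally show ?thesis by (simp add: K1_def algebra_simps)
  qed
  \<comment> \<open>The two errors of the second-order estimate: \<open>K\<close> comes from
    replacing \<open>\<Gamma>(x)\<close> by \<open>\<Gamma>(y0)\<close>, and \<open>K0 * K1\<close>
    from replacing \<open>z\<close> by \<open>z 0\<close>. In both, \<open>M' / m'\<close> bounds
    \<open>z\<close> by its initial value, and the two factors \<open>1 / m\<close> convert
    coordinate lengths into metric ones.\<close>
  define C1 where "C1 = (K + K0 * K1) * (M' / m') / m\<^sup>2"
  have C1: "C1 \<ge> 0" unfolding C1_def using K(1) K0 K1 m' by auto
  show ?thesis
  \<comment> \<open>Length below \<open>m * r\<close> confines the loop to the ball of radius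
    \<open>r\<close>. The factor \<open>M' / m'\<close> translates the coordinate norms of the final
    displacement and of the initial vector into fibre norms.\<close>
  proof (rule that[of "m * r" "M' * C1 / m'"])
    show "m * r > 0" using m(1) r by simp
    show "M' * C1 / m' \<ge> 0" using m' C1 by simp
    fix \<alpha> V
    assume \<alpha>: "pw_smooth A 0 1 \<alpha>" "\<alpha> 0 = p" "\<alpha> 1 = p" and short: "integral {0..1} (spd \<alpha>) < m * r"
      and V: "parallel 0 1 \<alpha> V"
    define l where "l = integral {0..1} (spd \<alpha>)"
    define x where "x t = snd c (\<alpha> t)" for t
    define z where "z t = snd T (V t)" for t
    have l0: "l \<ge> 0" unfolding l_def by (rule length_nonneg[OF \<alpha>(1)]) simp
    have conf: "\<alpha> t \<in> fst c \<and> x t \<in> ball y0 r" if "t \<in> {0..1}" for t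
      unfolding x_def y0_def
      by (rule short_curve_confined[OF c r _ m(1) _ \<alpha>(1,2) short that])
        (use near(1,2) in \<open>auto simp: y0_def[symmetric] subset_iff\<close>)
    have cb: "x t \<in> cball y0 r" if "t \<in> {0..1}" for t using conf[OF that] by auto
    have \<alpha>T: "\<alpha> t \<in> fst T" "\<alpha> t \<in> fst c" if t: "t \<in> {0..1}" for t
    proof -
      show 1: "\<alpha> t \<in> fst c" using conf[OF t] by blast
      obtain q where "q \<in> fst c" "q \<in> fst T" "snd c (\<alpha> t) = snd c q"
        using near(1)[OF cb[OF t]] by (auto simp: x_def)
      then show "\<alpha> t \<in> fst T" using M.chart_inv_chart[OF c(1)] 1 by metis
    qed
    have pr: "proj E (V t) = \<alpha> t" if "t \<in> {0..1}" for t using V that by (simp add: parallel_def)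
    have smV: "pw_smooth EA 0 1 V" using V by (simp add: parallel_def)
    have x0: "x 0 = y0" "x 1 = y0" using \<alpha> by (auto simp: x_def y0_def)
    have dx: "norm (x t - y0) \<le> l / m" if t: "t \<in> {0..1}" for t
    proof -
      have "norm (snd c (\<alpha> t) - snd c (\<alpha> 0)) \<le> integral {0..t} (spd \<alpha>) / m"
        by (rule displacement_le_length[OF c(1) pw_smooth_subset[OF \<alpha>(1)] _ _ m(1)])
          (use t \<alpha>T near(2)[OF cb] in \<open>auto simp: x_def\<close>)
      also have "\<dots> \<le> l / m" unfolding l_def using length_mono[OF \<alpha>(1) t] m(1) by (intro divide_right_mono) auto
      finally show ?thesis using \<alpha>(2) by (simp add: x_def y0_def)
    qed
    define N0 where "N0 = norm (z 0)"
    \<comment> \<open>The fibre norm of a parallel field is constant, so comparing norms at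
      \<open>t\<close> and at 0 bounds \<open>z\<close> without integrating its equation.\<close>
    have nz: "norm (z t) \<le> (M' / m') * N0" if t: "t \<in> {0..1}" for t
    proof -
      have "m' * norm (z t) \<le> sqrt (loc_h c T (x t) (z t) (z t))" by (rule near(3)[OF cb[OF t]])
      also have "\<dots> = sqrt (h (V t) (V t))"
        using h_local[OF c(1) T(1), of "V t" "V t"] pr[OF t] \<alpha>T[OF t] by (simp add: x_def z_def)
      also have "\<dots> = sqrt (h (V 0) (V 0))" using parallel_h_const[OF V V t] by simp
      also have "\<dots> = sqrt (loc_h c T (x 0) (z 0) (z 0))"
        using h_local[OF c(1) T(1), of "V 0" "V 0"] pr[of 0] \<alpha>T[of 0] by (simp add: x_def z_def)
      also have "\<dots> \<le> M' * N0" unfolding N0_def by (rule near(4)[OF cb]) simp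
      finally show ?thesis using m'(1) by (simp add: field_simps)
    qed
    define S where "S = {t \<in> {0..1}. cov V t \<noteq> bzero E (\<alpha> t)} \<union> {t \<in> {0..1}. \<not> tot.regular_at V t} \<union> {t \<in> {0..1}. \<not> M.regular_at \<alpha> t}"
    have S: "finite S" using V tot.finite_irregular[OF smV] M.finite_irregular[OF \<alpha>(1)] by (simp add: S_def parallel_def)
    define x' where "x' t = velocity A \<alpha> t c" for t
    have ders: "(x has_vector_derivative x' t) (at t)" "(z has_vector_derivative - Gam c T (x t) (x' t) (z t)) (at t)"
      "norm (x' t) \<le> spd \<alpha> t / m" if t: "t \<in> {0<..<1} - S" for t
    proof -
      have ti: "t \<in> {0..1}" and rV: "tot.regular_at V t" and r\<alpha>: "M.regular_at \<alpha> t" and cv: "cov V t = bzero E (\<alpha> t)"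
        using t by (auto simp: S_def)
      show xd: "(x has_vector_derivative x' t) (at t)"
        using M.regular_at_has_vector_derivative[OF r\<alpha> c(1)] \<alpha>T[OF ti] by (simp add: x_def[abs_def] x'_def o_def)
      have "\<forall>\<^sub>F s in nhds t. s \<in> {0<..<1}" using t eventually_nhds_in_open[of "{0<..<1}" t] by auto
      then have ev: "\<forall>\<^sub>F s in nhds t. x s = snd c (proj E (V s))" by eventually_elim (use pr in \<open>auto simp: x_def\<close>)
      have xV: "((\<lambda>s. snd c (proj E (V s))) has_vector_derivative x' t) (at t)"
        by (rule has_vector_derivative_cong_nhds[OF ev xd])
      have cT: "proj E (V t) \<in> fst c" "proj E (V t) \<in> fst T" using pr[OF ti] \<alpha>T[OF ti] by auto
      obtain z' where z': "(z has_vector_derivative z') (at t)"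
        using tot_regular_local(2)[OF rV c(1) cT(1) T(1) cT(2)] unfolding z_def[abs_def] by blast
      have "snd T (cov V t) = z' + Gam c T (x t) (x' t) (z t)"
        using cov_local[OF rV c(1) cT(1) T(1) cT(2) xV z'[unfolded z_def[abs_def]]] pr[OF ti] by (simp add: x_def z_def)
      then have "z' = - Gam c T (x t) (x' t) (z t)" using cv T(1) \<alpha>T[OF ti] by (simp add: eq_neg_iff_add_eq_0)
      then show "(z has_vector_derivative - Gam c T (x t) (x' t) (z t)) (at t)" using z' by simp
      show "norm (x' t) \<le> spd \<alpha> t / m"
        using near(2)[OF cb[OF ti], of "x' t"] spd_local[OF r\<alpha> c(1)] \<alpha>T[OF ti] m(1)
        by (simp add: x_def x'_def field_simps)
    qed
    have contz: "continuous_on {0..1} z" unfolding z_def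
      by (rule continuous_on_compose2[OF triv_cont[OF T(1)] pw_smooth_imp_continuous_on[OF smV]])
        (use pr \<alpha>T in auto)
    have contx: "continuous_on {0..1} x" unfolding x_def
      by (rule continuous_on_compose2[OF M.chart_cont[OF c(1)] pw_smooth_imp_continuous_on[OF \<alpha>(1)]])
        (use \<alpha>T in auto)
    have N0: "N0 \<ge> 0" by (simp add: N0_def)
    have MN: "(M' / m') * N0 \<ge> 0" using m' N0 by simp
    have spdS: "spd \<alpha> t \<ge> 0" if "t \<in> {0<..<1} - S" for t using spd_nonneg that by (auto simp: S_def)
    define b1 where "b1 = K1 * ((M' / m') * N0) / m"
    have b1: "b1 \<ge> 0"
      unfolding b1_def using m(1) by (intro divide_nonneg_nonneg mult_nonneg_nonneg[OF K1 MN]) simp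
    \<comment> \<open>A first-order bound for the deviation; inserted into the equation it makes the
      remainder below of second order.\<close>
    have dz: "norm (z t - z 0) \<le> b1 * l" if t: "t \<in> {0..1}" for t
    proof -
      have sub: "{0..t} \<subseteq> {0..1}" using t by auto
      have "norm (z t - z 0) \<le> integral {0..t} (\<lambda>s. b1 * spd \<alpha> s)"
      proof (rule norm_diff_le_integral[OF _ S continuous_on_subset[OF contz sub]])
        fix s assume s: "s \<in> {0<..<t} - S"
        then have s1: "s \<in> {0<..<1} - S" "s \<in> {0..1}" using t by auto
        show "(z has_vector_derivative - Gam c T (x s) (x' s) (z s)) (at s)" by (rule ders(2)[OF s1(1)])
        have "norm (Gam c T (x s) (x' s) (z s)) \<le> K1 * norm (x' s) * norm (z s)" by (rule G1[OF cb[OF s1(2)]])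
        also have "\<dots> \<le> K1 * (spd \<alpha> s / m) * ((M' / m') * N0)"
          using K1 ders(3)[OF s1(1)] nz[OF s1(2)] spdS[OF s1(1)] m(1) by (intro mult_mono mult_left_mono) auto
        also have "\<dots> = b1 * spd \<alpha> s" by (simp add: b1_def divide_inverse mult_ac)
        finally show "norm (- Gam c T (x s) (x' s) (z s)) \<le> b1 * spd \<alpha> s" by simp
      next
        show "(\<lambda>s. b1 * spd \<alpha> s) integrable_on {0..t}"
          using spd_integrable[OF pw_smooth_subset[OF \<alpha>(1)], of 0 t] t by (intro integrable_on_mult_right) auto
      qed (use t in auto)
      also have "\<dots> = b1 * integral {0..t} (spd \<alpha>)" by simp
      also have "\<dots> \<le> b1 * l" unfolding l_def using length_mono[OF \<alpha>(1) t] b1 by (intro mult_left_mono)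
      finally show ?thesis .
    qed
    \<comment> \<open>The added term vanishes at both ends because \<open>x 0 = x 1 = y0\<close>, so
      \<open>\<zeta>\<close> and \<open>z\<close> have the same increment. Its derivative cancels
      the first-order part of \<open>z'\<close>, leaving an integrand of size \<open>l\<close> times
      the speed.\<close>
    define \<zeta> where "\<zeta> t = z t + Gam c T y0 (x t - y0) (z 0)" for t
    define b2 where "b2 = C1 * l * N0"
    have linG: "bounded_linear (\<lambda>v. Gam c T y0 v (z 0))"
      using bil0 by (auto simp: bilinear_def linear_conv_bounded_linear)
    have "norm (\<zeta> 1 - \<zeta> 0) \<le> integral {0..1} (\<lambda>s. b2 * spd \<alpha> s)"
    proof (rule norm_diff_le_integral[OF _ S])
      show "continuous_on {0..1} \<zeta>" unfolding \<zeta>_def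
        by (intro continuous_on_add contz bounded_linear.continuous_on[OF linG] continuous_on_diff contx continuous_on_const)
      fix s assume s: "s \<in> {0<..<1} - S"
      then have si: "s \<in> {0..1}" by auto
      show "(\<zeta> has_vector_derivative (- Gam c T (x s) (x' s) (z s) + Gam c T y0 (x' s - 0) (z 0))) (at s)"
        unfolding \<zeta>_def
        by (intro has_vector_derivative_add ders(2)[OF s] bounded_linear.has_vector_derivative[OF linG]
            has_vector_derivative_diff ders(1)[OF s] has_vector_derivative_const)
      have eq: "- Gam c T (x s) (x' s) (z s) + Gam c T y0 (x' s - 0) (z 0) =
        - (Gam c T (x s) (x' s) (z s) - Gam c T y0 (x' s) (z s)) - Gam c T y0 (x' s) (z s - z 0)"
        by (simp add: bilinear_rsub[OF bil0])
      have "norm (- Gam c T (x s) (x' s) (z s) + Gam c T y0 (x' s - 0) (z 0)) \<le>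
        norm (Gam c T (x s) (x' s) (z s) - Gam c T y0 (x' s) (z s)) + norm (Gam c T y0 (x' s) (z s - z 0))"
        unfolding eq using norm_triangle_ineq4[of "- (Gam c T (x s) (x' s) (z s) - Gam c T y0 (x' s) (z s))"] by (metis norm_minus_cancel)
      also have "\<dots> \<le> K * norm (x s - y0) * norm (x' s) * norm (z s) + K0 * norm (x' s) * norm (z s - z 0)"
        by (intro add_mono near(5)[OF cb[OF si]] G0)
      also have "\<dots> \<le> K * (l / m) * (spd \<alpha> s / m) * ((M' / m') * N0) + K0 * (spd \<alpha> s / m) * (b1 * l)"
        using K(1) K0 l0 m(1) dx[OF si] ders(3)[OF s] nz[OF si] dz[OF si] spdS[OF s] MN b1
        by (intro add_mono mult_mono mult_nonneg_nonneg divide_nonneg_nonneg order_refl norm_ge_zero) auto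
      also have "\<dots> = b2 * spd \<alpha> s"
        by (simp add: b2_def C1_def b1_def power2_eq_square divide_inverse algebra_simps)
      finally show "norm (- Gam c T (x s) (x' s) (z s) + Gam c T y0 (x' s - 0) (z 0)) \<le> b2 * spd \<alpha> s" .
    next
      show "(\<lambda>s. b2 * spd \<alpha> s) integrable_on {0..1}"
        using spd_integrable[OF \<alpha>(1)] by (intro integrable_on_mult_right) auto
    qed auto
    also have "\<dots> = b2 * l" by (simp add: l_def)
    finally have "norm (\<zeta> 1 - \<zeta> 0) \<le> C1 * l\<^sup>2 * N0" by (simp add: b2_def power2_eq_square mult_ac)
    then have nz1: "norm (z 1 - z 0) \<le> C1 * l\<^sup>2 * N0" using x0 by (simp add: \<zeta>_def)
    have pV: "proj E (V 0) = p" "proj E (V 1) = p" using pr[of 0] pr[of 1] \<alpha> by auto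
    have y0c: "y0 \<in> cball y0 r" using r by simp
    have vm: "proj E (vminus (fibre E p) (V 1) (V 0)) = p" "snd T (vminus (fibre E p) (V 1) (V 0)) = z 1 - z 0"
      using triv_vminus[OF T(1), of "V 1" "V 0" p] pV T by (auto simp: z_def)
    have "fibre_norm h (vminus (fibre E p) (V 1) (V 0)) = sqrt (loc_h c T y0 (z 1 - z 0) (z 1 - z 0))"
      using fibre_norm_triv[OF c(1) T(1), of "vminus (fibre E p) (V 1) (V 0)"] vm c T by (simp add: y0_def)
    also have "\<dots> \<le> M' * norm (z 1 - z 0)" by (rule near(4)[OF y0c])
    also have "\<dots> \<le> M' * (C1 * l\<^sup>2 * N0)" using m' nz1 by (intro mult_left_mono) auto
    also have "\<dots> = (M' * C1 / m') * l\<^sup>2 * (m' * N0)" using m' by simp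
    also have "\<dots> \<le> (M' * C1 / m') * l\<^sup>2 * sqrt (loc_h c T y0 (z 0) (z 0))"
      unfolding N0_def using m' C1 by (intro mult_left_mono near(3)[OF y0c]) auto
    also have "sqrt (loc_h c T y0 (z 0) (z 0)) = fibre_norm h (V 0)"
      using fibre_norm_triv[OF c(1) T(1), of "V 0"] pV c T by (simp add: y0_def z_def)
    finally show "fibre_norm h (vminus (fibre E p) (V 1) (V 0)) \<le> M' * C1 / m' * (integral {0..1} (spd \<alpha>))\<^sup>2 * fibre_norm h (V 0)"
      by (simp add: l_def)
  qed
qed

section \<open>Parallel translation along loops\<close>

abbreviation "ptrans \<equiv> parallel_translation A E nabla"

lemma ptrans_eq:
  assumes "parallel 0 1 \<alpha> V" shows "ptrans \<alpha> (V 0) = V 1"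
proof -
  have "proj E (V 0) = \<alpha> 0" using assms by (simp add: parallel_def)
  moreover have "(THE w. \<exists>V'. parallel_along A E nabla \<alpha> V' \<and> V' 0 = V 0 \<and> V' 1 = w) = V 1"
  proof (rule the_equality)
    show "\<exists>V'. parallel_along A E nabla \<alpha> V' \<and> V' 0 = V 0 \<and> V' 1 = V 1"
      using assms by (auto simp: parallel_along_iff)
    fix w assume "\<exists>V'. parallel_along A E nabla \<alpha> V' \<and> V' 0 = V 0 \<and> V' 1 = w"
    then obtain V' where "parallel 0 1 \<alpha> V'" "V' 0 = V 0" "V' 1 = w" by (auto simp: parallel_along_iff)
    then show "w = V 1" using parallel_unique[OF _ assms, of V' 1] by simp
  qed
  ultimately show ?thesis by (simp add: parallel_translation_def)
qed

lemma ptrans_obtain: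
  assumes "pw_smooth A 0 1 \<alpha>" "proj E u = \<alpha> 0"
  obtains V where "parallel 0 1 \<alpha> V" "V 0 = u" "ptrans \<alpha> u = V 1" "proj E (V 1) = \<alpha> 1"
proof -
  obtain V where V: "parallel 0 1 \<alpha> V" "V 0 = u" using parallel_exists[OF assms(1) _ assms(2)] by auto
  then show ?thesis using that[OF V] ptrans_eq[OF V(1)] by (simp add: parallel_def)
qed

lemma ptrans_extensional: "\<alpha> 0 = p \<Longrightarrow> ptrans \<alpha> \<in> extensional (proj E -` {p})"
  by (simp add: parallel_translation_def)

section \<open>Concatenation, reversal and constant loops\<close>

lemma loops_iff: "\<alpha> \<in> loops A p \<longleftrightarrow> pw_smooth A 0 1 \<alpha> \<and> \<alpha> 0 = p \<and> \<alpha> 1 = p"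
  by (simp add: loops_def piecewise_smooth_path_iff)

text \<open>At \<open>t = 1/2\<close> the concatenation is defined by its first half. Agreement at
  the junction makes the second formula valid on the closed upper half, as needed for smooth pieces
  on closed intervals.\<close>

lemma joinpaths_upper: "f 1 = k 0 \<Longrightarrow> 1/2 \<le> t \<Longrightarrow> (f +++ k) t = k (2 * t + -1)"
proof -
  assume *: "f 1 = k 0" "1/2 \<le> t"
  show ?thesis
  proof (cases "t \<le> 1/2")
    case True
    then have "t = 1/2" using *(2) by simp
    then show ?thesis using *(1) by (simp only:) (simp add: joinpaths_def)
  qed (simp add: joinpaths_def)
qed

lemma pw_smooth_join:
  fixes B :: "('n::topological_space, 'd::euclidean_space) chart set"
  assumes \<beta>: "pw_smooth B 0 1 \<beta>" and \<alpha>: "pw_smooth B 0 1 \<alpha>" and eq: "\<beta> 1 = \<alpha> 0"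
  shows "pw_smooth B 0 1 (\<beta> +++ \<alpha>)"
proof (rule pw_smooth_combine[where b="1/2"])
  have "pw_smooth B 0 (1/2) (\<lambda>t. \<beta> (2 * t + 0))" by (rule pw_smooth_affine[OF \<beta>]) auto
  then show "pw_smooth B 0 (1/2) (\<beta> +++ \<alpha>)" by (rule pw_smooth_cong[rotated]) (auto simp: joinpaths_def)
  have "pw_smooth B (1/2) 1 (\<lambda>t. \<alpha> (2 * t + -1))" by (rule pw_smooth_affine[OF \<alpha>]) auto
  then show "pw_smooth B (1/2) 1 (\<beta> +++ \<alpha>)"
    by (rule pw_smooth_cong[rotated]) (use eq in \<open>simp add: joinpaths_upper\<close>)
qed auto

lemma parallel_joinpaths:
  assumes V: "parallel 0 1 \<beta> V" and W: "parallel 0 1 \<alpha> W" and eq: "V 1 = W 0"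
  shows "parallel 0 1 (\<beta> +++ \<alpha>) (V +++ W)"
proof (rule parallel_combine[where b="1/2"])
  have "proj E (V 1) = \<beta> 1" "proj E (W 0) = \<alpha> 0" using V W unfolding parallel_def by auto
  then have b: "\<beta> 1 = \<alpha> 0" using eq by simp
  have "parallel 0 (1/2) (\<lambda>t. \<beta> (2 * t + 0)) (\<lambda>t. V (2 * t + 0))" by (rule parallel_affine[OF V]) auto
  then show "parallel 0 (1/2) (\<beta> +++ \<alpha>) (V +++ W)" by (rule parallel_cong) (auto simp: joinpaths_def)
  have "parallel (1/2) 1 (\<lambda>t. \<alpha> (2 * t + -1)) (\<lambda>t. W (2 * t + -1))" by (rule parallel_affine[OF W]) auto
  then show "parallel (1/2) 1 (\<beta> +++ \<alpha>) (V +++ W)"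
    by (rule parallel_cong) (use eq b in \<open>simp_all add: joinpaths_upper\<close>)
qed auto

lemma length_join:
  assumes \<beta>: "pw_smooth A 0 1 \<beta>" and \<alpha>: "pw_smooth A 0 1 \<alpha>" and eq: "\<beta> 1 = \<alpha> 0"
  shows "curve_length A g (\<beta> +++ \<alpha>) = curve_length A g \<beta> + curve_length A g \<alpha>"
proof -
  have i1: "(\<lambda>t::real. 2 * t + 0) ` {0..1/2} = {0..1}" and i2: "(\<lambda>t::real. 2 * t + -1) ` {1/2..1} = {0..1}"
    unfolding image_affinity_atLeastAtMost by auto
  have 1: "(spd (\<lambda>t. \<beta> (2 * t + 0)) has_integral integral {0..1} (spd \<beta>)) {0..1/2}"
    by (rule length_affine[OF \<beta> _ _ i1]) auto
  have 2: "(spd (\<lambda>t. \<alpha> (2 * t + -1)) has_integral integral {0..1} (spd \<alpha>)) {1/2..1}"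
    by (rule length_affine[OF \<alpha> _ _ i2]) auto
  have "(spd (\<beta> +++ \<alpha>) has_integral integral {0..1} (spd \<beta>)) {0..1/2}"
    by (rule length_cong[OF pw_smooth_affine[OF \<beta>] _ _ 1]) (auto simp: joinpaths_def)
  moreover have "(spd (\<beta> +++ \<alpha>) has_integral integral {0..1} (spd \<alpha>)) {1/2..1}"
    by (rule length_cong[OF pw_smooth_affine[OF \<alpha>] _ _ 2]) (use eq in \<open>auto simp: joinpaths_upper\<close>)
  ultimately have "(spd (\<beta> +++ \<alpha>) has_integral integral {0..1} (spd \<beta>) + integral {0..1} (spd \<alpha>)) {0..1}"
    by (rule has_integral_combine[rotated 2]) auto
  then show ?thesis by (simp add: curve_length_spd integral_unique)
qed

lemma reverse_affine: "reversepath \<alpha> = (\<lambda>t. \<alpha> (-1 * t + 1))"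
  by (simp add: reversepath_def fun_eq_iff)

lemma length_reverse:
  assumes \<alpha>: "pw_smooth A 0 1 \<alpha>"
  shows "curve_length A g (reversepath \<alpha>) = curve_length A g \<alpha>"
proof -
  have im: "(\<lambda>t::real. -1 * t + 1) ` {0..1} = {0..1}"
    unfolding image_affinity_atLeastAtMost by auto
  have "(spd (\<lambda>t. \<alpha> (-1 * t + 1)) has_integral integral {0..1} (spd \<alpha>)) {0..1}"
    by (rule length_affine[OF \<alpha> _ _ im]) auto
  then show ?thesis unfolding reverse_affine by (simp add: curve_length_spd integral_unique)
qed

lemma loops_join: "\<alpha> \<in> loops A p \<Longrightarrow> \<beta> \<in> loops A p \<Longrightarrow> \<beta> +++ \<alpha> \<in> loops A p"
  using pw_smooth_join[of A \<beta> \<alpha>] by (auto simp: loops_iff joinpaths_def)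

lemma loops_reverse: "\<alpha> \<in> loops A p \<Longrightarrow> reversepath \<alpha> \<in> loops A p"
  using pw_smooth_affine[of A 0 1 \<alpha> "-1" 1 0 1] unfolding loops_iff reverse_affine by auto

lemma loops_const: "(\<lambda>t. p) \<in> loops A p"
proof -
  obtain c where c: "c \<in> A" "p \<in> fst c" using M.ex_chart by blast
  have "pw_smooth A 0 1 (\<lambda>t. p)"
    by (rule M.pw_smooth_chart[OF c(1)]) (use c in \<open>auto simp: o_def intro: smooth_on_interval_const\<close>)
  then show ?thesis by (simp add: loops_iff)
qed

lemma velocity_const: "velocity B (\<lambda>t. q) t = (\<lambda>c. 0)"
  by (auto simp: velocity_def o_def)

lemma length_const: "curve_length A g (\<lambda>t. p) = 0"
proof -
  obtain c where c: "c \<in> A" "p \<in> fst c" using M.ex_chart by blast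
  have "M.regular_at (\<lambda>t. p) t" for t using c by (auto simp: M.regular_at_def o_def)
  then have "spd (\<lambda>t. p) t = 0" for t
    using spd_local[of "\<lambda>t. p" t c] c by (simp add: velocity_const pos_bilinear_simps(7)[OF pos_loc_g[OF c]])
  then have "spd (\<lambda>t. p) = (\<lambda>t. 0)" by (rule ext)
  then show ?thesis by (simp add: curve_length_spd)
qed

lemma parallel_const: "proj E u = p \<Longrightarrow> parallel a b (\<lambda>t. p) (\<lambda>t. u)"
proof -
  assume u: "proj E u = p"
  obtain c where c: "c \<in> A" "proj E u \<in> fst c" using M.ex_chart by blast
  obtain T where T: "T \<in> trivs E" "proj E u \<in> fst T" using ex_triv by blast
  have C: "tchart c T \<in> EA" "u \<in> fst (tchart c T)" using tchart_in c T by auto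
  have "pw_smooth EA a b (\<lambda>t. u)"
  proof (cases "a \<le> b")
    case True
    then show ?thesis
      by (intro tot.pw_smooth_chart[OF C(1)]) (use C in \<open>auto simp: o_def intro: smooth_on_interval_const\<close>)
  qed (auto simp: pw_smooth_def intro!: exI[of _ "{}"])
  moreover have "cov (\<lambda>t. u) t = bzero E p" for t
  proof -
    have r: "tot.regular_at (\<lambda>t. u) t" using C unfolding tot.regular_at_def by (auto simp: o_def intro!: bexI[of _ "tchart c T"])
    have "snd c (proj E u) \<in> cdom c T" using c T by auto
    then have bil: "bilinear (Gam c T (snd c (proj E u)))"
      using smooth_Gam[OF c(1) T(1)] unfolding smooth_bilinear_def by blast
    have "snd T (cov (\<lambda>t. u) t) = 0 + Gam c T (snd c (proj E u)) 0 (snd T u)"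
      by (rule cov_local[OF r c T]) auto
    then have "snd T (cov (\<lambda>t. u) t) = 0" unfolding bilinear_lzero[OF bil] by simp
    then show ?thesis
      using triv_inj[OF T(1), of "cov (\<lambda>t. u) t" "bzero E p"] proj_cov[OF r] T u by simp
  qed
  ultimately show ?thesis using u by (simp add: parallel_def)
qed

lemma ptrans_const: "proj E u = p \<Longrightarrow> ptrans (\<lambda>t. p) u = u"
  using ptrans_eq[OF parallel_const, of u p] by simp

lemma ptrans_join:
  assumes "\<alpha> \<in> loops A p" "\<beta> \<in> loops A p" "proj E u = p"
  shows "ptrans (\<beta> +++ \<alpha>) u = ptrans \<alpha> (ptrans \<beta> u)"
proof -
  have l: "pw_smooth A 0 1 \<alpha>" "\<alpha> 0 = p" "pw_smooth A 0 1 \<beta>" "\<beta> 0 = p" "\<beta> 1 = p" using assms by (auto simp: loops_iff)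
  obtain V where V: "parallel 0 1 \<beta> V" "V 0 = u" "ptrans \<beta> u = V 1" "proj E (V 1) = \<beta> 1"
    using ptrans_obtain[OF l(3), of u] l assms(3) by metis
  obtain W where W: "parallel 0 1 \<alpha> W" "W 0 = V 1" "ptrans \<alpha> (V 1) = W 1"
    using ptrans_obtain[OF l(1), of "V 1"] l V(4) by metis
  have "ptrans (\<beta> +++ \<alpha>) ((V +++ W) 0) = (V +++ W) 1"
    using ptrans_eq[OF parallel_joinpaths[OF V(1) W(1)]] W(2) by simp
  then show ?thesis using V W by (simp add: joinpaths_def)
qed

lemma parallel_reverse: "parallel 0 1 \<alpha> V \<Longrightarrow> parallel 0 1 (reversepath \<alpha>) (reversepath V)"
  unfolding reverse_affine by (rule parallel_affine[of 0 1]) auto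

lemma ptrans_reverse:
  assumes "\<alpha> \<in> loops A p" "proj E u = p"
  shows "ptrans (reversepath \<alpha>) (ptrans \<alpha> u) = u"
proof -
  have l: "pw_smooth A 0 1 \<alpha>" "\<alpha> 0 = p" using assms by (auto simp: loops_iff)
  obtain V where V: "parallel 0 1 \<alpha> V" "V 0 = u" "ptrans \<alpha> u = V 1"
    using ptrans_obtain[OF l(1), of u] l assms(2) by metis
  show ?thesis using ptrans_eq[OF parallel_reverse[OF V(1)]] V by (simp add: reversepath_def)
qed

lemma proj_ptrans:
  assumes "\<alpha> \<in> loops A p" "proj E u = p" shows "proj E (ptrans \<alpha> u) = p"
proof -
  have l: "pw_smooth A 0 1 \<alpha>" "\<alpha> 0 = p" "\<alpha> 1 = p" using assms by (auto simp: loops_iff)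
  show ?thesis using ptrans_obtain[OF l(1), of u] l assms(2) by metis
qed

lemma ptrans_comb:
  assumes "\<alpha> \<in> loops A p" "proj E u = p" "proj E v = p"
  shows "ptrans \<alpha> (bplus E u (bscale E k v)) = bplus E (ptrans \<alpha> u) (bscale E k (ptrans \<alpha> v))"
proof -
  have l: "pw_smooth A 0 1 \<alpha>" "\<alpha> 0 = p" using assms by (auto simp: loops_iff)
  obtain V where V: "parallel 0 1 \<alpha> V" "V 0 = u" "ptrans \<alpha> u = V 1"
    using ptrans_obtain[OF l(1), of u] l assms(2) by metis
  obtain W where W: "parallel 0 1 \<alpha> W" "W 0 = v" "ptrans \<alpha> v = W 1"
    using ptrans_obtain[OF l(1), of v] l assms(3) by metis
  show ?thesis using ptrans_eq[OF parallel_comb[OF V(1) W(1), of k]] V W by (simp add: comb_def)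
qed

lemma fibre_norm_ptrans:
  assumes "\<alpha> \<in> loops A p" "proj E u = p"
  shows "fibre_norm h (ptrans \<alpha> u) = fibre_norm h u"
proof -
  have l: "pw_smooth A 0 1 \<alpha>" "\<alpha> 0 = p" using assms by (auto simp: loops_iff)
  obtain V where V: "parallel 0 1 \<alpha> V" "V 0 = u" "ptrans \<alpha> u = V 1"
    using ptrans_obtain[OF l(1), of u] l assms(2) by metis
  show ?thesis using parallel_h_const[OF V(1) V(1), of 1] V by (simp add: fibre_norm_def)
qed

end

section \<open>The holonomy group\<close>

text \<open>\<open>inv\<close> is a description relative to the carrier, so its value has to be
  found before the subset is known to be a group. A left inverse inside \<open>C\<close> is the
  inverse among all bijections, which makes it two-sided and unique in \<open>C\<close>.\<close>

lemma m_inv_BijGroup_subset: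
  assumes C: "C \<subseteq> Bij S" and x: "x \<in> C" and y: "y \<in> C" and yx: "y \<otimes>\<^bsub>BijGroup S\<^esub> x = \<one>\<^bsub>BijGroup S\<^esub>"
  shows "inv\<^bsub>(BijGroup S)\<lparr>carrier := C\<rparr>\<^esub> x = y"
proof -
  interpret B: group "BijGroup S" by (rule group_BijGroup)
  have car: "carrier (BijGroup S) = Bij S" by (simp add: BijGroup_def)
  have xB: "x \<in> carrier (BijGroup S)" "y \<in> carrier (BijGroup S)" using C x y car by auto
  have inv: "y' = inv\<^bsub>BijGroup S\<^esub> x" if "y' \<in> C" "y' \<otimes>\<^bsub>BijGroup S\<^esub> x = \<one>\<^bsub>BijGroup S\<^esub>" for y'
    using B.inv_equality[OF that(2) xB(1)] that(1) C car by auto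
  have "x \<otimes>\<^bsub>BijGroup S\<^esub> y = \<one>\<^bsub>BijGroup S\<^esub>" using inv[OF y yx] xB B.r_inv by simp
  then show ?thesis unfolding m_inv_def
    by (intro the_equality) (use y yx inv in auto)
qed

context metric_bundle
begin

section \<open>The fibre as a normed space\<close>

lemma fibre_norm_lift:
  assumes "T \<in> trivs E" "p \<in> fst T" "proj E e = p"
  shows "fibre_norm h e = sqrt (h (triv_inv E T (p, snd T e)) (triv_inv E T (p, snd T e)))"
  using assms lift_triv[OF assms(1), of e] by (simp add: fibre_norm_def)

lemma norm_on_fibre: "norm_on (fibre E p) (fibre_norm h)"
proof -
  obtain T where T: "T \<in> trivs E" "p \<in> fst T" using ex_triv by blast
  define K where "K v w = h (triv_inv E T (p, v)) (triv_inv E T (p, w))" for v w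
  have K: "pos_bilinear K" unfolding K_def[abs_def] by (rule pos_lift_h[OF T])
  have n: "fibre_norm h e = sqrt (K (snd T e) (snd T e))" if "proj E e = p" for e
    using fibre_norm_lift[OF T that] by (simp add: K_def)
  have "fibre_norm h e = 0 \<longleftrightarrow> e = bzero E p" if "proj E e = p" for e
  proof -
    have "snd T e = 0 \<longleftrightarrow> e = bzero E p" using triv_inj[OF T(1), of e "bzero E p"] T that by (metis proj_bzero triv_bzero)
    then show ?thesis using n[OF that] pos_bilinear_eq_0[OF K] by simp
  qed
  moreover have "fibre_norm h (bscale E k e) = \<bar>k\<bar> * fibre_norm h e" if "proj E e = p" for k e
  proof -
    have "K (k *\<^sub>R snd T e) (k *\<^sub>R snd T e) = k\<^sup>2 * K (snd T e) (snd T e)"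
      by (simp add: pos_bilinear_simps[OF K] power2_eq_square)
    then show ?thesis using n[of "bscale E k e"] n[OF that] that T by (simp add: real_sqrt_mult)
  qed
  moreover have "fibre_norm h (bplus E e e') \<le> fibre_norm h e + fibre_norm h e'" if "proj E e = p" "proj E e' = p" for e e'
    using n[of "bplus E e e'"] n[OF that(1)] n[OF that(2)] that T pos_bilinear_triangle[OF K] by simp
  moreover have "fibre_norm h e \<ge> 0" if "proj E e = p" for e using n[OF that] pos_bilinear_ge_0[OF K] by simp
  ultimately show ?thesis by (simp add: norm_on_def)
qed

lemma fibre_norm_nonneg: "fibre_norm h e \<ge> 0"
  using norm_on_fibre[of "proj E e"] by (simp add: norm_on_def)

lemma fibre_eqI: "(\<And>T. T \<in> trivs E \<Longrightarrow> proj E e \<in> fst T \<Longrightarrow> snd T e = snd T e') \<Longrightarrow> proj E e = proj E e' \<Longrightarrow> e = e'"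
  using ex_triv[of "proj E e"] triv_inj by metis

lemma bscale_one [simp]: "bscale E 1 e = e"
  by (rule fibre_eqI) auto

text \<open>Writes \<open>k u\<close> as \<open>u + (k - 1) u\<close>, so that homogeneity of
  parallel translation is a case of \<open>ptrans_comb\<close>.\<close>

lemma bscale_split: "bplus E e (bscale E (k - 1) e) = bscale E k e"
  by (rule fibre_eqI) (auto simp: algebra_simps)

lemma proj_vminus [simp]: "proj E e = p \<Longrightarrow> proj E e' = p \<Longrightarrow> proj E (vminus (fibre E q) e e') = p"
  by (simp add: vminus_def)

lemma triv_vminus' [simp]: "T \<in> trivs E \<Longrightarrow> proj E e = p \<Longrightarrow> proj E e' = p \<Longrightarrow> p \<in> fst T \<Longrightarrow>
    snd T (vminus (fibre E q) e e') = snd T e - snd T e'"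
  using triv_vminus[of T e e' q] by simp

abbreviation "isoms p \<equiv> isom_group (fibre E p) (fibre_norm h)"
abbreviation "hol p \<equiv> Hol A E nabla p"
abbreviation "hlen p \<equiv> hol_length A g E nabla p"

section \<open>Parallel translations as a subgroup of the isometries of the fibre\<close>

lemma ptrans_linear: "\<alpha> \<in> loops A p \<Longrightarrow> linear_map (fibre E p) (fibre E p) (ptrans \<alpha>)"
proof -
  assume \<alpha>: "\<alpha> \<in> loops A p"
  have "ptrans \<alpha> (bplus E u v) = bplus E (ptrans \<alpha> u) (ptrans \<alpha> v)" if "proj E u = p" "proj E v = p" for u v
    using ptrans_comb[OF \<alpha> that, of 1] by simp
  moreover have "ptrans \<alpha> (bscale E k u) = bscale E k (ptrans \<alpha> u)" if "proj E u = p" for k u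
    using ptrans_comb[OF \<alpha> that that, of "k - 1"] by (simp add: bscale_split)
  ultimately show ?thesis using proj_ptrans[OF \<alpha>] by (simp add: linear_map_def)
qed

lemma ptrans_vminus:
  assumes "\<alpha> \<in> loops A p" "proj E u = p" "proj E v = p"
  shows "ptrans \<alpha> (vminus (fibre E p) u v) = vminus (fibre E p) (ptrans \<alpha> u) (ptrans \<alpha> v)"
  using ptrans_comb[OF assms, of "-1"] by (simp add: vminus_def)

lemma ptrans_reverse':
  assumes "\<alpha> \<in> loops A p" "proj E u = p"
  shows "ptrans \<alpha> (ptrans (reversepath \<alpha>) u) = u"
  using ptrans_reverse[OF loops_reverse[OF assms(1)] assms(2)] by simp

lemma ptrans_Bij: "\<alpha> \<in> loops A p \<Longrightarrow> ptrans \<alpha> \<in> Bij (proj E -` {p})"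
proof -
  assume \<alpha>: "\<alpha> \<in> loops A p"
  have "bij_betw (ptrans \<alpha>) (proj E -` {p}) (proj E -` {p})"
    by (rule bij_betw_byWitness[where f'="ptrans (reversepath \<alpha>)"])
      (use \<alpha> ptrans_reverse ptrans_reverse' proj_ptrans loops_reverse in auto)
  then show ?thesis using ptrans_extensional \<alpha> by (auto simp: Bij_def loops_iff)
qed

lemma ptrans_isoms: "\<alpha> \<in> loops A p \<Longrightarrow> ptrans \<alpha> \<in> carrier (isoms p)"
  using ptrans_Bij ptrans_linear fibre_norm_ptrans by (simp add: isom_group_def)

lemma hol_subset_Bij: "hol p \<subseteq> Bij (proj E -` {p})"
  using ptrans_Bij by (auto simp: Hol_def)

text \<open>The order is reversed: the product is composition of maps, so the loop of the right
  factor is run through first.\<close>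

lemma BijGroup_ptrans_mult:
  assumes "\<alpha> \<in> loops A p" "\<beta> \<in> loops A p"
  shows "ptrans \<alpha> \<otimes>\<^bsub>BijGroup (proj E -` {p})\<^esub> ptrans \<beta> = ptrans (\<beta> +++ \<alpha>)"
proof -
  have "ptrans \<alpha> \<otimes>\<^bsub>BijGroup (proj E -` {p})\<^esub> ptrans \<beta> = compose (proj E -` {p}) (ptrans \<alpha>) (ptrans \<beta>)"
    using ptrans_Bij assms by (simp add: BijGroup_def)
  also have "\<dots> = ptrans (\<beta> +++ \<alpha>)"
  proof (rule extensionalityI[of _ "proj E -` {p}"])
    show "ptrans (\<beta> +++ \<alpha>) \<in> extensional (proj E -` {p})"
      using ptrans_extensional[of "\<beta> +++ \<alpha>" p] loops_join[OF assms] by (simp add: loops_iff)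
  qed (use ptrans_join[OF assms] in \<open>auto simp: compose_eq\<close>)
  finally show ?thesis .
qed

lemma BijGroup_one_ptrans: "\<one>\<^bsub>BijGroup (proj E -` {p})\<^esub> = ptrans (\<lambda>t. p)"
  unfolding BijGroup_def
  by (rule extensionalityI[of _ "proj E -` {p}"]) (use ptrans_const ptrans_extensional in auto)

lemma ptrans_reverse_mult:
  assumes "\<alpha> \<in> loops A p"
  shows "ptrans (reversepath \<alpha>) \<otimes>\<^bsub>BijGroup (proj E -` {p})\<^esub> ptrans \<alpha> = \<one>\<^bsub>BijGroup (proj E -` {p})\<^esub>"
proof -
  have "ptrans (reversepath \<alpha>) \<otimes>\<^bsub>BijGroup (proj E -` {p})\<^esub> ptrans \<alpha> =
    compose (proj E -` {p}) (ptrans (reversepath \<alpha>)) (ptrans \<alpha>)"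
    using ptrans_Bij assms loops_reverse by (simp add: BijGroup_def)
  also have "\<dots> = \<one>\<^bsub>BijGroup (proj E -` {p})\<^esub>"
    unfolding BijGroup_def
    by (rule extensionalityI[of _ "proj E -` {p}"]) (use assms ptrans_reverse in \<open>auto simp: compose_eq\<close>)
  finally show ?thesis .
qed

lemma isoms_eq: "isoms p = (BijGroup (proj E -` {p}))\<lparr>carrier := carrier (isoms p)\<rparr>"
  by (simp add: isom_group_def)

lemma hol_group_eq: "(isoms p)\<lparr>carrier := hol p\<rparr> = (BijGroup (proj E -` {p}))\<lparr>carrier := hol p\<rparr>"
  by (simp add: isom_group_def)

lemma isoms_mult: "x \<otimes>\<^bsub>isoms p\<^esub> y = x \<otimes>\<^bsub>BijGroup (proj E -` {p})\<^esub> y"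
  and isoms_one: "\<one>\<^bsub>isoms p\<^esub> = \<one>\<^bsub>BijGroup (proj E -` {p})\<^esub>"
  by (simp_all add: isom_group_def)

lemma hol_ptrans: "\<alpha> \<in> loops A p \<Longrightarrow> ptrans \<alpha> \<in> hol p"
  by (simp add: Hol_def)

lemma subgroup_hol: "subgroup (hol p) (isoms p)"
proof
  show "hol p \<subseteq> carrier (isoms p)" using ptrans_isoms by (auto simp: Hol_def)
  show "x \<otimes>\<^bsub>isoms p\<^esub> y \<in> hol p" if "x \<in> hol p" "y \<in> hol p" for x y
    using that BijGroup_ptrans_mult loops_join hol_ptrans unfolding isoms_mult by (auto simp: Hol_def)
  show "\<one>\<^bsub>isoms p\<^esub> \<in> hol p" unfolding isoms_one BijGroup_one_ptrans by (rule hol_ptrans[OF loops_const])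
  show "inv\<^bsub>isoms p\<^esub> x \<in> hol p" if "x \<in> hol p" for x
  proof -
    obtain \<alpha> where \<alpha>: "\<alpha> \<in> loops A p" "x = ptrans \<alpha>" using \<open>x \<in> hol p\<close> by (auto simp: Hol_def)
    have "inv\<^bsub>(BijGroup (proj E -` {p}))\<lparr>carrier := carrier (isoms p)\<rparr>\<^esub> x = ptrans (reversepath \<alpha>)"
      unfolding \<alpha>(2)
      by (rule m_inv_BijGroup_subset[OF _ _ _ ptrans_reverse_mult[OF \<alpha>(1)]])
        (use ptrans_isoms \<alpha>(1) loops_reverse in \<open>auto simp: isom_group_def\<close>)
    then show ?thesis using hol_ptrans[OF loops_reverse[OF \<alpha>(1)]] isoms_eq by simp
  qed
qed

lemma inv_hol:
  assumes "\<alpha> \<in> loops A p"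
  shows "inv\<^bsub>(isoms p)\<lparr>carrier := hol p\<rparr>\<^esub> (ptrans \<alpha>) = ptrans (reversepath \<alpha>)"
  unfolding hol_group_eq
  by (rule m_inv_BijGroup_subset[OF hol_subset_Bij _ _ ptrans_reverse_mult[OF assms]])
    (use assms loops_reverse hol_ptrans in auto)

subsection \<open>The length norm\<close>

lemma loop_length_nonneg: "\<alpha> \<in> loops A p \<Longrightarrow> curve_length A g \<alpha> \<ge> 0"
  using length_nonneg[of 0 1 \<alpha>] by (simp add: curve_length_spd loops_iff)

lemma hlen_le: "\<alpha> \<in> loops A p \<Longrightarrow> hlen p (ptrans \<alpha>) \<le> curve_length A g \<alpha>"
  unfolding hol_length_def
  by (rule cInf_lower) (use loop_length_nonneg in \<open>auto simp: bdd_below_def\<close>)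

lemma hlen_nonneg: "a \<in> hol p \<Longrightarrow> hlen p a \<ge> 0"
  unfolding hol_length_def by (rule cInf_greatest) (use loop_length_nonneg in \<open>auto simp: Hol_def\<close>)

lemma hlen_approx:
  assumes "a \<in> hol p" "e > 0"
  obtains \<alpha> where "\<alpha> \<in> loops A p" "ptrans \<alpha> = a" "curve_length A g \<alpha> < hlen p a + e"
proof -
  define S where "S = {curve_length A g \<alpha> |\<alpha>. \<alpha> \<in> loops A p \<and> ptrans \<alpha> = a}"
  have "S \<noteq> {}" using assms(1) by (auto simp: Hol_def S_def)
  moreover have "Inf S < hlen p a + e" using assms(2) by (simp add: hol_length_def S_def)
  ultimately obtain x where "x \<in> S" "x < hlen p a + e" using cInf_lessD[of S "hlen p a + e"] by blast
  then show ?thesis using that unfolding S_def by blast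
qed

lemma hlen_reverse: "\<alpha> \<in> loops A p \<Longrightarrow> hlen p (ptrans (reversepath \<alpha>)) \<le> hlen p (ptrans \<alpha>)"
proof (rule field_le_epsilon)
  fix e :: real assume \<alpha>: "\<alpha> \<in> loops A p" and e: "e > 0"
  obtain \<beta> where \<beta>: "\<beta> \<in> loops A p" "ptrans \<beta> = ptrans \<alpha>" "curve_length A g \<beta> < hlen p (ptrans \<alpha>) + e"
    using hlen_approx[OF hol_ptrans[OF \<alpha>] e] by metis
  \<comment> \<open>Translation along the reversed loop is the group inverse, so it depends on the
    translation and not on the loop. Hence reversing an almost shortest loop for one holonomy gives
    a competitor for its inverse.\<close>
  have "ptrans (reversepath \<beta>) = ptrans (reversepath \<alpha>)"
    using inv_hol[OF \<alpha>] inv_hol[OF \<beta>(1)] \<beta>(2) by simp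
  then have "hlen p (ptrans (reversepath \<alpha>)) \<le> curve_length A g (reversepath \<beta>)"
    using hlen_le[OF loops_reverse[OF \<beta>(1)]] by simp
  then show "hlen p (ptrans (reversepath \<alpha>)) \<le> hlen p (ptrans \<alpha>) + e"
    using length_reverse[of \<beta>] \<beta> by (simp add: loops_iff)
qed

lemma hlen_reverse_eq: "\<alpha> \<in> loops A p \<Longrightarrow> hlen p (ptrans (reversepath \<alpha>)) = hlen p (ptrans \<alpha>)"
  using hlen_reverse[of \<alpha> p] hlen_reverse[OF loops_reverse, of \<alpha> p] by simp

text \<open>The infimum need not be attained, so the bound is applied to loops of length below
  \<open>hlen p a + e\<close>; as \<open>\<epsilon>\<close> and \<open>C\<close> are the same for
  all loops, \<open>e\<close> can tend to 0.\<close>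

lemma hol_quadratic:
  fixes p :: 'm
  obtains \<epsilon> C where "\<epsilon> > 0" "C \<ge> 0"
    "\<And>a u. a \<in> hol p \<Longrightarrow> hlen p a < \<epsilon> \<Longrightarrow> proj E u = p \<Longrightarrow>
      fibre_norm h (vminus (fibre E p) (a u) u) \<le> C * (hlen p a)\<^sup>2 * fibre_norm h u"
proof -
  obtain \<epsilon> C where eC: "\<epsilon> > 0" "C \<ge> 0"
    "\<And>\<alpha> V. pw_smooth A 0 1 \<alpha> \<Longrightarrow> \<alpha> 0 = p \<Longrightarrow> \<alpha> 1 = p \<Longrightarrow> integral {0..1} (spd \<alpha>) < \<epsilon> \<Longrightarrow> parallel 0 1 \<alpha> V \<Longrightarrow>
      fibre_norm h (vminus (fibre E p) (V 1) (V 0)) \<le> C * (integral {0..1} (spd \<alpha>))\<^sup>2 * fibre_norm h (V 0)"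
    using holonomy_quadratic[of p] by metis
  have "fibre_norm h (vminus (fibre E p) (a u) u) \<le> C * (hlen p a)\<^sup>2 * fibre_norm h u"
    if a: "a \<in> hol p" and small: "hlen p a < \<epsilon>" and u: "proj E u = p" for a u
  proof (rule tendsto_lowerbound)
    show "((\<lambda>e. C * (hlen p a + e)\<^sup>2 * fibre_norm h u) \<longlongrightarrow> C * (hlen p a)\<^sup>2 * fibre_norm h u) (at_right 0)"
      by (auto intro!: tendsto_eq_intros)
    have "fibre_norm h (vminus (fibre E p) (a u) u) \<le> C * (hlen p a + e)\<^sup>2 * fibre_norm h u"
      if e: "e > 0" "e < \<epsilon> - hlen p a" for e
    proof -
      obtain \<alpha> where \<alpha>: "\<alpha> \<in> loops A p" "ptrans \<alpha> = a" "curve_length A g \<alpha> < hlen p a + e"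
        using hlen_approx[OF a e(1)] by metis
      have l: "pw_smooth A 0 1 \<alpha>" "\<alpha> 0 = p" "\<alpha> 1 = p" using \<alpha>(1) by (auto simp: loops_iff)
      obtain V where V: "parallel 0 1 \<alpha> V" "V 0 = u" "ptrans \<alpha> u = V 1"
        using ptrans_obtain[OF l(1), of u] l u by metis
      have "fibre_norm h (vminus (fibre E p) (a u) u) \<le> C * (curve_length A g \<alpha>)\<^sup>2 * fibre_norm h u"
        using eC(3)[OF l _ V(1)] \<alpha> V e by (simp add: curve_length_spd)
      also have "\<dots> \<le> C * (hlen p a + e)\<^sup>2 * fibre_norm h u"
        using \<alpha>(3) loop_length_nonneg[OF \<alpha>(1)] eC(2) fibre_norm_nonneg
        by (intro mult_right_mono mult_left_mono power_mono) auto
      finally show ?thesis .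
    qed
    then show "\<forall>\<^sub>F e in at_right 0. fibre_norm h (vminus (fibre E p) (a u) u) \<le> C * (hlen p a + e)\<^sup>2 * fibre_norm h u"
      using small unfolding eventually_at_right_field by (intro exI[of _ "\<epsilon> - hlen p a"]) auto
  qed simp
  then show ?thesis using that eC by blast
qed

text \<open>Definiteness is the analytic part: loops with holonomy \<open>a\<close> and lengths
  tending to 0 need not be trivial, but the quadratic bound with \<open>hlen p a = 0\<close> makes
  \<open>a\<close> fix every vector. The triangle inequality concatenates loops that are within
  \<open>e / 2\<close> of optimal.\<close>

lemma group_norm_hlen: "group_norm ((isoms p)\<lparr>carrier := hol p\<rparr>) (hlen p)"
proof -
  have 1: "\<one>\<^bsub>isoms p\<^esub> = ptrans (\<lambda>t. p)" unfolding isoms_one BijGroup_one_ptrans ..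
  have "hlen p a = 0 \<longleftrightarrow> a = \<one>\<^bsub>isoms p\<^esub>" if a: "a \<in> hol p" for a
  proof
    assume "a = \<one>\<^bsub>isoms p\<^esub>"
    then show "hlen p a = 0"
      using hlen_le[OF loops_const[of p]] hlen_nonneg[OF a] 1 by (simp add: length_const)
  next
    assume 0: "hlen p a = 0"
    obtain \<epsilon> C where eC: "\<epsilon> > 0" "C \<ge> 0"
      "\<And>a u. a \<in> hol p \<Longrightarrow> hlen p a < \<epsilon> \<Longrightarrow> proj E u = p \<Longrightarrow>
        fibre_norm h (vminus (fibre E p) (a u) u) \<le> C * (hlen p a)\<^sup>2 * fibre_norm h u"
      using hol_quadratic[of p] by metis
    have "a u = u" if u: "proj E u = p" for u
    proof -
      have pa: "proj E (a u) = p" using a u proj_ptrans by (auto simp: Hol_def)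
      have "fibre_norm h (vminus (fibre E p) (a u) u) = 0"
        using eC(3)[OF a _ u] 0 eC(1) fibre_norm_nonneg[of "vminus (fibre E p) (a u) u"] by simp
      then have z: "vminus (fibre E p) (a u) u = bzero E p"
        using norm_on_fibre[of p] u pa by (simp add: norm_on_def)
      obtain T where T: "T \<in> trivs E" "p \<in> fst T" using ex_triv by blast
      have "snd T (a u) - snd T u = 0"
        using triv_vminus'[OF T(1) pa u T(2), of p] z triv_bzero[OF T] by simp
      then show ?thesis using triv_inj[OF T(1), of "a u" u] pa u T by simp
    qed
    moreover have "a \<in> extensional (proj E -` {p})" using a hol_subset_Bij by (auto simp: Bij_def)
    ultimately have "a = ptrans (\<lambda>t. p)"
      using ptrans_const ptrans_extensional by (intro extensionalityI[of _ "proj E -` {p}"]) auto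
    then show "a = \<one>\<^bsub>isoms p\<^esub>" using 1 by simp
  qed
  moreover have "hlen p (inv\<^bsub>(isoms p)\<lparr>carrier := hol p\<rparr>\<^esub> a) = hlen p a" if "a \<in> hol p" for a
    using that inv_hol hlen_reverse_eq by (auto simp: Hol_def)
  moreover have "hlen p (a \<otimes>\<^bsub>isoms p\<^esub> b) \<le> hlen p a + hlen p b" if a: "a \<in> hol p" and b: "b \<in> hol p" for a b
  proof (rule field_le_epsilon)
    fix e :: real assume "e > 0"
    then have e: "e / 2 > 0" by simp
    obtain \<alpha> where \<alpha>: "\<alpha> \<in> loops A p" "ptrans \<alpha> = a" "curve_length A g \<alpha> < hlen p a + e / 2"
      using hlen_approx[OF a e] by metis
    obtain \<beta> where \<beta>: "\<beta> \<in> loops A p" "ptrans \<beta> = b" "curve_length A g \<beta> < hlen p b + e / 2"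
      using hlen_approx[OF b e] by metis
    have "a \<otimes>\<^bsub>isoms p\<^esub> b = ptrans (\<beta> +++ \<alpha>)"
      using BijGroup_ptrans_mult[OF \<alpha>(1) \<beta>(1)] \<alpha>(2) \<beta>(2) by (simp add: isoms_mult)
    then have "hlen p (a \<otimes>\<^bsub>isoms p\<^esub> b) \<le> curve_length A g (\<beta> +++ \<alpha>)"
      using hlen_le[OF loops_join[OF \<alpha>(1) \<beta>(1)]] by simp
    also have "\<dots> = curve_length A g \<beta> + curve_length A g \<alpha>"
      using \<alpha>(1) \<beta>(1) by (intro length_join) (auto simp: loops_iff)
    finally show "hlen p (a \<otimes>\<^bsub>isoms p\<^esub> b) \<le> hlen p a + hlen p b + e" using \<alpha>(3) \<beta>(3) by linarith
  qed
  ultimately show ?thesis using hlen_nonneg by (simp add: group_norm_def)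
qed

text \<open>With \<open>x = norm (A w - w)\<close> and \<open>norm (v - w) < 2 r\<close>, the left-hand side is at most \<open>4 r x\<close>. For short
  loops \<open>x = O(L A ^ 2)\<close>, for the others \<open>x\<close> is bounded.\<close>

lemma holonomic_local_condition:
  assumes u: "proj E u = p"
  shows "\<exists>r>0. \<forall>v\<in>vcarrier (fibre E p). \<forall>w\<in>vcarrier (fibre E p).
    fibre_norm h (vminus (fibre E p) v u) < r \<longrightarrow> fibre_norm h (vminus (fibre E p) w u) < r \<longrightarrow>
    (\<forall>a\<in>hol p. (fibre_norm h (vminus (fibre E p) v w))\<^sup>2 - (fibre_norm h (vminus (fibre E p) v (a w)))\<^sup>2 \<le> (hlen p a)\<^sup>2)"
proof -
  obtain T where T: "T \<in> trivs E" "p \<in> fst T" using ex_triv by blast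
  define K where "K v w = h (triv_inv E T (p, v)) (triv_inv E T (p, w))" for v w
  have K: "pos_bilinear K" unfolding K_def[abs_def] by (rule pos_lift_h[OF T])
  define n where "n v = sqrt (K v v)" for v
  have n: "fibre_norm h e = n (snd T e)" if "proj E e = p" for e
    using fibre_norm_lift[OF T that] by (simp add: K_def n_def)
  have nvm: "fibre_norm h (vminus (fibre E p) e e') = n (snd T e - snd T e')" if "proj E e = p" "proj E e' = p" for e e'
    using n[of "vminus (fibre E p) e e'"] that T by simp
  have tri: "n (x + y) \<le> n x + n y" for x y unfolding n_def by (rule pos_bilinear_triangle[OF K])
  have neg: "n (x - y) = n (y - x)" for x y unfolding n_def by (simp add: pos_bilinear_simps[OF K])
  have n0: "n x \<ge> 0" for x unfolding n_def using pos_bilinear_ge_0[OF K] by simp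
  obtain \<epsilon> C where eC: "\<epsilon> > 0" "C \<ge> 0"
    "\<And>a u. a \<in> hol p \<Longrightarrow> hlen p a < \<epsilon> \<Longrightarrow> proj E u = p \<Longrightarrow>
      fibre_norm h (vminus (fibre E p) (a u) u) \<le> C * (hlen p a)\<^sup>2 * fibre_norm h u"
    using hol_quadratic[of p] by metis
  \<comment> \<open>Bounds the norm of every \<open>w\<close> in the ball of radius
    \<open>r \<le> 1\<close> around \<open>u\<close>.\<close>
  define B where "B = n (snd T u) + 1"
  have B: "B > 0" using n0[of "snd T u"] by (simp add: B_def)
  \<comment> \<open>The second bound gives \<open>4 * r * C * B \<le> 1\<close>, which absorbs the
    constant of the quadratic estimate for short loops; the summand 1 in it keeps the denominator
    positive when \<open>C = 0\<close>. The third gives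
    \<open>8 * r * B \<le> \<epsilon>\<^sup>2\<close> for the other loops, where an isometry moves
    \<open>w\<close> by at most \<open>2 * B\<close>.\<close>
  define r where "r = min 1 (min (1 / (4 * C * B + 1)) (\<epsilon>\<^sup>2 / (8 * B)))"
  have CB: "4 * C * B + 1 > 0" using eC(2) B by (simp add: add_nonneg_pos)
  have r: "r > 0" "r \<le> 1" "r \<le> 1 / (4 * C * B + 1)" "r \<le> \<epsilon>\<^sup>2 / (8 * B)"
    using eC(1) B CB by (auto simp: r_def)
  have r1: "4 * r * C * B \<le> 1"
  proof -
    have "r * (4 * C * B + 1) \<le> 1" using r(3) CB by (simp add: field_simps)
    moreover have "r * (4 * C * B + 1) = 4 * r * C * B + r" by (simp add: algebra_simps)
    ultimately show ?thesis using r(1) by linarith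
  qed
  have r2: "4 * r * (2 * B) \<le> \<epsilon>\<^sup>2" using r(4) B by (simp add: field_simps)
  show ?thesis
  proof (intro exI[of _ r] conjI ballI impI r(1))
    fix v w a
    assume "v \<in> vcarrier (fibre E p)" "w \<in> vcarrier (fibre E p)" and a: "a \<in> hol p"
    then have vw: "proj E v = p" "proj E w = p" by auto
    assume "fibre_norm h (vminus (fibre E p) v u) < r" "fibre_norm h (vminus (fibre E p) w u) < r"
    then have close: "n (snd T v - snd T u) < r" "n (snd T w - snd T u) < r" using nvm vw u by auto
    obtain \<alpha> where \<alpha>: "\<alpha> \<in> loops A p" "a = ptrans \<alpha>" using a by (auto simp: Hol_def)
    have aw: "proj E (a w) = p" using proj_ptrans[OF \<alpha>(1) vw(2)] \<alpha>(2) by simp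
    define x where "x = n (snd T (a w) - snd T w)"
    define d where "d = n (snd T v - snd T w)"
    define y where "y = n (snd T v - snd T (a w))"
    have "d \<le> n (snd T v - snd T u) + n (snd T u - snd T w)"
      unfolding d_def using tri[of "snd T v - snd T u" "snd T u - snd T w"] by simp
    then have d: "d < 2 * r" using close neg[of "snd T u" "snd T w"] by linarith
    have "x \<le> n (snd T (a w) - snd T v) + n (snd T v - snd T w)"
      unfolding x_def using tri[of "snd T (a w) - snd T v" "snd T v - snd T w"] by simp
    then have xy: "x - d \<le> y" using neg[of "snd T (a w)" "snd T v"] by (simp add: d_def y_def)
    \<comment> \<open>By the triangle inequality \<open>y\<close> is at least
      \<open>\<bar>d - x\<bar>\<close>, so the left-hand side is at most
      \<open>2 * d * x - x\<^sup>2\<close>, and \<open>d < 2 * r\<close>. The cases make the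
      quantity being squared nonnegative.\<close>
    have dx: "d\<^sup>2 - y\<^sup>2 \<le> 4 * r * x"
    proof (cases "x \<le> d")
      case True
      have "d \<le> n (snd T v - snd T (a w)) + n (snd T (a w) - snd T w)"
        unfolding d_def using tri[of "snd T v - snd T (a w)" "snd T (a w) - snd T w"] by simp
      then have "d - x \<le> y" by (simp add: x_def y_def)
      then have "(d - x)\<^sup>2 \<le> y\<^sup>2" using True by (intro power_mono) auto
      moreover have "d * x \<le> 2 * r * x" using d n0 by (intro mult_right_mono) (auto simp: x_def)
      ultimately show ?thesis
        using zero_le_power2[of x] power2_diff[of d x] power2_diff[of x d] by linarith
    next
      case False
      then have "(x - d)\<^sup>2 \<le> y\<^sup>2" using xy by (intro power_mono) auto
      then have "(d - x)\<^sup>2 \<le> y\<^sup>2" by (simp only: power2_commute)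
      moreover have "d * x \<le> 2 * r * x" using d n0 by (intro mult_right_mono) (auto simp: x_def)
      ultimately show ?thesis
        using zero_le_power2[of x] power2_diff[of d x] power2_diff[of x d] by linarith
    qed
    have wB: "n (snd T w) \<le> B"
      using tri[of "snd T w - snd T u" "snd T u"] close r(2) by (simp add: B_def)
    have "4 * r * x \<le> (hlen p a)\<^sup>2"
    proof (cases "hlen p a < \<epsilon>")
      case True
      have "x \<le> C * (hlen p a)\<^sup>2 * n (snd T w)"
        using eC(3)[OF a True vw(2)] nvm[OF aw vw(2)] n[OF vw(2)] by (simp add: x_def)
      also have "\<dots> \<le> C * (hlen p a)\<^sup>2 * B" using wB eC(2) by (intro mult_left_mono) auto
      finally have "4 * r * x \<le> 4 * r * (C * (hlen p a)\<^sup>2 * B)" using r(1) by (intro mult_left_mono) auto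
      also have "\<dots> = (4 * r * C * B) * (hlen p a)\<^sup>2" by (simp add: mult_ac)
      also have "\<dots> \<le> 1 * (hlen p a)\<^sup>2" by (intro mult_right_mono r1) auto
      finally show ?thesis by simp
    next
      case False
      have "n (snd T (a w)) = n (snd T w)"
        using fibre_norm_ptrans[OF \<alpha>(1) vw(2)] n[OF aw] n[OF vw(2)] \<alpha>(2) by simp
      then have "x \<le> 2 * B"
        using tri[of "snd T (a w)" "- snd T w"] neg[of 0 "snd T w"] wB by (simp add: x_def)
      then have "4 * r * x \<le> 4 * r * (2 * B)" using r(1) by (intro mult_left_mono) auto
      also have "\<dots> \<le> \<epsilon>\<^sup>2" by (rule r2)
      also have "\<dots> \<le> (hlen p a)\<^sup>2" using False eC(1) by (intro power_mono) auto
      finally show ?thesis .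
    qed
    then show "(fibre_norm h (vminus (fibre E p) v w))\<^sup>2 - (fibre_norm h (vminus (fibre E p) v (a w)))\<^sup>2 \<le> (hlen p a)\<^sup>2"
      using dx nvm[OF vw] nvm[OF vw(1) aw] by (simp add: d_def y_def)
  qed
qed

lemma holonomic_space_hol: "holonomic_space (fibre E p) (fibre_norm h) (hol p) (hlen p)"
  unfolding holonomic_space_def
  by (intro conjI fibre_vspace norm_on_fibre subgroup_hol group_norm_hlen ballI holonomic_local_condition) simp

section \<open>Lengths in the total space\<close>

abbreviation "sasaki \<equiv> sasaki_metric A g E h nabla"

definition tspd :: "(real \<Rightarrow> 'x) \<Rightarrow> real \<Rightarrow> real" where
  "tspd \<gamma> t = sqrt (sasaki (\<gamma> t) (velocity EA \<gamma> t) (velocity EA \<gamma> t))"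

lemma tot_length_tspd: "curve_length EA sasaki \<gamma> = integral {0..1} (tspd \<gamma>)"
  by (simp add: curve_length_def tspd_def[abs_def])

lemma pushforward_velocity:
  assumes r: "tot.regular_at \<gamma> t"
  shows "pushforward EA A (proj E) (\<gamma> t) (velocity EA \<gamma> t) = velocity A (\<lambda>s. proj E (\<gamma> s)) t"
proof
  fix d
  show "pushforward EA A (proj E) (\<gamma> t) (velocity EA \<gamma> t) d = velocity A (\<lambda>s. proj E (\<gamma> s)) t d"
  proof (cases "d \<in> A \<and> proj E (\<gamma> t) \<in> fst d")
    case True
    then have d: "d \<in> A" "proj E (\<gamma> t) \<in> fst d" by auto
    obtain T where T: "T \<in> trivs E" "proj E (\<gamma> t) \<in> fst T" using ex_triv by blast
    let ?C = "tchart d T"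
    have C: "?C \<in> EA" "\<gamma> t \<in> fst ?C" using tchart_in d T by auto
    \<comment> \<open>In the charts \<open>tchart d T\<close> and \<open>d\<close> the bundle
      projection reads as the linear map \<open>fst\<close>.\<close>
    have "(fst has_derivative fst) (at (snd ?C (\<gamma> t)))" by (rule bounded_linear_imp_has_derivative[OF bounded_linear_fst])
    then have D: "((snd d \<circ> proj E \<circ> chart_inv ?C) has_derivative fst) (at (snd ?C (\<gamma> t)))"
      by (rule has_derivative_transform_within_open[OF _ tot.chart_image_open[OF C(1)]])
        (use C d T tot.chart_inv_chart[OF C(1)] in \<open>auto simp: chart_inv_tchart_self[OF d(1) T(1), unfolded snd_tchart]\<close>)
    then have "pushforward EA A (proj E) (\<gamma> t) (velocity EA \<gamma> t) d = fst (velocity EA \<gamma> t ?C)"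
      using tot.pushforward_chart[OF C tot.velocity_in_tangent_space[OF r] d(1), of "proj E"] d(2)
        frechet_derivative_at[OF D] by (auto simp: differentiable_def)
    then show ?thesis using tot_regular_base(2)[OF r d T] by simp
  qed (auto simp: pushforward_def velocity_def)
qed

text \<open>The splitting into horizontal and vertical speed: the projection sends the velocity to
  the velocity of the base curve, and the connection map sends it to the covariant
  derivative.\<close>

lemma tspd_regular:
  assumes r: "tot.regular_at \<gamma> t"
  shows "tspd \<gamma> t = sqrt ((spd (\<lambda>s. proj E (\<gamma> s)) t)\<^sup>2 + (fibre_norm h (cov \<gamma> t))\<^sup>2)"
proof -
  have "(spd (\<lambda>s. proj E (\<gamma> s)) t)\<^sup>2 = g (proj E (\<gamma> t)) (velocity A (\<lambda>s. proj E (\<gamma> s)) t) (velocity A (\<lambda>s. proj E (\<gamma> s)) t)"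
    using spd_nonneg[OF tot_regular_base(1)[OF r]] by (simp add: spd_def)
  moreover have "(fibre_norm h (cov \<gamma> t))\<^sup>2 = h (cov \<gamma> t) (cov \<gamma> t)"
    using fibre_norm_nonneg[of "cov \<gamma> t"] by (simp add: fibre_norm_def)
  ultimately show ?thesis by (simp add: tspd_def sasaki_metric_def pushforward_velocity[OF r] cov_def)
qed

lemma tspd_integrable:
  assumes "pw_smooth EA a b \<gamma>" "a \<le> b" shows "tspd \<gamma> integrable_on {a..b}"
  using assms
proof (induction rule: tot.pw_smooth_induct[where N="\<lambda>x. UNIV"])
  case (trans r s t)
  show ?case by (rule Henstock_Kurzweil_Integration.integrable_combine[OF trans(4,5,1,2)])
next
  case (refl t)
  then show ?case using integrable_on_refl[of "tspd \<gamma>" t] by simp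
next
  case (piece u C s t)
  then obtain c T where C: "C = tchart c T" "c \<in> A" "T \<in> trivs E" by (auto simp: total_atlas_eq)
  obtain D where D: "\<And>u. u \<in> {s..t} \<Longrightarrow> ((snd C \<circ> \<gamma>) has_vector_derivative D u) (at u within {s..t})"
    and Ds: "smooth_on_interval s t D" using smooth_on_intervalE[OF piece(8)] by metis
  define x where "x u = fst ((snd C \<circ> \<gamma>) u)" for u
  define z where "z u = snd ((snd C \<circ> \<gamma>) u)" for u
  define Dz where "Dz u = snd (D u) + Gam c T (x u) (fst (D u)) (z u)" for u
  \<comment> \<open>The speed computed from one-sided derivatives, continuous up to the ends of the
    piece.\<close>
  define k where "k u = sqrt (loc_g c (x u) (fst (D u)) (fst (D u)) + loc_h c T (x u) (Dz u) (Dz u))" for u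
  have inC: "proj E (\<gamma> u) \<in> fst c" "proj E (\<gamma> u) \<in> fst T" if "u \<in> {s..t}" for u
  proof -
    have "\<gamma> u \<in> fst C" using piece(4) that by blast
    then show "proj E (\<gamma> u) \<in> fst c" "proj E (\<gamma> u) \<in> fst T" using C by auto
  qed
  have xin: "x ` {s..t} \<subseteq> cdom c T" using inC C by (auto simp: x_def)
  have cont: "continuous_on {s..t} x" "continuous_on {s..t} z" "continuous_on {s..t} (\<lambda>u. fst (D u))"
    "continuous_on {s..t} (\<lambda>u. snd (D u))"
    unfolding x_def[abs_def] z_def[abs_def]
    by (intro continuous_on_fst continuous_on_snd smooth_on_interval_imp_continuous_on piece(8) Ds)+
  have cDz: "continuous_on {s..t} Dz" unfolding Dz_def[abs_def]
    by (intro continuous_on_add smooth_bilinear_continuous_on[OF smooth_Gam[OF C(2,3)]] cont xin)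
  have "continuous_on {s..t} k" unfolding k_def[abs_def]
    by (intro continuous_on_real_sqrt continuous_on_add smooth_bilinear_continuous_on[OF smooth_loc_h[OF C(2,3)]]
        smooth_bilinear_continuous_on[OF smooth_loc_g[OF C(2)]] cont cDz xin) (use xin in auto)
  then have "k integrable_on {s..t}" by (rule integrable_continuous_real)
  moreover have "tspd \<gamma> u = k u" if "u \<in> {s..t} - {s, t}" for u
  proof -
    have u: "u \<in> {s<..<t}" "u \<in> {s..t}" using that by auto
    note r = tot.regular_at_chart[OF piece(3,4) u(1) D[OF u(2)]]
    note i = inC[OF u(2)]
    have "(spd (\<lambda>s. proj E (\<gamma> s)) u)\<^sup>2 = loc_g c (x u) (fst (D u)) (fst (D u))"
      using spd_local[OF tot_regular_base(1)[OF r(1)] C(2)] i tot_regular_base(2)[OF r(1) C(2) i(1) C(3) i(2)] r(2)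
        pos_bilinear_ge_0[OF pos_loc_g[OF C(2) i(1)]] C(1) by (simp add: x_def)
    moreover have "snd T (cov \<gamma> u) = Dz u"
      using connection_map_local(2)[OF C(2) i(1) C(3) i(2) tot.velocity_in_tangent_space[OF r(1)]] r(2) C(1)
      by (simp add: cov_def Dz_def x_def z_def)
    then have "(fibre_norm h (cov \<gamma> u))\<^sup>2 = loc_h c T (x u) (Dz u) (Dz u)"
      using fibre_norm_triv[OF C(2,3), of "cov \<gamma> u"] proj_cov[OF r(1)] i
        pos_bilinear_ge_0[OF pos_loc_h[OF C(2,3) i]] C(1) by (simp add: x_def)
    ultimately show ?thesis using tspd_regular[OF r(1)] by (simp add: k_def)
  qed
  ultimately show ?case using integrable_spike_finite[of "{s, t}" "{s..t}" "tspd \<gamma>" k] by simp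
qed simp

end

section \<open>The distance formula\<close>

context metric_bundle
begin


text \<open>The initial value is found by transporting \<open>w\<close> back along the reversed
  loop.\<close>

lemma parallel_with_end:
  assumes \<alpha>: "\<alpha> \<in> loops A p" and w: "proj E w = p"
  obtains W where "parallel 0 1 \<alpha> W" "W 1 = w"
proof -
  have l: "pw_smooth A 0 1 \<alpha>" "\<alpha> 0 = p" using \<alpha> by (auto simp: loops_iff)
  let ?w = "ptrans (reversepath \<alpha>) w"
  have "proj E ?w = \<alpha> 0" using proj_ptrans[OF loops_reverse[OF \<alpha>] w] l by simp
  then obtain W where "parallel 0 1 \<alpha> W" "W 0 = ?w" "ptrans \<alpha> ?w = W 1" using ptrans_obtain[OF l(1)] by metis
  then show ?thesis using that ptrans_reverse'[OF \<alpha> w] by simp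
qed

lemma h_le_fibre_norms:
  assumes "proj E e = proj E e'" shows "h e e' \<le> fibre_norm h e * fibre_norm h e'"
proof -
  obtain T where T: "T \<in> trivs E" "proj E e \<in> fst T" using ex_triv by blast
  show ?thesis
    using pos_bilinear_Cauchy_Schwarz[OF pos_lift_h[OF T], of "snd T e" "snd T e'"] T assms lift_triv[OF T(1), of e'] lift_triv[OF T]
    by (simp add: fibre_norm_def)
qed

lemma h_vminus:
  assumes "proj E e = p" "proj E e' = p" "proj E w = p"
  shows "h (vminus (fibre E p) e e') w = h e w - h e' w"
proof -
  obtain T where T: "T \<in> trivs E" "p \<in> fst T" using ex_triv by blast
  have l: "triv_inv E T (p, snd T x) = x" if "proj E x = p" for x using lift_triv[OF T(1), of x] T that by simp
  have "h (vminus (fibre E p) e e') w = h (triv_inv E T (p, snd T (vminus (fibre E p) e e'))) (triv_inv E T (p, snd T w))"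
    using l[of "vminus (fibre E p) e e'"] l[OF assms(3)] assms by simp
  also have "\<dots> = h (triv_inv E T (p, snd T e)) (triv_inv E T (p, snd T w)) - h (triv_inv E T (p, snd T e')) (triv_inv E T (p, snd T w))"
    unfolding triv_vminus'[OF T(1) assms(1,2) T(2)] by (rule pos_bilinear_simps(5)[OF pos_lift_h[OF T]])
  finally show ?thesis using l assms by simp
qed

text \<open>Pair the curve with the parallel field \<open>W\<close> that ends in \<open>\<delta> = v - a u\<close>: the vertical speed integrates to
  at least \<open>norm \<delta>\<close>, and the Cauchy-Schwarz inequality in the plane combines it with the horizontal speed.\<close>

lemma length_lower_bound:
  assumes \<gamma>: "pw_smooth EA 0 1 \<gamma>" and u: "\<gamma> 0 = u" "proj E u = p" and v: "\<gamma> 1 = v" "proj E v = p"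
  defines "\<alpha> \<equiv> \<lambda>t. proj E (\<gamma> t)"
  shows "\<alpha> \<in> loops A p"
    "sqrt ((curve_length A g \<alpha>)\<^sup>2 + (fibre_norm h (vminus (fibre E p) (ptrans \<alpha> u) v))\<^sup>2) \<le> curve_length EA sasaki \<gamma>"
proof -
  have sm: "pw_smooth A 0 1 \<alpha>" unfolding \<alpha>_def by (rule base_pw_smooth[OF \<gamma>]) simp
  show \<alpha>: "\<alpha> \<in> loops A p" using sm u v by (simp add: loops_iff \<alpha>_def)
  have \<alpha>01: "\<alpha> 0 = p" "\<alpha> 1 = p" using u v by (auto simp: \<alpha>_def)
  obtain V where V: "parallel 0 1 \<alpha> V" "V 0 = u" "ptrans \<alpha> u = V 1" "proj E (V 1) = p"
    using ptrans_obtain[OF sm, of u] u \<alpha>01 by metis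
  define \<delta> where "\<delta> = vminus (fibre E p) v (V 1)"
  have p\<delta>: "proj E \<delta> = p" unfolding \<delta>_def using v V by simp
  obtain W where W: "parallel 0 1 \<alpha> W" "W 1 = \<delta>" using parallel_with_end[OF \<alpha> p\<delta>] by metis
  have prW: "proj E (W t) = \<alpha> t" if "t \<in> {0..1}" for t using W(1) that by (simp add: parallel_def)
  have smW: "pw_smooth EA 0 1 W" using W(1) by (simp add: parallel_def)
  define D where "D = fibre_norm h \<delta>"
  define l where "l = curve_length A g \<alpha>"
  define R where "R = sqrt (l\<^sup>2 + D\<^sup>2)"
  have D0: "D \<ge> 0" unfolding D_def by (rule fibre_norm_nonneg)
  have l0: "l \<ge> 0" unfolding l_def by (rule loop_length_nonneg[OF \<alpha>])
  have nW: "fibre_norm h (W t) = D" if "t \<in> {0..1}" for t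
    using parallel_h_const[OF W(1) W(1) that] parallel_h_const[OF W(1) W(1), of 1] W(2) by (simp add: fibre_norm_def D_def)
  define \<phi> where "\<phi> t = h (cov \<gamma> t) (W t) + h (\<gamma> t) (cov W t)" for t
  have "(\<phi> has_integral (h (\<gamma> 1) (W 1) - h (\<gamma> 0) (W 0))) {0..1}"
    unfolding \<phi>_def[abs_def] by (rule h_FTC[OF \<gamma> smW]) (use prW in \<open>auto simp: \<alpha>_def\<close>)
  moreover have "h (\<gamma> 1) (W 1) - h (\<gamma> 0) (W 0) = D\<^sup>2"
  proof -
    \<comment> \<open>The curve and the parallel field \<open>V\<close> start at the same vector
      \<open>u\<close>, and the product of \<open>V\<close> and \<open>W\<close> is constant. The
      increment of the pairing is therefore the product of \<open>v - V 1 = \<delta>\<close> with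
      \<open>W 1 = \<delta>\<close>.\<close>
    have "h (\<gamma> 0) (W 0) = h (V 1) \<delta>" using parallel_h_const[OF V(1) W(1), of 1] V u W by simp
    then have "h (\<gamma> 1) (W 1) - h (\<gamma> 0) (W 0) = h \<delta> \<delta>"
      using h_vminus[OF v(2) V(4) p\<delta>] v W(2) by (simp add: \<delta>_def[symmetric])
    moreover have "D\<^sup>2 = h \<delta> \<delta>" using D0 by (simp add: D_def fibre_norm_def)
    ultimately show ?thesis by simp
  qed
  ultimately have \<phi>: "(\<phi> has_integral D\<^sup>2) {0..1}" by simp
  have s: "(spd \<alpha> has_integral l) {0..1}"
    unfolding l_def curve_length_spd by (rule integrable_integral[OF spd_integrable[OF sm]]) simp
  have i: "((\<lambda>t. l * spd \<alpha> t + \<phi> t) has_integral (l * l + D\<^sup>2)) {0..1}"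
    by (rule has_integral_add[OF has_integral_mult_right[OF s] \<phi>])
  let ?S = "{t \<in> {0..1}. \<not> tot.regular_at \<gamma> t} \<union> {t \<in> {0..1}. cov W t \<noteq> bzero E (\<alpha> t)}"
  have S: "finite ?S" using tot.finite_irregular[OF \<gamma>] W(1) by (simp add: parallel_def)
  have T: "tspd \<gamma> integrable_on {0..1}" by (rule tspd_integrable[OF \<gamma>]) simp
  \<comment> \<open>The pair of horizontal and vertical speed is tested against the fixed vector
    with entries \<open>l\<close> and \<open>D\<close>. The left side integrates to
    \<open>R * R\<close>, and multiplying by \<open>R\<close> instead of dividing leaves only the
    case \<open>R = 0\<close> to be treated apart.\<close>
  have "integral {0..1} (\<lambda>t. l * spd \<alpha> t + \<phi> t) \<le> integral {0..1} (\<lambda>t. R * tspd \<gamma> t)"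
  proof (rule integral_mono_finite[OF has_integral_integrable[OF i] _ S])
    show "(\<lambda>t. R * tspd \<gamma> t) integrable_on {0..1}" by (rule integrable_on_mult_right[OF T])
    fix t assume t: "t \<in> {0..1} - ?S"
    then have r: "tot.regular_at \<gamma> t" and ti: "t \<in> {0..1}" and cW: "cov W t = bzero E (proj E (\<gamma> t))" by (auto simp: \<alpha>_def)
    define a where "a = spd \<alpha> t"
    define b where "b = fibre_norm h (cov \<gamma> t)"
    have "\<phi> t \<le> b * D"
      using h_le_fibre_norms[of "cov \<gamma> t" "W t"] proj_cov[OF r] prW[OF ti] nW[OF ti] cW by (simp add: \<phi>_def b_def \<alpha>_def)
    then have "l * a + \<phi> t \<le> l * a + D * b" by (simp add: mult.commute)
    also have "\<dots> \<le> R * sqrt (a\<^sup>2 + b\<^sup>2)"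
    proof -
      \<comment> \<open>Lagrange's identity: the two sides differ by the square of
        \<open>l * b - D * a\<close>.\<close>
      have "(l * a + D * b)\<^sup>2 \<le> (l\<^sup>2 + D\<^sup>2) * (a\<^sup>2 + b\<^sup>2)"
        using zero_le_power2[of "l * b - D * a"] by (simp add: power2_eq_square algebra_simps)
      then have "\<bar>l * a + D * b\<bar> \<le> sqrt ((l\<^sup>2 + D\<^sup>2) * (a\<^sup>2 + b\<^sup>2))" by (metis real_sqrt_abs real_sqrt_le_iff)
      then show ?thesis by (simp add: R_def real_sqrt_mult)
    qed
    also have "sqrt (a\<^sup>2 + b\<^sup>2) = tspd \<gamma> t" using tspd_regular[OF r] by (simp add: a_def b_def \<alpha>_def)
    finally show "l * spd \<alpha> t + \<phi> t \<le> R * tspd \<gamma> t" by (simp add: a_def)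
  qed
  then have RR: "R * R \<le> R * curve_length EA sasaki \<gamma>"
    using integral_unique[OF i] by (simp add: tot_length_tspd R_def power2_eq_square)
  have "R \<le> curve_length EA sasaki \<gamma>"
  proof (cases "R = 0")
    case True
    have "integral {0..1} (\<lambda>t::real. 0) \<le> integral {0..1} (tspd \<gamma>)"
      by (rule integral_mono_finite[OF integrable_0 T S]) (auto simp: tspd_regular)
    then show ?thesis using True by (simp add: tot_length_tspd)
  next
    case False
    moreover have "R \<ge> 0" by (simp add: R_def)
    ultimately show ?thesis using RR by (simp add: mult_le_cancel_left)
  qed
  moreover have "fibre_norm h (vminus (fibre E p) (ptrans \<alpha> u) v) = D"
  proof -
    obtain T where T: "T \<in> trivs E" "p \<in> fst T" using ex_triv by blast
    have "vminus (fibre E p) (V 1) v = bscale E (-1) \<delta>"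
      by (rule triv_inj[OF T(1)]) (use T V v p\<delta> in \<open>auto simp: \<delta>_def\<close>)
    then show ?thesis using norm_on_fibre[of p] p\<delta> V(3) by (simp add: norm_on_def D_def)
  qed
  ultimately show "sqrt ((curve_length A g \<alpha>)\<^sup>2 + (fibre_norm h (vminus (fibre E p) (ptrans \<alpha> u) v))\<^sup>2) \<le> curve_length EA sasaki \<gamma>"
    by (simp add: R_def l_def)
qed

text \<open>The speed may vanish and need not be smooth, so it is replaced by a slightly larger function \<open>\<sigma>'\<close> that is
  piecewise polynomial; \<open>\<sigma>\<close> then serves as time scale for the vertical motion.\<close>

lemma speed_majorant:
  assumes \<alpha>: "pw_smooth A a b \<alpha>" and ab: "a \<le> b" and e: "e > 0"
  obtains \<sigma> S where "pw_smooth real_atlas a b \<sigma>" "\<sigma> a = 0" "finite S"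
    "\<And>t. t \<in> {a<..<b} - S \<Longrightarrow> \<exists>m. (\<sigma> has_vector_derivative m) (at t) \<and> spd \<alpha> t \<le> m \<and> e \<le> m \<and> m \<le> spd \<alpha> t + 3 * e"
proof -
  define Q where "Q \<sigma> t \<longleftrightarrow> (\<exists>m. (\<sigma> has_vector_derivative m) (at t) \<and> spd \<alpha> t \<le> m \<and> e \<le> m \<and> m \<le> spd \<alpha> t + 3 * e)" for \<sigma> t
  \<comment> \<open>The initial value \<open>y\<close> is left free, so that majorants of adjacent
    pieces can be joined continuously.\<close>
  define P where "P a b \<longleftrightarrow> (\<forall>y. \<exists>\<sigma>. \<sigma> a = y \<and> pw_smooth real_atlas a b \<sigma> \<and> (\<exists>S. finite S \<and> (\<forall>t\<in>{a<..<b} - S. Q \<sigma> t)))" for a b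
  have Qcong: "Q \<sigma>' t" if "Q \<sigma> t" "\<forall>\<^sub>F s in nhds t. \<sigma> s = \<sigma>' s" for \<sigma> \<sigma>' t
    using that has_vector_derivative_cong_nhds unfolding Q_def by blast
  have "P a b" using \<alpha> ab
  proof (induction rule: M.pw_smooth_induct[where N="\<lambda>x. UNIV"])
    case (trans r s t)
    show ?case unfolding P_def
    proof
      fix y
      obtain \<sigma>1 S1 where 1: "\<sigma>1 r = y" "pw_smooth real_atlas r s \<sigma>1" "finite S1" "\<And>u. u \<in> {r<..<s} - S1 \<Longrightarrow> Q \<sigma>1 u"
        using trans(1) unfolding P_def by metis
      obtain \<sigma>2 S2 where 2: "\<sigma>2 s = \<sigma>1 s" "pw_smooth real_atlas s t \<sigma>2" "finite S2" "\<And>u. u \<in> {s<..<t} - S2 \<Longrightarrow> Q \<sigma>2 u"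
        using trans(2) unfolding P_def by metis
      define \<sigma> where "\<sigma> u = (if u \<le> s then \<sigma>1 u else \<sigma>2 u)" for u
      have "pw_smooth real_atlas r s \<sigma>" by (rule pw_smooth_cong[OF _ 1(2)]) (auto simp: \<sigma>_def)
      moreover have "pw_smooth real_atlas s t \<sigma>" by (rule pw_smooth_cong[OF _ 2(2)]) (use 2(1) in \<open>auto simp: \<sigma>_def\<close>)
      ultimately have "pw_smooth real_atlas r t \<sigma>" using pw_smooth_combine trans(4,5) by blast
      moreover have "Q \<sigma> u" if u: "u \<in> {r<..<t} - (insert s (S1 \<union> S2))" for u
      proof (cases "u < s")
        case True
        have "\<forall>\<^sub>F v in nhds u. v \<in> {..<s}" using True eventually_nhds_in_open[of "{..<s}" u] by auto
        then have "\<forall>\<^sub>F v in nhds u. \<sigma>1 v = \<sigma> v" by eventually_elim (auto simp: \<sigma>_def)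
        then show ?thesis using Qcong[OF 1(4)] True u by auto
      next
        case False
        then have us: "s < u" using u by auto
        then have "\<forall>\<^sub>F v in nhds u. v \<in> {s<..}" using eventually_nhds_in_open[of "{s<..}" u] by auto
        then have "\<forall>\<^sub>F v in nhds u. \<sigma>2 v = \<sigma> v" by eventually_elim (auto simp: \<sigma>_def)
        then show ?thesis using Qcong[OF 2(4)] us u by auto
      qed
      moreover have "\<sigma> r = y" using 1(1) trans(4) by (simp add: \<sigma>_def)
      moreover have "finite (insert s (S1 \<union> S2))" using 1(3) 2(3) by simp
      ultimately show "\<exists>\<sigma>. \<sigma> r = y \<and> pw_smooth real_atlas r t \<sigma> \<and> (\<exists>S. finite S \<and> (\<forall>t\<in>{r<..<t} - S. Q \<sigma> t))"
        by blast
    qed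
  next
    case (refl t)
    have "pw_smooth real_atlas t t (\<lambda>s. y)" for y by (rule pw_smooth_real) auto
    then show ?case unfolding P_def by (intro allI exI[of _ "\<lambda>s. _"]) auto
  next
    case (piece u c s t)
    obtain k where k: "continuous_on {s..t} k" "\<And>u. u \<in> {s..t} \<Longrightarrow> k u \<ge> 0" "\<And>u. u \<in> {s<..<t} \<Longrightarrow> spd \<alpha> u = k u"
      using spd_piece[OF piece(3,4,8)] by metis
    have "continuous_on {s..t} (\<lambda>u. k u + 2 * e)" by (intro continuous_intros k)
    \<comment> \<open>The target is the speed raised by \<open>2 * e\<close> and the tolerance is
      \<open>e\<close>. Hence \<open>q\<close> lies between \<open>k + e\<close> and
      \<open>k + 3 * e\<close>: it dominates the speed, and it is at least \<open>e\<close> because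
      \<open>k\<close> is nonnegative.\<close>
    then obtain q where q: "real_polynomial_function q" "\<And>u. u \<in> {s..t} \<Longrightarrow> \<bar>k u + 2 * e - q u\<bar> < e"
      using Stone_Weierstrass_real_polynomial_function[of "{s..t}" "\<lambda>u. k u + 2 * e" e] e by (metis compact_Icc)
    have qs: "smooth_on_interval s t q" by (rule smooth_on_interval_polynomial[OF q(1)])
    show ?case unfolding P_def
    proof
      fix y
      define \<sigma> where "\<sigma> v = y + integral {s..v} q" for v
      have der: "(\<sigma> has_vector_derivative 0 + q v) (at v within {s..t})" if "v \<in> {s..t}" for v
        unfolding \<sigma>_def
        by (intro has_vector_derivative_add has_vector_derivative_const integral_has_vector_derivative
            smooth_on_interval_imp_continuous_on qs that)
      obtain Dq where Dq: "Dq 0 = q" "\<And>k t'. t' \<in> {s..t} \<Longrightarrow> (Dq k has_vector_derivative Dq (Suc k) t') (at t' within {s..t})"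
        using qs unfolding smooth_on_interval_def by blast
      \<comment> \<open>The sequence of derivatives of \<open>\<sigma>\<close> is
        \<open>\<sigma>\<close> itself followed by that of \<open>q\<close>.\<close>
      have "smooth_on_interval s t \<sigma>" unfolding smooth_on_interval_def
        by (intro exI[of _ "\<lambda>k. case k of 0 \<Rightarrow> \<sigma> | Suc k \<Rightarrow> Dq k"] conjI allI ballI)
          (use der Dq in \<open>auto split: nat.splits\<close>)
      then have "pw_smooth real_atlas s t \<sigma>" using piece by (intro pw_smooth_real) auto
      moreover have "Q \<sigma> v" if v: "v \<in> {s<..<t} - {}" for v
      proof -
        have vi: "v \<in> interior {s..t}" "v \<in> {s..t}" "v \<in> {s<..<t}" using v by auto
        have "(\<sigma> has_vector_derivative q v) (at v)"
          using der[OF vi(2)] unfolding at_within_interior[OF vi(1)] by simp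
        then show ?thesis unfolding Q_def k(3)[OF vi(3)] using q(2)[OF vi(2)] k(2)[OF vi(2)]
          by (intro exI[of _ "q v"]) (auto simp: abs_less_iff)
      qed
      moreover have "\<sigma> s = y" by (simp add: \<sigma>_def)
      ultimately show "\<exists>\<sigma>. \<sigma> s = y \<and> pw_smooth real_atlas s t \<sigma> \<and> (\<exists>S. finite S \<and> (\<forall>t\<in>{s<..<t} - S. Q \<sigma> t))"
        by blast
    qed
  qed auto
  then obtain \<sigma> S where "\<sigma> a = 0" "pw_smooth real_atlas a b \<sigma>" "finite S" "\<forall>t\<in>{a<..<b} - S. Q \<sigma> t"
    unfolding P_def by metis
  then show ?thesis using that unfolding Q_def by blast
qed

text \<open>A hypotenuse grows no faster than its leg. This absorbs both the excess of the speed
  majorant and the excess of an almost shortest loop.\<close>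

lemma sqrt_sum_squares_shift:
  fixes x e D :: real
  assumes "x \<ge> 0" "e \<ge> 0"
  shows "sqrt ((x + e)\<^sup>2 + D\<^sup>2) \<le> sqrt (x\<^sup>2 + D\<^sup>2) + e"
proof (rule real_le_lsqrt)
  have "x \<le> sqrt (x\<^sup>2 + D\<^sup>2)" by (rule real_le_rsqrt) simp
  then have "2 * e * x \<le> 2 * e * sqrt (x\<^sup>2 + D\<^sup>2)" using assms by (intro mult_left_mono) auto
  then show "(x + e)\<^sup>2 + D\<^sup>2 \<le> (sqrt (x\<^sup>2 + D\<^sup>2) + e)\<^sup>2"
    by (simp add: power2_sum mult_ac)
qed (use assms in auto)

lemma pw_smooth_real_scale:
  assumes "pw_smooth real_atlas a b \<sigma>" "a \<le> b"
  shows "pw_smooth real_atlas a b (\<lambda>t. k * \<sigma> t)"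
  using assms
proof (induction rule: R.pw_smooth_induct[where N="\<lambda>x. UNIV"])
  case (piece u c s t)
  have "smooth_on_interval s t \<sigma>" using piece(3,8) by (simp add: real_atlas_def o_def)
  from smooth_on_interval_bounded_linear[OF bounded_linear_mult_right this]
  show ?case using piece by (intro pw_smooth_real) auto
next
  case (trans r s t)
  then show ?case using pw_smooth_combine by blast
next
  case (refl t)
  show ?case by (rule pw_smooth_real) auto
qed auto

text \<open>The curve is \<open>V + s Z\<close>, where \<open>Z\<close> is the parallel field ending
  in \<open>\<delta>\<close> and \<open>s\<close> is the majorant \<open>\<sigma>\<close> divided by
  its final value \<open>L\<close>. Its vertical speed is \<open>(m / L) * D\<close> and its
  horizontal speed is at most \<open>m\<close>, so its speed is at most \<open>m / L\<close> times
  \<open>sqrt (L\<^sup>2 + D\<^sup>2)\<close>. As \<open>m\<close> integrates to \<open>L\<close>,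
  this integrates to \<open>sqrt (L\<^sup>2 + D\<^sup>2)\<close>, and \<open>L\<close> exceeds the
  length of the loop by at most \<open>\<eta>\<close>.\<close>

lemma length_upper_bound:
  assumes \<alpha>: "\<alpha> \<in> loops A p" and u: "proj E u = p" and v: "proj E v = p" and \<eta>: "\<eta> > 0"
  obtains \<gamma> where "pw_smooth EA 0 1 \<gamma>" "\<gamma> 0 = u" "\<gamma> 1 = v"
    "curve_length EA sasaki \<gamma> \<le> sqrt ((curve_length A g \<alpha>)\<^sup>2 + (fibre_norm h (vminus (fibre E p) (ptrans \<alpha> u) v))\<^sup>2) + \<eta>"
proof -
  have l: "pw_smooth A 0 1 \<alpha>" "\<alpha> 0 = p" "\<alpha> 1 = p" using \<alpha> by (auto simp: loops_iff)
  obtain V where V: "parallel 0 1 \<alpha> V" "V 0 = u" "ptrans \<alpha> u = V 1" "proj E (V 1) = p"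
    using ptrans_obtain[OF l(1), of u] u l by metis
  define \<delta> where "\<delta> = vminus (fibre E p) v (V 1)"
  have p\<delta>: "proj E \<delta> = p" unfolding \<delta>_def using v V by simp
  obtain Z where Z: "parallel 0 1 \<alpha> Z" "Z 1 = \<delta>" using parallel_with_end[OF \<alpha> p\<delta>] by metis
  obtain T where T: "T \<in> trivs E" "p \<in> fst T" using ex_triv by blast
  define D where "D = fibre_norm h \<delta>"
  have D0: "D \<ge> 0" unfolding D_def by (rule fibre_norm_nonneg)
  have nZ: "fibre_norm h (Z t) = D" if "t \<in> {0..1}" for t
    using parallel_h_const[OF Z(1) Z(1) that] parallel_h_const[OF Z(1) Z(1), of 1] Z(2) by (simp add: fibre_norm_def D_def)
  have nD: "fibre_norm h (vminus (fibre E p) (ptrans \<alpha> u) v) = D"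
  proof -
    have "vminus (fibre E p) (V 1) v = bscale E (-1) \<delta>"
      by (rule triv_inj[OF T(1)]) (use T V v p\<delta> in \<open>auto simp: \<delta>_def\<close>)
    then show ?thesis using norm_on_fibre[of p] p\<delta> V(3) by (simp add: norm_on_def D_def)
  qed
  have prV: "proj E (V t) = \<alpha> t" "proj E (Z t) = \<alpha> t" if "t \<in> {0..1}" for t using V(1) Z(1) that by (auto simp: parallel_def)
  have smVZ: "pw_smooth EA 0 1 V" "pw_smooth EA 0 1 Z" using V(1) Z(1) by (auto simp: parallel_def)
  define len where "len = curve_length A g \<alpha>"
  have len0: "len \<ge> 0" unfolding len_def by (rule loop_length_nonneg[OF \<alpha>])
  \<comment> \<open>The majorant exceeds the speed by at most \<open>3 * e\<close>.\<close>
  define e where "e = \<eta> / 3"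
  have e: "e > 0" using \<eta> by (simp add: e_def)
  obtain \<sigma> S where \<sigma>: "pw_smooth real_atlas 0 1 \<sigma>" "\<sigma> 0 = 0" "finite S"
    "\<And>t. t \<in> {0<..<1} - S \<Longrightarrow> \<exists>m. (\<sigma> has_vector_derivative m) (at t) \<and> spd \<alpha> t \<le> m \<and> e \<le> m \<and> m \<le> spd \<alpha> t + 3 * e"
    using speed_majorant[OF l(1) _ e] by (metis zero_le_one)
  define m where "m t = vector_derivative \<sigma> (at t)" for t
  have m: "(\<sigma> has_vector_derivative m t) (at t)" "spd \<alpha> t \<le> m t" "e \<le> m t" "m t \<le> spd \<alpha> t + \<eta>" if "t \<in> {0<..<1} - S" for t
    using \<sigma>(4)[OF that] by (auto simp: m_def vector_derivative_at e_def)
  define L where "L = \<sigma> 1"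
  have mi: "(m has_integral L) {0..1}"
    using fundamental_theorem_of_calculus_interior_strong[OF \<sigma>(3) zero_le_one m(1) pw_smooth_imp_continuous_on[OF \<sigma>(1)]] \<sigma>(2)
    by (simp add: L_def)
  have S2: "finite (insert 0 (insert 1 S))" using \<sigma>(3) by simp
  have si: "spd \<alpha> integrable_on {0..1}" by (rule spd_integrable[OF l(1)]) simp
  \<comment> \<open>The lower bound \<open>e \<le> m\<close> keeps \<open>L\<close> positive even
    for a constant loop, over which the motion is purely vertical.\<close>
  have "integral {0..1} (\<lambda>t::real. e) \<le> integral {0..1} m"
    by (rule integral_mono_finite[OF _ has_integral_integrable[OF mi] S2]) (use m(3) in auto)
  then have L: "L > 0" using e integral_unique[OF mi] by simp
  have "integral {0..1} m \<le> integral {0..1} (\<lambda>t. spd \<alpha> t + \<eta>)"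
    by (rule integral_mono_finite[OF has_integral_integrable[OF mi] _ S2]) (use m(4) si in \<open>auto intro!: integrable_add\<close>)
  also have "\<dots> = len + \<eta>"
    using integral_add[OF si integrable_const_ivl, of \<eta>] by (simp add: len_def curve_length_spd)
  finally have Ll: "L \<le> len + \<eta>" using integral_unique[OF mi] by simp
  define s where "s t = (1 / L) * \<sigma> t" for t
  have ss: "pw_smooth real_atlas 0 1 s" unfolding s_def[abs_def] by (rule pw_smooth_real_scale[OF \<sigma>(1)]) simp
  have s01: "s 0 = 0" "s 1 = 1" using \<sigma>(2) L by (auto simp: s_def L_def)
  define \<gamma> where "\<gamma> = comb V s Z"
  have sm: "pw_smooth EA 0 1 \<gamma>" unfolding \<gamma>_def by (rule pw_smooth_comb[OF smVZ ss]) (use prV in auto)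
  have pr\<gamma>: "proj E (\<gamma> t) = \<alpha> t" if "t \<in> {0..1}" for t using prV[OF that] by (simp add: \<gamma>_def proj_comb)
  have "\<gamma> 0 = u"
    by (rule triv_inj[OF T(1)]) (use pr\<gamma>[of 0] prV[of 0] l u T V(2) s01 in \<open>auto simp: \<gamma>_def triv_comb\<close>)
  moreover have "\<gamma> 1 = v"
    by (rule triv_inj[OF T(1)]) (use pr\<gamma>[of 1] prV[of 1] l v T V(4) s01 Z(2) in \<open>auto simp: \<gamma>_def triv_comb \<delta>_def\<close>)
  moreover have "curve_length EA sasaki \<gamma> \<le> sqrt (len\<^sup>2 + D\<^sup>2) + \<eta>"
  proof -
    let ?S = "{t \<in> {0..1}. \<not> tot.regular_at V t} \<union> {t \<in> {0..1}. \<not> tot.regular_at Z t} \<union> {t \<in> {0..1}. \<not> tot.regular_at \<gamma> t} \<union>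
      {t \<in> {0..1}. \<not> M.regular_at \<alpha> t} \<union>
      {t \<in> {0..1}. cov V t \<noteq> bzero E (\<alpha> t)} \<union> {t \<in> {0..1}. cov Z t \<noteq> bzero E (\<alpha> t)} \<union> insert 0 (insert 1 S)"
    have fin: "finite ?S"
      using V(1) Z(1) tot.finite_irregular[OF smVZ(1)] tot.finite_irregular[OF smVZ(2)] tot.finite_irregular[OF sm]
        M.finite_irregular[OF l(1)] \<sigma>(3) by (simp add: parallel_def)
    define Q where "Q = sqrt (L\<^sup>2 + D\<^sup>2) / L"
    have "integral {0..1} (tspd \<gamma>) \<le> integral {0..1} (\<lambda>t. Q * m t)"
    proof (rule integral_mono_finite[OF tspd_integrable[OF sm] integrable_on_mult_right[OF has_integral_integrable[OF mi]] fin])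
      fix t assume t: "t \<in> {0..1} - ?S"
      then have ti: "t \<in> {0<..<1} - S" "t \<in> {0..1}" by auto
      have rV: "tot.regular_at V t" and rZ: "tot.regular_at Z t" and r\<gamma>: "tot.regular_at \<gamma> t" and r\<alpha>: "M.regular_at \<alpha> t"
        and cV: "cov V t = bzero E (\<alpha> t)" and cZ: "cov Z t = bzero E (\<alpha> t)" using t by auto
      have ev: "\<forall>\<^sub>F r in nhds t. r \<in> {0<..<1}" using ti eventually_nhds_in_open[of "{0<..<1}" t] by auto
      then have pr: "\<forall>\<^sub>F r in nhds t. proj E (Z r) = proj E (V r)" by eventually_elim (use prV in auto)
      have "(s has_vector_derivative (1 / L) * m t) (at t)"
        unfolding s_def[abs_def] by (rule has_vector_derivative_mult_right[OF m(1)[OF ti(1)]])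
      from cov_comb[OF rV rZ r\<gamma>[unfolded \<gamma>_def] pr this]
      have "cov \<gamma> t = bplus E (bplus E (bzero E (\<alpha> t)) (bzero E (\<alpha> t))) (bscale E (m t / L) (Z t))"
        by (simp add: \<gamma>_def cV cZ)
      also have "\<dots> = bscale E (m t / L) (Z t)"
        by (rule fibre_eqI) (use prV[OF ti(2)] in auto)
      finally have "fibre_norm h (cov \<gamma> t) = (m t / L) * D"
        using norm_on_fibre[of "\<alpha> t"] prV[OF ti(2)] nZ[OF ti(2)] m(3)[OF ti(1)] e L by (simp add: norm_on_def)
      moreover have "spd (\<lambda>s. proj E (\<gamma> s)) t = spd \<alpha> t"
      proof (rule spd_cong[OF _ r\<alpha>])
        show "\<forall>\<^sub>F r in nhds t. \<alpha> r = proj E (\<gamma> r)" using ev by eventually_elim (use pr\<gamma> in auto)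
      qed
      ultimately have "tspd \<gamma> t = sqrt ((spd \<alpha> t)\<^sup>2 + ((m t / L) * D)\<^sup>2)" using tspd_regular[OF r\<gamma>] by simp
      also have "\<dots> \<le> sqrt ((m t)\<^sup>2 + ((m t / L) * D)\<^sup>2)"
        using m(2)[OF ti(1)] spd_nonneg[OF r\<alpha>] by (intro real_sqrt_le_mono add_right_mono power_mono)
      also have "(m t)\<^sup>2 + ((m t / L) * D)\<^sup>2 = (m t / L)\<^sup>2 * (L\<^sup>2 + D\<^sup>2)"
        using L by (simp add: power_divide power_mult_distrib field_simps)
      also have "sqrt \<dots> = (m t / L) * sqrt (L\<^sup>2 + D\<^sup>2)"
        using L m(3)[OF ti(1)] e by (simp add: real_sqrt_mult)
      finally show "tspd \<gamma> t \<le> Q * m t" by (simp add: Q_def mult.commute)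
    qed simp
    also have "\<dots> = sqrt (L\<^sup>2 + D\<^sup>2)" using integral_unique[OF mi] L by (simp add: Q_def)
    also have "\<dots> \<le> sqrt ((len + \<eta>)\<^sup>2 + D\<^sup>2)"
      using L Ll by (intro real_sqrt_le_mono add_right_mono power_mono) auto
    also have "\<dots> \<le> sqrt (len\<^sup>2 + D\<^sup>2) + \<eta>" using sqrt_sum_squares_shift[OF len0, of \<eta> D] \<eta> by simp
    finally show ?thesis by (simp add: tot_length_tspd)
  qed
  ultimately show ?thesis using that[OF sm] nD by (simp add: len_def)
qed

text \<open>The two infima are compared element by element: the length of each curve dominates the
  value at some holonomy, and the value at each holonomy is approached by lengths of curves. The
  first comparison also bounds the lengths from below, and the second provides a curve from
  \<open>u\<close> to \<open>v\<close>, so both infima are meaningful.\<close>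

lemma distance_formula:
  assumes u: "proj E u = p" and v: "proj E v = p"
  shows "riemannian_dist EA sasaki u v =
      (INF a\<in>hol p. sqrt ((hlen p a)\<^sup>2 + (fibre_norm h (vminus (fibre E p) (a u) v))\<^sup>2))"
proof -
  let ?X = "{curve_length EA sasaki \<gamma> |\<gamma>. piecewise_smooth_path EA \<gamma> \<and> \<gamma> 0 = u \<and> \<gamma> 1 = v}"
  let ?f = "\<lambda>a. sqrt ((hlen p a)\<^sup>2 + (fibre_norm h (vminus (fibre E p) (a u) v))\<^sup>2)"
  have Hne: "hol p \<noteq> {}" using hol_ptrans[OF loops_const] by blast
  have bddH: "bdd_below (?f ` hol p)" by (auto simp: bdd_below_def intro!: exI[of _ 0])
  have low: "\<exists>a\<in>hol p. ?f a \<le> x" if "x \<in> ?X" for x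
  proof -
    obtain \<gamma> where \<gamma>: "pw_smooth EA 0 1 \<gamma>" "\<gamma> 0 = u" "\<gamma> 1 = v" "x = curve_length EA sasaki \<gamma>"
      using \<open>x \<in> ?X\<close> by (auto simp: piecewise_smooth_path_iff)
    define \<alpha> where "\<alpha> = (\<lambda>t. proj E (\<gamma> t))"
    note lb = length_lower_bound[OF \<gamma>(1,2) u \<gamma>(3) v, folded \<alpha>_def]
    have "?f (ptrans \<alpha>) \<le> sqrt ((curve_length A g \<alpha>)\<^sup>2 + (fibre_norm h (vminus (fibre E p) (ptrans \<alpha> u) v))\<^sup>2)"
      using hlen_le[OF lb(1)] hlen_nonneg[OF hol_ptrans[OF lb(1)]]
      by (intro real_sqrt_le_mono add_right_mono power_mono)
    also have "\<dots> \<le> x" using lb(2) \<gamma>(4) by simp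
    finally show ?thesis using hol_ptrans[OF lb(1)] by blast
  qed
  have bddX: "bdd_below ?X"
  proof (rule bdd_belowI[of _ 0])
    fix x assume "x \<in> ?X"
    then obtain a where "?f a \<le> x" using low by blast
    moreover have "0 \<le> ?f a" by simp
    ultimately show "0 \<le> x" by linarith
  qed
  have up: "\<exists>x\<in>?X. x \<le> ?f a + e" if a: "a \<in> hol p" and e: "e > 0" for a e
  proof -
    have e2: "e / 2 > 0" using e by simp
    obtain \<alpha> where \<alpha>: "\<alpha> \<in> loops A p" "ptrans \<alpha> = a" "curve_length A g \<alpha> < hlen p a + e / 2"
      using hlen_approx[OF a e2] by metis
    obtain \<gamma> where \<gamma>: "pw_smooth EA 0 1 \<gamma>" "\<gamma> 0 = u" "\<gamma> 1 = v"
      "curve_length EA sasaki \<gamma> \<le> sqrt ((curve_length A g \<alpha>)\<^sup>2 + (fibre_norm h (vminus (fibre E p) (ptrans \<alpha> u) v))\<^sup>2) + e / 2"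
      using length_upper_bound[OF \<alpha>(1) u v e2] by metis
    have "sqrt ((curve_length A g \<alpha>)\<^sup>2 + (fibre_norm h (vminus (fibre E p) (ptrans \<alpha> u) v))\<^sup>2) \<le>
      sqrt ((hlen p a + e / 2)\<^sup>2 + (fibre_norm h (vminus (fibre E p) (a u) v))\<^sup>2)"
      using \<alpha> loop_length_nonneg[OF \<alpha>(1)] by (intro real_sqrt_le_mono add_mono power_mono) (auto intro: fibre_norm_nonneg)
    also have "\<dots> \<le> ?f a + e / 2" using sqrt_sum_squares_shift[OF hlen_nonneg[OF a]] e2 by simp
    finally have "curve_length EA sasaki \<gamma> \<le> ?f a + e" using \<gamma>(4) by linarith
    moreover have "curve_length EA sasaki \<gamma> \<in> ?X" using \<gamma> by (auto simp: piecewise_smooth_path_iff)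
    ultimately show ?thesis by blast
  qed
  have Xne: "?X \<noteq> {}" using up[of _ 1] Hne by force
  show ?thesis unfolding riemannian_dist_def
  proof (rule antisym)
    show "Inf ?X \<le> (INF a\<in>hol p. ?f a)"
    proof (rule cINF_greatest[OF Hne])
      fix a assume a: "a \<in> hol p"
      show "Inf ?X \<le> ?f a"
      proof (rule field_le_epsilon)
        fix e :: real assume "e > 0"
        then obtain x where "x \<in> ?X" "x \<le> ?f a + e" using up[OF a] by blast
        then show "Inf ?X \<le> ?f a + e" using cInf_lower[OF _ bddX] by fastforce
      qed
    qed
    show "(INF a\<in>hol p. ?f a) \<le> Inf ?X"
    proof (rule cInf_greatest[OF Xne])
      fix x assume "x \<in> ?X"
      then obtain a where "a \<in> hol p" "?f a \<le> x" using low by blast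
      then show "(INF a\<in>hol p. ?f a) \<le> x" using cINF_lower[OF bddH] by fastforce
    qed
  qed
qed

text \<open>Applying the inverse of \<open>a\<close>, an isometry of the same length norm, turns the
  norm of \<open>u - a v\<close> into that of the inverse applied to \<open>u\<close> minus
  \<open>v\<close>. As the inverse runs through the whole group, both infima are over the same set
  of values.\<close>

lemma holonomic_dist_eq:
  assumes u: "proj E u = p" and v: "proj E v = p"
  shows "holonomic_dist (fibre E p) (fibre_norm h) (hol p) (hlen p) u v =
      (INF a\<in>hol p. sqrt ((hlen p a)\<^sup>2 + (fibre_norm h (vminus (fibre E p) (a u) v))\<^sup>2))"
proof -
  let ?f = "\<lambda>a. sqrt ((hlen p a)\<^sup>2 + (fibre_norm h (vminus (fibre E p) u (a v)))\<^sup>2)"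
  let ?f' = "\<lambda>a. sqrt ((hlen p a)\<^sup>2 + (fibre_norm h (vminus (fibre E p) (a u) v))\<^sup>2)"
  have eq: "?f (ptrans \<alpha>) = ?f' (ptrans (reversepath \<alpha>))" if \<alpha>: "\<alpha> \<in> loops A p" for \<alpha>
  proof -
    let ?b = "ptrans (reversepath \<alpha>)"
    have pv: "proj E (ptrans \<alpha> v) = p" by (rule proj_ptrans[OF \<alpha> v])
    have "fibre_norm h (vminus (fibre E p) u (ptrans \<alpha> v)) = fibre_norm h (?b (vminus (fibre E p) u (ptrans \<alpha> v)))"
      using fibre_norm_ptrans[OF loops_reverse[OF \<alpha>]] u pv by simp
    also have "\<dots> = fibre_norm h (vminus (fibre E p) (?b u) v)"
      using ptrans_vminus[OF loops_reverse[OF \<alpha>] u pv] ptrans_reverse[OF \<alpha> v] by simp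
    finally show ?thesis using hlen_reverse_eq[OF \<alpha>] by simp
  qed
  have "?f ` hol p = ?f' ` hol p"
  proof (intro subset_antisym image_subsetI)
    fix a assume "a \<in> hol p"
    then obtain \<alpha> where \<alpha>: "\<alpha> \<in> loops A p" "a = ptrans \<alpha>" by (auto simp: Hol_def)
    show "?f a \<in> ?f' ` hol p" using eq[OF \<alpha>(1)] hol_ptrans[OF loops_reverse[OF \<alpha>(1)]] \<alpha>(2) by blast
    show "?f' a \<in> ?f ` hol p"
      using eq[OF loops_reverse[OF \<alpha>(1)]] hol_ptrans[OF loops_reverse[OF \<alpha>(1)]] \<alpha>(2) by (metis (no_types, lifting) imageI reversepath_reversepath)
  qed
  then show ?thesis unfolding holonomic_dist_def by simp
qed

end

theorem theoremC:
  fixes A :: "('m::{t2_space, second_countable_topology}, 'e::euclidean_space) chart set"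
    and g :: "'m \<Rightarrow> ('m, 'e) tvec \<Rightarrow> ('m, 'e) tvec \<Rightarrow> real"
    and E :: "('x::topological_space, 'm, 'f::euclidean_space) vbundle"
    and h :: "'x \<Rightarrow> 'x \<Rightarrow> real"
    and nabla :: "('x, 'm, 'e) covariant_derivative"
    and p :: 'm
  assumes "smooth_atlas A"
    and "riemannian_metric A g"
    and "vector_bundle A E"
    and "bundle_metric A E h"
    and "connection A E nabla"
    and "metric_compatible A E h nabla"
  shows "holonomic_space (fibre E p) (fibre_norm h) (Hol A E nabla p) (hol_length A g E nabla p) \<and>
    (\<forall>u\<in>vcarrier (fibre E p). \<forall>v\<in>vcarrier (fibre E p).
       riemannian_dist (total_atlas A E) (sasaki_metric A g E h nabla) u v =
         (INF a\<in>Hol A E nabla p.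
            sqrt ((hol_length A g E nabla p a)\<^sup>2 + (fibre_norm h (vminus (fibre E p) (a u) v))\<^sup>2)) \<and>
       holonomic_dist (fibre E p) (fibre_norm h) (Hol A E nabla p) (hol_length A g E nabla p) u v =
         riemannian_dist (total_atlas A E) (sasaki_metric A g E h nabla) u v)"
proof -
  interpret metric_bundle A g E h nabla using assms by unfold_locales
  show ?thesis
    using holonomic_space_hol[of p] distance_formula[of _ p] holonomic_dist_eq[of _ p] by simp
qed

end
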